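(* Let $n\ge 1$ and $q\in\left(2,\frac{4n}{2n-1}\right)$. There exists $\lambda>0$ such that the equation $$-\Delta_{g_{H}}u+\lambda u=\lambda u^{q-1}$$ has a nonconstant positive solution $u$ on $(\mathbb{H}\mathbf{P}^n,g_{H})$, invariant under the action of the symplectic group $Sp(n)$, which is degenerate, i.e. the linearized equation $-\Delta_{g_H}v+\lambda v=\lambda(q-1)u^{q-2}v$ has a nontrivial solution $v$.
   Context: $g_H$ is the canonical metric on $\mathbb{H}\mathbf{P}^n$, normalized so that the eigenvalues of $-\Delta_{g_H}$ are $4k(k+2n+1)$, $k\ge0$. $Sp(n)$ acts on $\mathbb{H}\mathbf{P}^n$ by $A\cdot[z_0:z_1:\dots:z_n]=[z_0:A(z_1,\dots,z_n)]$ (cohomogeneity one action fixing $[1:0:\dots:0]$); invariant means constant on orbits. A solution $(u_0,\lambda_0)$ of $-\Delta u+\lambda u=\lambda u^{q-1}$ is called degenerate if $-\Delta v+\lambda_0 v=\lambda_0(q-1)u_0^{q-2}v$ has a nontrivial solution. *)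

theory Defs
  imports "HOL-Analysis.Analysis"
begin

text \<open>Quaternions are modelled as real^4 with coordinates (1,2,3,4) = (re, i, j, k).\<close>

definition qmul :: "real^4 \<Rightarrow> real^4 \<Rightarrow> real^4" where
  "qmul p r = (\<chi> m. if m = 1 then p$1*r$1 - p$2*r$2 - p$3*r$3 - p$4*r$4
                 else if m = 2 then p$1*r$2 + p$2*r$1 + p$3*r$4 - p$4*r$3
                 else if m = 3 then p$1*r$3 - p$2*r$4 + p$3*r$1 + p$4*r$2
                 else p$1*r$4 + p$2*r$3 - p$3*r$2 + p$4*r$1)"

definition qconj :: "real^4 \<Rightarrow> real^4" where
  "qconj p = (\<chi> m. if m = 1 then p$1 else - (p$m))"

definition qone :: "real^4" where
  "qone = (\<chi> m. if m = 1 then 1 else 0)"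

text \<open>H^(n+1) = real^4^('n option); coordinate None is z_0, Some i are z_1..z_n.
  Right scalar multiplication by a quaternion.\<close>
definition rmul :: "real^4^'m \<Rightarrow> real^4 \<Rightarrow> real^4^'m" where
  "rmul z p = (\<chi> i. qmul (z$i) p)"

definition sp_mat :: "('n::finite \<Rightarrow> 'n \<Rightarrow> real^4) \<Rightarrow> bool" where
  "sp_mat A \<longleftrightarrow> (\<forall>i j. (\<Sum>k\<in>UNIV. qmul (qconj (A k i)) (A k j)) = (if i = j then qone else 0))"

text \<open>Action A . [z_0 : z'] = [z_0 : A z'].\<close>
definition sp_act :: "('n::finite \<Rightarrow> 'n \<Rightarrow> real^4) \<Rightarrow> real^4^('n option) \<Rightarrow> real^4^('n option)" where
  "sp_act A z = (\<chi> i. case i of None \<Rightarrow> z$None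
                          | Some a \<Rightarrow> (\<Sum>b\<in>UNIV. qmul (A a b) (z$(Some b))))"

text \<open>Functions on HP^n = S^(4n+3)/Sp(1): functions on the unit sphere of H^(n+1)
  invariant under right multiplication by unit quaternions.\<close>
definition HP_fun :: "(real^4^('n::finite option) \<Rightarrow> real) \<Rightarrow> bool" where
  "HP_fun u \<longleftrightarrow> (\<forall>x\<in>sphere 0 1. \<forall>p. norm p = 1 \<longrightarrow> u (rmul x p) = u x)"

definition Sp_invariant :: "(real^4^('n::finite option) \<Rightarrow> real) \<Rightarrow> bool" where
  "Sp_invariant u \<longleftrightarrow> (\<forall>A. sp_mat A \<longrightarrow> (\<forall>x\<in>sphere 0 1. u (sp_act A x) = u x))"

definition hom0 :: "('a::real_normed_vector \<Rightarrow> real) \<Rightarrow> 'a \<Rightarrow> real" where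
  "hom0 u x = u (x /\<^sub>R norm x)"

definition C2_on :: "'a::euclidean_space set \<Rightarrow> ('a \<Rightarrow> real) \<Rightarrow> bool" where
  "C2_on S f \<longleftrightarrow> (\<exists>Df :: 'a \<Rightarrow> ('a \<Rightarrow>\<^sub>L real). \<exists>D2f :: 'a \<Rightarrow> ('a \<Rightarrow>\<^sub>L ('a \<Rightarrow>\<^sub>L real)).
      (\<forall>x\<in>S. (f has_derivative blinfun_apply (Df x)) (at x)) \<and>
      (\<forall>x\<in>S. (Df has_derivative blinfun_apply (D2f x)) (at x)) \<and>
      continuous_on S D2f)"

definition lap :: "('a::euclidean_space \<Rightarrow> real) \<Rightarrow> 'a \<Rightarrow> real" where
  "lap f x = (\<Sum>b\<in>Basis. deriv (\<lambda>t. deriv (\<lambda>s. f (x + s *\<^sub>R b)) t) 0)"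

text \<open>Laplace-Beltrami operator of (HP^n, g_H) on a function u, evaluated at a point x of the
  unit sphere (representing its class): the Laplacian of the lift to S^(4n+3), computed as the
  Euclidean Laplacian of the 0-homogeneous extension.\<close>
definition lap_HP :: "(real^4^('n::finite option) \<Rightarrow> real) \<Rightarrow> real^4^('n option) \<Rightarrow> real" where
  "lap_HP u x = lap (hom0 u) x"

end

theory Submission
  imports Defs "HOL-Real_Asymp.Real_Asymp"
begin

text \<open>Functions of \<open>t = |z_0|^2\<close> are \<open>Sp(n)\<close>-invariant, and on them the Laplacian is four times the
  Jacobi operator \<open>L f = t (1 - t) f'' + (a - (a + b) t) f'\<close> with \<open>a = 2\<close>, \<open>b = 2 n\<close>. (For \<open>n = 1\<close>
  one uses functions of \<open>s = (2 t - 1)^2\<close> instead, where \<open>a = 1/2\<close>, \<open>b = 2\<close>, so that always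
  \<open>a < b\<close>.) For \<open>h = \<mu>^(1/(q-2)) f\<close> the equation is \<open>L h + h^(q-1) - \<mu> h = 0\<close>, and \<open>\<mu>\<close> is
  proportional to \<open>\<lambda>\<close>. Let \<open>\<mu>\<^sub>*\<close> be the infimum of the \<open>\<mu>\<close> below the first bifurcation
  value \<open>\<mu>1 = (a + b) / (q - 2)\<close> that admit a nonconstant positive solution.

  Such \<open>\<mu>\<close> exist, since the bifurcation from the constants at \<open>\<mu>1\<close> is transcritical: the third
  moment of the first eigenfunction does not vanish because \<open>a \<noteq> b\<close>. In the subcritical range a
  blow-up argument based on Pohozaev's identity bounds all positive solutions with
  \<open>0 \<le> \<mu> \<le> \<mu>1\<close>, so solutions for \<open>\<mu> \<rightarrow> \<mu>\<^sub>*\<close> converge; by Bochner's formula the limit is not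
  constant, and \<open>\<mu>\<^sub>* > 0\<close>. If this solution were nondegenerate, it would persist for slightly
  smaller \<open>\<mu>\<close>, contradicting the choice of \<open>\<mu>\<^sub>*\<close>. All solutions are found by shooting from both
  endpoints and matching the values and derivatives at an interior point \<open>m\<close>.\<close>

text \<open>With \<open>s = r^2 / 4\<close> the operator \<open>s h'' + a h'\<close> is the radial
  Laplacian in dimension \<open>2 a\<close>. For \<open>a = 2\<close>, \<open>b = 2 n\<close> the
  orbit space thus looks near \<open>t = 0\<close> like the radius of a ball of dimension 4, normal
  to \<open>z_0 = 0\<close>, and near \<open>t = 1\<close> like that of a ball of dimension
  \<open>4 n\<close> around the fixed point. The bound \<open>q < 4 n / (2 n - 1)\<close> is Sobolev
  subcriticality \<open>q < 2 b / (b - 1)\<close> in dimension \<open>2 b\<close>; as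
  \<open>a < b\<close>, it passes on to the other end. The obstacle is that the equation is singular
  at both ends. At each end the regular solutions form a one-parameter family, and as a Volterra
  equation the problem admits Gronwall estimates up to the end. A solution on the whole interval is
  then a zero of a map of the plane: two initial values against two mismatches at \<open>m\<close>.
  So no function spaces enter. Poincare-Miranda replaces both the bifurcation theorem and the
  implicit function theorem and asks only for first-order expansions with error bounds, and
  compactness of solution sets becomes compactness of pairs of initial values.\<close>

section \<open>The singular integral operator\<close>

text \<open>Substituting \<open>r = s * \<sigma> powr (1/a)\<close> in \<open>\<integral> r powr (a - 1) * G r\<close> over \<open>[0, s]\<close> gives
  \<open>s powr a / a * av a G s\<close>, without a singular weight. Hence \<open>- kop a b 1 y\<close> is the derivative of the
  solution of \<open>L h = - y\<close> that is regular at \<open>0\<close>. The parameter \<open>e\<close> is the blow-up scale; \<open>e = 0\<close> is the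
  limit equation \<open>s h'' + a h' = - y\<close>.\<close>

definition av :: "real \<Rightarrow> (real \<Rightarrow> real) \<Rightarrow> real \<Rightarrow> real" where
  "av a G s = integral {0..1} (\<lambda>\<sigma>. G (s * \<sigma> powr (1/a)))"

definition kop :: "real \<Rightarrow> real \<Rightarrow> real \<Rightarrow> (real \<Rightarrow> real) \<Rightarrow> real \<Rightarrow> real" where
  "kop a b e y s = (1 - e * s) powr (-b) / a * av a (\<lambda>r. (1 - e * r) powr (b - 1) * y r) s"

definition jop :: "real \<Rightarrow> real \<Rightarrow> real \<Rightarrow> (real \<Rightarrow> real) \<Rightarrow> real \<Rightarrow> real" where
  "jop a b e y t = integral {0..t} (kop a b e y)"

lemma scaled_powr_bounds:
  fixes a s \<sigma> :: real
  assumes "0 < a" "0 \<le> s" "\<sigma> \<in> {0..1}"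
  shows "0 \<le> s * \<sigma> powr (1/a)" "s * \<sigma> powr (1/a) \<le> s"
  using assms by (auto intro!: mult_left_le powr_le1)

lemma continuous_on_scaled_powr:
  assumes "0 < a" "0 \<le> s" "s \<le> m" "continuous_on {0..m} G"
  shows "continuous_on {0..1::real} (\<lambda>\<sigma>. G (s * \<sigma> powr (1/a)) :: real)"
proof (rule continuous_on_compose2[OF assms(4)])
  show "continuous_on {0..1} (\<lambda>\<sigma>. s * \<sigma> powr (1 / a))"
    using assms by (intro continuous_intros continuous_on_powr') auto
  show "(\<lambda>\<sigma>. s * \<sigma> powr (1 / a)) ` {0..1} \<subseteq> {0..m}"
    using scaled_powr_bounds[OF assms(1,2)] assms(3) by fastforce
qed

lemma av_integrable:
  assumes "0 < a" "0 \<le> s" "s \<le> m" "continuous_on {0..m} G"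
  shows "(\<lambda>\<sigma>. G (s * \<sigma> powr (1/a)) :: real) integrable_on {0..1::real}"
  using continuous_on_scaled_powr[OF assms] integrable_continuous_real by blast

lemma continuous_on_av:
  assumes a: "0 < a" and G: "continuous_on {0..m} G"
  shows "continuous_on {0..m} (av a G)"
proof -
  have "continuous_on {0..m} (\<lambda>s. integral (cbox 0 1) (\<lambda>\<sigma>. G (s * \<sigma> powr (1/a))))"
  proof (rule integral_continuous_on_param)
    have "continuous_on ({0..m} \<times> cbox 0 1) (\<lambda>x. G (fst x * snd x powr (1/a)))"
    proof (rule continuous_on_compose2[OF G])
      show "continuous_on ({0..m} \<times> cbox (0::real) 1) (\<lambda>x. fst x * snd x powr (1 / a))"
        using a by (intro continuous_intros continuous_on_powr') auto
      show "(\<lambda>x. fst x * snd x powr (1 / a)) ` ({0..m} \<times> cbox 0 1) \<subseteq> {0..m}"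
        using scaled_powr_bounds[OF a] by fastforce
    qed
    then show "continuous_on ({0..m} \<times> cbox 0 1) (\<lambda>(s, \<sigma>). G (s * \<sigma> powr (1/a)))"
      by (simp add: case_prod_unfold)
  qed
  then show ?thesis by (simp add: av_def[abs_def])
qed

lemma av_mono:
  assumes "0 < a" "0 \<le> s" "s \<le> m" "continuous_on {0..m} G" "continuous_on {0..m} H"
    and "\<And>r. 0 \<le> r \<Longrightarrow> r \<le> s \<Longrightarrow> G r \<le> H r"
  shows "av a G s \<le> av a H s"
  unfolding av_def
  using assms scaled_powr_bounds[OF assms(1,2)]
  by (intro integral_le av_integrable[of _ _ m]) auto

lemma av_const [simp]: "av a (\<lambda>_. c) s = c"
  by (simp add: av_def)

lemma av_add:
  assumes "0 < a" "0 \<le> s" "s \<le> m" "continuous_on {0..m} G" "continuous_on {0..m} H"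
  shows "av a (\<lambda>r. G r + H r) s = av a G s + av a H s"
  unfolding av_def using assms by (intro integral_add av_integrable[of _ _ m])

lemma av_cmult: "av a (\<lambda>r. c * G r) s = c * av a G s"
  unfolding av_def by (rule integral_mult_right)

lemma av_cong:
  assumes "0 < a" "0 \<le> s" "\<And>r. 0 \<le> r \<Longrightarrow> r \<le> s \<Longrightarrow> G r = H r"
  shows "av a G s = av a H s"
  unfolding av_def using assms(3) scaled_powr_bounds[OF assms(1,2)]
  by (intro integral_cong) auto

text \<open>In the variable \<open>\<rho> = s powr a * \<sigma>\<close> the point \<open>s\<close>
  enters only through the upper limit, so the fundamental theorem of calculus differentiates the
  average for \<open>s > 0\<close> with merely continuous \<open>G\<close>.\<close>

lemma powr_times_av:
  assumes a: "0 < a" and s: "0 < s" and G: "continuous_on {0..s} G"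
  shows "s powr a * av a G s = integral {0..s powr a} (\<lambda>\<rho>. G (\<rho> powr (1/a)))"
proof -
  have sp: "0 < s powr a" using s by simp
  have im: "(\<lambda>x. x / s powr a) ` {0..s powr a} = {0..1::real}"
    using sp by (auto simp: field_simps image_iff intro!: bexI[of _ "_ * s powr a"])
  have *: "(s powr a * x) powr (1/a) = s * x powr (1/a)" for x
    using a s by (simp add: powr_mult powr_powr)
  have "integral ((\<lambda>x. x / s powr a) ` {0..s powr a}) (\<lambda>x. G ((s powr a * x) powr (1/a)))
      = (1 / \<bar>s powr a\<bar>) *\<^sub>R integral {0..s powr a} (\<lambda>\<rho>. G (\<rho> powr (1/a)))"
    by (rule integral_stretch_real) (use sp in simp)
  then show ?thesis using sp unfolding im * av_def by (simp add: field_simps)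
qed

lemma av_has_derivative:
  assumes a: "0 < a" and s: "0 < s" "s \<le> m" and G: "continuous_on {0..m} G"
  shows "(av a G has_real_derivative a * (G s - av a G s) / s) (at s within {0..m})"
proof -
  define F where "F x = integral {0..x} (\<lambda>\<rho>. G (\<rho> powr (1/a)))" for x
  have m: "0 < m" using s by simp
  have cont: "continuous_on {0..m powr a} (\<lambda>\<rho>. G (\<rho> powr (1/a)))"
  proof (rule continuous_on_compose2[OF G])
    show "continuous_on {0..m powr a} (\<lambda>\<rho>. \<rho> powr (1/a))"
      using a by (intro continuous_intros continuous_on_powr') auto
    have "\<rho> powr (1/a) \<le> m" if "0 \<le> \<rho>" "\<rho> \<le> m powr a" for \<rho>
    proof -
      have "\<rho> powr (1/a) \<le> (m powr a) powr (1/a)" using that a by (intro powr_mono2) auto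
      also have "\<dots> = m" using a m by (simp add: powr_powr)
      finally show ?thesis .
    qed
    then show "(\<lambda>\<rho>. \<rho> powr (1/a)) ` {0..m powr a} \<subseteq> {0..m}" by auto
  qed
  have mem: "x powr a \<in> {0..m powr a}" if "x \<in> {0..m}" for x
    using that a by (auto intro: powr_mono2)
  have "(F has_real_derivative G ((s powr a) powr (1/a))) (at (s powr a) within {0..m powr a})"
    unfolding F_def by (rule integral_has_real_derivative[OF cont]) (use mem s in auto)
  moreover have "(s powr a) powr (1/a) = s" using a s by (simp add: powr_powr)
  ultimately have "(F has_real_derivative G s) (at (s powr a) within (\<lambda>x. x powr a) ` {0..m})"
    using mem by (auto intro: DERIV_subset)
  then have "((\<lambda>x. F (x powr a)) has_real_derivative G s * (a * s powr (a - 1))) (at s within {0..m})"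
    by (rule DERIV_image_chain[unfolded o_def])
       (use s in \<open>auto intro!: derivative_eq_intros\<close>)
  then have d: "((\<lambda>x. x powr (-a) * F (x powr a)) has_real_derivative
      s powr (-a) * (G s * (a * s powr (a - 1))) + (-a) * s powr (-a-1) * F (s powr a)) (at s within {0..m})"
    using s by (auto intro!: derivative_eq_intros simp: algebra_simps)
  have F: "x powr (-a) * F (x powr a) = av a G x" if "x \<in> {0..m}" "x > 0" for x
  proof -
    have "x powr a * av a G x = F (x powr a)"
      unfolding F_def using that a by (intro powr_times_av continuous_on_subset[OF G]) auto
    then have "x powr (-a) * F (x powr a) = (x powr (-a) * x powr a) * av a G x" by simp
    also have "x powr (-a) * x powr a = 1" using that by (simp add: powr_minus)
    finally show ?thesis by simp
  qed
  have 1: "s powr (-a) * s powr (a - 1) = 1 / s"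
    using s by (simp add: powr_diff powr_minus_divide)
  have 2: "s powr (-a-1) = s powr (-a) / s" using s by (simp add: powr_diff)
  have "s powr (-a) * (G s * (a * s powr (a - 1))) + (-a) * s powr (-a-1) * F (s powr a)
      = a * G s * (s powr (-a) * s powr (a - 1)) - a / s * (s powr (-a) * F (s powr a))"
    unfolding 2 by simp
  also have "\<dots> = a * (G s - av a G s) / s"
    unfolding 1 using F[of s] s by (simp add: field_simps)
  finally have "((\<lambda>x. x powr (-a) * F (x powr a)) has_real_derivative
      a * (G s - av a G s) / s) (at s within {0..m})" using d by simp
  \<comment> \<open>The radius \<open>d = s\<close> keeps the neighbourhood inside
    \<open>x > 0\<close>, where \<open>F\<close> applies.\<close>
  then show ?thesis
    by (rule has_field_derivative_transform_within[where d=s]) (use s F in \<open>auto simp: dist_real_def\<close>)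
qed

text \<open>At \<open>0\<close> the formula of \<open>av_has_derivative\<close> reads
  \<open>0 / 0\<close>. Differentiating under the integral sign works there too, because the
  substitution has removed the singular weight; the price is a derivative of
  \<open>G\<close>.\<close>

lemma av_C1:
  assumes a: "0 < a" and G: "\<And>s. s \<in> {0..m} \<Longrightarrow> (G has_real_derivative G' s) (at s within {0..m})"
    and G': "continuous_on {0..m} G'" and m: "0 < m"
  shows "\<exists>D. continuous_on {0..m} D \<and> (\<forall>s\<in>{0..m}. (av a G has_real_derivative D s) (at s within {0..m}))"
proof -
  define D where "D s = integral (cbox 0 1) (\<lambda>\<sigma>. \<sigma> powr (1/a) * G' (s * \<sigma> powr (1/a)))" for s
  have Gc: "continuous_on {0..m} G" using G by (meson DERIV_continuous_on)
  have cont: "continuous_on ({0..m} \<times> cbox 0 1) (\<lambda>(s,\<sigma>). \<sigma> powr (1/a) * G' (s * \<sigma> powr (1/a)))"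
  proof -
    have "continuous_on ({0..m} \<times> cbox 0 1) (\<lambda>x. G' (fst x * snd x powr (1/a)))"
    proof (rule continuous_on_compose2[OF G'])
      show "continuous_on ({0..m} \<times> cbox (0::real) 1) (\<lambda>x. fst x * snd x powr (1 / a))"
        using a by (intro continuous_intros continuous_on_powr') auto
      show "(\<lambda>x. fst x * snd x powr (1 / a)) ` ({0..m} \<times> cbox 0 1) \<subseteq> {0..m}"
        using scaled_powr_bounds[OF a] by fastforce
    qed
    moreover have "continuous_on ({0..m} \<times> cbox (0::real) 1) (\<lambda>x. snd x powr (1 / a))"
      using a by (intro continuous_intros continuous_on_powr') auto
    ultimately show ?thesis
      unfolding case_prod_unfold by (intro continuous_on_mult)
  qed
  have "continuous_on {0..m} D"
    unfolding D_def by (rule integral_continuous_on_param[OF cont])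
  moreover have "(av a G has_real_derivative D s) (at s within {0..m})" if s: "s \<in> {0..m}" for s
  proof -
    have "((\<lambda>s. integral (cbox 0 1) (\<lambda>\<sigma>. G (s * \<sigma> powr (1/a)))) has_field_derivative D s) (at s within {0..m})"
      unfolding D_def
    proof (rule leibniz_rule_field_derivative[OF _ _ cont s])
      fix x \<sigma> :: real assume x: "x \<in> {0..m}" and \<sigma>: "\<sigma> \<in> cbox 0 1"
      have im: "(\<lambda>x. x * \<sigma> powr (1/a)) ` {0..m} \<subseteq> {0..m}"
        using scaled_powr_bounds[OF a, of _ \<sigma>] \<sigma> by fastforce
      then have "(G has_real_derivative G' (x * \<sigma> powr (1/a))) (at (x * \<sigma> powr (1/a)) within (\<lambda>x. x * \<sigma> powr (1/a)) ` {0..m})"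
        using x by (intro DERIV_subset[OF G]) (auto simp: image_subset_iff)
      then have "((\<lambda>x. G (x * \<sigma> powr (1/a))) has_real_derivative G' (x * \<sigma> powr (1/a)) * \<sigma> powr (1/a)) (at x within {0..m})"
        by (rule DERIV_image_chain[unfolded o_def]) (auto intro!: derivative_eq_intros)
      then show "((\<lambda>x. G (x * \<sigma> powr (1/a))) has_field_derivative \<sigma> powr (1/a) * G' (x * \<sigma> powr (1/a))) (at x within {0..m})"
        by (simp add: mult.commute)
    next
      fix x assume "x \<in> {0..m}"
      then show "(\<lambda>\<sigma>. G (x * \<sigma> powr (1/a))) integrable_on cbox 0 1"
        using av_integrable[OF a _ _ Gc] by auto
    qed simp
    then show ?thesis by (simp add: av_def[abs_def])
  qed
  ultimately show ?thesis by blast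
qed

section \<open>Volterra operators at one singular endpoint\<close>

locale radial =
  fixes a b e m :: real
  assumes a: "0 < a" and b: "0 < b" and e: "0 \<le> e" and m: "0 < m" and em: "e * m < 1"
begin

abbreviation K where "K \<equiv> kop a b e"
abbreviation J where "J \<equiv> jop a b e"

text \<open>A bound for \<open>K\<close> in the supremum norm, from estimating the weights at
  \<open>s = m\<close>. The last factor \<open>1 / (1 - e * m)\<close> takes care of the exponent
  \<open>b - 1\<close>, which may be negative.\<close>

definition C where "C = (1 - e * m) powr (-b) / a / (1 - e * m)"

lemma C_pos: "0 < C"
  using a em by (simp add: C_def)

lemma es: "e * s < 1" "0 \<le> e * s" "e * s \<le> e * m" if "s \<in> {0..m}" for s
proof -
  show *: "e * s \<le> e * m" using that e by (auto intro: mult_left_mono)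
  then show "e * s < 1" using em by simp
  show "0 \<le> e * s" using that e by auto
qed

lemma continuous_on_weight: "continuous_on {0..m} (\<lambda>r. (1 - e * r) powr c)"
proof -
  have "\<forall>x\<in>{0..m}. 1 - e * x \<noteq> 0" using es by fastforce
  then show ?thesis by (intro continuous_intros)
qed

lemma continuous_on_wy:
  assumes "continuous_on {0..m} y"
  shows "continuous_on {0..m} (\<lambda>r. (1 - e * r) powr (b - 1) * y r)"
  by (intro continuous_on_mult continuous_on_weight assms)

lemma continuous_on_K:
  assumes y: "continuous_on {0..m} y"
  shows "continuous_on {0..m} (K y)"
  unfolding kop_def[abs_def] divide_inverse
  by (intro continuous_on_mult continuous_on_weight continuous_on_av a continuous_on_wy y continuous_intros)

lemma K_mono:
  assumes "continuous_on {0..m} y" "continuous_on {0..m} z" "s \<in> {0..m}"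
    and "\<And>r. 0 \<le> r \<Longrightarrow> r \<le> s \<Longrightarrow> y r \<le> z r"
  shows "K y s \<le> K z s"
  unfolding kop_def using assms a
  by (intro mult_left_mono av_mono[of _ _ m] continuous_on_wy) (auto intro!: mult_left_mono)

lemma K_cong:
  assumes "s \<in> {0..m}" "\<And>r. 0 \<le> r \<Longrightarrow> r \<le> s \<Longrightarrow> y r = z r"
  shows "K y s = K z s"
  unfolding kop_def using av_cong[OF a, of s "\<lambda>r. (1 - e * r) powr (b - 1) * y r" "\<lambda>r. (1 - e * r) powr (b - 1) * z r"]
    assms by auto

lemma K_add:
  assumes "continuous_on {0..m} y" "continuous_on {0..m} z" "s \<in> {0..m}"
  shows "K (\<lambda>r. y r + z r) s = K y s + K z s"
proof -
  have "av a (\<lambda>r. (1 - e * r) powr (b - 1) * (y r + z r)) s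
      = av a (\<lambda>r. (1 - e * r) powr (b - 1) * y r + (1 - e * r) powr (b - 1) * z r) s"
    by (simp add: distrib_left)
  also have "\<dots> = av a (\<lambda>r. (1 - e * r) powr (b - 1) * y r) s + av a (\<lambda>r. (1 - e * r) powr (b - 1) * z r) s"
    using assms by (intro av_add[OF a, of _ m] continuous_on_wy) auto
  finally show ?thesis by (simp add: kop_def distrib_left)
qed

lemma K_cmult: "K (\<lambda>r. c * y r) s = c * K y s"
proof -
  have "av a (\<lambda>r. (1 - e * r) powr (b - 1) * (c * y r)) s = av a (\<lambda>r. c * ((1 - e * r) powr (b - 1) * y r)) s"
    by (simp add: mult.left_commute)
  then show ?thesis by (simp add: kop_def av_cmult)
qed

lemma K_diff:
  assumes "continuous_on {0..m} y" "continuous_on {0..m} z" "s \<in> {0..m}"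
  shows "K (\<lambda>r. y r - z r) s = K y s - K z s"
proof -
  have "K (\<lambda>r. y r - z r) s = K (\<lambda>r. y r + (- 1) * z r) s" by simp
  also have "\<dots> = K y s + K (\<lambda>r. (- 1) * z r) s"
    using assms by (intro K_add continuous_intros) auto
  finally show ?thesis by (simp only: K_cmult)
qed

lemma K_zero [simp]: "K (\<lambda>_. 0) s = 0"
  using K_cmult[of 0 "\<lambda>_. 0"] by simp

lemma K_const_le:
  assumes "s \<in> {0..m}" "0 \<le> B"
  shows "K (\<lambda>_. B) s \<le> C * B"
proof -
  have pos: "0 < 1 - e * m" using em by simp
  have w: "(1 - e * r) powr (b - 1) \<le> 1 / (1 - e * m)" if "r \<in> {0..m}" for r
  proof -
    have 1: "0 < 1 - e * r" "1 - e * r \<le> 1" "1 - e * m \<le> 1 - e * r" using es[OF that] by auto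
    have "(1 - e * r) powr (b - 1) = (1 - e * r) powr b / (1 - e * r)"
      using 1 by (simp add: powr_diff)
    also have "\<dots> \<le> 1 / (1 - e * m)"
      using 1 b pos by (intro frac_le powr_le1) auto
    finally show ?thesis .
  qed
  have "av a (\<lambda>r. (1 - e * r) powr (b - 1) * B) s \<le> av a (\<lambda>r. 1 / (1 - e * m) * B) s"
    using assms by (intro av_mono[OF a, of _ m] continuous_on_wy mult_right_mono w continuous_intros) auto
  then have A: "av a (\<lambda>r. (1 - e * r) powr (b - 1) * B) s \<le> B / (1 - e * m)" by simp
  have P: "(1 - e * s) powr (-b) \<le> (1 - e * m) powr (-b)"
    using es[OF assms(1)] em b by (intro powr_mono2') auto
  have "K (\<lambda>_. B) s \<le> (1 - e * s) powr (-b) / a * (B / (1 - e * m))"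
    unfolding kop_def using A a by (intro mult_left_mono) auto
  also have "\<dots> \<le> (1 - e * m) powr (-b) / a * (B / (1 - e * m))"
    using P a pos assms by (intro mult_right_mono divide_right_mono) auto
  finally show ?thesis by (simp add: C_def)
qed

lemma K_le:
  assumes "continuous_on {0..m} y" "s \<in> {0..m}" "0 \<le> B"
    and "\<And>r. 0 \<le> r \<Longrightarrow> r \<le> s \<Longrightarrow> y r \<le> B"
  shows "K y s \<le> C * B"
  using K_mono[OF assms(1) _ assms(2), of "\<lambda>_. B"] K_const_le[OF assms(2,3)] assms(4) by fastforce

lemma K_abs_le:
  assumes "continuous_on {0..m} y" "s \<in> {0..m}"
    and "\<And>r. 0 \<le> r \<Longrightarrow> r \<le> s \<Longrightarrow> \<bar>y r\<bar> \<le> B"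
  shows "\<bar>K y s\<bar> \<le> C * B"
proof -
  have B: "0 \<le> B" using assms(2) assms(3)[of 0] by auto
  have "K y s \<le> C * B"
    using assms by (intro K_le B) (auto simp: abs_le_iff)
  moreover have "K (\<lambda>r. - 1 * y r) s \<le> C * B"
    using assms by (intro K_le B continuous_intros) (fastforce simp: abs_le_iff)+
  ultimately show ?thesis unfolding K_cmult by (simp add: abs_le_iff)
qed

lemma K_nonneg:
  assumes "continuous_on {0..m} y" "s \<in> {0..m}"
    and "\<And>r. 0 \<le> r \<Longrightarrow> r \<le> s \<Longrightarrow> 0 \<le> y r"
  shows "0 \<le> K y s"
  using K_mono[OF _ assms(1,2), of "\<lambda>_. 0"] assms(3) by simp

text \<open>With \<open>k = K y\<close> this is the equation
  \<open>s (1 - e s) k' + (a - (a + b) e s) k = y\<close> solved for \<open>k'\<close>; the division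
  by \<open>s\<close> excludes the endpoint.\<close>

lemma K_has_derivative:
  assumes y: "continuous_on {0..m} y" and s: "0 < s" "s \<le> m"
  shows "(K y has_real_derivative (y s - (a - (a + b) * e * s) * K y s) / (s * (1 - e * s))) (at s within {0..m})"
proof -
  define U where "U = av a (\<lambda>r. (1 - e * r) powr (b - 1) * y r)"
  have p: "0 < 1 - e * s" using es[of s] s by simp
  have U: "(U has_real_derivative a * ((1 - e * s) powr (b - 1) * y s - U s) / s) (at s within {0..m})"
    unfolding U_def by (rule av_has_derivative[OF a s continuous_on_wy[OF y]])
  have P: "((\<lambda>s. (1 - e * s) powr (-b)) has_real_derivative b * e * (1 - e * s) powr (-b) / (1 - e * s)) (at s within {0..m})"
    using p by (auto intro!: derivative_eq_intros simp: powr_diff field_simps)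
  have D: "((\<lambda>s. (1 - e * s) powr (-b) / a * U s) has_real_derivative
     (b * e * (1 - e * s) powr (-b) / (1 - e * s)) / a * U s
     + (a * ((1 - e * s) powr (b - 1) * y s - U s) / s) * ((1 - e * s) powr (-b) / a)) (at s within {0..m})"
    by (rule DERIV_mult[OF DERIV_cdivide[OF P] U])
  have "(1 - e * s) powr (b - 1) * (1 - e * s) powr (-b) = 1 / (1 - e * s)"
    using p by (simp add: powr_diff powr_minus_divide)
  then have pp: "(1 - e * s) powr (b - 1) = 1 / (1 - e * s) / (1 - e * s) powr (-b)"
    using p by (simp add: field_simps)
  have "(b * e * (1 - e * s) powr (-b) / (1 - e * s)) / a * U s
     + (a * ((1 - e * s) powr (b - 1) * y s - U s) / s) * ((1 - e * s) powr (-b) / a)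
     = (y s - (a - (a + b) * e * s) * ((1 - e * s) powr (-b) / a * U s)) / (s * (1 - e * s))"
    unfolding pp using p s a by (simp add: divide_simps) (simp add: algebra_simps)
  then show ?thesis using D unfolding kop_def[abs_def] U_def by simp
qed

text \<open>Regularity up to the singular endpoint, which \<open>K_has_derivative\<close> cannot
  see. It is what makes the glued profiles C^2 at \<open>t = 0\<close> and
  \<open>t = 1\<close>.\<close>

lemma K_C1:
  assumes y: "\<And>s. s \<in> {0..m} \<Longrightarrow> (y has_real_derivative y' s) (at s within {0..m})"
    and y': "continuous_on {0..m} y'"
  shows "\<exists>D. continuous_on {0..m} D \<and> (\<forall>s\<in>{0..m}. (K y has_real_derivative D s) (at s within {0..m}))"
proof -
  define G where "G = (\<lambda>r. (1 - e * r) powr (b - 1) * y r)"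
  define G' where "G' r = (1 - e * r) powr (b - 1) * y' r + (-e * (b - 1)) * (1 - e * r) powr (b - 2) * y r" for r
  have yc: "continuous_on {0..m} y" using y by (meson DERIV_continuous_on)
  have p: "0 < 1 - e * s" if "s \<in> {0..m}" for s using es[OF that] by simp
  have "(G has_real_derivative G' s) (at s within {0..m})" if "s \<in> {0..m}" for s
    unfolding G_def G'_def using p[OF that]
    by (auto intro!: derivative_eq_intros y[OF that])
  moreover have "continuous_on {0..m} G'"
    unfolding G'_def by (intro continuous_on_mult continuous_on_add continuous_on_const y' yc continuous_on_weight)
  ultimately obtain D where D: "continuous_on {0..m} D" "\<And>s. s\<in>{0..m} \<Longrightarrow> (av a G has_real_derivative D s) (at s within {0..m})"
    using av_C1[OF a, of m G G'] m by blast
  have GC: "continuous_on {0..m} (av a G)" using D(2) by (meson DERIV_continuous_on)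
  define E where "E s = b * e * (1 - e * s) powr (-b - 1) / a * av a G s + D s * ((1 - e * s) powr (-b) / a)" for s
  have "continuous_on {0..m} E"
    unfolding E_def divide_inverse by (intro continuous_on_mult continuous_on_add continuous_on_const GC D continuous_on_weight)
  moreover have "(K y has_real_derivative E s) (at s within {0..m})" if s: "s \<in> {0..m}" for s
  proof -
    have "((\<lambda>s. (1 - e * s) powr (-b) / a) has_real_derivative b * e * (1 - e * s) powr (-b - 1) / a) (at s within {0..m})"
      using p[OF s] a by (auto intro!: derivative_eq_intros)
    from DERIV_mult[OF this D(2)[OF s]] show ?thesis
      unfolding E_def kop_def[abs_def] G_def by simp
  qed
  ultimately show ?thesis by blast
qed

text \<open>The weight \<open>s powr a * (1 - e * s) powr b\<close> turns the equation into a vanishing derivative,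
  and it vanishes at the singular endpoint.\<close>

lemma singular_homogeneous_eq_0:
  assumes e1: "e = 1" and E: "continuous_on {0..m} E"
    and D: "\<And>s. 0 < s \<Longrightarrow> s \<le> m \<Longrightarrow> (E has_real_derivative D s) (at s within {0..m})"
    and eq: "\<And>s. 0 < s \<Longrightarrow> s \<le> m \<Longrightarrow> s * (1 - s) * D s + (a - (a + b) * s) * E s = 0"
    and s: "s \<in> {0<..m}"
  shows "E s = 0"
proof -
  define W where "W s = s powr a * (1 - s) powr b * E s" for s
  have m1: "m < 1" using em e1 by simp
  have cW: "continuous_on {0..m} W"
    unfolding W_def using a b m1 by (intro continuous_intros continuous_on_powr' E) auto
  have W: "W s = W 0"
  proof (rule has_derivative_zero_unique_strong_interval[of "{0}" 0 m W "W 0"])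
    show "(W has_derivative (\<lambda>h. 0)) (at x within {0..m})" if x: "x \<in> {0..m} - {0}" for x
    proof -
      have x': "0 < x" "x \<le> m" "x < 1" using x m1 by auto
      have "(W has_real_derivative ((a * x powr (a - 1)) * (1 - x) powr b + x powr a * (- b * (1 - x) powr (b - 1))) * E x
          + x powr a * (1 - x) powr b * D x) (at x within {0..m})"
        unfolding W_def using x' by (auto intro!: derivative_eq_intros D simp: algebra_simps)
      moreover have "((a * x powr (a - 1)) * (1 - x) powr b + x powr a * (- b * (1 - x) powr (b - 1))) * E x
          + x powr a * (1 - x) powr b * D x
          = x powr a * (1 - x) powr b / (x * (1 - x)) * (x * (1 - x) * D x + (a - (a + b) * x) * E x)"
        using x' by (simp add: powr_diff divide_simps) (simp add: algebra_simps)
      ultimately have "(W has_real_derivative 0) (at x within {0..m})"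
        using eq[OF x'(1,2)] by simp
      then show ?thesis by (simp add: has_field_derivative_def lambda_zero)
    qed
  qed (use cW s in auto)
  then show ?thesis using s m1 by (simp add: W_def)
qed

lemma J_has_derivative:
  assumes "continuous_on {0..m} y" "t \<in> {0..m}"
  shows "(J y has_real_derivative K y t) (at t within {0..m})"
  unfolding jop_def[abs_def] by (rule integral_has_real_derivative[OF continuous_on_K[OF assms(1)] assms(2)])

lemma continuous_on_J:
  assumes "continuous_on {0..m} y"
  shows "continuous_on {0..m} (J y)"
  using J_has_derivative[OF assms] by (meson DERIV_continuous_on)

lemma K_integrable:
  assumes "continuous_on {0..m} y" "t \<in> {0..m}"
  shows "K y integrable_on {0..t}"
  using assms by (intro integrable_continuous_real continuous_on_subset[OF continuous_on_K]) auto

lemma J_add: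
  assumes "continuous_on {0..m} y" "continuous_on {0..m} z" "t \<in> {0..m}"
  shows "J (\<lambda>r. y r + z r) t = J y t + J z t"
proof -
  have "J (\<lambda>r. y r + z r) t = integral {0..t} (\<lambda>s. K y s + K z s)"
    unfolding jop_def using assms by (intro integral_cong K_add) auto
  then show ?thesis unfolding jop_def using assms by (simp add: integral_add K_integrable)
qed

lemma J_cmult: "J (\<lambda>r. c * y r) t = c * J y t"
  unfolding jop_def K_cmult[abs_def] by (rule integral_mult_right)

lemma J_diff:
  assumes "continuous_on {0..m} y" "continuous_on {0..m} z" "t \<in> {0..m}"
  shows "J (\<lambda>r. y r - z r) t = J y t - J z t"
proof -
  have "J (\<lambda>r. y r - z r) t = J (\<lambda>r. y r + (- 1) * z r) t" by simp
  also have "\<dots> = J y t + J (\<lambda>r. (- 1) * z r) t"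
    using assms by (intro J_add continuous_intros) auto
  finally show ?thesis by (simp only: J_cmult)
qed

lemma J_zero_left [simp]: "J y 0 = 0"
  by (simp add: jop_def)

lemma J_cong:
  assumes "t \<in> {0..m}" "\<And>r. 0 \<le> r \<Longrightarrow> r \<le> t \<Longrightarrow> y r = z r"
  shows "J y t = J z t"
  unfolding jop_def using assms by (intro integral_cong K_cong) auto

lemma J_nonneg:
  assumes "continuous_on {0..m} y" "t \<in> {0..m}"
    and "\<And>r. 0 \<le> r \<Longrightarrow> r \<le> t \<Longrightarrow> 0 \<le> y r"
  shows "0 \<le> J y t"
  unfolding jop_def using assms by (intro integral_nonneg K_integrable K_nonneg) auto

text \<open>Integrating the exponential gains the factor \<open>1 / L\<close>. The bound is
  one-sided on purpose: in \<open>ivp_upper\<close> the source is controlled from one side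
  only.\<close>

lemma J_le_exp:
  assumes y: "continuous_on {0..m} y" and t: "t \<in> {0..m}" and L: "0 < L" and B: "0 \<le> B"
    and le: "\<And>r. r \<in> {0..m} \<Longrightarrow> y r \<le> B * exp (L * r)"
  shows "J y t \<le> C * B / L * exp (L * t)"
proof -
  have FT: "((\<lambda>s. C * B * exp (L * s)) has_integral (C * B / L * exp (L * t) - C * B / L * exp (L * 0))) {0..t}"
    using t L by (intro fundamental_theorem_of_calculus)
      (auto intro!: derivative_eq_intros simp flip: has_real_derivative_iff_has_vector_derivative)
  have "J y t \<le> integral {0..t} (\<lambda>s. C * B * exp (L * s))"
    unfolding jop_def
  proof (rule integral_le)
    show "K y integrable_on {0..t}" by (rule K_integrable[OF y t])
    show "(\<lambda>s. C * B * exp (L * s)) integrable_on {0..t}" using FT by blast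
    fix s assume s: "s \<in> {0..t}"
    have "K y s \<le> C * (B * exp (L * s))"
    proof (rule K_le[OF y])
      fix r assume r: "0 \<le> r" "r \<le> s"
      have "y r \<le> B * exp (L * r)" using r s t by (intro le) auto
      also have "\<dots> \<le> B * exp (L * s)" using r L B by (intro mult_left_mono) auto
      finally show "y r \<le> B * exp (L * s)" .
    qed (use s t B in auto)
    then show "K y s \<le> C * B * exp (L * s)" by simp
  qed
  also have "\<dots> = C * B / L * exp (L * t) - C * B / L * exp (L * 0)"
    using FT by (rule integral_unique)
  also have "\<dots> \<le> C * B / L * exp (L * t)" using C_pos B L by simp
  finally show ?thesis .
qed

lemma J_abs_le_exp:
  assumes y: "continuous_on {0..m} y" and t: "t \<in> {0..m}" and L: "0 < L"
    and le: "\<And>r. r \<in> {0..m} \<Longrightarrow> \<bar>y r\<bar> \<le> B * exp (L * r)"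
  shows "\<bar>J y t\<bar> \<le> C * B / L * exp (L * t)"
proof -
  have B: "0 \<le> B" using le[of 0] m by auto
  have "J y t \<le> C * B / L * exp (L * t)"
    using le by (intro J_le_exp[OF y t L B]) (auto simp: abs_le_iff)
  moreover have "J (\<lambda>r. - 1 * y r) t \<le> C * B / L * exp (L * t)"
    using le y by (intro J_le_exp[OF _ t L B] continuous_intros) (auto simp: abs_le_iff)
  ultimately show ?thesis unfolding J_cmult by (simp add: abs_le_iff)
qed

lemma J_abs_le:
  assumes y: "continuous_on {0..m} y" and t: "t \<in> {0..m}"
    and le: "\<And>r. r \<in> {0..m} \<Longrightarrow> \<bar>y r\<bar> \<le> B"
  shows "\<bar>J y t\<bar> \<le> C * B * t"
proof -
  have "norm (integral (cbox 0 t) (K y)) \<le> C * B * measure lborel (cbox 0 t)"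
  proof (rule integrable_bound)
    show "0 \<le> C * B" using C_pos le[of 0] m by (intro mult_nonneg_nonneg) auto
    show "K y integrable_on cbox 0 t" using K_integrable[OF y t] by simp
    fix x assume "x \<in> cbox 0 t"
    then show "norm (K y x) \<le> C * B" using t le by (auto intro!: K_abs_le[OF y])
  qed
  then show ?thesis using t by (simp add: jop_def)
qed

text \<open>The norm weighted by \<open>exp (- L * t)\<close> is realized at a point, so that
  Gronwall-type bounds follow by evaluating one inequality at that point.\<close>

lemma weighted_max:
  fixes z :: "real \<Rightarrow> real"
  assumes "continuous_on {0..m} z"
  obtains t M where "t \<in> {0..m}" "z t = M * exp (L * t)" "\<And>r. r \<in> {0..m} \<Longrightarrow> z r \<le> M * exp (L * r)"
proof -
  have "continuous_on {0..m} (\<lambda>t. z t * exp (- (L * t)))" using assms by (intro continuous_intros)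
  then obtain t where t: "t \<in> {0..m}" "\<And>r. r \<in> {0..m} \<Longrightarrow> z r * exp (- (L * r)) \<le> z t * exp (- (L * t))"
    using continuous_attains_sup[of "{0..m}" "\<lambda>t. z t * exp (- (L * t))"] m by auto
  show ?thesis
  proof (rule that[OF t(1), of "z t * exp (- (L * t))"])
    fix r assume "r \<in> {0..m}"
    then have "z r * exp (- (L * r)) * exp (L * r) \<le> z t * exp (- (L * t)) * exp (L * r)"
      using t by (intro mult_right_mono) auto
    moreover have "z r * exp (- (L * r)) * exp (L * r) = z r"
      by (simp add: mult.assoc flip: exp_add)
    ultimately show "z r \<le> z t * exp (- (L * t)) * exp (L * r)" by simp
  qed (simp add: exp_minus)
qed

text \<open>Gronwall: in the norm weighted by \<open>exp (- L * t)\<close> with \<open>L\<close> large, the Volterra operator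
  halves.\<close>

lemma stability:
  assumes z: "continuous_on {0..m} z" and y: "continuous_on {0..m} y"
    and zle: "\<And>t. t \<in> {0..m} \<Longrightarrow> \<bar>z t\<bar> \<le> E + \<bar>J y t\<bar>"
    and yle: "\<And>t. t \<in> {0..m} \<Longrightarrow> \<bar>y t\<bar> \<le> k * \<bar>z t\<bar> + F"
    and k: "0 \<le> k" and F: "0 \<le> F" and E: "0 \<le> E" and t: "t \<in> {0..m}"
  shows "\<bar>z t\<bar> \<le> 2 * (E + F) * exp ((2 * C * (k + 1)) * m)"
proof -
  define L where "L = 2 * C * (k + 1)"
  have L: "0 < L" using C_pos k by (simp add: L_def)
  obtain t0 M where t0: "t0 \<in> {0..m}" "\<bar>z t0\<bar> = M * exp (L * t0)"
    and M: "\<And>r. r \<in> {0..m} \<Longrightarrow> \<bar>z r\<bar> \<le> M * exp (L * r)"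
    using weighted_max[of "\<lambda>t. \<bar>z t\<bar>" L] z by (auto intro: continuous_intros)
  have M0: "0 \<le> M" using t0(2) by (metis abs_ge_zero exp_gt_zero zero_le_mult_iff not_le)
  have e1: "1 \<le> exp (L * r)" if "r \<in> {0..m}" for r using L that by auto
  have "\<bar>J y t0\<bar> \<le> C * (k * M + F) / L * exp (L * t0)"
  proof (rule J_abs_le_exp[OF y t0(1) L])
    fix r assume r: "r \<in> {0..m}"
    have "\<bar>y r\<bar> \<le> k * \<bar>z r\<bar> + F" by (rule yle[OF r])
    also have "\<dots> \<le> k * (M * exp (L * r)) + F * exp (L * r)"
      using M[OF r] k F mult_left_mono[OF e1[OF r] F] by (intro add_mono mult_left_mono) simp_all
    finally show "\<bar>y r\<bar> \<le> (k * M + F) * exp (L * r)" by (simp add: algebra_simps)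
  qed
  also have "C * (k * M + F) / L \<le> M / 2 + F / 2"
  proof -
    have "C * (k * M + F) / L = (k * M + F) / (2 * (k + 1))" using C_pos by (simp add: L_def)
    also have "\<dots> \<le> (k + 1) * (M + F) / (2 * (k + 1))"
      using k M0 F by (intro divide_right_mono) (auto simp: algebra_simps)
    also have "\<dots> = M / 2 + F / 2" using k by (simp add: divide_simps)
    finally show ?thesis .
  qed
  finally have "\<bar>J y t0\<bar> \<le> (M / 2 + F / 2) * exp (L * t0)" by simp
  moreover have "E \<le> E * exp (L * t0)" using e1[OF t0(1)] E by (simp add: mult_left_le_one_le mult_le_cancel_left1)
  ultimately have "M * exp (L * t0) \<le> (E + (M / 2 + F / 2)) * exp (L * t0)"
    using zle[OF t0(1)] t0(2) by (simp add: algebra_simps)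
  then have "M \<le> 2 * E + F" by simp
  then have M2: "M \<le> 2 * (E + F)" using F by simp
  have "\<bar>z t\<bar> \<le> M * exp (L * t)" by (rule M[OF t])
  also have "\<dots> \<le> 2 * (E + F) * exp (L * m)"
    using M2 M0 L t by (intro mult_mono) auto
  finally show ?thesis by (simp add: L_def)
qed

end

section \<open>The initial value problem at the singular endpoint\<close>

text \<open>The mean value theorem in the shape used by all monotonicity arguments below: the
  derivative is taken within the interval of the solution and known only in the open part, so
  functions singular at \<open>0\<close> are covered.\<close>

lemma nondecreasing_within:
  fixes f :: "real \<Rightarrow> real"
  assumes uv: "u \<le> v" "l \<le> u" "v \<le> r" and f: "continuous_on {u..v} f"
    and D: "\<And>x. u < x \<Longrightarrow> x < v \<Longrightarrow> (f has_real_derivative D x) (at x within {l..r})"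
    and nn: "\<And>x. u < x \<Longrightarrow> x < v \<Longrightarrow> 0 \<le> D x"
  shows "f u \<le> f v"
proof (cases "u = v")
  case False
  then have lt: "u < v" using uv by simp
  have D': "DERIV f x :> D x" if "u < x" "x < v" for x
    using D[OF that] uv that by (simp add: at_within_Icc_at)
  obtain d z where "u < z" "z < v" "DERIV f z :> d" "f v - f u = (v - u) * d"
    using MVT[OF lt f] D' real_differentiable_def by blast
  then have "f v - f u = (v - u) * D z" using DERIV_unique D' by blast
  then show ?thesis using nn[of z] lt \<open>u < z\<close> \<open>z < v\<close> by (metis diff_ge_0_iff_ge less_imp_le mult_nonneg_nonneg)
qed simp

context radial
begin

text \<open>The regular solution of \<open>s (1 - e s) h'' + (a - (a + b) e s) h' = - y\<close> with
  \<open>h 0 = A\<close>, as an integral equation. The source is an argument of its own, so that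
  sums, differences and multiples are again instances, and genuine, truncated and linearized
  equations share one theory.\<close>

definition ivp :: "real \<Rightarrow> (real \<Rightarrow> real) \<Rightarrow> (real \<Rightarrow> real) \<Rightarrow> bool" where
  "ivp A y h \<longleftrightarrow> continuous_on {0..m} h \<and> continuous_on {0..m} y \<and> (\<forall>t\<in>{0..m}. h t = A - J y t)"

lemma ivpD:
  assumes "ivp A y h"
  shows "continuous_on {0..m} h" "continuous_on {0..m} y" "\<And>t. t \<in> {0..m} \<Longrightarrow> h t = A - J y t"
  using assms by (auto simp: ivp_def)

lemma ivp_at_0: "ivp A y h \<Longrightarrow> h 0 = A"
  using m by (simp add: ivp_def)

lemma ivp_has_derivative:
  assumes "ivp A y h" "t \<in> {0..m}"
  shows "(h has_real_derivative - K y t) (at t within {0..m})"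
proof -
  have "((\<lambda>t. A - J y t) has_real_derivative - K y t) (at t within {0..m})"
    using J_has_derivative[OF ivpD(2)[OF assms(1)] assms(2)] by (auto intro!: derivative_eq_intros)
  then show ?thesis
    by (rule has_field_derivative_transform_within[where d=1]) (use ivpD(3)[OF assms(1)] assms in auto)
qed

lemma ivp_cmult:
  assumes "ivp A y h"
  shows "ivp (c * A) (\<lambda>r. c * y r) (\<lambda>r. c * h r)"
  using assms unfolding ivp_def by (auto intro!: continuous_intros simp: J_cmult algebra_simps)

lemma ivp_diff:
  assumes "ivp A y h" "ivp A' y' h'"
  shows "ivp (A - A') (\<lambda>r. y r - y' r) (\<lambda>r. h r - h' r)"
  using assms unfolding ivp_def by (auto intro!: continuous_intros simp: J_diff)

lemma ivp_add:
  assumes "ivp A y h" "ivp A' y' h'"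
  shows "ivp (A + A') (\<lambda>r. y r + y' r) (\<lambda>r. h r + h' r)"
  using assms unfolding ivp_def by (auto intro!: continuous_intros simp: J_add)

lemma ivp_cong:
  assumes "ivp A y h" "\<And>r. r \<in> {0..m} \<Longrightarrow> y r = y' r" "\<And>r. r \<in> {0..m} \<Longrightarrow> h r = h' r"
  shows "ivp A y' h'"
proof -
  have "continuous_on {0..m} h'" "continuous_on {0..m} y'"
    using continuous_on_eq[OF ivpD(1)[OF assms(1)] assms(3)] continuous_on_eq[OF ivpD(2)[OF assms(1)] assms(2)]
    by auto
  moreover have "J y' t = J y t" if "t \<in> {0..m}" for t
    using that assms(2) by (intro J_cong) auto
  ultimately show ?thesis using assms unfolding ivp_def by auto
qed

lemma ivp_cong_source:
  assumes "ivp A y h" "\<And>r. r \<in> {0..m} \<Longrightarrow> y r = y' r"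
  shows "ivp A y' h"
  using ivp_cong[OF assms] by simp

lemma ivp_const: "ivp A (\<lambda>_. 0) (\<lambda>_. A)"
  using J_cmult[of 0 "\<lambda>_. 0"] by (simp add: ivp_def)

lemma ivp_bound:
  assumes "ivp A y z" and "\<And>t. t \<in> {0..m} \<Longrightarrow> \<bar>y t\<bar> \<le> k * \<bar>z t\<bar> + F"
    and "0 \<le> k" "0 \<le> F" "t \<in> {0..m}"
  shows "\<bar>z t\<bar> \<le> 2 * (\<bar>A\<bar> + F) * exp (2 * C * (k + 1) * m)"
  using ivpD[OF assms(1)] by (intro stability[OF _ _ _ assms(2-4) _ assms(5), where E="\<bar>A\<bar>"]) auto

text \<open>Picard iteration converges on all of \<open>[0, m]\<close> at once, because successive
  differences halve in the norm weighted by \<open>exp (- L * t)\<close>.\<close>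

lemma ivp_exists:
  assumes Fc: "continuous_on ({0..m} \<times> UNIV) (\<lambda>x. F (fst x) (snd x))"
    and lip: "\<And>t x y. t \<in> {0..m} \<Longrightarrow> \<bar>F t x - F t y\<bar> \<le> k * \<bar>x - y\<bar>" and k: "0 \<le> k"
  shows "\<exists>h. ivp A (\<lambda>r. F r (h r)) h"
proof -
  define L where "L = 2 * C * (k + 1)"
  have L: "0 < L" using C_pos k by (simp add: L_def)
  define h where "h n = ((\<lambda>g t. A - J (\<lambda>r. F r (g r)) t) ^^ n) (\<lambda>_. A)" for n
  have h0: "h 0 = (\<lambda>_. A)" and hS: "h (Suc n) = (\<lambda>t. A - J (\<lambda>r. F r (h n r)) t)" for n
    by (auto simp: h_def)
  have Fh: "continuous_on {0..m} (\<lambda>r. F r (g r))" if "continuous_on {0..m} g" for g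
  proof -
    have "continuous_on {0..m} (\<lambda>r. (\<lambda>x. F (fst x) (snd x)) (r, g r))"
      by (rule continuous_on_compose2[OF Fc]) (use that in \<open>auto intro!: continuous_intros\<close>)
    then show ?thesis by simp
  qed
  have hc: "continuous_on {0..m} (h n)" for n
  proof (induction n)
    case (Suc n)
    then show ?case unfolding hS by (intro continuous_intros continuous_on_J Fh)
  qed (simp add: h0)
  have "continuous_on {0..m} (\<lambda>t. \<bar>h 1 t - h 0 t\<bar>)" by (intro continuous_intros hc)
  then obtain D where D: "\<And>r. r \<in> {0..m} \<Longrightarrow> \<bar>h 1 r - h 0 r\<bar> \<le> D * exp (L * r)"
    by (rule weighted_max[of _ L]) (rule that)
  have D0: "0 \<le> D" using D[of 0] m by auto
  have step: "\<bar>h (Suc n) t - h n t\<bar> \<le> D * (1/2)^n * exp (L * t)" if "t \<in> {0..m}" for n t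
    using that
  proof (induction n arbitrary: t)
    case 0 then show ?case using D by simp
  next
    case (Suc n)
    have "h (Suc (Suc n)) t - h (Suc n) t = - J (\<lambda>r. F r (h (Suc n) r) - F r (h n r)) t"
      using J_diff[OF Fh[OF hc] Fh[OF hc] Suc.prems, of "Suc n" n]
        fun_cong[OF hS[of "Suc n"], of t] fun_cong[OF hS[of n], of t] by linarith
    moreover have "\<bar>J (\<lambda>r. F r (h (Suc n) r) - F r (h n r)) t\<bar> \<le> C * (k * (D * (1/2)^n)) / L * exp (L * t)"
    proof (rule J_abs_le_exp[OF _ Suc.prems L])
      show "continuous_on {0..m} (\<lambda>r. F r (h (Suc n) r) - F r (h n r))" by (intro continuous_intros Fh hc)
      fix r assume r: "r \<in> {0..m}"
      have "\<bar>F r (h (Suc n) r) - F r (h n r)\<bar> \<le> k * \<bar>h (Suc n) r - h n r\<bar>" by (rule lip[OF r])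
      also have "\<dots> \<le> k * (D * (1/2)^n * exp (L * r))" by (rule mult_left_mono[OF Suc.IH[OF r] k])
      finally show "\<bar>F r (h (Suc n) r) - F r (h n r)\<bar> \<le> k * (D * (1/2)^n) * exp (L * r)" by simp
    qed
    moreover have "C * (k * (D * (1/2)^n)) / L \<le> D * (1/2)^Suc n"
    proof -
      have "C * (k * (D * (1/2)^n)) / L = k / (k + 1) * (D * (1/2)^Suc n)"
        using C_pos k by (simp add: L_def)
      also have "\<dots> \<le> 1 * (D * (1/2)^Suc n)" using k D0 by (intro mult_right_mono) auto
      finally show ?thesis by simp
    qed
    then have "C * (k * (D * (1/2)^n)) / L * exp (L * t) \<le> D * (1/2)^Suc n * exp (L * t)"
      by (rule mult_right_mono) simp
    ultimately show ?case by linarith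
  qed
  define g where "g t = A + (\<Sum>n. h (Suc n) t - h n t)" for t
  have "uniform_limit {0..m} (\<lambda>n t. \<Sum>i<n. h (Suc i) t - h i t) (\<lambda>t. \<Sum>n. h (Suc n) t - h n t) sequentially"
  proof (rule Weierstrass_m_test)
    show "norm (h (Suc n) t - h n t) \<le> D * (1/2)^n * exp (L * m)" if "t \<in> {0..m}" for n t
    proof -
      have "D * (1/2)^n * exp (L * t) \<le> D * (1/2)^n * exp (L * m)"
        using D0 L that by (intro mult_left_mono) auto
      then show ?thesis using step[OF that, of n] by simp
    qed
    show "summable (\<lambda>n. D * (1/2)^n * exp (L * m))"
      by (intro summable_mult summable_mult2 summable_geometric) simp
  qed
  moreover have "(\<Sum>i<n. h (Suc i) t - h i t) = h n t - A" for n t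
    using sum_lessThan_telescope[of "\<lambda>i. h i t" n] h0 by simp
  ultimately have "uniform_limit {0..m} (\<lambda>n t. h n t - A) (\<lambda>t. g t - A) sequentially"
    by (simp add: g_def)
  then have ul: "uniform_limit {0..m} h g sequentially"
    by (simp add: uniform_limit_iff dist_real_def)
  have gc: "continuous_on {0..m} g"
    by (rule uniform_limit_theorem[OF _ ul]) (auto simp: hc)
  have "g t = A - J (\<lambda>r. F r (g r)) t" if t: "t \<in> {0..m}" for t
  proof -
    have "\<bar>g t - (A - J (\<lambda>r. F r (g r)) t)\<bar> \<le> 0 + \<epsilon>" if \<epsilon>: "\<epsilon> > 0" for \<epsilon>
    proof -
      define d where "d = \<epsilon> / (1 + C * k * m)"
      have pos: "0 < 1 + C * k * m" using C_pos k m by (simp add: add_pos_nonneg)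
      then have d: "0 < d" using \<epsilon> by (simp add: d_def)
      have "\<forall>\<^sub>F n in sequentially. \<forall>x\<in>{0..m}. dist (h n x) (g x) < d"
        using ul d by (auto simp: uniform_limit_iff)
      then obtain n0 where n0: "\<And>n x. n \<ge> n0 \<Longrightarrow> x \<in> {0..m} \<Longrightarrow> \<bar>h n x - g x\<bar> < d"
        unfolding eventually_sequentially dist_real_def by blast
      have "\<bar>J (\<lambda>r. F r (h n0 r) - F r (g r)) t\<bar> \<le> C * (k * d) * t"
      proof (rule J_abs_le[OF _ t])
        show "continuous_on {0..m} (\<lambda>r. F r (h n0 r) - F r (g r))" by (intro continuous_intros Fh hc gc)
        fix r assume r: "r \<in> {0..m}"
        have "\<bar>F r (h n0 r) - F r (g r)\<bar> \<le> k * \<bar>h n0 r - g r\<bar>" by (rule lip[OF r])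
        also have "\<dots> \<le> k * d" using n0[OF order_refl r] k by (intro mult_left_mono) auto
        finally show "\<bar>F r (h n0 r) - F r (g r)\<bar> \<le> k * d" .
      qed
      also have "\<dots> \<le> C * (k * d) * m" using t C_pos k d by (intro mult_left_mono) auto
      finally have 1: "\<bar>J (\<lambda>r. F r (h n0 r)) t - J (\<lambda>r. F r (g r)) t\<bar> \<le> C * (k * d) * m"
        using t by (simp add: J_diff Fh hc gc)
      have 2: "\<bar>h (Suc n0) t - g t\<bar> \<le> d" using n0[of "Suc n0" t] t by simp
      have "\<bar>g t - (A - J (\<lambda>r. F r (g r)) t)\<bar> \<le> d + C * (k * d) * m"
        using 1 2 unfolding hS by linarith
      also have "\<dots> = d * (1 + C * k * m)" by (simp add: algebra_simps)
      also have "\<dots> = \<epsilon>" using pos by (simp add: d_def)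
      finally show ?thesis by simp
    qed
    then have "\<bar>g t - (A - J (\<lambda>r. F r (g r)) t)\<bar> \<le> 0" by (rule field_le_epsilon)
    then show ?thesis by simp
  qed
  then show ?thesis using gc Fh[OF gc] by (auto simp: ivp_def)
qed

text \<open>Going back from a regular point \<open>t0\<close>, the energy
  \<open>Z = z^2 + (K y)^2\<close> satisfies \<open>Z' + B * Z \<ge> 0\<close> on
  \<open>[s, t0]\<close>, so \<open>Z t0 = 0\<close> forces \<open>Z s = 0\<close>. The constant
  \<open>B\<close> blows up as \<open>s\<close> tends to \<open>0\<close>; the endpoint itself is
  reached by continuity.\<close>

lemma backward_unique:
  assumes e1: "e = 1" and z: "ivp A y z" and k: "\<And>t. t \<in> {0..m} \<Longrightarrow> \<bar>y t\<bar> \<le> k * \<bar>z t\<bar>"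
    and t0: "0 < t0" "t0 \<le> m" and z0: "z t0 = 0" "K y t0 = 0"
    and t: "t \<in> {0..t0}"
  shows "z t = 0"
proof -
  have m1: "m < 1" using em e1 by simp
  have pos: "z s = 0" if s: "0 < s" "s \<le> t0" for s
  proof (cases "s = t0")
    case False
    define D where "D r = (y r - (a - (a + b) * r) * K y r) / (r * (1 - r))" for r
    have KD: "(K y has_real_derivative D r) (at r within {0..m})" if "0 < r" "r \<le> m" for r
      using K_has_derivative[OF ivpD(2)[OF z] that] by (simp add: D_def e1)
    have zD: "(z has_real_derivative - K y r) (at r within {0..m})" if "0 < r" "r \<le> m" for r
      using ivp_has_derivative[OF z] that by auto
    define k' where "k' = \<bar>k\<bar>"
    have kk: "\<bar>y t\<bar> \<le> k' * \<bar>z t\<bar>" if "t \<in> {0..m}" for t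
      using k[OF that] mult_right_mono[OF abs_ge_self[of k], of "\<bar>z t\<bar>"] by (simp add: k'_def)
    have k0: "0 \<le> k'" by (simp add: k'_def)
    define q where "q = 1 / (s * (1 - m))"
    have q: "0 < q" using s m1 by (simp add: q_def)
    define B where "B = 1 + q * (k' + 2 * (a + b))"
    define Z where "Z r = (z r)^2 + (K y r)^2" for r
    define Z' where "Z' r = 2 * z r * (- K y r) + 2 * K y r * D r" for r
    have ZD: "(Z has_real_derivative Z' r) (at r within {0..m})" if "0 < r" "r \<le> m" for r
      unfolding Z_def Z'_def using zD[OF that] KD[OF that] by (auto intro!: derivative_eq_intros)
    have Z'ge: "0 \<le> Z' r + B * Z r" if r: "s \<le> r" "r \<le> t0" for r
    proof -
      have r': "r \<in> {0..m}" "0 < r" "r < 1" using r s t0 m1 by auto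
      have "s * (1 - m) \<le> r * (1 - r)" using r s m1 t0 by (intro mult_mono) auto
      then have q': "1 / (r * (1 - r)) \<le> q" unfolding q_def using s m1 by (intro divide_left_mono) (use r' in auto)
      have co: "\<bar>a - (a + b) * r\<bar> \<le> a + b"
      proof -
        have "0 \<le> (a + b) * r" "(a + b) * r \<le> (a + b)" using r' a b by (auto intro: mult_left_le)
        then show ?thesis using a b by linarith
      qed
      have "\<bar>y r - (a - (a + b) * r) * K y r\<bar> \<le> k' * \<bar>z r\<bar> + (a + b) * \<bar>K y r\<bar>"
        using kk[OF r'(1)] mult_right_mono[OF co, of "\<bar>K y r\<bar>"] by (simp add: abs_mult[symmetric])
      then have D1: "\<bar>D r\<bar> \<le> (k' * \<bar>z r\<bar> + (a + b) * \<bar>K y r\<bar>) * q"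
      proof -
        assume A: "\<bar>y r - (a - (a + b) * r) * K y r\<bar> \<le> k' * \<bar>z r\<bar> + (a + b) * \<bar>K y r\<bar>"
        have "\<bar>D r\<bar> = \<bar>y r - (a - (a + b) * r) * K y r\<bar> * (1 / (r * (1 - r)))"
          using r' by (simp add: D_def abs_mult)
        also have "\<dots> \<le> (k' * \<bar>z r\<bar> + (a + b) * \<bar>K y r\<bar>) * q"
          using A q' r' k0 a b by (intro mult_mono) auto
        finally show ?thesis .
      qed
      have am: "2 * \<bar>z r\<bar> * \<bar>K y r\<bar> \<le> Z r"
        using sum_squares_bound[of "\<bar>z r\<bar>" "\<bar>K y r\<bar>"] by (simp add: Z_def)
      have K2: "\<bar>K y r\<bar>^2 \<le> Z r" by (simp add: Z_def)
      have "\<bar>Z' r\<bar> \<le> 2 * \<bar>z r\<bar> * \<bar>K y r\<bar> + 2 * \<bar>K y r\<bar> * \<bar>D r\<bar>"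
        unfolding Z'_def by (rule order_trans[OF abs_triangle_ineq]) (simp add: abs_mult)
      also have "2 * \<bar>K y r\<bar> * \<bar>D r\<bar> \<le> 2 * \<bar>K y r\<bar> * ((k' * \<bar>z r\<bar> + (a + b) * \<bar>K y r\<bar>) * q)"
        by (intro mult_left_mono D1) auto
      also have "\<dots> = q * k' * (2 * \<bar>z r\<bar> * \<bar>K y r\<bar>) + q * 2 * (a + b) * \<bar>K y r\<bar>^2"
        by (simp add: algebra_simps power2_eq_square)
      also have "\<dots> \<le> q * k' * Z r + q * 2 * (a + b) * Z r"
        using q k0 a b am K2 by (intro add_mono mult_left_mono) auto
      finally have "\<bar>Z' r\<bar> \<le> 2 * \<bar>z r\<bar> * \<bar>K y r\<bar> + (q * k' * Z r + q * 2 * (a + b) * Z r)" by simp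
      also have "\<dots> \<le> Z r + (q * k' * Z r + q * 2 * (a + b) * Z r)" using am by simp
      also have "\<dots> = B * Z r" by (simp add: B_def algebra_simps)
      finally show ?thesis by linarith
    qed
    have "Z s * exp (B * s) \<le> Z t0 * exp (B * t0)"
    proof (rule nondecreasing_within[where f="\<lambda>r. Z r * exp (B * r)" and l=0 and r=m and D="\<lambda>r. (Z' r + B * Z r) * exp (B * r)"])
      show "continuous_on {s..t0} (\<lambda>r. Z r * exp (B * r))"
        unfolding Z_def using s t0
        by (intro continuous_intros continuous_on_subset[OF ivpD(1)[OF z]] continuous_on_subset[OF continuous_on_K[OF ivpD(2)[OF z]]]) auto
      fix x assume x: "s < x" "x < t0"
      then show "((\<lambda>r. Z r * exp (B * r)) has_real_derivative (Z' x + B * Z x) * exp (B * x)) (at x within {0..m})"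
        using ZD[of x] s t0 by (auto intro!: derivative_eq_intros simp: algebra_simps)
      show "0 \<le> (Z' x + B * Z x) * exp (B * x)" using Z'ge[of x] x by simp
    qed (use s t0 in auto)
    also have "Z t0 = 0" using z0 by (simp add: Z_def)
    finally have "Z s \<le> 0" by (simp add: mult_le_0_iff)
    then show ?thesis using zero_le_power2[of "z s"] zero_le_power2[of "K y s"]
      unfolding Z_def by (simp add: sum_power2_le_zero_iff)
  qed (use z0 in simp)
  show ?thesis
  proof (cases "t = 0")
    case True
    have "continuous_on {0..t0} z" using ivpD(1)[OF z] t0 by (auto intro: continuous_on_subset)
    then show ?thesis
      using True continuous_constant_on_closure[of "{0<..<t0}" z 0 0] pos t0 by simp
  qed (use t pos in auto)
qed

end

section \<open>A priori bounds\<close>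

text \<open>Truncating the nonlinearity makes it globally Lipschitz; it agrees with \<open>x powr (q - 1)\<close> on \<open>[0, M]\<close>.\<close>

definition cpow :: "real \<Rightarrow> real \<Rightarrow> real \<Rightarrow> real" where
  "cpow q M x = (min (max x 0) M) powr (q - 1)"

lemma cpow_eq: "0 \<le> x \<Longrightarrow> x \<le> M \<Longrightarrow> cpow q M x = x powr (q - 1)"
  by (simp add: cpow_def)

lemma cpow_nonneg: "0 \<le> cpow q M x"
  by (simp add: cpow_def)

lemma cpow_le: "2 < q \<Longrightarrow> 0 \<le> M \<Longrightarrow> cpow q M x \<le> M powr (q - 1)"
  unfolding cpow_def by (rule powr_mono2) auto

lemma powr_lipschitz:
  fixes q :: real
  assumes q: "2 < q" and uv: "0 \<le> u" "u \<le> v" "v \<le> M"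
  shows "v powr (q - 1) - u powr (q - 1) \<le> (q - 1) * M powr (q - 2) * (v - u)"
proof (cases "u = v")
  case False
  then have lt: "u < v" using uv by simp
  have D: "DERIV (\<lambda>x. x powr (q - 1)) x :> (q - 1) * x powr (q - 2)" if "u < x" for x
    using that uv by (auto intro!: derivative_eq_intros)
  have c: "continuous_on {u..v} (\<lambda>x. x powr (q - 1))"
    using uv q by (intro continuous_on_powr' continuous_intros) auto
  obtain d z where z: "u < z" "z < v" "DERIV (\<lambda>x. x powr (q - 1)) z :> d"
      "v powr (q - 1) - u powr (q - 1) = (v - u) * d"
    using MVT[OF lt c] D real_differentiable_def by blast
  have "d = (q - 1) * z powr (q - 2)" using z D DERIV_unique by blast
  also have "\<dots> \<le> (q - 1) * M powr (q - 2)"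
    using z uv q by (intro mult_left_mono powr_mono2) auto
  finally show ?thesis using z(4) lt by (simp add: mult.commute mult_left_mono)
qed simp

lemma cpow_lipschitz:
  assumes q: "2 < q" and M: "0 \<le> M"
  shows "\<bar>cpow q M x - cpow q M y\<bar> \<le> (q - 1) * M powr (q - 2) * \<bar>x - y\<bar>"
proof -
  have *: "\<bar>cpow q M x - cpow q M y\<bar> \<le> (q - 1) * M powr (q - 2) * \<bar>x - y\<bar>" if "y \<le> x" for x y
  proof -
    define u v where "u = min (max y 0) M" and "v = min (max x 0) M"
    have uv: "0 \<le> u" "u \<le> v" "v \<le> M" "v - u \<le> \<bar>x - y\<bar>" using that M by (auto simp: u_def v_def)
    have "u powr (q - 1) \<le> v powr (q - 1)" using uv q by (intro powr_mono2) auto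
    then have "\<bar>cpow q M x - cpow q M y\<bar> = v powr (q - 1) - u powr (q - 1)"
      by (simp add: cpow_def u_def v_def)
    also have "\<dots> \<le> (q - 1) * M powr (q - 2) * (v - u)" by (rule powr_lipschitz[OF q uv(1-3)])
    also have "\<dots> \<le> (q - 1) * M powr (q - 2) * \<bar>x - y\<bar>" using q uv by (intro mult_left_mono) auto
    finally show ?thesis .
  qed
  show ?thesis
    using *[of y x] *[of x y] by (cases "y \<le> x") (auto simp: abs_minus_commute)
qed

lemma continuous_on_cpow [continuous_intros]:
  assumes "2 < q" "0 \<le> M" "continuous_on S f"
  shows "continuous_on S (\<lambda>x. cpow q M (f x))"
  unfolding cpow_def using assms by (intro continuous_on_powr' continuous_intros) auto

context radial
begin

lemma K_const_e0: "e = 0 \<Longrightarrow> K (\<lambda>_. c) s = c / a"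
  by (simp add: kop_def)

text \<open>The Pohozaev identity: if the profile stays nonnegative up to \<open>2 * s\<close>, the Pohozaev
  functional at \<open>s\<close> is bounded below by a constant but decays in the subcritical range.\<close>

lemma profile_estimate:
  assumes e0: "e = 0" and q: "2 < q" and sub: "q * (a - 1) < 2 * a" and M: "1 \<le> M"
    and \<Phi>: "ivp 1 (\<lambda>r. cpow q M (\<Phi> r)) \<Phi>" and nn: "\<And>r. r \<in> {0..m} \<Longrightarrow> 0 \<le> \<Phi> r"
    and s: "a / 2 \<le> s" "2 * s = m"
  shows "(a / q - (a - 1) / 2) * (1/2) powr q * (a / 2) powr a / a
    \<le> (4 powr a / 2 + \<bar>a - 1\<bar> * 2 powr a / 2 + a / (q * (q - 2))) * ((q - 2) / a) powr (- (2 / (q - 2)))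
      * s powr (- (q / (q - 2) - a))"
proof -
  define y where "y = (\<lambda>r. cpow q M (\<Phi> r))"
  define k where "k = K y"
  define \<kappa> where "\<kappa> = a / q - (a - 1) / 2"
  have \<kappa>: "0 < \<kappa>" using sub q by (simp add: \<kappa>_def field_simps)
  have \<Phi>': "ivp 1 y \<Phi>" using \<Phi> by (simp add: y_def)
  note yc = ivpD(2)[OF \<Phi>'] and \<Phi>c = ivpD(1)[OF \<Phi>']
  have kc: "continuous_on {0..m} k" unfolding k_def by (rule continuous_on_K[OF yc])
  have y0: "0 \<le> y r" for r by (simp add: y_def cpow_nonneg)
  have \<Phi>1: "\<Phi> r \<le> 1" if "r \<in> {0..m}" for r
    using ivpD(3)[OF \<Phi>' that] J_nonneg[OF yc that y0] by simp
  have yeq: "y r = \<Phi> r powr (q - 1)" if "r \<in> {0..m}" for r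
    using nn[OF that] \<Phi>1[OF that] M by (simp add: y_def cpow_eq)
  have k0: "0 \<le> k r" if "r \<in> {0..m}" for r
    unfolding k_def by (rule K_nonneg[OF yc that y0])
  have D\<Phi>: "(\<Phi> has_real_derivative - k r) (at r within {0..m})" if "r \<in> {0..m}" for r
    unfolding k_def by (rule ivp_has_derivative[OF \<Phi>' that])
  have Dk: "(k has_real_derivative (y r - a * k r) / r) (at r within {0..m})" if "0 < r" "r \<le> m" for r
    using K_has_derivative[OF yc that] by (simp add: k_def e0)
  have anti: "\<Phi> v \<le> \<Phi> u" if uv: "0 \<le> u" "u \<le> v" "v \<le> m" for u v
  proof -
    have "- \<Phi> u \<le> - \<Phi> v"
    proof (rule nondecreasing_within[where f="\<lambda>r. - \<Phi> r" and l=0 and r=m and D=k])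
      show "continuous_on {u..v} (\<lambda>r. - \<Phi> r)" using uv
        by (intro continuous_intros continuous_on_subset[OF \<Phi>c]) auto
      fix x assume "u < x" "x < v"
      then have x: "x \<in> {0..m}" using uv by auto
      show "((\<lambda>r. - \<Phi> r) has_real_derivative k x) (at x within {0..m})"
        using D\<Phi>[OF x] by (auto intro!: derivative_eq_intros)
      show "0 \<le> k x" by (rule k0[OF x])
    qed (use uv in auto)
    then show ?thesis by simp
  qed
  \<comment> \<open>\<open>\<Phi>\<close> decreases, so the source on \<open>[0, r]\<close> is at
    least its value at \<open>r\<close>, and for \<open>e = 0\<close> the operator \<open>K\<close>
    divides constants by \<open>a\<close>.\<close>
  have klow: "\<Phi> r powr (q - 1) / a \<le> k r" if r: "r \<in> {0..m}" for r
  proof -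
    have "K (\<lambda>_. \<Phi> r powr (q - 1)) r \<le> k r"
      unfolding k_def
    proof (rule K_mono[OF _ yc r])
      fix x assume x: "0 \<le> x" "x \<le> r"
      then have x': "x \<in> {0..m}" using r by auto
      show "\<Phi> r powr (q - 1) \<le> y x"
        unfolding yeq[OF x'] using anti[of x r] x r nn[OF r] q by (intro powr_mono2) auto
    qed simp
    then show ?thesis by (simp add: K_const_e0[OF e0])
  qed
  have kup: "k r \<le> 1 / a" if r: "r \<in> {0..m}" for r
  proof -
    have "k r \<le> K (\<lambda>_. 1) r"
      unfolding k_def
    proof (rule K_mono[OF yc _ r])
      fix x assume "0 \<le> x" "x \<le> r"
      then have x': "x \<in> {0..m}" using r by auto
      show "y x \<le> 1" unfolding yeq[OF x'] using nn[OF x'] \<Phi>1[OF x'] q by (intro powr_le1) auto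
    qed simp
    then show ?thesis by (simp add: K_const_e0[OF e0])
  qed
  have sm: "0 < s" "s \<le> m" "a / 2 \<le> m" using s a by auto
  \<comment> \<open>\<open>- \<Phi>' = k \<le> 1 / a\<close> gives
    \<open>\<Phi> r \<ge> 1 - r / a\<close>; this is where the length \<open>a / 2\<close> comes
    from.\<close>
  have \<Phi>half: "1/2 \<le> \<Phi> r" if r: "0 \<le> r" "r \<le> a / 2" for r
  proof -
    have "\<Phi> 0 + 0 / a \<le> \<Phi> r + r / a"
    proof (rule nondecreasing_within[where f="\<lambda>r. \<Phi> r + r / a" and l=0 and r=m and D="\<lambda>x. 1 / a - k x"])
      show "continuous_on {0..r} (\<lambda>r. \<Phi> r + r / a)" using r sm a
        by (intro continuous_intros continuous_on_subset[OF \<Phi>c]) auto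
      fix x assume "0 < x" "x < r"
      then have x: "x \<in> {0..m}" using r sm by auto
      show "((\<lambda>r. \<Phi> r + r / a) has_real_derivative 1 / a - k x) (at x within {0..m})"
        using D\<Phi>[OF x] a by (auto intro!: derivative_eq_intros)
      show "0 \<le> 1 / a - k x" using kup[OF x] by simp
    qed (use r sm in auto)
    moreover have "\<Phi> 0 = 1" by (rule ivp_at_0[OF \<Phi>'])
    moreover have "r / a \<le> 1/2" using r a by (simp add: field_simps)
    ultimately show ?thesis by linarith
  qed
  have skm: "u powr a * k u \<le> v powr a * k v" if uv: "0 \<le> u" "u \<le> v" "v \<le> m" for u v
  proof (rule nondecreasing_within[where f="\<lambda>r. r powr a * k r" and l=0 and r=m and D="\<lambda>x. x powr a / x * y x"])
    show "continuous_on {u..v} (\<lambda>r. r powr a * k r)" using uv a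
      by (intro continuous_intros continuous_on_powr' continuous_on_subset[OF kc]) auto
    fix x assume x: "u < x" "x < v"
    then have x': "0 < x" "x \<le> m" using uv by auto
    show "((\<lambda>r. r powr a * k r) has_real_derivative x powr a / x * y x) (at x within {0..m})"
      using Dk[OF x'] x' by (auto intro!: derivative_eq_intros simp: powr_diff field_simps)
    show "0 \<le> x powr a / x * y x" using x' y0 by simp
  qed (use uv in auto)
  have kpos: "0 < k s"
  proof -
    have "0 < (1/2) powr (q - 1) / a" using a by simp
    also have "\<dots> \<le> \<Phi> (a/2) powr (q - 1) / a"
      using \<Phi>half[of "a/2"] a q by (intro divide_right_mono powr_mono2) auto
    also have "\<dots> \<le> k (a/2)" using sm a by (intro klow) auto
    finally have "0 < (a/2) powr a * k (a/2)" using a by simp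
    also have "\<dots> \<le> s powr a * k s" using s sm a by (intro skm) auto
    finally show ?thesis using sm by (simp add: zero_less_mult_iff)
  qed
  \<comment> \<open>Here nonnegativity up to \<open>2 * s\<close> enters. Since
    \<open>r powr a * k r\<close> increases, \<open>k\<close> stays above
    \<open>k s * 2 powr (-a)\<close> on \<open>[s, 2 * s]\<close>, and \<open>\<Phi>\<close> must
    not fall below \<open>0\<close> over this length.\<close>
  have sk: "s * k s \<le> 2 powr a * \<Phi> s"
  proof -
    have kv: "k s * 2 powr (-a) \<le> k v" if v: "s \<le> v" "v \<le> m" for v
    proof -
      have "s powr a * k s \<le> v powr a * k v" using v sm by (intro skm) auto
      also have "\<dots> \<le> (2 * s) powr a * k v"
        using v s sm k0[of v] a by (intro mult_right_mono powr_mono2) auto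
      also have "\<dots> = s powr a * (2 powr a * k v)" using sm by (simp add: powr_mult)
      finally have "k s \<le> 2 powr a * k v" using sm by simp
      then show ?thesis by (simp add: powr_minus field_simps)
    qed
    have "- \<Phi> s - k s * 2 powr (-a) * s \<le> - \<Phi> m - k s * 2 powr (-a) * m"
    proof (rule nondecreasing_within[where f="\<lambda>r. - \<Phi> r - k s * 2 powr (-a) * r" and l=0 and r=m and D="\<lambda>x. k x - k s * 2 powr (-a)"])
      show "continuous_on {s..m} (\<lambda>r. - \<Phi> r - k s * 2 powr (-a) * r)" using sm
        by (intro continuous_intros continuous_on_subset[OF \<Phi>c]) auto
      fix x assume x: "s < x" "x < m"
      then have x': "x \<in> {0..m}" using sm by auto
      show "((\<lambda>r. - \<Phi> r - k s * 2 powr (-a) * r) has_real_derivative k x - k s * 2 powr (-a)) (at x within {0..m})"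
        using D\<Phi>[OF x'] by (auto intro!: derivative_eq_intros)
      show "0 \<le> k x - k s * 2 powr (-a)" using kv[of x] x by simp
    qed (use sm in auto)
    then have "k s * 2 powr (-a) * s \<le> \<Phi> s" using nn[of m] m s by (simp add: algebra_simps flip: s(2))
    then show ?thesis by (simp add: powr_minus field_simps)
  qed
  then have \<Phi>pos: "0 < \<Phi> s" using kpos sm by (smt (verit) mult_pos_pos powr_gt_zero zero_less_mult_pos)
  have \<Phi>p: "0 < \<Phi> r" if "0 \<le> r" "r \<le> s" for r
    using anti[of r s] \<Phi>pos that sm by simp
  define X where "X = (q - 2) / a * s"
  have X: "0 < X" using q a sm by (simp add: X_def)
  \<comment> \<open>\<open>klow\<close> is the separable inequality
    \<open>- \<Phi>' \<ge> \<Phi> powr (q - 1) / a\<close>; integrating it gives algebraic decay of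
    \<open>\<Phi>\<close>.\<close>
  have decay: "X \<le> \<Phi> s powr (- (q - 2))"
  proof -
    have "\<Phi> 0 powr (- (q - 2)) - (q - 2) / a * 0 \<le> \<Phi> s powr (- (q - 2)) - (q - 2) / a * s"
    proof (rule nondecreasing_within[where f="\<lambda>r. \<Phi> r powr (- (q - 2)) - (q - 2) / a * r" and l=0 and r=m
          and D="\<lambda>x. (q - 2) * (\<Phi> x powr (- (q - 1)) * k x - 1 / a)"])
      show "continuous_on {0..s} (\<lambda>r. \<Phi> r powr (- (q - 2)) - (q - 2) / a * r)" using sm \<Phi>p
        by (intro continuous_intros continuous_on_subset[OF \<Phi>c]) force+
      fix x assume x: "0 < x" "x < s"
      then have x': "x \<in> {0..m}" using sm by auto
      have p: "0 < \<Phi> x" using \<Phi>p[of x] x by simp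
      have "- (q - 2) - 1 = - (q - 1)" by simp
      then show "((\<lambda>r. \<Phi> r powr (- (q - 2)) - (q - 2) / a * r) has_real_derivative
          (q - 2) * (\<Phi> x powr (- (q - 1)) * k x - 1 / a)) (at x within {0..m})"
        using D\<Phi>[OF x'] p a by (auto intro!: derivative_eq_intros simp: field_simps)
      have "1 / a = \<Phi> x powr (- (q - 1)) * (\<Phi> x powr (q - 1) / a)"
        using p by (simp add: powr_add[symmetric])
      also have "\<dots> \<le> \<Phi> x powr (- (q - 1)) * k x" by (intro mult_left_mono klow x') simp
      finally show "0 \<le> (q - 2) * (\<Phi> x powr (- (q - 1)) * k x - 1 / a)" using q by simp
    qed (use sm in auto)
    then show ?thesis using ivp_at_0[OF \<Phi>'] by (simp add: X_def)
  qed
  have \<Phi>X: "\<Phi> s powr (q - 2) \<le> 1 / X"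
  proof -
    have "X * \<Phi> s powr (q - 2) \<le> \<Phi> s powr (- (q - 2)) * \<Phi> s powr (q - 2)"
      by (intro mult_right_mono decay) simp
    also have "\<dots> = 1" using \<Phi>pos by (simp add: powr_add[symmetric])
    finally show ?thesis using X by (simp add: field_simps)
  qed
  have \<Phi>2: "(\<Phi> s)^2 \<le> X powr (- (2 / (q - 2)))"
  proof -
    have "(\<Phi> s)^2 = (\<Phi> s powr (q - 2)) powr (2 / (q - 2))"
    proof -
      have "(q - 2) * (2 / (q - 2)) = 2" using q by (simp add: field_simps)
      then show ?thesis using \<Phi>pos by (simp only: powr_powr powr_numeral less_imp_le)
    qed
    also have "\<dots> \<le> (1 / X) powr (2 / (q - 2))" using \<Phi>X q by (intro powr_mono2) auto
    also have "\<dots> = X powr (- (2 / (q - 2)))" using X by (simp add: powr_minus_divide powr_divide)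
    finally show ?thesis .
  qed
  \<comment> \<open>The Pohozaev functional, with \<open>k = - \<Phi>'\<close>. The coefficient
    \<open>(a - 1) / 2\<close> is chosen so that the terms in \<open>k\<close> cancel in the
    derivative; what remains is \<open>\<kappa> * \<Phi> r powr q\<close> times a power of
    \<open>r\<close>, and \<open>\<kappa> > 0\<close> is exactly subcriticality.\<close>
  define P where "P r = r powr a * (r * (k r)^2 / 2 + \<Phi> r powr q / q - (a - 1) / 2 * \<Phi> r * k r)" for r
  have DP: "(P has_real_derivative r powr a / r * (\<kappa> * \<Phi> r powr q)) (at r within {0..m})" if r: "0 < r" "r \<le> s" for r
  proof -
    have r': "r \<in> {0..m}" "r \<le> m" using r sm by auto
    have p: "0 < \<Phi> r" using \<Phi>p[of r] r by simp
    have "(P has_real_derivative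
        (a * r powr (a - 1)) * (r * (k r)^2 / 2 + \<Phi> r powr q / q - (a - 1) / 2 * \<Phi> r * k r)
        + r powr a * ((k r)^2 / 2 + r * (k r * ((y r - a * k r) / r)) + \<Phi> r powr (q - 1) * (- k r)
          - (a - 1) / 2 * ((- k r) * k r + \<Phi> r * ((y r - a * k r) / r)))) (at r within {0..m})"
      unfolding P_def using D\<Phi>[OF r'(1)] Dk[OF r(1) r'(2)] r p q
      by (auto intro!: derivative_eq_intros simp: divide_simps) (simp add: algebra_simps power2_eq_square)
    moreover have "\<Phi> r powr q = \<Phi> r * y r"
      using p yeq[OF r'(1)] by (simp add: powr_mult_base)
    moreover have "\<Phi> r powr (q - 1) = y r" using yeq[OF r'(1)] by simp
    moreover have "(a * r powr (a - 1)) * (r * (k r)^2 / 2 + \<Phi> r * y r / q - (a - 1) / 2 * \<Phi> r * k r)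
        + r powr a * ((k r)^2 / 2 + r * (k r * ((y r - a * k r) / r)) + y r * (- k r)
          - (a - 1) / 2 * ((- k r) * k r + \<Phi> r * ((y r - a * k r) / r)))
        = r powr a / r * (\<kappa> * (\<Phi> r * y r))"
    proof -
      have 1: "r powr (a - 1) = r powr a / r" using r by (simp add: powr_diff)
      show ?thesis unfolding 1 \<kappa>_def using r q by (simp add: divide_simps power2_eq_square) (simp add: algebra_simps)
    qed
    ultimately show ?thesis by simp
  qed
  have cP: "continuous_on {0..s} P"
  proof -
    have "continuous_on {0..s} (\<lambda>r. \<Phi> r powr q)"
      using sm \<Phi>p q by (intro continuous_intros continuous_on_powr' continuous_on_subset[OF \<Phi>c]) force+
    moreover have "continuous_on {0..s} (\<lambda>r. r powr a)"
      using a by (intro continuous_on_powr' continuous_intros) auto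
    ultimately show ?thesis
      unfolding P_def using sm q
      by (intro continuous_on_mult continuous_on_add continuous_on_diff continuous_on_divide continuous_on_power
          continuous_on_subset[OF kc] continuous_on_subset[OF \<Phi>c] continuous_on_const continuous_on_id) auto
  qed
  have "\<kappa> * (1/2) powr q * (a / 2) powr a / a \<le> P (a / 2)"
  proof -
    have "P 0 - \<kappa> * (1/2) powr q * 0 powr a / a \<le> P (a / 2) - \<kappa> * (1/2) powr q * (a / 2) powr a / a"
    proof (rule nondecreasing_within[where f="\<lambda>r. P r - \<kappa> * (1/2) powr q * r powr a / a" and l=0 and r=m
          and D="\<lambda>x. x powr a / x * \<kappa> * (\<Phi> x powr q - (1/2) powr q)"])
      show "continuous_on {0..a / 2} (\<lambda>r. P r - \<kappa> * (1/2) powr q * r powr a / a)" using s a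
        by (intro continuous_intros continuous_on_powr' continuous_on_subset[OF cP]) auto
      fix x assume x: "0 < x" "x < a / 2"
      then show "((\<lambda>r. P r - \<kappa> * (1/2) powr q * r powr a / a) has_real_derivative
          x powr a / x * \<kappa> * (\<Phi> x powr q - (1/2) powr q)) (at x within {0..m})"
        using s a DP[of x] by (auto intro!: derivative_eq_intros simp: powr_diff field_simps)
      have "(1/2) powr q \<le> \<Phi> x powr q" using \<Phi>half[of x] x q by (intro powr_mono2) auto
      then show "0 \<le> x powr a / x * \<kappa> * (\<Phi> x powr q - (1/2) powr q)" using x \<kappa> by simp
    qed (use sm a in auto)
    then show ?thesis by (simp add: P_def)
  qed
  also have "P (a / 2) \<le> P s"
  proof (rule nondecreasing_within[where f=P and l=0 and r=m and D="\<lambda>x. x powr a / x * (\<kappa> * \<Phi> x powr q)"])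
    show "continuous_on {a / 2..s} P" using a by (intro continuous_on_subset[OF cP]) auto
    fix x assume x: "a / 2 < x" "x < s"
    then show "(P has_real_derivative x powr a / x * (\<kappa> * \<Phi> x powr q)) (at x within {0..m})"
      using a by (intro DP) auto
    show "0 \<le> x powr a / x * (\<kappa> * \<Phi> x powr q)" using x a \<kappa> by (auto intro!: mult_nonneg_nonneg)
  qed (use sm s a in auto)
  also have "P s \<le> (4 powr a / 2 + \<bar>a - 1\<bar> * 2 powr a / 2 + a / (q * (q - 2))) * (s powr a / s * (\<Phi> s)^2)"
  proof -
    have 1: "(s * k s)^2 \<le> 4 powr a * (\<Phi> s)^2"
    proof -
      have "(s * k s)^2 \<le> (2 powr a * \<Phi> s)^2" using sk kpos sm by (intro power_mono) auto
      also have "\<dots> = 4 powr a * (\<Phi> s)^2"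
        by (simp add: power2_eq_square powr_mult[symmetric])
      finally show ?thesis .
    qed
    have 2: "- (a - 1) / 2 * \<Phi> s * (s * k s) \<le> \<bar>a - 1\<bar> / 2 * \<Phi> s * (2 powr a * \<Phi> s)"
    proof -
      have "- (a - 1) / 2 * (\<Phi> s * (s * k s)) \<le> \<bar>a - 1\<bar> / 2 * (\<Phi> s * (s * k s))"
        using \<Phi>pos kpos sm by (intro mult_right_mono) (auto simp: abs_if)
      also have "\<dots> \<le> \<bar>a - 1\<bar> / 2 * (\<Phi> s * (2 powr a * \<Phi> s))"
        using \<Phi>pos sk by (intro mult_left_mono) auto
      finally show ?thesis by (simp add: mult.assoc)
    qed
    have 3: "s * \<Phi> s powr q \<le> a / (q - 2) * (\<Phi> s)^2"
    proof -
      have "\<Phi> s powr q = \<Phi> s powr (2 + (q - 2))" by simp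
      also have "\<dots> = (\<Phi> s)^2 * \<Phi> s powr (q - 2)" using \<Phi>pos unfolding powr_add by simp
      also have "\<dots> \<le> (\<Phi> s)^2 * (1 / X)" by (intro mult_left_mono \<Phi>X) auto
      finally have "s * \<Phi> s powr q \<le> s * ((\<Phi> s)^2 * (1 / X))" using sm by (intro mult_left_mono) auto
      also have "\<dots> = a / (q - 2) * (\<Phi> s)^2" using sm q a by (simp add: X_def)
      finally show ?thesis .
    qed
    have "P s = s powr a / s * ((s * k s)^2 / 2 + s * \<Phi> s powr q / q + - (a - 1) / 2 * \<Phi> s * (s * k s))"
      unfolding P_def using sm by (simp add: field_simps power2_eq_square)
    also have "\<dots> \<le> s powr a / s * (4 powr a * (\<Phi> s)^2 / 2 + a / (q - 2) * (\<Phi> s)^2 / q + \<bar>a - 1\<bar> / 2 * \<Phi> s * (2 powr a * \<Phi> s))"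
      using 1 2 3 sm q by (intro mult_left_mono add_mono divide_right_mono) auto
    also have "\<dots> = (4 powr a / 2 + \<bar>a - 1\<bar> * 2 powr a / 2 + a / (q * (q - 2))) * (s powr a / s * (\<Phi> s)^2)"
      using sm q by (simp add: field_simps power2_eq_square)
    finally show ?thesis .
  qed
  also have "\<dots> \<le> (4 powr a / 2 + \<bar>a - 1\<bar> * 2 powr a / 2 + a / (q * (q - 2)))
      * (((q - 2) / a) powr (- (2 / (q - 2))) * s powr (- (q / (q - 2) - a)))"
  proof (rule mult_left_mono)
    have "s powr a / s * (\<Phi> s)^2 \<le> s powr a / s * X powr (- (2 / (q - 2)))"
      using sm \<Phi>2 by (intro mult_left_mono) auto
    also have "X powr (- (2 / (q - 2))) = ((q - 2) / a) powr (- (2 / (q - 2))) * s powr (- (2 / (q - 2)))"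
      unfolding X_def by (rule powr_mult)
    also have "s powr a / s * (((q - 2) / a) powr (- (2 / (q - 2))) * s powr (- (2 / (q - 2))))
        = ((q - 2) / a) powr (- (2 / (q - 2))) * (s powr (a - 1) * s powr (- (2 / (q - 2))))"
      using sm by (simp add: powr_diff)
    also have "s powr (a - 1) * s powr (- (2 / (q - 2))) = s powr (a - 1 - 2 / (q - 2))"
      by (simp add: powr_add[symmetric])
    also have "a - 1 - 2 / (q - 2) = - (q / (q - 2) - a)" using q by (simp add: field_simps)
    finally show "s powr a / s * (\<Phi> s)^2 \<le> ((q - 2) / a) powr (- (2 / (q - 2))) * s powr (- (q / (q - 2) - a))" .
  qed (use q a in auto)
  finally show ?thesis by (simp add: \<kappa>_def mult.assoc)
qed

end

text \<open>The two sides of \<open>profile_estimate\<close> become incompatible for large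
  \<open>s\<close>. The length \<open>S\<close> is independent of the truncation level
  \<open>M\<close>, which matters because \<open>apriori_bound\<close> computes its \<open>M\<close>
  from \<open>S\<close>.\<close>

lemma profile_crosses_zero:
  fixes a b q :: real
  assumes a: "0 < a" and b: "0 < b" and q: "2 < q" and sub: "q * (a - 1) < 2 * a"
  obtains S where "0 < S" "radial a b 0 S"
    "\<And>M \<Phi>. 1 \<le> M \<Longrightarrow> radial.ivp a b 0 S 1 (\<lambda>r. cpow q M (\<Phi> r)) \<Phi> \<Longrightarrow> \<exists>s\<in>{0..S}. \<Phi> s < 0"
proof -
  define c0 where "c0 = (a / q - (a - 1) / 2) * (1/2) powr q * (a / 2) powr a / a"
  define c1 where "c1 = (4 powr a / 2 + \<bar>a - 1\<bar> * 2 powr a / 2 + a / (q * (q - 2))) * ((q - 2) / a) powr (- (2 / (q - 2)))"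
  \<comment> \<open>Positive exactly when \<open>q * (a - 1) < 2 * a\<close>: the upper bound
    \<open>c1 * s powr (- \<theta>)\<close> decays, the lower bound \<open>c0\<close> does
    not.\<close>
  define \<theta> where "\<theta> = q / (q - 2) - a"
  have "0 < a / q - (a - 1) / 2" using sub q by (simp add: field_simps)
  then have c0: "0 < c0" using a unfolding c0_def by (intro divide_pos_pos mult_pos_pos) auto
  have \<theta>: "0 < \<theta>" using sub q by (simp add: \<theta>_def field_simps)
  have "((\<lambda>s. c1 * s powr (- \<theta>)) \<longlongrightarrow> c1 * 0) at_top"
    using \<theta> by (intro tendsto_intros tendsto_neg_powr filterlim_ident) auto
  then have "\<forall>\<^sub>F s in at_top. c1 * s powr (- \<theta>) < c0"
    using c0 by (intro order_tendstoD(2)) auto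
  then have "\<forall>\<^sub>F s in at_top. c1 * s powr (- \<theta>) < c0 \<and> a / 2 \<le> s"
    using eventually_ge_at_top[of "a / 2"] by eventually_elim auto
  then obtain s where s: "c1 * s powr (- \<theta>) < c0" "a / 2 \<le> s"
    by (auto dest: eventually_happens)
  have S: "0 < 2 * s" using s a by simp
  interpret radial a b 0 "2 * s" by unfold_locales (use a b S in auto)
  show ?thesis
  proof (rule that[OF S radial_axioms])
    fix M \<Phi> assume M: "1 \<le> M" and \<Phi>: "ivp 1 (\<lambda>r. cpow q M (\<Phi> r)) \<Phi>"
    show "\<exists>s\<in>{0..2 * s}. \<Phi> s < 0"
    proof (rule ccontr)
      assume "\<not> ?thesis"
      then have "c0 \<le> c1 * s powr (- \<theta>)"
        unfolding c0_def c1_def \<theta>_def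
        by (intro profile_estimate[OF refl q sub M \<Phi> _ s(2) refl]) (meson not_less)
      then show False using s by simp
    qed
  qed
qed

text \<open>Zooming in by \<open>\<epsilon>\<close> at the singular endpoint replaces
  \<open>e = 1\<close> by \<open>e = \<epsilon>\<close>, which pushes the other singular point out
  to \<open>1 / \<epsilon>\<close>.\<close>

lemma kop_scale: "kop a b 1 y (\<epsilon> * s) = kop a b \<epsilon> (\<lambda>r. y (\<epsilon> * r)) s"
  by (simp add: kop_def av_def mult.assoc)

lemma jop_scale:
  assumes "0 < \<epsilon>"
  shows "jop a b 1 y (\<epsilon> * t) = \<epsilon> * jop a b \<epsilon> (\<lambda>r. y (\<epsilon> * r)) t"
proof -
  have im: "(\<lambda>x. x / \<epsilon>) ` {0..\<epsilon> * t} = {0..t}"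
    using assms by (auto simp: field_simps image_iff intro!: bexI[of _ "_ * \<epsilon>"])
  have "integral ((\<lambda>x. x / \<epsilon>) ` {0..\<epsilon> * t}) (\<lambda>x. kop a b 1 y (\<epsilon> * x)) = (1 / \<bar>\<epsilon>\<bar>) *\<^sub>R integral {0..\<epsilon> * t} (kop a b 1 y)"
    by (rule integral_stretch_real) (use assms in simp)
  then show ?thesis using assms unfolding im jop_def kop_scale by (simp add: field_simps)
qed

context radial
begin

text \<open>A positive source only pushes \<open>h\<close> down, so Gronwall has to count just the
  linear term: for \<open>y = h powr (q - 1) - \<mu> * h\<close> the bound is linear in
  \<open>A\<close> and independent of \<open>q\<close>.\<close>

lemma ivp_upper:
  assumes h: "ivp A y h" and nn: "\<And>t. t \<in> {0..m} \<Longrightarrow> 0 \<le> h t"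
    and y: "\<And>t. t \<in> {0..m} \<Longrightarrow> - y t \<le> k * h t" and k: "0 \<le> k" and t: "t \<in> {0..m}"
  shows "h t \<le> 2 * A * exp (2 * C * (k + 1) * m)"
proof -
  define L where "L = 2 * C * (k + 1)"
  have L: "0 < L" using C_pos k by (simp add: L_def)
  obtain t0 M where t0: "t0 \<in> {0..m}" "h t0 = M * exp (L * t0)"
    and M: "\<And>r. r \<in> {0..m} \<Longrightarrow> h r \<le> M * exp (L * r)"
    by (rule weighted_max[OF ivpD(1)[OF h], of L]) (rule that)
  have M0: "0 \<le> M" using nn[OF t0(1)] t0(2) by (simp add: zero_le_mult_iff)
  have A: "0 \<le> A" using nn[of 0] ivp_at_0[OF h] m by simp
  have "J (\<lambda>r. - 1 * y r) t0 \<le> C * (k * M) / L * exp (L * t0)"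
  proof (rule J_le_exp[OF _ t0(1) L])
    show "continuous_on {0..m} (\<lambda>r. - 1 * y r)" by (intro continuous_intros ivpD(2)[OF h])
    fix r assume r: "r \<in> {0..m}"
    have "- 1 * y r \<le> k * h r" using y[OF r] by simp
    also have "\<dots> \<le> k * (M * exp (L * r))" by (intro mult_left_mono M r k)
    finally show "- 1 * y r \<le> k * M * exp (L * r)" by simp
  qed (use k M0 in auto)
  also have "C * (k * M) / L \<le> M / 2"
  proof -
    have "C * (k * M) / L = k / (k + 1) * (M / 2)" using C_pos k by (simp add: L_def)
    also have "\<dots> \<le> 1 * (M / 2)" using k M0 by (intro mult_right_mono) auto
    finally show ?thesis by simp
  qed
  finally have "- J y t0 \<le> M / 2 * exp (L * t0)" unfolding J_cmult by simp
  moreover have "A \<le> A * exp (L * t0)" using A L t0 by (intro mult_right_mono[of 1, simplified] mult_le_cancel_left1[THEN iffD2]) auto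
  ultimately have "M * exp (L * t0) \<le> (A + M / 2) * exp (L * t0)"
    using ivpD(3)[OF h t0(1)] t0(2) by (simp add: algebra_simps)
  then have "M \<le> 2 * A" by simp
  moreover have "h t \<le> M * exp (L * t)" by (rule M[OF t])
  moreover have "M * exp (L * t) \<le> 2 * A * exp (L * m)"
    using \<open>M \<le> 2 * A\<close> M0 L t by (intro mult_mono) auto
  ultimately show ?thesis by (simp add: L_def)
qed

text \<open>Up to the factor \<open>1 / a\<close> both operators average \<open>y\<close>, the one
  at scale \<open>e\<close> against an extra weight \<open>W\<close> between \<open>1\<close> and
  \<open>1 + \<eta>\<close>; and \<open>\<eta>\<close> tends to \<open>0\<close> with
  \<open>e\<close>.\<close>

lemma K_minus_K0:
  assumes y: "continuous_on {0..m} y" and B: "\<And>r. r \<in> {0..m} \<Longrightarrow> \<bar>y r\<bar> \<le> B" and s: "s \<in> {0..m}"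
  shows "\<bar>K y s - kop a b 0 y s\<bar> \<le> ((1 - e * m) powr (-b) / (1 - e * m) - 1) * B / a"
proof -
  define \<eta> where "\<eta> = (1 - e * m) powr (-b) / (1 - e * m) - 1"
  define W where "W r = (1 - e * s) powr (-b) * (1 - e * r) powr (b - 1)" for r
  have W: "1 \<le> W r" "W r \<le> 1 + \<eta>" if r: "0 \<le> r" "r \<le> s" for r
  proof -
    define x w where "x = 1 - e * s" and "w = 1 - e * r"
    have xw: "0 < x" "x \<le> w" "w \<le> 1" "1 - e * m \<le> x" "0 < 1 - e * m"
      using es[OF s] es[of r] r s e em by (auto simp: x_def w_def intro: mult_left_mono)
    have W': "W r = x powr (-b) * w powr b / w"
      using xw by (simp add: W_def x_def[symmetric] w_def[symmetric] powr_diff)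
    have "1 \<le> x powr (-b) * w powr b"
    proof -
      have "1 = x powr (-b) * x powr b" using xw by (simp add: powr_minus)
      also have "\<dots> \<le> x powr (-b) * w powr b" using xw b by (intro mult_left_mono powr_mono2) auto
      finally show ?thesis .
    qed
    then show "1 \<le> W r" unfolding W' using xw by (simp add: field_simps)
    have "W r \<le> x powr (-b) * 1 / w"
      unfolding W' using xw b by (intro divide_right_mono mult_left_mono powr_le1) auto
    also have "\<dots> \<le> (1 - e * m) powr (-b) / (1 - e * m)"
      using xw b by (intro frac_le) (auto intro: powr_mono2')
    finally show "W r \<le> 1 + \<eta>" by (simp add: \<eta>_def)
  qed
  have \<eta>0: "0 \<le> \<eta>" using W[of 0] s by simp
  have Wc: "continuous_on {0..m} W" unfolding W_def by (intro continuous_on_mult continuous_on_const continuous_on_weight)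
  have bd: "\<bar>(W r - 1) * y r\<bar> \<le> \<eta> * B" if "0 \<le> r" "r \<le> s" for r
    unfolding abs_mult using W[OF that] B[of r] s that \<eta>0 by (intro mult_mono) auto
  have "K y s - kop a b 0 y s = (1 / a) * (av a (\<lambda>r. W r * y r) s - av a y s)"
  proof -
    have "av a (\<lambda>r. W r * y r) s = (1 - e * s) powr (-b) * av a (\<lambda>r. (1 - e * r) powr (b - 1) * y r) s"
      unfolding W_def mult.assoc by (rule av_cmult)
    then show ?thesis by (simp add: kop_def right_diff_distrib)
  qed
  also have "av a (\<lambda>r. W r * y r) s - av a y s = av a (\<lambda>r. (W r - 1) * y r) s"
  proof -
    have "av a (\<lambda>r. W r * y r) s = av a (\<lambda>r. (W r - 1) * y r + y r) s" by (simp add: algebra_simps)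
    also have "\<dots> = av a (\<lambda>r. (W r - 1) * y r) s + av a y s"
      using s by (intro av_add[OF a, of _ m] continuous_intros Wc y) auto
    finally show ?thesis by simp
  qed
  finally have eq: "K y s - kop a b 0 y s = (1 / a) * av a (\<lambda>r. (W r - 1) * y r) s" .
  have "av a (\<lambda>r. (W r - 1) * y r) s \<le> av a (\<lambda>r. \<eta> * B) s"
    using s bd by (intro av_mono[OF a, of _ m] continuous_intros Wc y) (auto simp: abs_le_iff)
  moreover have "av a (\<lambda>r. - (\<eta> * B)) s \<le> av a (\<lambda>r. (W r - 1) * y r) s"
    using s bd by (intro av_mono[OF a, of _ m] continuous_intros Wc y) (fastforce simp: abs_le_iff)+
  ultimately have "\<bar>av a (\<lambda>r. (W r - 1) * y r) s\<bar> \<le> \<eta> * B" by (simp add: abs_le_iff)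
  then show ?thesis unfolding eq abs_mult using a by (simp add: \<eta>_def field_simps)
qed

lemma J_minus_J0:
  assumes y: "continuous_on {0..m} y" and B: "\<And>r. r \<in> {0..m} \<Longrightarrow> \<bar>y r\<bar> \<le> B" and t: "t \<in> {0..m}"
  shows "\<bar>J y t - jop a b 0 y t\<bar> \<le> ((1 - e * m) powr (-b) / (1 - e * m) - 1) * B / a * m"
proof -
  interpret r0: radial a b 0 m by unfold_locales (use a b m in auto)
  define D where "D = ((1 - e * m) powr (-b) / (1 - e * m) - 1) * B / a"
  have D: "\<bar>K y s - r0.K y s\<bar> \<le> D" if "s \<in> {0..m}" for s
    unfolding D_def by (rule K_minus_K0[OF y B that])
  have D0: "0 \<le> D" using D[of 0] m by auto
  have int: "(\<lambda>s. K y s - r0.K y s) integrable_on cbox 0 t"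
    using K_integrable[OF y t] r0.K_integrable[OF y t] by (simp add: integrable_diff)
  have "norm (integral (cbox 0 t) (\<lambda>s. K y s - r0.K y s)) \<le> D * measure lborel (cbox 0 t)"
    by (rule integrable_bound[OF D0 int]) (use D t in auto)
  then have "\<bar>J y t - jop a b 0 y t\<bar> \<le> D * t"
    using t K_integrable[OF y t] r0.K_integrable[OF y t] by (simp add: jop_def integral_diff)
  also have "\<dots> \<le> D * m" using D0 t by (intro mult_left_mono) auto
  finally show ?thesis by (simp add: D_def)
qed

end

text \<open>Blow-up argument: rescaling a solution with large initial value \<open>A\<close> by \<open>\<epsilon> = A powr (2 - q)\<close>
  gives an approximate solution of the profile equation, which becomes negative.\<close>

lemma apriori_bound:
  assumes "radial a b 1 m" and q: "2 < q" and sub: "q * (a - 1) < 2 * a" and \<mu>1: "0 \<le> \<mu>1"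
  obtains A0 where "0 < A0"
    "\<And>\<mu> A h. 0 \<le> \<mu> \<Longrightarrow> \<mu> \<le> \<mu>1 \<Longrightarrow> radial.ivp a b 1 m A (\<lambda>r. h r powr (q - 1) - \<mu> * h r) h \<Longrightarrow>
       (\<And>t. t \<in> {0..m} \<Longrightarrow> 0 \<le> h t) \<Longrightarrow> A \<le> A0"
proof -
  interpret r1: radial a b 1 m by fact
  note a = r1.a and b = r1.b
  obtain S where S: "0 < S" and r0: "radial a b 0 S"
    and cross: "\<And>M \<Phi>. 1 \<le> M \<Longrightarrow> radial.ivp a b 0 S 1 (\<lambda>r. cpow q M (\<Phi> r)) \<Phi> \<Longrightarrow> \<exists>s\<in>{0..S}. \<Phi> s < 0"
    by (rule profile_crosses_zero[OF a b q sub]) blast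
  interpret r0: radial a b 0 S by fact
  \<comment> \<open>Bounds the constant \<open>C\<close> of every scale \<open>\<epsilon>\<close>
    with \<open>\<epsilon> * S \<le> 1/2\<close>.\<close>
  define C1 where "C1 = (1/2) powr (-b) / a / (1/2)"
  have C1: "0 < C1" using a by (simp add: C1_def)
  \<comment> \<open>By \<open>ivp_upper\<close> every rescaled solution, having initial value
    \<open>1\<close>, stays below this \<open>M\<close>; truncating at \<open>M\<close> does not
    change it.\<close>
  define M where "M = 2 * exp (2 * C1 * (\<mu>1 + 1) * S)"
  have "1 \<le> exp (2 * C1 * (\<mu>1 + 1) * S)" using C1 \<mu>1 S by simp
  then have M: "1 \<le> M" unfolding M_def by linarith
  define k where "k = (q - 1) * M powr (q - 2)"
  have k: "0 \<le> k" using q by (simp add: k_def)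
  define B where "B = M powr (q - 1)"
  obtain \<Phi> where \<Phi>: "r0.ivp 1 (\<lambda>r. cpow q M (\<Phi> r)) \<Phi>"
  proof -
    have "\<exists>h. r0.ivp 1 (\<lambda>r. cpow q M (h r)) h"
    proof (rule r0.ivp_exists[where k=k])
      show "continuous_on ({0..S} \<times> UNIV) (\<lambda>x. cpow q M (snd x))"
        using M by (intro continuous_intros q) auto
    qed (use k M cpow_lipschitz[OF q, of M] in \<open>auto simp: k_def\<close>)
    then show ?thesis using that by blast
  qed
  obtain s where s: "s \<in> {0..S}" "\<Phi> s < 0" using cross[OF M \<Phi>] by blast
  \<comment> \<open>The right side of the \<open>stability\<close> estimate between the rescaled
    solution and the profile. It tends to \<open>0\<close> with \<open>\<epsilon>\<close>, whereas
    \<open>\<Phi> s < 0\<close> is fixed.\<close>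
  define R where "R \<epsilon> = 2 * (((1 - \<epsilon> * S) powr (-b) / (1 - \<epsilon> * S) - 1) * B / a * S + \<epsilon> * \<mu>1 * M) * exp (2 * C1 * (k + 1) * S)" for \<epsilon>
  have "(R \<longlongrightarrow> 2 * (((1 - 0 * S) powr (-b) / (1 - 0 * S) - 1) * B / a * S + 0 * \<mu>1 * M) * exp (2 * C1 * (k + 1) * S)) (at_right 0)"
    unfolding R_def using a by (intro tendsto_intros) auto
  then have "\<forall>\<^sub>F \<epsilon> in at_right 0. R \<epsilon> < - \<Phi> s"
    using s by (intro order_tendstoD(2)) auto
  moreover have "\<forall>\<^sub>F \<epsilon> in at_right 0. 0 < \<epsilon> \<and> \<epsilon> < min 1 (min (1 / (2 * S)) (m / S))"
    using S r1.m by (intro eventually_at_right_real[of 0 "min 1 (min (1 / (2 * S)) (m / S))", THEN eventually_mono]) auto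
  ultimately have "\<forall>\<^sub>F \<epsilon> in at_right 0. R \<epsilon> < - \<Phi> s \<and> \<epsilon> < min 1 (min (1 / (2 * S)) (m / S))"
    by eventually_elim auto
  then obtain \<epsilon>0 where \<epsilon>0: "0 < \<epsilon>0" and small: "\<And>\<epsilon>. 0 < \<epsilon> \<Longrightarrow> \<epsilon> < \<epsilon>0 \<Longrightarrow> R \<epsilon> < - \<Phi> s \<and> \<epsilon> < min 1 (min (1 / (2 * S)) (m / S))"
    unfolding eventually_at_right[OF zero_less_one] by auto
  show ?thesis
  \<comment> \<open>\<open>A\<close> exceeds this bound exactly when the scale
    \<open>A powr (- (q - 2))\<close> is below \<open>\<epsilon>0\<close>.\<close>
  proof (rule that[of "\<epsilon>0 powr (- 1 / (q - 2))"])
    show "0 < \<epsilon>0 powr (- 1 / (q - 2))" using \<epsilon>0 by simp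
    fix \<mu> A h
    assume \<mu>: "0 \<le> \<mu>" "\<mu> \<le> \<mu>1" and h: "r1.ivp A (\<lambda>r. h r powr (q - 1) - \<mu> * h r) h"
      and nn: "\<And>t. t \<in> {0..m} \<Longrightarrow> 0 \<le> h t"
    show "A \<le> \<epsilon>0 powr (- 1 / (q - 2))"
    proof (rule ccontr)
      assume "\<not> ?thesis"
      then have AA: "\<epsilon>0 powr (- 1 / (q - 2)) < A" by simp
      then have A: "0 < A" by (rule le_less_trans[rotated]) simp
      define \<epsilon> where "\<epsilon> = A powr (- (q - 2))"
      have \<epsilon>: "0 < \<epsilon>" using A by (simp add: \<epsilon>_def)
      have "\<epsilon> < (\<epsilon>0 powr (- 1 / (q - 2))) powr (- (q - 2))"
        unfolding \<epsilon>_def using AA \<epsilon>0 q by (intro powr_less_mono2_neg) auto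
      also have "\<dots> = \<epsilon>0"
      proof -
        have "- 1 / (q - 2) * (- (q - 2)) = 1" using q by (simp add: field_simps)
        then show ?thesis using \<epsilon>0 by (simp only: powr_powr powr_one less_imp_le)
      qed
      finally have sm: "R \<epsilon> < - \<Phi> s" "\<epsilon> < 1" "\<epsilon> < 1 / (2 * S)" "\<epsilon> < m / S" using small[OF \<epsilon>] by auto
      have \<epsilon>S: "\<epsilon> * S < 1 / 2" "\<epsilon> * S < m" using sm S by (auto simp: field_simps)
      interpret re: radial a b \<epsilon> S by unfold_locales (use a b \<epsilon> S \<epsilon>S in auto)
      have Ce: "re.C \<le> C1"
        unfolding re.C_def C1_def using \<epsilon>S a b \<epsilon> S
        by (intro frac_le divide_right_mono powr_mono2') auto
      define F where "F r = h (\<epsilon> * r) / A" for r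
      define y where "y r = h r powr (q - 1) - \<mu> * h r" for r
      have mem: "\<epsilon> * r \<in> {0..m}" if "r \<in> {0..S}" for r
      proof -
        have "\<epsilon> * r \<le> \<epsilon> * S" using that \<epsilon> by (intro mult_left_mono) auto
        then have "\<epsilon> * r \<le> m" using \<epsilon>S by linarith
        then show ?thesis using that \<epsilon> by simp
      qed
      have F0: "0 \<le> F r" if "r \<in> {0..S}" for r
        using nn[OF mem[OF that]] A by (simp add: F_def)
      have hc: "continuous_on {0..m} h" using r1.ivpD(1)[OF h] .
      have Fc: "continuous_on {0..S} F"
        unfolding F_def using mem A by (intro continuous_intros continuous_on_compose2[OF hc]) auto
      have Fy: "\<epsilon> / A * y (\<epsilon> * r) = F r powr (q - 1) - \<epsilon> * \<mu> * F r" if "r \<in> {0..S}" for r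
      proof -
        have hF: "h (\<epsilon> * r) = A * F r" using A by (simp add: F_def)
        have "\<epsilon> / A * A powr (q - 1) = 1"
        proof -
          have "A powr (q - 1) = A powr (1 + (q - 2))" by simp
          also have "\<dots> = A * A powr (q - 2)" using A unfolding powr_add by simp
          finally show ?thesis using A by (simp add: \<epsilon>_def powr_add[symmetric])
        qed
        moreover have "\<epsilon> / A * y (\<epsilon> * r) = (\<epsilon> / A * A powr (q - 1)) * F r powr (q - 1) - \<epsilon> * \<mu> * F r"
          unfolding y_def hF powr_mult using A by (simp add: right_diff_distrib)
        ultimately show ?thesis by simp
      qed
      have "re.ivp 1 (\<lambda>r. \<epsilon> / A * y (\<epsilon> * r)) F"
        unfolding re.ivp_def
      proof (intro conjI ballI)
        show "continuous_on {0..S} F" by (rule Fc)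
        have yc: "continuous_on {0..m} y" using r1.ivpD(2)[OF h] by (simp add: y_def[abs_def])
        show "continuous_on {0..S} (\<lambda>r. \<epsilon> / A * y (\<epsilon> * r))"
          using mem A by (intro continuous_intros continuous_on_compose2[OF yc]) auto
        fix t assume t: "t \<in> {0..S}"
        have "h (\<epsilon> * t) = A - jop a b 1 y (\<epsilon> * t)"
          using r1.ivpD(3)[OF h mem[OF t]] by (simp add: y_def[abs_def])
        also have "jop a b 1 y (\<epsilon> * t) = \<epsilon> * re.J (\<lambda>r. y (\<epsilon> * r)) t" by (rule jop_scale[OF \<epsilon>])
        finally show "F t = 1 - re.J (\<lambda>r. \<epsilon> / A * y (\<epsilon> * r)) t"
          unfolding re.J_cmult F_def using A by (simp add: diff_divide_distrib)
      qed
      then have F: "re.ivp 1 (\<lambda>r. F r powr (q - 1) - \<epsilon> * \<mu> * F r) F"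
        by (rule re.ivp_cong_source) (rule Fy)
      have \<epsilon>\<mu>: "\<epsilon> * \<mu> \<le> \<mu>1" using mult_right_mono[of \<epsilon> 1 \<mu>] sm \<mu> by simp
      have FM: "F r \<le> M" if r: "r \<in> {0..S}" for r
      proof -
        have "F r \<le> 2 * 1 * exp (2 * re.C * (\<epsilon> * \<mu> + 1) * S)"
          by (rule re.ivp_upper[OF F F0 _ _ r]) (use \<epsilon> \<mu> in auto)
        also have "2 * re.C * (\<epsilon> * \<mu> + 1) * S \<le> 2 * C1 * (\<mu>1 + 1) * S"
          using \<epsilon>\<mu> Ce C1 \<epsilon> \<mu> S re.C_pos by (intro mult_right_mono mult_mono) auto
        finally show ?thesis by (simp add: M_def)
      qed
      define z where "z r = F r - \<Phi> r" for r
      define yz where "yz r = (F r powr (q - 1) - \<epsilon> * \<mu> * F r) - cpow q M (\<Phi> r)" for r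
      note Phic = r0.ivpD(1)[OF \<Phi>] and cPhi = r0.ivpD(2)[OF \<Phi>] and cF = re.ivpD(2)[OF F]
      define E where "E = ((1 - \<epsilon> * S) powr (-b) / (1 - \<epsilon> * S) - 1) * B / a * S"
      have JE: "\<bar>re.J (\<lambda>r. cpow q M (\<Phi> r)) t - jop a b 0 (\<lambda>r. cpow q M (\<Phi> r)) t\<bar> \<le> E" if t: "t \<in> {0..S}" for t
        unfolding E_def using cpow_le[OF q, of M] M
        by (intro re.J_minus_J0[OF cPhi _ t]) (auto simp: cpow_nonneg B_def)
      have E0: "0 \<le> E" using JE[of 0] S by auto
      have "\<bar>z s\<bar> \<le> 2 * (E + \<epsilon> * \<mu>1 * M) * exp (2 * re.C * (k + 1) * S)"
      proof (rule re.stability[where z=z and y=yz and t=s])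
        show "continuous_on {0..S} z" unfolding z_def by (intro continuous_intros Fc Phic)
        show "continuous_on {0..S} yz" unfolding yz_def by (intro continuous_on_diff[OF cF cPhi])
        fix t assume t: "t \<in> {0..S}"
        have "re.J yz t = re.J (\<lambda>r. F r powr (q - 1) - \<epsilon> * \<mu> * F r) t - re.J (\<lambda>r. cpow q M (\<Phi> r)) t"
          unfolding yz_def by (rule re.J_diff[OF cF cPhi t])
        then show "\<bar>z t\<bar> \<le> E + \<bar>re.J yz t\<bar>"
          using JE[OF t] re.ivpD(3)[OF F t] r0.ivpD(3)[OF \<Phi> t] unfolding z_def by linarith
        have "F t powr (q - 1) = cpow q M (F t)" using F0[OF t] FM[OF t] by (simp add: cpow_eq)
        moreover have "\<bar>cpow q M (F t) - cpow q M (\<Phi> t)\<bar> \<le> k * \<bar>z t\<bar>"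
          unfolding k_def z_def using M by (intro cpow_lipschitz[OF q]) simp
        moreover have "\<epsilon> * \<mu> * F t \<le> \<epsilon> * \<mu>1 * M" "0 \<le> \<epsilon> * \<mu> * F t"
          using \<epsilon> \<mu> F0[OF t] FM[OF t] by (auto intro!: mult_mono)
        ultimately show "\<bar>yz t\<bar> \<le> k * \<bar>z t\<bar> + \<epsilon> * \<mu>1 * M"
          unfolding yz_def by linarith
      qed (use k \<epsilon> \<mu>1 M E0 s in auto)
      also have "\<dots> \<le> 2 * (E + \<epsilon> * \<mu>1 * M) * exp (2 * C1 * (k + 1) * S)"
        using Ce k S E0 \<epsilon> \<mu>1 M by (intro mult_left_mono) (auto intro!: mult_right_mono)
      also have "\<dots> = R \<epsilon>" by (simp add: R_def E_def)
      also have "\<dots> < - \<Phi> s" by (rule sm)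
      finally have "F s < 0" unfolding z_def by linarith
      then show False using F0[OF s(1)] by simp
    qed
  qed
qed

section \<open>Rigidity, linearization and moments\<close>

context radial
begin

lemma K_pos:
  assumes y: "continuous_on {0..m} y" and s: "s \<in> {0..m}"
    and pos: "\<And>r. 0 \<le> r \<Longrightarrow> r \<le> s \<Longrightarrow> 0 < y r"
  shows "0 < K y s"
proof -
  define G where "G r = (1 - e * r) powr (b - 1) * y r" for r
  have Gc: "continuous_on {0..m} G" unfolding G_def by (rule continuous_on_wy[OF y])
  then have "continuous_on {0..s} G" by (rule continuous_on_subset) (use s in auto)
  then obtain r0 where r0: "r0 \<in> {0..s}" "\<And>r. r \<in> {0..s} \<Longrightarrow> G r0 \<le> G r"
    using continuous_attains_inf[of "{0..s}" G] s by auto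
  have "0 < 1 - e * r0" using es[of r0] r0 s by auto
  then have "0 < G r0" unfolding G_def using pos[of r0] r0 by auto
  also have "G r0 = av a (\<lambda>_. G r0) s" by simp
  also have "\<dots> \<le> av a G s"
    using s r0 by (intro av_mono[OF a, of _ m] Gc) auto
  finally have "0 < av a G s" .
  moreover have "0 < 1 - e * s" using es[OF s] by simp
  ultimately show ?thesis unfolding kop_def G_def using a by auto
qed

text \<open>Bochner's argument: the derivative \<open>- K y\<close> of \<open>h\<close> solves the linearized equation shifted
  by \<open>a + b\<close>.\<close>

lemma bochner:
  assumes e1: "e = 1" and h: "ivp A y h"
    and Dy: "\<And>t. 0 < t \<Longrightarrow> t \<le> m \<Longrightarrow> (y has_real_derivative n t * (- K y t)) (at t within {0..m})"
    and n: "\<And>t. 0 < t \<Longrightarrow> t \<le> m \<Longrightarrow> n t < a + b"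
  shows "0 \<le> K y m * (y m - (a - (a + b) * m) * K y m)"
    and "K y m * (y m - (a - (a + b) * m) * K y m) \<le> 0 \<Longrightarrow> t \<in> {0..m} \<Longrightarrow> h t = A"
proof -
  have m1: "m < 1" using em e1 by simp
  define Z where "Z t = y t - (a - (a + b) * t) * K y t" for t
  define p where "p t = t powr a * (1 - t) powr b" for t
  \<comment> \<open>\<open>Z\<close> is \<open>t (1 - t) k'\<close> for \<open>k = K y\<close>.
    Differentiating the weight \<open>p\<close> cancels the first-order term of \<open>Z'\<close>,
    and the derivative \<open>Q'\<close> becomes a sum of two nonnegative terms once
    \<open>n t < a + b\<close>.\<close>
  define Q where "Q t = p t * (K y t * Z t)" for t
  define Q' where "Q' t = p t * ((Z t)^2 / (t * (1 - t)) + (a + b - n t) * (K y t)^2)" for t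
  note yc = ivpD(2)[OF h]
  have pc: "continuous_on {0..m} p"
    unfolding p_def using a b m1 by (intro continuous_intros continuous_on_powr') auto
  have Qc: "continuous_on {0..m} Q"
    unfolding Q_def Z_def by (intro continuous_intros pc yc continuous_on_K)
  have DQ: "(Q has_real_derivative Q' t) (at t within {0..m})" if t: "0 < t" "t \<le> m" for t
  proof -
    have t1: "t < 1" using t m1 by simp
    have KD: "(K y has_real_derivative Z t / (t * (1 - t))) (at t within {0..m})"
      using K_has_derivative[OF yc t] by (simp add: Z_def e1)
    have ZD: "(Z has_real_derivative (a + b - n t) * K y t - (a - (a + b) * t) * (Z t / (t * (1 - t)))) (at t within {0..m})"
    proof -
      define w where "w = Z t / (t * (1 - t))"
      have "((\<lambda>t. a - (a + b) * t) has_real_derivative - (a + b)) (at t within {0..m})"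
        by (auto intro!: derivative_eq_intros)
      from DERIV_diff[OF Dy[OF t] DERIV_mult[OF this KD[folded w_def]]]
      have "(Z has_real_derivative n t * (- K y t) - (- (a + b) * K y t + w * (a - (a + b) * t))) (at t within {0..m})"
        unfolding Z_def[abs_def] .
      also have "n t * (- K y t) - (- (a + b) * K y t + w * (a - (a + b) * t)) = (a + b - n t) * K y t - (a - (a + b) * t) * w"
        by (simp add: algebra_simps)
      finally show ?thesis by (simp add: w_def)
    qed
    have "(p has_real_derivative (a * t powr (a - 1)) * (1 - t) powr b + t powr a * (- b * (1 - t) powr (b - 1))) (at t within {0..m})"
      unfolding p_def[abs_def] using t t1 by (auto intro!: derivative_eq_intros)
    also have "(a * t powr (a - 1)) * (1 - t) powr b + t powr a * (- b * (1 - t) powr (b - 1))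
        = p t * ((a - (a + b) * t) / (t * (1 - t)))"
      using t t1 by (simp add: p_def powr_diff divide_simps) (simp add: algebra_simps)
    finally have pD: "(p has_real_derivative p t * ((a - (a + b) * t) / (t * (1 - t)))) (at t within {0..m})" .
    have "(Q has_real_derivative p t * ((a - (a + b) * t) / (t * (1 - t))) * (K y t * Z t)
        + (Z t / (t * (1 - t)) * Z t + ((a + b - n t) * K y t - (a - (a + b) * t) * (Z t / (t * (1 - t)))) * K y t) * p t) (at t within {0..m})"
      unfolding Q_def[abs_def] by (rule DERIV_mult[OF pD DERIV_mult[OF KD ZD]])
    moreover have "p t * ((a - (a + b) * t) / (t * (1 - t))) * (K y t * Z t)
        + (Z t / (t * (1 - t)) * Z t + ((a + b - n t) * K y t - (a - (a + b) * t) * (Z t / (t * (1 - t)))) * K y t) * p t = Q' t"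
      unfolding Q'_def divide_inverse by (simp add: algebra_simps power2_eq_square)
    ultimately show ?thesis by simp
  qed
  have p0: "0 < p t" if "0 < t" "t \<le> m" for t using that m1 by (simp add: p_def)
  have Q'lb: "p t * ((a + b - n t) * (K y t)^2) \<le> Q' t" if t: "0 < t" "t \<le> m" for t
    unfolding Q'_def using p0[OF t] t m1 by (intro mult_left_mono) auto
  have Q'0: "0 \<le> Q' t" if t: "0 < t" "t \<le> m" for t
  proof -
    have "0 \<le> p t * ((a + b - n t) * (K y t)^2)" using p0[OF t] n[OF t] by auto
    then show ?thesis using Q'lb[OF t] by simp
  qed
  have mono: "Q u \<le> Q v" if "0 \<le> u" "u \<le> v" "v \<le> m" for u v
    by (rule nondecreasing_within[where l=0 and r=m and D=Q'])
       (use that DQ Q'0 in \<open>auto intro: continuous_on_subset[OF Qc]\<close>)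
  have Q0: "Q 0 = 0" by (simp add: Q_def p_def)
  have Qm: "Q m = p m * (K y m * (y m - (a - (a + b) * m) * K y m))" by (simp add: Q_def Z_def)
  show "0 \<le> K y m * (y m - (a - (a + b) * m) * K y m)"
    using mono[of 0 m] Q0 m p0[of m] unfolding Qm by (simp add: zero_le_mult_iff)
  assume le: "K y m * (y m - (a - (a + b) * m) * K y m) \<le> 0" and t: "t \<in> {0..m}"
  then have "Q m \<le> 0" unfolding Qm using p0[of m] m by (simp add: mult_le_0_iff)
  then have Qz: "Q t = 0" if "t \<in> {0..m}" for t
    using mono[of 0 t] mono[of t m] Q0 that by simp
  have K0: "K y t = 0" if t: "0 < t" "t < m" for t
  proof -
    have "(Q has_real_derivative Q' t) (at t)"
      using DQ[of t] t by (simp add: at_within_Icc_at)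
    moreover have "(Q has_real_derivative 0) (at t)"
      by (rule has_field_derivative_transform_within_open[of "\<lambda>_. 0" _ _ "{0<..<m}"]) (use t Qz in auto)
    ultimately have "Q' t = 0" by (rule DERIV_unique)
    then have "p t * ((a + b - n t) * (K y t)^2) \<le> 0" using Q'lb[of t] t by simp
    then have "(K y t)^2 \<le> 0" using p0[of t] n[of t] t by (simp add: mult_le_0_iff)
    then show ?thesis by simp
  qed
  have "h t = h 0"
  proof (rule DERIV_isconst2[OF m ivpD(1)[OF h]])
    fix x assume x: "0 < x" "x < m"
    then show "DERIV h x :> 0"
      using ivp_has_derivative[OF h, of x] K0[of x] by (simp add: at_within_Icc_at)
  qed (use t in auto)
  then show "h t = A" using ivp_at_0[OF h] by simp
qed

text \<open>The product of two Gronwall factors, one from bounding \<open>z\<close> and one from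
  bounding \<open>z - d * \<psi>\<close>.\<close>

definition lin_const :: "real \<Rightarrow> real" where
  "lin_const n0 = 4 * exp (4 * C * (n0 + 2) * m)"

lemma lin_const_pos: "0 < lin_const n0"
  by (simp add: lin_const_def)

text \<open>\<open>z - d * \<psi>\<close> solves the linear equation with zero initial value and a
  forcing of size \<open>\<eta> * \<bar>z\<bar>\<close>, and \<open>z\<close> itself is of size
  \<open>d\<close>. Since \<open>\<eta>\<close> is any relative error of the source, this serves
  both for Taylor remainders and for a shifted coefficient \<open>n\<close>.\<close>

lemma linearization:
  assumes z: "ivp d y z" and \<psi>: "ivp 1 (\<lambda>r. n r * \<psi> r) \<psi>"
    and n: "\<And>t. t \<in> {0..m} \<Longrightarrow> \<bar>n t\<bar> \<le> n0" and \<eta>: "0 \<le> \<eta>" "\<eta> \<le> 1"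
    and y: "\<And>t. t \<in> {0..m} \<Longrightarrow> \<bar>y t - n t * z t\<bar> \<le> \<eta> * \<bar>z t\<bar>" and t: "t \<in> {0..m}"
  shows "\<bar>z t\<bar> \<le> lin_const n0 * \<bar>d\<bar>"
    and "\<bar>z t - d * \<psi> t\<bar> \<le> lin_const n0 * \<eta> * \<bar>d\<bar>"
    and "\<bar>K y t - d * K (\<lambda>r. n r * \<psi> r) t\<bar> \<le> C * (n0 + 1) * lin_const n0 * \<eta> * \<bar>d\<bar>"
proof -
  have n00: "0 \<le> n0" using n[of 0] m by auto
  define E where "E = exp (2 * C * (n0 + 2) * m)"
  have E1: "1 \<le> E" using C_pos n00 m by (simp add: E_def)
  have lin: "lin_const n0 = 4 * (E * E)"
    by (simp add: lin_const_def E_def exp_add[symmetric] algebra_simps)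
  have zb: "\<bar>z t\<bar> \<le> 2 * \<bar>d\<bar> * E" if t: "t \<in> {0..m}" for t
  proof -
    have "\<bar>z t\<bar> \<le> 2 * (\<bar>d\<bar> + 0) * exp (2 * C * ((n0 + 1) + 1) * m)"
    proof (rule ivp_bound[OF z _ _ _ t])
      fix r assume r: "r \<in> {0..m}"
      have "\<bar>y r\<bar> \<le> \<bar>n r * z r\<bar> + \<eta> * \<bar>z r\<bar>" using y[OF r] by linarith
      also have "\<dots> \<le> n0 * \<bar>z r\<bar> + 1 * \<bar>z r\<bar>"
        unfolding abs_mult using n[OF r] \<eta> by (intro add_mono mult_right_mono) auto
      finally show "\<bar>y r\<bar> \<le> (n0 + 1) * \<bar>z r\<bar> + 0" by (simp add: algebra_simps)
    qed (use n00 in auto)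
    moreover have "(n0 + 1) + 1 = n0 + 2" by simp
    ultimately show ?thesis unfolding E_def by (metis add.right_neutral)
  qed
  have wi: "ivp (d - d * 1) (\<lambda>r. y r - d * (n r * \<psi> r)) (\<lambda>r. z r - d * \<psi> r)"
    by (rule ivp_diff[OF z ivp_cmult[OF \<psi>]])
  have ey: "\<bar>y r - d * (n r * \<psi> r)\<bar> \<le> n0 * \<bar>z r - d * \<psi> r\<bar> + \<eta> * (2 * \<bar>d\<bar> * E)" if r: "r \<in> {0..m}" for r
  proof -
    have "y r - d * (n r * \<psi> r) = n r * (z r - d * \<psi> r) + (y r - n r * z r)" by (simp add: algebra_simps)
    then have "\<bar>y r - d * (n r * \<psi> r)\<bar> \<le> \<bar>n r * (z r - d * \<psi> r)\<bar> + \<bar>y r - n r * z r\<bar>" by linarith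
    also have "\<bar>n r * (z r - d * \<psi> r)\<bar> \<le> n0 * \<bar>z r - d * \<psi> r\<bar>"
      unfolding abs_mult by (intro mult_right_mono n r) simp
    also have "\<bar>y r - n r * z r\<bar> \<le> \<eta> * (2 * \<bar>d\<bar> * E)"
      using y[OF r] mult_left_mono[OF zb[OF r] \<eta>(1)] by linarith
    finally show ?thesis by simp
  qed
  have nn: "0 \<le> \<eta> * (2 * \<bar>d\<bar> * E)" using \<eta> E1 by simp
  have wb: "\<bar>z t - d * \<psi> t\<bar> \<le> lin_const n0 * \<eta> * \<bar>d\<bar>" if t: "t \<in> {0..m}" for t
  proof -
    have "\<bar>z t - d * \<psi> t\<bar> \<le> 2 * (\<bar>d - d * 1\<bar> + \<eta> * (2 * \<bar>d\<bar> * E)) * exp (2 * C * (n0 + 1) * m)"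
      by (rule ivp_bound[OF wi ey n00 nn t])
    also have "\<dots> \<le> 2 * (\<eta> * (2 * \<bar>d\<bar> * E)) * E"
      unfolding E_def using C_pos m \<eta> by (intro mult_mono) (auto intro!: mult_right_mono)
    also have "\<dots> = lin_const n0 * \<eta> * \<bar>d\<bar>" by (simp add: lin)
    finally show ?thesis .
  qed
  show "\<bar>z t - d * \<psi> t\<bar> \<le> lin_const n0 * \<eta> * \<bar>d\<bar>" by (rule wb[OF t])
  have E2: "E \<le> E * E" "1 \<le> E * E" using E1 by (auto intro: order_trans[OF _ mult_mono[of 1 _ 1], simplified])
  have "2 * \<bar>d\<bar> * E \<le> 2 * \<bar>d\<bar> * (E * E)" using E2 by (intro mult_left_mono) auto
  also have "\<dots> \<le> lin_const n0 * \<bar>d\<bar>" unfolding lin using E1 by simp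
  finally have "2 * \<bar>d\<bar> * E \<le> lin_const n0 * \<bar>d\<bar>" .
  note le = this
  then show "\<bar>z t\<bar> \<le> lin_const n0 * \<bar>d\<bar>" using zb[OF t] by simp
  have "\<bar>K (\<lambda>r. y r - d * (n r * \<psi> r)) t\<bar> \<le> C * ((n0 + 1) * lin_const n0 * \<eta> * \<bar>d\<bar>)"
  proof (rule K_abs_le[OF ivpD(2)[OF wi] t])
    fix r assume "0 \<le> r" "r \<le> t"
    then have r: "r \<in> {0..m}" using t by auto
    have "\<bar>y r - d * (n r * \<psi> r)\<bar> \<le> n0 * (lin_const n0 * \<eta> * \<bar>d\<bar>) + \<eta> * (lin_const n0 * \<bar>d\<bar>)"
      using ey[OF r] mult_left_mono[OF wb[OF r] n00] mult_left_mono[OF le \<eta>(1)] by linarith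
    then show "\<bar>y r - d * (n r * \<psi> r)\<bar> \<le> (n0 + 1) * lin_const n0 * \<eta> * \<bar>d\<bar>" by (simp add: algebra_simps)
  qed
  moreover have "K (\<lambda>r. y r - d * (n r * \<psi> r)) t = K y t - d * K (\<lambda>r. n r * \<psi> r) t"
  proof -
    have "continuous_on {0..m} (\<lambda>r. d * (n r * \<psi> r))" by (intro continuous_on_mult_left ivpD(2)[OF \<psi>])
    from K_diff[OF ivpD(2)[OF z] this t] show ?thesis by (simp only: K_cmult)
  qed
  ultimately show "\<bar>K y t - d * K (\<lambda>r. n r * \<psi> r) t\<bar> \<le> C * (n0 + 1) * lin_const n0 * \<eta> * \<bar>d\<bar>"
    by (simp add: mult.assoc)
qed

text \<open>The first-order equation has only one solution continuous at the singular endpoint, so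
  an explicit one must be \<open>K Y\<close>. In this way \<open>K\<close> is evaluated without
  computing an integral.\<close>

lemma K_exact:
  assumes e1: "e = 1" and g: "continuous_on {0..m} g" and Y: "continuous_on {0..m} Y"
    and D: "\<And>s. 0 < s \<Longrightarrow> s \<le> m \<Longrightarrow> (g has_real_derivative g' s) (at s within {0..m})"
    and eq: "\<And>s. 0 < s \<Longrightarrow> s \<le> m \<Longrightarrow> Y s = s * (1 - s) * g' s + (a - (a + b) * s) * g s"
    and s: "0 < s" "s \<le> m"
  shows "K Y s = g s"
proof -
  have "g s - K Y s = 0"
  proof (rule singular_homogeneous_eq_0[OF e1,
        where D="\<lambda>s. g' s - (Y s - (a - (a + b) * s) * K Y s) / (s * (1 - s))" and E="\<lambda>s. g s - K Y s"])
    show "continuous_on {0..m} (\<lambda>s. g s - K Y s)" by (intro continuous_intros g continuous_on_K Y)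
    fix x assume x: "0 < x" "x \<le> m"
    then have x1: "x < 1" using em e1 by simp
    show "((\<lambda>s. g s - K Y s) has_real_derivative g' x - (Y x - (a - (a + b) * x) * K Y x) / (x * (1 - x))) (at x within {0..m})"
      using D[OF x] K_has_derivative[OF Y x] by (auto intro!: derivative_eq_intros simp: e1)
    have "x * (1 - x) * ((Y x - (a - (a + b) * x) * K Y x) / (x * (1 - x))) = Y x - (a - (a + b) * x) * K Y x"
      using x x1 by simp
    then show "x * (1 - x) * (g' x - (Y x - (a - (a + b) * x) * K Y x) / (x * (1 - x))) + (a - (a + b) * x) * (g x - K Y x) = 0"
      unfolding right_diff_distrib[of "x * (1 - x)"] eq[OF x] by (simp add: algebra_simps)
  qed (use s in auto)
  then show ?thesis by simp
qed

text \<open>\<open>t - a / (a + b)\<close> is the first nonconstant eigenfunction, with eigenvalue \<open>a + b\<close>.\<close>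

definition \<tau> where "\<tau> = a / (a + b)"

lemma ab_\<tau>: "(a + b) * \<tau> = a" "0 < \<tau>" "\<tau> < 1"
  using a b by (auto simp: \<tau>_def)

text \<open>Green's identity. As \<open>z' = - K y\<close>, the function
  \<open>g = - K y t * (t - \<tau>) - z t\<close> is the Wronskian of \<open>z\<close> with the
  eigenfunction, and inserting it into the first-order equation leaves only the source projected on
  \<open>t - \<tau>\<close>.\<close>

lemma green_eigenfunction:
  assumes e1: "e = 1" and z: "ivp A y z"
  shows "K (\<lambda>t. (t - \<tau>) * ((a + b) * z t - y t)) m = - K y m * (m - \<tau>) - z m"
proof (rule K_exact[OF e1, where g="\<lambda>t. - K y t * (t - \<tau>) - z t"
      and g'="\<lambda>t. - ((y t - (a - (a + b) * t) * K y t) / (t * (1 - t)) * (t - \<tau>))"])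
  note yc = ivpD(2)[OF z] and zc = ivpD(1)[OF z]
  show "continuous_on {0..m} (\<lambda>t. - K y t * (t - \<tau>) - z t)" by (intro continuous_intros continuous_on_K yc zc)
  show "continuous_on {0..m} (\<lambda>t. (t - \<tau>) * ((a + b) * z t - y t))" by (intro continuous_intros yc zc)
  fix s assume s: "0 < s" "s \<le> m"
  then have s1: "s < 1" using em e1 by simp
  define D where "D = a - (a + b) * s"
  have D: "D = - ((a + b) * (s - \<tau>))" using ab_\<tau>(1) by (simp add: D_def algebra_simps)
  show "((\<lambda>t. - K y t * (t - \<tau>) - z t) has_real_derivative - ((y s - (a - (a + b) * s) * K y s) / (s * (1 - s)) * (s - \<tau>))) (at s within {0..m})"
    using K_has_derivative[OF yc s] ivp_has_derivative[OF z, of s] s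
    by (auto intro!: derivative_eq_intros simp: e1)
  have "s * (1 - s) * (- ((y s - D * K y s) / (s * (1 - s)) * (s - \<tau>))) = - ((y s - D * K y s) * (s - \<tau>))"
    using s s1 by simp
  then show "(s - \<tau>) * ((a + b) * z s - y s) = s * (1 - s) * (- ((y s - (a - (a + b) * s) * K y s) / (s * (1 - s)) * (s - \<tau>)))
      + (a - (a + b) * s) * (- K y s * (s - \<tau>) - z s)"
    unfolding D_def[symmetric] by (simp add: D) (simp add: algebra_simps)
qed (use m in auto)

lemma ivp_eigenfunction:
  assumes e1: "e = 1"
  shows "ivp 1 (\<lambda>r. (a + b) * (1 - r / \<tau>)) (\<lambda>r. 1 - r / \<tau>)"
proof -
  have K: "K (\<lambda>r. (a + b) * (1 - r / \<tau>)) s = 1 / \<tau>" if s: "0 < s" "s \<le> m" for s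
  proof (rule K_exact[OF e1 _ _ _ _ s, where g'="\<lambda>_. 0"])
    fix x assume "0 < x" "x \<le> m"
    show "(a + b) * (1 - x / \<tau>) = x * (1 - x) * 0 + (a - (a + b) * x) * (1 / \<tau>)"
      using ab_\<tau> by (simp add: field_simps)
  qed (use ab_\<tau> in \<open>auto intro!: continuous_intros\<close>)
  have yc: "continuous_on {0..m} (\<lambda>r. (a + b) * (1 - r / \<tau>))" using ab_\<tau> by (intro continuous_intros) auto
  have J: "J (\<lambda>r. (a + b) * (1 - r / \<tau>)) t = t / \<tau>" if t: "t \<in> {0..m}" for t
  proof -
    have "J (\<lambda>r. (a + b) * (1 - r / \<tau>)) t = integral {0..t} (\<lambda>_. 1 / \<tau>)"
      \<comment> \<open>\<open>K\<close> has been computed for \<open>s > 0\<close> only; the single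
        point \<open>0\<close> does not affect the integral.\<close>
      unfolding jop_def by (rule integral_spike[of "{0}"]) (use K t in auto)
    then show ?thesis using t by simp
  qed
  show ?thesis unfolding ivp_def using J yc ab_\<tau> by (auto intro!: continuous_intros)
qed

text \<open>\<open>K_exact\<close> for a constant \<open>g\<close> and for
  \<open>g = (t - \<tau>)^2\<close>. The second relation expresses the third moment by lower ones
  and a boundary term that cancels between the two sides of the matching point.\<close>

lemma moments:
  assumes e1: "e = 1"
  shows "K (\<lambda>t. t - \<tau>) m = - 1 / (a + b)"
    and "2 * \<tau> * (1 - \<tau>) * K (\<lambda>t. t - \<tau>) m + 2 * (1 - 2 * \<tau>) * K (\<lambda>t. (t - \<tau>)^2) m
      - (a + b + 2) * K (\<lambda>t. (t - \<tau>)^3) m = (m - \<tau>)^2"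
proof -
  show "K (\<lambda>t. t - \<tau>) m = - 1 / (a + b)"
  proof (rule K_exact[OF e1, where g'="\<lambda>_. 0"])
    fix x assume "0 < x" "x \<le> m"
    show "x - \<tau> = x * (1 - x) * 0 + (a - (a + b) * x) * (- 1 / (a + b))"
      using a b ab_\<tau>(1) by (simp add: field_simps)
  qed (use m in \<open>auto intro!: continuous_intros\<close>)
  have c: "continuous_on {0..m} (\<lambda>t. t - \<tau>)" "continuous_on {0..m} (\<lambda>t. (t - \<tau>)^2)" "continuous_on {0..m} (\<lambda>t. (t - \<tau>)^3)"
    by (intro continuous_intros)+
  have mm: "m \<in> {0..m}" using m by simp
  have "K (\<lambda>t. (2 * \<tau> * (1 - \<tau>)) * (t - \<tau>) + (2 * (1 - 2 * \<tau>)) * (t - \<tau>)^2 - (a + b + 2) * (t - \<tau>)^3) m = (m - \<tau>)^2"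
  proof (rule K_exact[OF e1, where g="\<lambda>t. (t - \<tau>)^2" and g'="\<lambda>t. 2 * (t - \<tau>)"])
    fix x assume "0 < x" "x \<le> m"
    show "((\<lambda>t. (t - \<tau>)\<^sup>2) has_real_derivative 2 * (x - \<tau>)) (at x within {0..m})"
      by (auto intro!: derivative_eq_intros)
    define D where "D = a - (a + b) * x"
    have D: "D = - ((a + b) * (x - \<tau>))" using ab_\<tau>(1) by (simp add: D_def algebra_simps)
    show "2 * \<tau> * (1 - \<tau>) * (x - \<tau>) + 2 * (1 - 2 * \<tau>) * (x - \<tau>)\<^sup>2 - (a + b + 2) * (x - \<tau>) ^ 3 =
      x * (1 - x) * (2 * (x - \<tau>)) + (a - (a + b) * x) * (x - \<tau>)\<^sup>2"
      unfolding D_def[symmetric] D by (simp add: algebra_simps power2_eq_square power3_eq_cube)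
  qed (use m in \<open>auto intro!: continuous_intros\<close>)
  moreover have "K (\<lambda>t. (2 * \<tau> * (1 - \<tau>)) * (t - \<tau>) + (2 * (1 - 2 * \<tau>)) * (t - \<tau>)^2 - (a + b + 2) * (t - \<tau>)^3) m
    = 2 * \<tau> * (1 - \<tau>) * K (\<lambda>t. t - \<tau>) m + 2 * (1 - 2 * \<tau>) * K (\<lambda>t. (t - \<tau>)^2) m - (a + b + 2) * K (\<lambda>t. (t - \<tau>)^3) m"
    by (subst K_diff[OF _ _ mm], (intro continuous_intros)+, subst K_add[OF _ _ mm], (intro continuous_intros)+) (simp only: K_cmult)
  ultimately show "2 * \<tau> * (1 - \<tau>) * K (\<lambda>t. t - \<tau>) m + 2 * (1 - 2 * \<tau>) * K (\<lambda>t. (t - \<tau>)^2) m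
      - (a + b + 2) * K (\<lambda>t. (t - \<tau>)^3) m = (m - \<tau>)^2" by simp
qed

end

section \<open>Transcritical bifurcation\<close>

text \<open>Brouwer applied to \<open>p - (F p, G p)\<close> clipped to the box. Where the clipping
  is active, the fixed point lies on a face, and the sign condition there forces the component to
  vanish all the same.\<close>

lemma poincare_miranda:
  fixes F G :: "real \<times> real \<Rightarrow> real"
  assumes box: "l1 \<le> u1" "l2 \<le> u2"
    and F: "continuous_on ({l1..u1} \<times> {l2..u2}) F" and G: "continuous_on ({l1..u1} \<times> {l2..u2}) G"
    and F1: "\<And>y. y \<in> {l2..u2} \<Longrightarrow> F (l1, y) \<le> 0" and F2: "\<And>y. y \<in> {l2..u2} \<Longrightarrow> 0 \<le> F (u1, y)"
    and G1: "\<And>x. x \<in> {l1..u1} \<Longrightarrow> G (x, l2) \<le> 0" and G2: "\<And>x. x \<in> {l1..u1} \<Longrightarrow> 0 \<le> G (x, u2)"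
  obtains x y where "x \<in> {l1..u1}" "y \<in> {l2..u2}" "F (x, y) = 0" "G (x, y) = 0"
proof -
  define S where "S = {l1..u1} \<times> {l2..u2}"
  define T where "T p = (max l1 (min u1 (fst p - F p)), max l2 (min u2 (snd p - G p)))" for p
  have "compact S" "convex S" "S \<noteq> {}"
    unfolding S_def using box by (auto intro!: compact_Times convex_Times)
  moreover have "continuous_on S T"
    unfolding T_def S_def by (intro continuous_intros F G)
  moreover have "T \<in> S \<rightarrow> S" unfolding T_def S_def using box by auto
  ultimately obtain p where p: "p \<in> S" "T p = p" by (rule brouwer)
  obtain x y where xy: "p = (x, y)" by (cases p)
  have mem: "x \<in> {l1..u1}" "y \<in> {l2..u2}" using p(1) by (auto simp: xy S_def)
  have x: "max l1 (min u1 (x - F (x, y))) = x" and y: "max l2 (min u2 (y - G (x, y))) = y"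
    using p(2) by (auto simp: T_def xy)
  have "F (x, y) = 0"
    using x F1[OF mem(2)] F2[OF mem(2)] mem(1)
    by (cases "x = l1"; cases "x = u1") (auto simp: max_def min_def split: if_splits)
  moreover have "G (x, y) = 0"
    using y G1[OF mem(1)] G2[OF mem(1)] mem(2)
    by (cases "y = l2"; cases "y = u2") (auto simp: max_def min_def split: if_splits)
  ultimately show ?thesis using that mem by blast
qed

definition rem2 :: "real \<Rightarrow> real \<Rightarrow> real" where
  "rem2 q x = (1 + x) powr (q - 1) - 1 - (q - 1) * x"

lemma rem2_taylor:
  fixes q \<epsilon> :: real
  assumes "0 < \<epsilon>"
  obtains \<rho> where "0 < \<rho>" "\<And>x. \<bar>x\<bar> \<le> \<rho> \<Longrightarrow> \<bar>rem2 q x - (q - 1) * (q - 2) / 2 * x\<^sup>2\<bar> \<le> \<epsilon> * x\<^sup>2"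
proof -
  have "((\<lambda>x::real. rem2 q x / x^2) \<longlongrightarrow> (q-1)*(q-2)/2) (at 0)"
    unfolding rem2_def by real_asymp
  then have "\<forall>\<^sub>F x in at 0. dist (rem2 q x / x^2) ((q-1)*(q-2)/2) < \<epsilon>"
    using assms by (rule tendstoD)
  then obtain d where d: "0 < d" "\<And>x. x \<noteq> 0 \<Longrightarrow> \<bar>x\<bar> < d \<Longrightarrow> \<bar>rem2 q x / x^2 - (q-1)*(q-2)/2\<bar> < \<epsilon>"
    unfolding eventually_at by (auto simp: dist_real_def)
  show ?thesis
  proof (rule that[of "d / 2"])
    fix x assume x: "\<bar>x\<bar> \<le> d / 2"
    show "\<bar>rem2 q x - (q - 1) * (q - 2) / 2 * x\<^sup>2\<bar> \<le> \<epsilon> * x\<^sup>2"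
    proof (cases "x = 0")
      case False
      have "\<bar>rem2 q x - (q - 1) * (q - 2) / 2 * x\<^sup>2\<bar> = \<bar>(rem2 q x / x^2 - (q-1)*(q-2)/2) * x\<^sup>2\<bar>"
        using False by (simp add: left_diff_distrib)
      also have "\<dots> \<le> \<epsilon> * x\<^sup>2"
        unfolding abs_mult using d(2)[OF False] x d(1) by (intro mult_mono) auto
      finally show ?thesis .
    qed (simp add: rem2_def)
  qed (use d in auto)
qed

text \<open>The truncated nonlinearity for \<open>f = 1 + z\<close>, normalized so that the constant solution is \<open>1\<close>.\<close>

definition bsrc :: "real \<Rightarrow> real \<Rightarrow> (real \<Rightarrow> real) \<Rightarrow> real \<Rightarrow> real" where
  "bsrc q \<mu> z r = \<mu> * (cpow q 2 (1 + z r) - (1 + z r))"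

text \<open>The truncation at \<open>2\<close> is inactive for \<open>1 + z\<close> in
  \<open>[0, 2]\<close>. The linear coefficient \<open>\<mu> * (q - 2)\<close> equals the first
  eigenvalue \<open>a + b\<close> at the bifurcation value.\<close>

lemma bsrc_eq:
  assumes "\<bar>z r\<bar> \<le> 1"
  shows "bsrc q \<mu> z r = \<mu> * (q - 2) * z r + \<mu> * rem2 q (z r)"
  using assms by (simp add: bsrc_def cpow_eq rem2_def algebra_simps abs_le_iff)

lemma bsrc_lipschitz:
  assumes "2 < q" "0 \<le> \<mu>"
  shows "\<bar>bsrc q \<mu> z r - bsrc q \<mu> w r\<bar> \<le> \<mu> * ((q - 1) * 2 powr (q - 2) + 1) * \<bar>z r - w r\<bar>"
proof -
  have "\<bar>cpow q 2 (1 + z r) - cpow q 2 (1 + w r)\<bar> \<le> (q - 1) * 2 powr (q - 2) * \<bar>z r - w r\<bar>"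
    using cpow_lipschitz[OF assms(1), of 2 "1 + z r" "1 + w r"] by simp
  then have "\<bar>(cpow q 2 (1 + z r) - (1 + z r)) - (cpow q 2 (1 + w r) - (1 + w r))\<bar> \<le> ((q - 1) * 2 powr (q - 2) + 1) * \<bar>z r - w r\<bar>"
    by (simp add: algebra_simps)
  from mult_left_mono[OF this assms(2)] show ?thesis
    using assms(2) by (simp add: bsrc_def abs_mult right_diff_distrib[symmetric] mult.assoc)
qed

context radial
begin

lemma ivp_dependence:
  assumes h: "ivp A y h" and g: "ivp B w g"
    and le: "\<And>t. t \<in> {0..m} \<Longrightarrow> \<bar>y t - w t\<bar> \<le> k * \<bar>h t - g t\<bar> + F"
    and k: "0 \<le> k" and F: "0 \<le> F" and t: "t \<in> {0..m}"
  shows "\<bar>h t - g t\<bar> \<le> 2 * (\<bar>A - B\<bar> + F) * exp (2 * C * (k + 1) * m)"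
    and "\<bar>K y t - K w t\<bar> \<le> C * (k * (2 * (\<bar>A - B\<bar> + F) * exp (2 * C * (k + 1) * m)) + F)"
proof -
  have b: "\<bar>h t - g t\<bar> \<le> 2 * (\<bar>A - B\<bar> + F) * exp (2 * C * (k + 1) * m)" if "t \<in> {0..m}" for t
    by (rule ivp_bound[OF ivp_diff[OF h g] le k F that])
  show "\<bar>h t - g t\<bar> \<le> 2 * (\<bar>A - B\<bar> + F) * exp (2 * C * (k + 1) * m)" by (rule b[OF t])
  have "\<bar>K (\<lambda>r. y r - w r) t\<bar> \<le> C * (k * (2 * (\<bar>A - B\<bar> + F) * exp (2 * C * (k + 1) * m)) + F)"
  proof (rule K_abs_le[OF ivpD(2)[OF ivp_diff[OF h g]] t])
    fix r assume "0 \<le> r" "r \<le> t"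
    then have r: "r \<in> {0..m}" using t by auto
    show "\<bar>y r - w r\<bar> \<le> k * (2 * (\<bar>A - B\<bar> + F) * exp (2 * C * (k + 1) * m)) + F"
      using le[OF r] mult_left_mono[OF b[OF r] k] by linarith
  qed
  then show "\<bar>K y t - K w t\<bar> \<le> C * (k * (2 * (\<bar>A - B\<bar> + F) * exp (2 * C * (k + 1) * m)) + F)"
    using K_diff[OF ivpD(2)[OF h] ivpD(2)[OF g] t] by simp
qed

text \<open>Supplies the continuity for Poincare-Miranda. The Lipschitz bound in \<open>d\<close>
  holds for every choice of the solutions \<open>Z d\<close>, so they may come from a bare existence
  statement.\<close>

lemma ivp_family_continuous:
  assumes Z: "\<And>d. ivp d (Y d) (Z d)" and k: "0 \<le> k"
    and lip: "\<And>d d' t. t \<in> {0..m} \<Longrightarrow> \<bar>Y d t - Y d' t\<bar> \<le> k * \<bar>Z d t - Z d' t\<bar>"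
    and t: "t \<in> {0..m}"
  shows "continuous_on UNIV (\<lambda>d. Z d t)" "continuous_on UNIV (\<lambda>d. K (Y d) t)"
proof -
  define E where "E = 2 * exp (2 * C * (k + 1) * m)"
  have le: "\<bar>Y d r - Y d' r\<bar> \<le> k * \<bar>Z d r - Z d' r\<bar> + 0" if "r \<in> {0..m}" for d d' r
    using lip[OF that] by simp
  have "\<bar>Z d t - Z d' t\<bar> \<le> E * \<bar>d - d'\<bar>" for d d'
    using ivp_dependence(1)[OF Z Z le k order_refl t, of d d'] by (simp add: E_def mult_ac)
  then have "E-lipschitz_on UNIV (\<lambda>d. Z d t)"
    by (intro lipschitz_onI) (auto simp: dist_real_def E_def)
  then show "continuous_on UNIV (\<lambda>d. Z d t)" by (rule lipschitz_on_continuous_on)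
  have "\<bar>K (Y d) t - K (Y d') t\<bar> \<le> (C * k * E) * \<bar>d - d'\<bar>" for d d'
    using ivp_dependence(2)[OF Z Z le k order_refl t, of d d'] by (simp add: E_def mult_ac)
  then have "(C * k * E)-lipschitz_on UNIV (\<lambda>d. K (Y d) t)"
    using C_pos k by (intro lipschitz_onI) (auto simp: dist_real_def E_def)
  then show "continuous_on UNIV (\<lambda>d. K (Y d) t)" by (rule lipschitz_on_continuous_on)
qed

lemma bsrc_ivp_exists:
  assumes "2 < q" "0 \<le> \<mu>"
  shows "\<exists>z. ivp d (bsrc q \<mu> z) z"
proof -
  have "\<exists>z. ivp d (\<lambda>r. (\<lambda>_ x. \<mu> * (cpow q 2 (1 + x) - (1 + x))) r (z r)) z"
  proof (rule ivp_exists[where k="\<mu> * ((q - 1) * 2 powr (q - 2) + 1)"])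
    show "continuous_on ({0..m} \<times> UNIV) (\<lambda>x. \<mu> * (cpow q 2 (1 + snd x) - (1 + snd x)))"
      using assms by (intro continuous_intros) auto
    show "\<bar>\<mu> * (cpow q 2 (1 + x) - (1 + x)) - \<mu> * (cpow q 2 (1 + y) - (1 + y))\<bar>
        \<le> \<mu> * ((q - 1) * 2 powr (q - 2) + 1) * \<bar>x - y\<bar>" for t x y
      using bsrc_lipschitz[OF assms, of "\<lambda>_. x" 0 "\<lambda>_. y"] by (simp add: bsrc_def)
  qed (use assms in auto)
  then show ?thesis by (simp add: bsrc_def[abs_def])
qed

text \<open>Near the bifurcation point the source is \<open>(a + b) * z\<close> up to the eigenvalue
  gap and the quadratic remainder. Both are small multiples of \<open>\<bar>z\<bar>\<close>, so
  \<open>linearization\<close> compares \<open>z\<close> with the eigenfunction.\<close>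

lemma bifurcation_side:
  assumes e1: "e = 1" and q: "2 < q" and \<mu>1: "0 \<le> \<mu>1" and \<kappa>: "0 < \<kappa>" and \<epsilon>: "0 < \<epsilon>"
  obtains \<rho> where "0 < \<rho>"
    "\<And>\<mu> d z t. 0 \<le> \<mu> \<Longrightarrow> \<mu> \<le> \<mu>1 \<Longrightarrow> \<bar>a + b - \<mu> * (q - 2)\<bar> \<le> \<rho> \<Longrightarrow> \<bar>d\<bar> \<le> \<rho> \<Longrightarrow> ivp d (bsrc q \<mu> z) z \<Longrightarrow>
      t \<in> {0..m} \<Longrightarrow> \<bar>z t\<bar> \<le> 1/2 \<and> \<bar>z t - d * (1 - t / \<tau>)\<bar> \<le> \<kappa> * \<bar>d\<bar> \<and>
        \<bar>rem2 q (z t) - (q - 1) * (q - 2) / 2 * (z t)\<^sup>2\<bar> \<le> \<epsilon> * (z t)\<^sup>2"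
proof -
  define r2 where "r2 = (q - 1) * (q - 2) / 2"
  have r2: "0 \<le> r2" using q by (simp add: r2_def)
  obtain \<rho>2 where \<rho>2: "0 < \<rho>2" "\<And>x. \<bar>x\<bar> \<le> \<rho>2 \<Longrightarrow> \<bar>rem2 q x - r2 * x\<^sup>2\<bar> \<le> \<epsilon> * x\<^sup>2"
    using rem2_taylor[OF \<epsilon>, of q] unfolding r2_def by blast
  define k where "k = \<mu>1 * ((q - 1) * 2 powr (q - 2) + 1)"
  have k: "0 \<le> k" using \<mu>1 q by (simp add: k_def)
  define c where "c = 2 * exp (2 * C * (k + 1) * m)"
  have c: "0 < c" by (simp add: c_def)
  \<comment> \<open>\<open>w * \<rho>\<close> will be the relative error of the source: the summand
    \<open>1\<close> stands for the eigenvalue gap, the other for the quadratic remainder, where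
    \<open>\<bar>z\<bar> \<le> c * \<rho>\<close>.\<close>
  define w where "w = 1 + \<mu>1 * (r2 + \<epsilon>) * c"
  have w: "1 \<le> w" using \<mu>1 r2 \<epsilon> c by (simp add: w_def)
  define Lc where "Lc = lin_const (a + b)"
  have Lc: "0 < Lc" by (simp add: Lc_def lin_const_pos)
  define \<rho> where "\<rho> = min (min (1/2) \<rho>2 / c) (min 1 (\<kappa> / Lc) / w)"
  have \<rho>: "0 < \<rho>" using \<rho>2 c \<kappa> Lc w by (simp add: \<rho>_def)
  have \<rho>c: "\<rho> * c \<le> 1/2" "\<rho> * c \<le> \<rho>2"
  proof -
    have "\<rho> \<le> min (1/2) \<rho>2 / c" by (simp add: \<rho>_def)
    then have "\<rho> * c \<le> min (1/2) \<rho>2" using c by (simp add: pos_le_divide_eq)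
    then show "\<rho> * c \<le> 1/2" "\<rho> * c \<le> \<rho>2" by auto
  qed
  have \<rho>w: "w * \<rho> \<le> 1" "w * \<rho> \<le> \<kappa> / Lc"
  proof -
    have "\<rho> \<le> min 1 (\<kappa> / Lc) / w" by (simp add: \<rho>_def)
    then have "w * \<rho> \<le> min 1 (\<kappa> / Lc)" using w by (simp add: pos_le_divide_eq mult.commute)
    then show "w * \<rho> \<le> 1" "w * \<rho> \<le> \<kappa> / Lc" by auto
  qed
  show ?thesis
  proof (rule that[OF \<rho>])
    fix \<mu> d z t
    assume \<mu>: "0 \<le> \<mu>" "\<mu> \<le> \<mu>1" and e0: "\<bar>a + b - \<mu> * (q - 2)\<bar> \<le> \<rho>" and d: "\<bar>d\<bar> \<le> \<rho>"
      and z: "ivp d (bsrc q \<mu> z) z" and t: "t \<in> {0..m}"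
    have zb: "\<bar>z t\<bar> \<le> c * \<bar>d\<bar>" if t: "t \<in> {0..m}" for t
    proof -
      have "\<bar>z t\<bar> \<le> 2 * (\<bar>d\<bar> + 0) * exp (2 * C * (k + 1) * m)"
      proof (rule ivp_bound[OF z _ k _ t])
        fix r
        have "bsrc q \<mu> (\<lambda>_. 0) r = 0" by (simp add: bsrc_def cpow_def)
        then have "\<bar>bsrc q \<mu> z r\<bar> \<le> \<mu> * ((q - 1) * 2 powr (q - 2) + 1) * \<bar>z r\<bar>"
          using bsrc_lipschitz[OF q \<mu>(1), of z r "\<lambda>_. 0"] by simp
        also have "\<dots> \<le> k * \<bar>z r\<bar>"
          unfolding k_def using \<mu> q by (intro mult_right_mono) auto
        finally show "\<bar>bsrc q \<mu> z r\<bar> \<le> k * \<bar>z r\<bar> + 0" by simp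
      qed simp
      then show ?thesis by (simp add: c_def mult_ac)
    qed
    have zr: "\<bar>z t\<bar> \<le> \<rho> * c" if "t \<in> {0..m}" for t
      by (rule order_trans[OF zb[OF that]]) (use d c in \<open>simp add: mult.commute\<close>)
    have tay: "\<bar>rem2 q (z t) - r2 * (z t)\<^sup>2\<bar> \<le> \<epsilon> * (z t)\<^sup>2" if "t \<in> {0..m}" for t
      using zr[OF that] \<rho>c by (intro \<rho>2(2)) simp
    have rem: "\<bar>rem2 q (z t)\<bar> \<le> (r2 + \<epsilon>) * (\<rho> * c) * \<bar>z t\<bar>" if t: "t \<in> {0..m}" for t
    proof -
      have "\<bar>rem2 q (z t)\<bar> \<le> r2 * (z t)\<^sup>2 + \<epsilon> * (z t)\<^sup>2"
        using tay[OF t] r2 by (smt (verit) mult_nonneg_nonneg zero_le_power2)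
      also have "\<dots> = (r2 + \<epsilon>) * \<bar>z t\<bar> * \<bar>z t\<bar>" by (simp add: algebra_simps power2_eq_square flip: abs_mult)
      also have "\<dots> \<le> (r2 + \<epsilon>) * (\<rho> * c) * \<bar>z t\<bar>"
        using zr[OF t] r2 \<epsilon> by (intro mult_right_mono mult_left_mono) auto
      finally show ?thesis .
    qed
    have lin: "\<bar>z t - d * (1 - t / \<tau>)\<bar> \<le> lin_const (a + b) * (w * \<rho>) * \<bar>d\<bar>"
    proof (rule linearization(2)[OF z ivp_eigenfunction[OF e1] _ _ \<rho>w(1) _ t])
      show "0 \<le> w * \<rho>" using w \<rho> by simp
      fix r assume r: "r \<in> {0..m}"
      show "\<bar>a + b\<bar> \<le> a + b" using a b by simp
      have "bsrc q \<mu> z r - (a + b) * z r = - (a + b - \<mu> * (q - 2)) * z r + \<mu> * rem2 q (z r)"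
        using bsrc_eq[of z r q \<mu>] zr[OF r] \<rho>c by (simp add: algebra_simps)
      then have "\<bar>bsrc q \<mu> z r - (a + b) * z r\<bar> \<le> \<bar>a + b - \<mu> * (q - 2)\<bar> * \<bar>z r\<bar> + \<mu> * \<bar>rem2 q (z r)\<bar>"
        using \<mu> abs_triangle_ineq[of "- (a + b - \<mu> * (q - 2)) * z r" "\<mu> * rem2 q (z r)"] by (simp only: abs_mult abs_minus abs_of_nonneg)
      also have "\<dots> \<le> \<rho> * \<bar>z r\<bar> + \<mu>1 * ((r2 + \<epsilon>) * (\<rho> * c) * \<bar>z r\<bar>)"
        using e0 \<mu> rem[OF r] by (intro add_mono mult_right_mono mult_mono) auto
      also have "\<dots> = w * \<rho> * \<bar>z r\<bar>" by (simp add: w_def algebra_simps)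
      finally show "\<bar>bsrc q \<mu> z r - (a + b) * z r\<bar> \<le> w * \<rho> * \<bar>z r\<bar>" .
    qed
    also have "\<dots> \<le> \<kappa> * \<bar>d\<bar>"
      using \<rho>w(2) Lc by (intro mult_right_mono) (auto simp: Lc_def field_simps)
    finally have "\<bar>z t - d * (1 - t / \<tau>)\<bar> \<le> \<kappa> * \<bar>d\<bar>" .
    then show "\<bar>z t\<bar> \<le> 1/2 \<and> \<bar>z t - d * (1 - t / \<tau>)\<bar> \<le> \<kappa> * \<bar>d\<bar> \<and>
        \<bar>rem2 q (z t) - (q - 1) * (q - 2) / 2 * (z t)\<^sup>2\<bar> \<le> \<epsilon> * (z t)\<^sup>2"
      using tay[OF t] zr[OF t] \<rho>c by (simp add: r2_def)
  qed
qed

text \<open>Inserts \<open>z \<approx> \<sigma> * (t - \<tau>)\<close> into the projected source of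
  Green's identity. The linear part yields the second moment, the quadratic remainder the third;
  \<open>\<theta>\<close> measures the deviation from the eigenfunction and
  \<open>\<epsilon>\<close> the Taylor error.\<close>

lemma weighted_expansion:
  fixes q r2 :: real
  defines "r2 \<equiv> (q - 1) * (q - 2) / 2"
  assumes e1: "e = 1" and q: "2 < q" and z: "continuous_on {0..m} z" and \<mu>: "0 \<le> \<mu>" and \<epsilon>: "0 \<le> \<epsilon>"
    and \<theta>: "0 \<le> \<theta>" "\<theta> \<le> 1" and zr: "\<And>t. t \<in> {0..m} \<Longrightarrow> \<bar>z t\<bar> \<le> 1"
    and zs: "\<And>t. t \<in> {0..m} \<Longrightarrow> \<bar>z t - \<sigma> * (t - \<tau>)\<bar> \<le> \<theta> * \<bar>\<sigma>\<bar>"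
    and tay: "\<And>t. t \<in> {0..m} \<Longrightarrow> \<bar>rem2 q (z t) - r2 * (z t)\<^sup>2\<bar> \<le> \<epsilon> * (z t)\<^sup>2"
  shows "\<bar>K (\<lambda>t. (t - \<tau>) * (\<gamma> * z t - \<mu> * rem2 q (z t))) m
      - (\<sigma> * \<gamma> * K (\<lambda>t. (t - \<tau>)^2) m - \<mu> * r2 * \<sigma>\<^sup>2 * K (\<lambda>t. (t - \<tau>)^3) m)\<bar>
    \<le> C * (\<bar>\<sigma>\<bar> * (\<bar>\<gamma>\<bar> * \<theta> + \<bar>\<sigma>\<bar> * \<mu> * (4 * \<epsilon> + 3 * r2 * \<theta>)))"
proof -
  have mm: "m \<in> {0..m}" using m by simp
  have r2: "0 \<le> r2" using q by (simp add: r2_def)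
  define B where "B = \<bar>\<sigma>\<bar> * (\<bar>\<gamma>\<bar> * \<theta> + \<bar>\<sigma>\<bar> * \<mu> * (4 * \<epsilon> + 3 * r2 * \<theta>))"
  define f where "f t = (t - \<tau>) * (\<gamma> * z t - \<mu> * rem2 q (z t))" for t
  define g where "g t = (\<sigma> * \<gamma>) * (t - \<tau>)^2 - (\<mu> * r2 * \<sigma>\<^sup>2) * (t - \<tau>)^3" for t
  have "continuous_on {0..m} (\<lambda>t. rem2 q (z t))"
    unfolding rem2_def using zr q by (intro continuous_intros continuous_on_powr' z) (fastforce simp: abs_le_iff)+
  then have fc: "continuous_on {0..m} f" unfolding f_def by (intro continuous_intros z)
  have gc: "continuous_on {0..m} g" unfolding g_def by (intro continuous_intros)
  have "\<bar>K (\<lambda>t. f t - g t) m\<bar> \<le> C * B"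
  proof (rule K_abs_le[OF _ mm])
    show "continuous_on {0..m} (\<lambda>t. f t - g t)" by (intro continuous_intros fc gc)
    fix t assume "0 \<le> t" "t \<le> m"
    then have t: "t \<in> {0..m}" by simp
    define p where "p = t - \<tau>"
    have p: "\<bar>p\<bar> \<le> 1" using t ab_\<tau> em e1 by (auto simp: p_def abs_le_iff)
    have zp: "\<bar>z t - \<sigma> * p\<bar> \<le> \<theta> * \<bar>\<sigma>\<bar>" using zs[OF t] by (simp add: p_def)
    have sp: "\<bar>\<sigma> * p\<bar> \<le> \<bar>\<sigma>\<bar>" unfolding abs_mult using p by (simp add: mult_left_le)
    have ts: "\<theta> * \<bar>\<sigma>\<bar> \<le> \<bar>\<sigma>\<bar>" using \<theta> by (simp add: mult_left_le_one_le)
    have zz: "\<bar>z t\<bar> \<le> 2 * \<bar>\<sigma>\<bar>" using zp sp ts by linarith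
    have z2: "(z t)\<^sup>2 \<le> 4 * \<sigma>\<^sup>2"
      using power_mono[OF zz abs_ge_zero, of 2] by (simp add: power_mult_distrib)
    have dd: "\<bar>(z t)\<^sup>2 - (\<sigma> * p)\<^sup>2\<bar> \<le> 3 * \<theta> * \<sigma>\<^sup>2"
    proof -
      have "(z t)\<^sup>2 - (\<sigma> * p)\<^sup>2 = (z t - \<sigma> * p) * (z t + \<sigma> * p)" by (simp add: power2_eq_square algebra_simps)
      moreover have "\<bar>(z t - \<sigma> * p) * (z t + \<sigma> * p)\<bar> \<le> (\<theta> * \<bar>\<sigma>\<bar>) * (3 * \<bar>\<sigma>\<bar>)"
        unfolding abs_mult using zp zz sp \<theta> by (intro mult_mono) auto
      ultimately show ?thesis by (simp add: power2_eq_square)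
    qed
    have "\<bar>rem2 q (z t) - r2 * (\<sigma> * p)\<^sup>2\<bar> \<le> \<bar>rem2 q (z t) - r2 * (z t)\<^sup>2\<bar> + r2 * \<bar>(z t)\<^sup>2 - (\<sigma> * p)\<^sup>2\<bar>"
    proof -
      have "r2 * \<bar>(z t)\<^sup>2 - (\<sigma> * p)\<^sup>2\<bar> = \<bar>r2 * (z t)\<^sup>2 - r2 * (\<sigma> * p)\<^sup>2\<bar>"
        using r2 by (simp add: abs_mult flip: right_diff_distrib)
      then show ?thesis by linarith
    qed
    also have "\<dots> \<le> \<epsilon> * (4 * \<sigma>\<^sup>2) + r2 * (3 * \<theta> * \<sigma>\<^sup>2)"
      using order_trans[OF tay[OF t] mult_left_mono[OF z2 \<epsilon>]] mult_left_mono[OF dd r2] by linarith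
    finally have rr: "\<bar>rem2 q (z t) - r2 * (\<sigma> * p)\<^sup>2\<bar> \<le> \<sigma>\<^sup>2 * (4 * \<epsilon> + 3 * r2 * \<theta>)" by (simp add: algebra_simps)
    have "f t - g t = p * (\<gamma> * (z t - \<sigma> * p) - \<mu> * (rem2 q (z t) - r2 * (\<sigma> * p)\<^sup>2))"
      unfolding f_def g_def p_def by (simp add: algebra_simps power2_eq_square power3_eq_cube)
    also have "\<bar>\<dots>\<bar> \<le> 1 * (\<bar>\<gamma>\<bar> * (\<theta> * \<bar>\<sigma>\<bar>) + \<mu> * (\<sigma>\<^sup>2 * (4 * \<epsilon> + 3 * r2 * \<theta>)))"
    proof -
      have "\<bar>\<gamma> * (z t - \<sigma> * p) - \<mu> * (rem2 q (z t) - r2 * (\<sigma> * p)\<^sup>2)\<bar>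
          \<le> \<bar>\<gamma> * (z t - \<sigma> * p)\<bar> + \<bar>\<mu> * (rem2 q (z t) - r2 * (\<sigma> * p)\<^sup>2)\<bar>" by (rule abs_triangle_ineq4)
      also have "\<dots> \<le> \<bar>\<gamma>\<bar> * (\<theta> * \<bar>\<sigma>\<bar>) + \<mu> * (\<sigma>\<^sup>2 * (4 * \<epsilon> + 3 * r2 * \<theta>))"
        unfolding abs_mult using \<mu> zp rr by (intro add_mono mult_mono) auto
      finally show ?thesis unfolding abs_mult[of p] using p by (intro mult_mono) auto
    qed
    also have "\<dots> = B"
    proof -
      have "\<sigma>\<^sup>2 = \<bar>\<sigma>\<bar> * \<bar>\<sigma>\<bar>" by (simp add: power2_eq_square flip: abs_mult)
      then show ?thesis unfolding B_def by (simp only:) (simp only: algebra_simps)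
    qed
    finally show "\<bar>f t - g t\<bar> \<le> B" .
  qed
  moreover have "K g m = \<sigma> * \<gamma> * K (\<lambda>t. (t - \<tau>)^2) m - \<mu> * r2 * \<sigma>\<^sup>2 * K (\<lambda>t. (t - \<tau>)^3) m"
    unfolding g_def by (subst K_diff[OF _ _ mm], (intro continuous_intros)+) (simp only: K_cmult)
  ultimately show ?thesis using K_diff[OF fc gc mm] unfolding B_def[symmetric] f_def[abs_def] by simp
qed

end

text \<open>The reflection \<open>t \<mapsto> 1 - t\<close> exchanges the Jacobi parameters, so both
  halves are instances of \<open>radial\<close> with \<open>a\<close> and \<open>b\<close> swapped.
  The matching point lies to the right of the zero \<open>a / (a + b)\<close> of the eigenfunction,
  whose value \<open>\<phi>\<close> at \<open>m\<close> is therefore nonzero.\<close>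

locale two_sided =
  fixes a b m q :: real
  assumes a: "0 < a" and ab: "a < b" and m: "a / (a + b) < m" "m < 1"
    and q: "2 < q" and sub: "q * (b - 1) < 2 * b"
begin

lemma b: "0 < b" using a ab by simp

lemma m0: "0 < m" using m a b by (smt (verit) divide_pos_pos)

sublocale L: radial a b 1 m
  by unfold_locales (use a b m m0 in auto)

sublocale R: radial b a 1 "1 - m"
  by unfold_locales (use a b m m0 in auto)

definition \<phi> where "\<phi> = m - L.\<tau>"

lemma \<phi>_pos: "0 < \<phi>"
  using m by (simp add: \<phi>_def L.\<tau>_def)

lemma R\<tau>: "R.\<tau> = 1 - L.\<tau>"
  using a b by (simp add: L.\<tau>_def R.\<tau>_def field_simps)

lemma mem_m: "m \<in> {0..m}" "1 - m \<in> {0..1 - m}"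
  using m0 m by auto

definition \<mu>1 where "\<mu>1 = (a + b) / (q - 2)"

lemma \<mu>1_pos: "0 < \<mu>1" using a b q by (simp add: \<mu>1_def)

text \<open>Up to one common factor these are the second and third moments of the eigenfunction on
  \<open>[0, 1]\<close> with the weight \<open>t powr (a - 1) * (1 - t) powr (b - 1)\<close>.
  Reflection reverses the sign of odd powers, hence the minus in \<open>k3\<close>.\<close>

definition k1 where "k1 = L.K (\<lambda>t. (t - L.\<tau>)^2) m + R.K (\<lambda>t. (t - R.\<tau>)^2) (1 - m)"
definition k3 where "k3 = L.K (\<lambda>t. (t - L.\<tau>)^3) m - R.K (\<lambda>t. (t - R.\<tau>)^3) (1 - m)"

lemma k1_pos: "0 < k1"
proof -
  have "0 \<le> L.K (\<lambda>t. (t - L.\<tau>)^2) m"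
    by (rule L.K_nonneg) (use mem_m in \<open>auto intro!: continuous_intros\<close>)
  moreover have "0 < R.K (\<lambda>t. (t - R.\<tau>)^2) (1 - m)"
  proof (rule R.K_pos)
    fix r assume "r \<le> 1 - m"
    then have "r - R.\<tau> \<noteq> 0" using \<phi>_pos by (simp add: R\<tau> \<phi>_def)
    then show "0 < (r - R.\<tau>)^2" by simp
  qed (use mem_m in \<open>auto intro!: continuous_intros\<close>)
  ultimately show ?thesis by (simp add: k1_def)
qed

text \<open>The third moment of the eigenfunction is nonzero because \<open>a \<noteq> b\<close>; this makes the
  bifurcation transcritical.\<close>

lemma k3_pos: "0 < k3"
proof -
  have 1: "L.K (\<lambda>t. t - L.\<tau>) m = - 1 / (a + b)" "R.K (\<lambda>t. t - R.\<tau>) (1 - m) = - 1 / (a + b)"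
    using L.moments(1) R.moments(1) by (auto simp: add.commute)
  define X3 Y3 X2 Y2 where "X3 = L.K (\<lambda>t. (t - L.\<tau>)^3) m" and "Y3 = R.K (\<lambda>t. (t - R.\<tau>)^3) (1 - m)"
    and "X2 = L.K (\<lambda>t. (t - L.\<tau>)^2) m" and "Y2 = R.K (\<lambda>t. (t - R.\<tau>)^2) (1 - m)"
  have eL: "2 * L.\<tau> * (1 - L.\<tau>) * (- 1 / (a + b)) + 2 * (1 - 2 * L.\<tau>) * X2 - (a + b + 2) * X3 = (m - L.\<tau>)^2"
    using L.moments(2) unfolding 1 X2_def X3_def by simp
  have eR: "2 * R.\<tau> * (1 - R.\<tau>) * (- 1 / (a + b)) + 2 * (1 - 2 * R.\<tau>) * Y2 - (a + b + 2) * Y3 = (1 - m - R.\<tau>)^2"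
    using R.moments(2) unfolding 1 Y2_def Y3_def by (simp add: add.commute[of b a])
  have sq: "(1 - m - R.\<tau>)^2 = (m - L.\<tau>)^2" unfolding R\<tau> by (simp add: power2_eq_square algebra_simps)
  \<comment> \<open>In the difference of \<open>eL\<close> and \<open>eR\<close> the boundary
    squares and the first moments cancel, while \<open>1 - 2 * \<tau>\<close> changes sign under the
    reflection, so the second moments add up.\<close>
  have "2 * (1 - 2 * L.\<tau>) * (X2 + Y2) = (a + b + 2) * (X3 - Y3)"
    using eL eR[unfolded sq] unfolding R\<tau> by (simp add: algebra_simps)
  moreover have "0 < 2 * (1 - 2 * L.\<tau>) * (X2 + Y2)"
  proof -
    have "L.\<tau> < 1/2" using a ab by (simp add: L.\<tau>_def field_simps)
    then show ?thesis using k1_pos by (simp add: k1_def X2_def Y2_def)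
  qed
  ultimately have "0 < (a + b + 2) * (X3 - Y3)" by simp
  then have "0 < X3 - Y3" using a b by (simp add: zero_less_mult_iff)
  then show ?thesis by (simp add: k3_def X3_def Y3_def)
qed

text \<open>Both sides are expanded along the common eigenfunction: \<open>z0 \<approx> \<delta> (1 + \<eta>) (t - \<tau>)\<close> and
  \<open>z1 \<approx> \<delta> (t - \<tau>)\<close>, so that \<open>\<eta>\<close> measures the mismatch of the values at \<open>m\<close>, while the
  mismatch \<open>\<Omega>\<close> of the derivatives behaves like \<open>\<delta> (e k1 - \<delta> \<mu> r2 k3)\<close>.\<close>

lemma bifurcation_expansion:
  fixes \<kappa> \<epsilon> :: real
  defines "r2 \<equiv> (q - 1) * (q - 2) / 2"
  assumes \<kappa>: "0 < \<kappa>" "\<kappa> \<le> 1/2" and \<epsilon>: "0 < \<epsilon>" "\<epsilon> \<le> 1/2"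
  obtains \<rho> where "0 < \<rho>"
    "\<And>\<mu> \<delta> \<eta> z0 z1 e. 0 \<le> \<mu> \<Longrightarrow> \<mu> \<le> \<mu>1 \<Longrightarrow> e = a + b - \<mu> * (q - 2) \<Longrightarrow> \<bar>e\<bar> \<le> \<rho> \<Longrightarrow> 0 < \<delta> \<Longrightarrow> \<delta> \<le> \<rho> \<Longrightarrow> \<bar>\<eta>\<bar> \<le> \<kappa> \<Longrightarrow>
       L.ivp (- L.\<tau> * \<delta> * (1 + \<eta>)) (bsrc q \<mu> z0) z0 \<Longrightarrow> R.ivp (R.\<tau> * \<delta>) (bsrc q \<mu> z1) z1 \<Longrightarrow>
       (\<forall>t\<in>{0..m}. \<bar>z0 t\<bar> \<le> 1/2) \<and> (\<forall>t\<in>{0..1 - m}. \<bar>z1 t\<bar> \<le> 1/2) \<and>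
       \<bar>(z0 m - z1 (1 - m)) - \<delta> * \<eta> * \<phi>\<bar> \<le> \<epsilon> * \<delta> \<and>
       \<bar>(- (L.K (bsrc q \<mu> z0) m + R.K (bsrc q \<mu> z1) (1 - m)) * \<phi> - (z0 m - z1 (1 - m)))
          - \<delta> * (e * k1 - \<delta> * \<mu> * r2 * k3)\<bar>
         \<le> \<delta> * (L.C + R.C) * (\<bar>e\<bar> * (\<epsilon> + \<kappa>) + \<delta> * \<mu> * (4 * \<epsilon> + 3 * r2 * (\<epsilon> + \<kappa>)))"
proof -
  obtain \<rho>L where \<rho>L: "0 < \<rho>L" and
    side_L: "\<And>\<mu> d z t. 0 \<le> \<mu> \<Longrightarrow> \<mu> \<le> \<mu>1 \<Longrightarrow> \<bar>a + b - \<mu> * (q - 2)\<bar> \<le> \<rho>L \<Longrightarrow> \<bar>d\<bar> \<le> \<rho>L \<Longrightarrow> L.ivp d (bsrc q \<mu> z) z \<Longrightarrow>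
      t \<in> {0..m} \<Longrightarrow> \<bar>z t\<bar> \<le> 1/2 \<and> \<bar>z t - d * (1 - t / L.\<tau>)\<bar> \<le> \<epsilon> / 4 * \<bar>d\<bar> \<and>
        \<bar>rem2 q (z t) - (q - 1) * (q - 2) / 2 * (z t)\<^sup>2\<bar> \<le> \<epsilon> * (z t)\<^sup>2"
    using L.bifurcation_side[OF refl q less_imp_le[OF \<mu>1_pos], of "\<epsilon> / 4" \<epsilon>] \<epsilon> by auto
  obtain \<rho>R where \<rho>R: "0 < \<rho>R" and
    side_R: "\<And>\<mu> d z t. 0 \<le> \<mu> \<Longrightarrow> \<mu> \<le> \<mu>1 \<Longrightarrow> \<bar>b + a - \<mu> * (q - 2)\<bar> \<le> \<rho>R \<Longrightarrow> \<bar>d\<bar> \<le> \<rho>R \<Longrightarrow> R.ivp d (bsrc q \<mu> z) z \<Longrightarrow>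
      t \<in> {0..1 - m} \<Longrightarrow> \<bar>z t\<bar> \<le> 1/2 \<and> \<bar>z t - d * (1 - t / R.\<tau>)\<bar> \<le> \<epsilon> / 4 * \<bar>d\<bar> \<and>
        \<bar>rem2 q (z t) - (q - 1) * (q - 2) / 2 * (z t)\<^sup>2\<bar> \<le> \<epsilon> * (z t)\<^sup>2"
    using R.bifurcation_side[OF refl q less_imp_le[OF \<mu>1_pos], of "\<epsilon> / 4" \<epsilon>] \<epsilon> by auto
  \<comment> \<open>Halved because the initial values are only bounded by
    \<open>2 * \<delta>\<close>.\<close>
  define \<rho> where "\<rho> = min \<rho>L \<rho>R / 2"
  have \<rho>: "0 < \<rho>" "2 * \<rho> \<le> \<rho>L" "2 * \<rho> \<le> \<rho>R" using \<rho>L \<rho>R by (auto simp: \<rho>_def)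
  show ?thesis
  proof (rule that[OF \<rho>(1)])
    fix \<mu> \<delta> \<eta> z0 z1 e
    assume \<mu>: "0 \<le> \<mu>" "\<mu> \<le> \<mu>1" and e: "e = a + b - \<mu> * (q - 2)" "\<bar>e\<bar> \<le> \<rho>" and \<delta>: "0 < \<delta>" "\<delta> \<le> \<rho>"
      and \<eta>: "\<bar>\<eta>\<bar> \<le> \<kappa>"
      and z0: "L.ivp (- L.\<tau> * \<delta> * (1 + \<eta>)) (bsrc q \<mu> z0) z0" and z1: "R.ivp (R.\<tau> * \<delta>) (bsrc q \<mu> z1) z1"
    have d0: "\<bar>- L.\<tau> * \<delta> * (1 + \<eta>)\<bar> \<le> 2 * \<delta>"
    proof -
      have "\<bar>- L.\<tau> * \<delta> * (1 + \<eta>)\<bar> = L.\<tau> * \<delta> * \<bar>1 + \<eta>\<bar>" using L.ab_\<tau> \<delta> by (simp add: abs_mult)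
      also have "\<dots> \<le> 1 * \<delta> * 2" using L.ab_\<tau> \<delta> \<eta> \<kappa> by (intro mult_mono) auto
      finally show ?thesis by simp
    qed
    have d1: "\<bar>R.\<tau> * \<delta>\<bar> \<le> 2 * \<delta>"
    proof -
      have "\<bar>R.\<tau> * \<delta>\<bar> \<le> 1 * \<delta>" unfolding abs_mult using R.ab_\<tau> \<delta> by (intro mult_mono) auto
      then show ?thesis using \<delta> by simp
    qed
    have eL: "\<bar>a + b - \<mu> * (q - 2)\<bar> \<le> \<rho>L" "\<bar>b + a - \<mu> * (q - 2)\<bar> \<le> \<rho>R" using e \<rho> by (auto simp: add.commute)
    have dL: "\<bar>- L.\<tau> * \<delta> * (1 + \<eta>)\<bar> \<le> \<rho>L" "\<bar>R.\<tau> * \<delta>\<bar> \<le> \<rho>R" using d0 d1 \<rho> \<delta> by auto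
    note S0 = side_L[OF \<mu> eL(1) dL(1) z0] and S1 = side_R[OF \<mu> eL(2) dL(2) z1]
    have w0: "\<bar>z0 t - \<delta> * (1 + \<eta>) * (t - L.\<tau>)\<bar> \<le> \<epsilon> / 2 * \<delta>" if t: "t \<in> {0..m}" for t
    proof -
      have "- L.\<tau> * \<delta> * (1 + \<eta>) * (1 - t / L.\<tau>) = \<delta> * (1 + \<eta>) * (t - L.\<tau>)"
        using L.ab_\<tau> by (simp add: field_simps)
      note eq = this
      have "\<epsilon> / 4 * \<bar>- L.\<tau> * \<delta> * (1 + \<eta>)\<bar> \<le> \<epsilon> / 4 * (2 * \<delta>)" using \<epsilon> d0 by (intro mult_left_mono) auto
      from order_trans[OF S0[OF t, THEN conjunct2, THEN conjunct1] this]
      show ?thesis unfolding eq by (simp add: mult.commute)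
    qed
    have w1: "\<bar>z1 t - (- \<delta>) * (t - R.\<tau>)\<bar> \<le> \<epsilon> / 2 * \<delta>" if t: "t \<in> {0..1 - m}" for t
    proof -
      have "R.\<tau> * \<delta> * (1 - t / R.\<tau>) = (- \<delta>) * (t - R.\<tau>)"
        using R.ab_\<tau> by (simp add: field_simps)
      note eq = this
      have "\<epsilon> / 4 * \<bar>R.\<tau> * \<delta>\<bar> \<le> \<epsilon> / 4 * (2 * \<delta>)" using \<epsilon> d1 by (intro mult_left_mono) auto
      from order_trans[OF S1[OF t, THEN conjunct2, THEN conjunct1] this]
      show ?thesis unfolding eq by (simp add: mult.commute)
    qed
    have P3: "\<bar>(z0 m - z1 (1 - m)) - \<delta> * \<eta> * \<phi>\<bar> \<le> \<epsilon> * \<delta>"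
    proof -
      have "\<delta> * (1 + \<eta>) * (m - L.\<tau>) - (- \<delta>) * ((1 - m) - R.\<tau>) = \<delta> * \<eta> * \<phi>"
        unfolding R\<tau> \<phi>_def by (simp add: algebra_simps)
      then show ?thesis using w0[OF mem_m(1)] w1[OF mem_m(2)] by linarith
    qed
    \<comment> \<open>This combination of the two mismatches is what Green's identity delivers: the
      difference of the projected sources \<open>VL\<close> and \<open>VR\<close>, with no boundary
      values left.\<close>
    define \<Omega> where "\<Omega> = - (L.K (bsrc q \<mu> z0) m + R.K (bsrc q \<mu> z1) (1 - m)) * \<phi> - (z0 m - z1 (1 - m))"
    define VL where "VL = L.K (\<lambda>t. (t - L.\<tau>) * (e * z0 t - \<mu> * rem2 q (z0 t))) m"
    define VR where "VR = R.K (\<lambda>t. (t - R.\<tau>) * (e * z1 t - \<mu> * rem2 q (z1 t))) (1 - m)"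
    have "VL = L.K (\<lambda>t. (t - L.\<tau>) * ((a + b) * z0 t - bsrc q \<mu> z0 t)) m"
      unfolding VL_def
    proof (rule L.K_cong[OF mem_m(1)])
      fix r assume "0 \<le> r" "r \<le> m"
      then have "\<bar>z0 r\<bar> \<le> 1" using S0[of r] by auto
      then show "(r - L.\<tau>) * (e * z0 r - \<mu> * rem2 q (z0 r)) = (r - L.\<tau>) * ((a + b) * z0 r - bsrc q \<mu> z0 r)"
        by (simp add: bsrc_eq e(1) algebra_simps)
    qed
    then have VL: "VL = - L.K (bsrc q \<mu> z0) m * \<phi> - z0 m"
      using L.green_eigenfunction[OF refl z0] by (simp add: \<phi>_def)
    have "VR = R.K (\<lambda>t. (t - R.\<tau>) * ((b + a) * z1 t - bsrc q \<mu> z1 t)) (1 - m)"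
      unfolding VR_def
    proof (rule R.K_cong[OF mem_m(2)])
      fix r assume "0 \<le> r" "r \<le> 1 - m"
      then have "\<bar>z1 r\<bar> \<le> 1" using S1[of r] by auto
      then show "(r - R.\<tau>) * (e * z1 r - \<mu> * rem2 q (z1 r)) = (r - R.\<tau>) * ((b + a) * z1 r - bsrc q \<mu> z1 r)"
        by (simp add: bsrc_eq e(1) algebra_simps)
    qed
    also have "\<dots> = - R.K (bsrc q \<mu> z1) (1 - m) * ((1 - m) - R.\<tau>) - z1 (1 - m)"
      by (rule R.green_eigenfunction[OF refl z1])
    also have "(1 - m) - R.\<tau> = - \<phi>" by (simp add: R\<tau> \<phi>_def)
    finally have VR: "VR = R.K (bsrc q \<mu> z1) (1 - m) * \<phi> - z1 (1 - m)" by simp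
    have \<Omega>: "\<Omega> = VL - VR" unfolding \<Omega>_def VL VR by (simp add: algebra_simps)
    define B where "B = \<delta> * (\<bar>e\<bar> * (\<epsilon> + \<kappa>) + \<delta> * \<mu> * (4 * \<epsilon> + 3 * r2 * (\<epsilon> + \<kappa>)))"
    have 1: "\<bar>VL - (\<delta> * e * L.K (\<lambda>t. (t - L.\<tau>)^2) m - \<mu> * r2 * \<delta>\<^sup>2 * L.K (\<lambda>t. (t - L.\<tau>)^3) m)\<bar>
        \<le> L.C * (\<bar>\<delta>\<bar> * (\<bar>e\<bar> * (\<epsilon> + \<kappa>) + \<bar>\<delta>\<bar> * \<mu> * (4 * \<epsilon> + 3 * r2 * (\<epsilon> + \<kappa>))))"
      unfolding VL_def r2_def
    proof (rule L.weighted_expansion[OF refl q L.ivpD(1)[OF z0] \<mu>(1)])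
      fix t assume t: "t \<in> {0..m}"
      show "\<bar>z0 t\<bar> \<le> 1" using S0[OF t] by simp
      show "\<bar>rem2 q (z0 t) - (q - 1) * (q - 2) / 2 * (z0 t)\<^sup>2\<bar> \<le> \<epsilon> * (z0 t)\<^sup>2" using S0[OF t] by simp
      have tl: "\<bar>t - L.\<tau>\<bar> \<le> 1" using t L.ab_\<tau> m by (auto simp: abs_le_iff)
      have "\<bar>\<delta> * \<eta> * (t - L.\<tau>)\<bar> \<le> \<delta> * \<kappa> * 1"
        unfolding abs_mult using \<delta> \<eta> tl \<kappa> by (intro mult_mono) auto
      moreover have "\<delta> * (1 + \<eta>) * (t - L.\<tau>) = \<delta> * (t - L.\<tau>) + \<delta> * \<eta> * (t - L.\<tau>)" by (simp add: algebra_simps)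
      moreover have "(\<epsilon> + \<kappa>) * \<bar>\<delta>\<bar> = \<epsilon> * \<delta> + \<delta> * \<kappa>" "\<epsilon> / 2 * \<delta> \<le> \<epsilon> * \<delta>" using \<delta> \<epsilon> by (auto simp: algebra_simps)
      ultimately show "\<bar>z0 t - \<delta> * (t - L.\<tau>)\<bar> \<le> (\<epsilon> + \<kappa>) * \<bar>\<delta>\<bar>" using w0[OF t] by linarith
    qed (use \<epsilon> \<kappa> in auto)
    have 2: "\<bar>VR - (- \<delta> * e * R.K (\<lambda>t. (t - R.\<tau>)^2) (1 - m) - \<mu> * r2 * (- \<delta>)\<^sup>2 * R.K (\<lambda>t. (t - R.\<tau>)^3) (1 - m))\<bar>
        \<le> R.C * (\<bar>- \<delta>\<bar> * (\<bar>e\<bar> * (\<epsilon> + \<kappa>) + \<bar>- \<delta>\<bar> * \<mu> * (4 * \<epsilon> + 3 * r2 * (\<epsilon> + \<kappa>))))"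
      unfolding VR_def r2_def
    proof (rule R.weighted_expansion[OF refl q R.ivpD(1)[OF z1] \<mu>(1)])
      fix t assume t: "t \<in> {0..1 - m}"
      show "\<bar>z1 t\<bar> \<le> 1" using S1[OF t] by simp
      show "\<bar>rem2 q (z1 t) - (q - 1) * (q - 2) / 2 * (z1 t)\<^sup>2\<bar> \<le> \<epsilon> * (z1 t)\<^sup>2" using S1[OF t] by simp
      have "\<epsilon> / 2 * \<delta> \<le> (\<epsilon> + \<kappa>) * \<bar>- \<delta>\<bar>" using \<delta> \<epsilon> \<kappa> by (simp add: mult_right_mono)
      then show "\<bar>z1 t - - \<delta> * (t - R.\<tau>)\<bar> \<le> (\<epsilon> + \<kappa>) * \<bar>- \<delta>\<bar>" using w1[OF t] by linarith
    qed (use \<epsilon> \<kappa> in auto)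
    have "\<bar>\<Omega> - \<delta> * (e * k1 - \<delta> * \<mu> * r2 * k3)\<bar> \<le> L.C * B + R.C * B"
    proof -
      have "\<delta> * (e * k1 - \<delta> * \<mu> * r2 * k3) = (\<delta> * e * L.K (\<lambda>t. (t - L.\<tau>)^2) m - \<mu> * r2 * \<delta>\<^sup>2 * L.K (\<lambda>t. (t - L.\<tau>)^3) m)
          - (- \<delta> * e * R.K (\<lambda>t. (t - R.\<tau>)^2) (1 - m) - \<mu> * r2 * (- \<delta>)\<^sup>2 * R.K (\<lambda>t. (t - R.\<tau>)^3) (1 - m))"
        unfolding k1_def k3_def by (simp add: algebra_simps power2_eq_square)
      moreover have "\<bar>\<delta>\<bar> = \<delta>" "\<bar>- \<delta>\<bar> = \<delta>" using \<delta> by auto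
      ultimately show ?thesis using 1 2 unfolding \<Omega> B_def by (simp only:)
    qed
    also have "\<dots> = \<delta> * (L.C + R.C) * (\<bar>e\<bar> * (\<epsilon> + \<kappa>) + \<delta> * \<mu> * (4 * \<epsilon> + 3 * r2 * (\<epsilon> + \<kappa>)))"
      unfolding B_def by (simp add: algebra_simps)
    finally show "(\<forall>t\<in>{0..m}. \<bar>z0 t\<bar> \<le> 1/2) \<and> (\<forall>t\<in>{0..1 - m}. \<bar>z1 t\<bar> \<le> 1/2) \<and>
       \<bar>(z0 m - z1 (1 - m)) - \<delta> * \<eta> * \<phi>\<bar> \<le> \<epsilon> * \<delta> \<and>
       \<bar>(- (L.K (bsrc q \<mu> z0) m + R.K (bsrc q \<mu> z1) (1 - m)) * \<phi> - (z0 m - z1 (1 - m)))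
          - \<delta> * (e * k1 - \<delta> * \<mu> * r2 * k3)\<bar>
         \<le> \<delta> * (L.C + R.C) * (\<bar>e\<bar> * (\<epsilon> + \<kappa>) + \<delta> * \<mu> * (4 * \<epsilon> + 3 * r2 * (\<epsilon> + \<kappa>)))"
      using S0 S1 P3 unfolding \<Omega>_def by auto
  qed
qed

definition src :: "real \<Rightarrow> (real \<Rightarrow> real) \<Rightarrow> real \<Rightarrow> real" where
  "src \<mu> h r = h r powr (q - 1) - \<mu> * h r"

text \<open>\<open>h0\<close> is the solution on \<open>[0, m]\<close> and \<open>h1\<close> is the one on \<open>[m, 1]\<close>, reflected by \<open>t \<mapsto> 1 - t\<close>; the
  reflection turns equality of the derivatives at \<open>m\<close> into a vanishing sum.\<close>

definition sol :: "real \<Rightarrow> real \<Rightarrow> real \<Rightarrow> (real \<Rightarrow> real) \<Rightarrow> (real \<Rightarrow> real) \<Rightarrow> bool" where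
  "sol \<mu> \<alpha> \<beta> h0 h1 \<longleftrightarrow> L.ivp \<alpha> (src \<mu> h0) h0 \<and> R.ivp \<beta> (src \<mu> h1) h1 \<and>
     (\<forall>t\<in>{0..m}. 0 < h0 t) \<and> (\<forall>t\<in>{0..1 - m}. 0 < h1 t) \<and>
     h0 m = h1 (1 - m) \<and> L.K (src \<mu> h0) m + R.K (src \<mu> h1) (1 - m) = 0"

text \<open>The constant solution.\<close>

definition c :: "real \<Rightarrow> real" where "c \<mu> = \<mu> powr (1 / (q - 2))"

lemma c_pos: "0 < \<mu> \<Longrightarrow> 0 < c \<mu>"
  by (simp add: c_def)

lemma c_powr: assumes "0 < \<mu>" shows "c \<mu> powr (q - 2) = \<mu>" "c \<mu> powr (q - 1) = c \<mu> * \<mu>"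
proof -
  have "1 / (q - 2) * (q - 2) = 1" using q by simp
  then show *: "c \<mu> powr (q - 2) = \<mu>" unfolding c_def powr_powr using assms by simp
  have "c \<mu> powr (q - 1) = c \<mu> powr (1 + (q - 2))" by simp
  also have "\<dots> = c \<mu> * c \<mu> powr (q - 2)" unfolding powr_add using c_pos[OF assms] by simp
  finally show "c \<mu> powr (q - 1) = c \<mu> * \<mu>" by (simp add: *)
qed

lemma rescale_bsrc:
  assumes \<mu>: "0 < \<mu>" and z: "\<bar>z r\<bar> \<le> 1/2"
  shows "c \<mu> * bsrc q \<mu> z r = src \<mu> (\<lambda>r. c \<mu> * (1 + z r)) r"
proof -
  have "0 < 1 + z r" "1 + z r \<le> 2" using z by (auto simp: abs_le_iff)
  then show ?thesis
    by (simp only: bsrc_def src_def cpow_eq powr_mult c_powr(2)[OF \<mu>] less_imp_le) (simp add: algebra_simps)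
qed

text \<open>The unknowns are the amplitude \<open>\<delta>\<close> and the ratio parameter
  \<open>\<eta>\<close>. To leading order \<open>G\<close> is
  \<open>\<delta> * \<eta> * \<phi>\<close> and \<open>- F\<close> is
  \<open>\<delta> * (e * k1 - \<delta> * \<mu> * r2 * k3)\<close>. For \<open>e > 0\<close>, that is
  \<open>\<mu> < \<mu>1\<close>, the latter changes sign at a positive amplitude since
  \<open>k3 > 0\<close>.\<close>

lemma bifurcation:
  "\<exists>\<mu> \<alpha> \<beta> h0 h1. 0 < \<mu> \<and> \<mu> < \<mu>1 \<and> sol \<mu> \<alpha> \<beta> h0 h1 \<and> \<alpha> \<noteq> c \<mu>"
proof -
  define r2 where "r2 = (q - 1) * (q - 2) / 2"
  have r2: "0 < r2" using q by (simp add: r2_def)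
  define CC where "CC = L.C + R.C"
  have CC: "0 < CC" using L.C_pos R.C_pos by (simp add: CC_def)
  have \<phi>1: "\<phi> \<le> 1" using m L.ab_\<tau> by (simp add: \<phi>_def)
  \<comment> \<open>Makes the errors in \<open>E1\<close> and \<open>E2\<close> at most half of the
    coefficients \<open>k1\<close> and \<open>r2 * k3\<close> of the leading terms.\<close>
  define \<kappa> where "\<kappa> = min (1/2) (min (k1 / (4 * CC)) (r2 * k3 / (2 * CC * (4 + 6 * r2))))"
  have "0 < \<kappa>" unfolding \<kappa>_def using CC r2 k1_pos k3_pos by simp
  moreover have "\<kappa> \<le> 1/2" "\<kappa> \<le> k1 / (4 * CC)" "\<kappa> \<le> r2 * k3 / (2 * CC * (4 + 6 * r2))"
    unfolding \<kappa>_def by linarith+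
  ultimately have \<kappa>: "0 < \<kappa>" "\<kappa> \<le> 1/2" "\<kappa> \<le> k1 / (4 * CC)" "\<kappa> \<le> r2 * k3 / (2 * CC * (4 + 6 * r2))" .
  \<comment> \<open>At \<open>\<eta> = \<kappa>\<close> and \<open>\<eta> = - \<kappa>\<close> the
    leading term of \<open>G\<close> has size \<open>\<delta> * \<kappa> * \<phi>\<close>, which is
    exactly the permitted error.\<close>
  define \<epsilon> where "\<epsilon> = \<kappa> * \<phi>"
  have \<epsilon>\<kappa>: "\<epsilon> \<le> \<kappa>" using \<kappa> \<phi>1 by (simp add: \<epsilon>_def mult_left_le)
  have \<epsilon>: "0 < \<epsilon>" "\<epsilon> \<le> 1/2" using \<kappa> \<phi>_pos \<epsilon>\<kappa> by (simp add: \<epsilon>_def, linarith)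
  have E1: "CC * (\<epsilon> + \<kappa>) \<le> k1 / 2"
  proof -
    have "CC * (\<epsilon> + \<kappa>) \<le> CC * (2 * \<kappa>)" using \<epsilon>\<kappa> CC by (intro mult_left_mono) auto
    also have "\<dots> \<le> CC * (2 * (k1 / (4 * CC)))" using \<kappa> CC by (intro mult_left_mono) auto
    finally show ?thesis using CC by simp
  qed
  have E2: "CC * (4 * \<epsilon> + 3 * r2 * (\<epsilon> + \<kappa>)) \<le> r2 * k3 / 2"
  proof -
    have "4 * \<epsilon> + 3 * r2 * (\<epsilon> + \<kappa>) \<le> 4 * \<kappa> + 3 * r2 * (2 * \<kappa>)"
      using \<epsilon>\<kappa> r2 by (intro add_mono mult_left_mono) auto
    also have "\<dots> = (4 + 6 * r2) * \<kappa>" by (simp add: algebra_simps)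
    finally have "CC * (4 * \<epsilon> + 3 * r2 * (\<epsilon> + \<kappa>)) \<le> CC * ((4 + 6 * r2) * \<kappa>)" using CC by (intro mult_left_mono) auto
    also have "\<dots> \<le> CC * ((4 + 6 * r2) * (r2 * k3 / (2 * CC * (4 + 6 * r2))))"
      using \<kappa> CC r2 by (intro mult_left_mono) auto
    also have "\<dots> = r2 * k3 / 2" using CC r2 by (simp add: divide_simps)
    finally show ?thesis .
  qed
  obtain \<rho> where \<rho>: "0 < \<rho>" and expn:
    "\<And>\<mu> \<delta> \<eta> z0 z1 e. 0 \<le> \<mu> \<Longrightarrow> \<mu> \<le> \<mu>1 \<Longrightarrow> e = a + b - \<mu> * (q - 2) \<Longrightarrow> \<bar>e\<bar> \<le> \<rho> \<Longrightarrow> 0 < \<delta> \<Longrightarrow> \<delta> \<le> \<rho> \<Longrightarrow> \<bar>\<eta>\<bar> \<le> \<kappa> \<Longrightarrow>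
       L.ivp (- L.\<tau> * \<delta> * (1 + \<eta>)) (bsrc q \<mu> z0) z0 \<Longrightarrow> R.ivp (R.\<tau> * \<delta>) (bsrc q \<mu> z1) z1 \<Longrightarrow>
       (\<forall>t\<in>{0..m}. \<bar>z0 t\<bar> \<le> 1/2) \<and> (\<forall>t\<in>{0..1 - m}. \<bar>z1 t\<bar> \<le> 1/2) \<and>
       \<bar>(z0 m - z1 (1 - m)) - \<delta> * \<eta> * \<phi>\<bar> \<le> \<epsilon> * \<delta> \<and>
       \<bar>(- (L.K (bsrc q \<mu> z0) m + R.K (bsrc q \<mu> z1) (1 - m)) * \<phi> - (z0 m - z1 (1 - m)))
          - \<delta> * (e * k1 - \<delta> * \<mu> * r2 * k3)\<bar>
         \<le> \<delta> * CC * (\<bar>e\<bar> * (\<epsilon> + \<kappa>) + \<delta> * \<mu> * (4 * \<epsilon> + 3 * r2 * (\<epsilon> + \<kappa>)))"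
    using bifurcation_expansion[OF \<kappa>(1,2) \<epsilon>] unfolding r2_def CC_def by blast
  \<comment> \<open>With errors of one half, the sign of \<open>F\<close> is settled once one of
    \<open>e * k1\<close> and \<open>\<delta> * \<mu> * r2 * k3\<close> is three times the other.
    The last entry ensures this at \<open>\<delta> = \<rho>\<close>, given
    \<open>\<mu> \<ge> \<mu>1 / 2\<close>; the definition of \<open>\<delta>s\<close> ensures the
    opposite case at the small end.\<close>
  define e where "e = min \<rho> (min ((a + b) / 2) (\<rho> * \<mu>1 * r2 * k3 / (6 * k1)))"
  have "0 < e" unfolding e_def using \<rho> a b \<mu>1_pos r2 k1_pos k3_pos by simp
  moreover have "e \<le> \<rho>" "e \<le> (a + b) / 2" "e \<le> \<rho> * \<mu>1 * r2 * k3 / (6 * k1)"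
    unfolding e_def by linarith+
  ultimately have e: "0 < e" "e \<le> \<rho>" "e \<le> (a + b) / 2" "e \<le> \<rho> * \<mu>1 * r2 * k3 / (6 * k1)" .
  define \<mu> where "\<mu> = (a + b - e) / (q - 2)"
  have \<mu>e: "e = a + b - \<mu> * (q - 2)" using q by (simp add: \<mu>_def)
  have "\<mu>1 / 2 = ((a + b) / 2) / (q - 2)" by (simp add: \<mu>1_def)
  also have "\<dots> \<le> \<mu>" unfolding \<mu>_def using e q by (intro divide_right_mono) auto
  finally have "\<mu>1 / 2 \<le> \<mu>" .
  moreover have "\<mu> < \<mu>1" unfolding \<mu>_def \<mu>1_def using e q by (intro divide_strict_right_mono) auto
  ultimately have \<mu>: "\<mu> < \<mu>1" "\<mu>1 / 2 \<le> \<mu>" by auto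
  have \<mu>0: "0 < \<mu>" using \<mu>1_pos \<mu> by simp
  define \<delta>s where "\<delta>s = min \<rho> (e * k1 / (3 * \<mu>1 * r2 * k3))"
  have \<delta>s: "0 < \<delta>s" "\<delta>s \<le> \<rho>" "\<delta>s \<le> e * k1 / (3 * \<mu>1 * r2 * k3)"
    unfolding \<delta>s_def using \<rho> e \<mu>1_pos r2 k1_pos k3_pos by auto
  have "\<forall>d. \<exists>z. L.ivp d (bsrc q \<mu> z) z" using L.bsrc_ivp_exists[OF q, of \<mu>] \<mu>0 by simp
  then obtain Z0 where Z0: "\<And>d. L.ivp d (bsrc q \<mu> (Z0 d)) (Z0 d)" by metis
  have "\<forall>d. \<exists>z. R.ivp d (bsrc q \<mu> z) z" using R.bsrc_ivp_exists[OF q, of \<mu>] \<mu>0 by simp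
  then obtain Z1 where Z1: "\<And>d. R.ivp d (bsrc q \<mu> (Z1 d)) (Z1 d)" by metis
  define k where "k = \<mu> * ((q - 1) * 2 powr (q - 2) + 1)"
  have k: "0 \<le> k" using \<mu>0 q by (simp add: k_def)
  have lip: "\<bar>bsrc q \<mu> z t - bsrc q \<mu> w t\<bar> \<le> k * \<bar>z t - w t\<bar>" for z w t
    unfolding k_def using \<mu>0 by (intro bsrc_lipschitz[OF q]) simp
  note c0 = L.ivp_family_continuous[OF Z0 k lip mem_m(1)] and c1 = R.ivp_family_continuous[OF Z1 k lip mem_m(2)]
  define d0 where "d0 p = - L.\<tau> * fst p * (1 + snd p)" for p :: "real \<times> real"
  define d1 where "d1 p = R.\<tau> * fst p" for p :: "real \<times> real"
  define G where "G p = Z0 (d0 p) m - Z1 (d1 p) (1 - m)" for p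
  define F where "F p = (L.K (bsrc q \<mu> (Z0 (d0 p))) m + R.K (bsrc q \<mu> (Z1 (d1 p))) (1 - m)) * \<phi> + G p" for p
  have dc: "continuous_on UNIV d0" "continuous_on UNIV d1" unfolding d0_def d1_def by (intro continuous_intros)+
  have Gc: "continuous_on UNIV G" unfolding G_def
    by (intro continuous_on_diff continuous_on_compose2[OF c0(1) dc(1)] continuous_on_compose2[OF c1(1) dc(2)]) auto
  have Fc: "continuous_on UNIV F" unfolding F_def
    by (intro continuous_on_add continuous_on_mult continuous_on_const Gc continuous_on_compose2[OF c0(2) dc(1)] continuous_on_compose2[OF c1(2) dc(2)]) auto
  have X: "(\<forall>t\<in>{0..m}. \<bar>Z0 (d0 (\<delta>, \<eta>)) t\<bar> \<le> 1/2) \<and> (\<forall>t\<in>{0..1 - m}. \<bar>Z1 (d1 (\<delta>, \<eta>)) t\<bar> \<le> 1/2) \<and>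
       \<bar>G (\<delta>, \<eta>) - \<delta> * \<eta> * \<phi>\<bar> \<le> \<epsilon> * \<delta> \<and>
       \<bar>- F (\<delta>, \<eta>) - \<delta> * (e * k1 - \<delta> * \<mu> * r2 * k3)\<bar> \<le> \<delta> * (e * k1 / 2 + \<delta> * \<mu> * (r2 * k3 / 2))"
    if \<delta>: "\<delta> \<in> {\<delta>s..\<rho>}" and \<eta>: "\<eta> \<in> {-\<kappa>..\<kappa>}" for \<delta> \<eta>
  proof -
    have \<delta>0: "0 < \<delta>" "\<delta> \<le> \<rho>" using \<delta> \<delta>s by auto
    have ee: "\<bar>e\<bar> \<le> \<rho>" using e by simp
    have \<eta>': "\<bar>\<eta>\<bar> \<le> \<kappa>" using \<eta> by auto
    note Y = expn[OF less_imp_le[OF \<mu>0] less_imp_le[OF \<mu>(1)] \<mu>e ee \<delta>0 \<eta>' Z0 Z1]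
    have "\<delta> * CC * (\<bar>e\<bar> * (\<epsilon> + \<kappa>) + \<delta> * \<mu> * (4 * \<epsilon> + 3 * r2 * (\<epsilon> + \<kappa>)))
        = \<delta> * (e * (CC * (\<epsilon> + \<kappa>)) + \<delta> * \<mu> * (CC * (4 * \<epsilon> + 3 * r2 * (\<epsilon> + \<kappa>))))"
      using e by (simp add: algebra_simps)
    also have "\<dots> \<le> \<delta> * (e * (k1 / 2) + \<delta> * \<mu> * (r2 * k3 / 2))"
      using E1 E2 \<delta>0 e \<mu>0 by (intro mult_left_mono add_mono) auto
    finally have Z: "\<delta> * CC * (\<bar>e\<bar> * (\<epsilon> + \<kappa>) + \<delta> * \<mu> * (4 * \<epsilon> + 3 * r2 * (\<epsilon> + \<kappa>))) \<le> \<delta> * (e * k1 / 2 + \<delta> * \<mu> * (r2 * k3 / 2))"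
      by simp
    have FY: "- F (\<delta>, \<eta>) = - (L.K (bsrc q \<mu> (Z0 (- L.\<tau> * \<delta> * (1 + \<eta>)))) m + R.K (bsrc q \<mu> (Z1 (R.\<tau> * \<delta>))) (1 - m)) * \<phi>
        - (Z0 (- L.\<tau> * \<delta> * (1 + \<eta>)) m - Z1 (R.\<tau> * \<delta>) (1 - m))"
      by (simp add: F_def G_def d0_def d1_def algebra_simps)
    show ?thesis
      unfolding FY using Y order_trans[OF Y[THEN conjunct2, THEN conjunct2, THEN conjunct2] Z]
      by (simp only: d0_def d1_def G_def fst_conv snd_conv) simp
  qed
  have box: "\<delta>s \<le> \<rho>" "- \<kappa> \<le> \<kappa>" using \<delta>s \<kappa> by auto
  obtain \<delta> \<eta> where de: "\<delta> \<in> {\<delta>s..\<rho>}" "\<eta> \<in> {-\<kappa>..\<kappa>}" "F (\<delta>, \<eta>) = 0" "G (\<delta>, \<eta>) = 0"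
  proof (rule poincare_miranda[OF box continuous_on_subset[OF Fc] continuous_on_subset[OF Gc]])
    fix y assume y: "y \<in> {-\<kappa>..\<kappa>}"
    show "F (\<delta>s, y) \<le> 0"
    proof -
      have "\<delta>s * (3 * \<mu>1 * r2 * k3) \<le> e * k1" using \<delta>s(3) \<mu>1_pos r2 k3_pos by (simp add: pos_le_divide_eq)
      moreover have "\<delta>s * (3 * \<mu> * r2 * k3) \<le> \<delta>s * (3 * \<mu>1 * r2 * k3)"
        using \<delta>s \<mu> r2 k3_pos by (intro mult_left_mono mult_right_mono) auto
      ultimately have "0 \<le> e * k1 - 3 * (\<delta>s * \<mu> * r2 * k3)" by (simp add: algebra_simps)
      then have "0 \<le> \<delta>s * ((e * k1 - 3 * (\<delta>s * \<mu> * r2 * k3)) / 2)" using \<delta>s by simp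
      also have "\<dots> = \<delta>s * (e * k1 - \<delta>s * \<mu> * r2 * k3) - \<delta>s * (e * k1 / 2 + \<delta>s * \<mu> * (r2 * k3 / 2))"
        by (simp add: field_simps)
      finally have le: "0 \<le> \<delta>s * (e * k1 - \<delta>s * \<mu> * r2 * k3) - \<delta>s * (e * k1 / 2 + \<delta>s * \<mu> * (r2 * k3 / 2))" .
      have "\<delta>s \<in> {\<delta>s..\<rho>}" using \<delta>s by simp
      from X[OF this y, THEN conjunct2, THEN conjunct2, THEN conjunct2] le show ?thesis by linarith
    qed
    show "0 \<le> F (\<rho>, y)"
    proof -
      have "e * (6 * k1) \<le> \<rho> * \<mu>1 * r2 * k3" using e(4) k1_pos by (simp add: pos_le_divide_eq)
      moreover have "\<rho> * (\<mu>1 / 2) * r2 * k3 \<le> \<rho> * \<mu> * r2 * k3"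
        using \<rho> \<mu> r2 k3_pos by (intro mult_right_mono mult_left_mono) auto
      ultimately have "0 \<le> \<rho> * \<mu> * r2 * k3 - 3 * (e * k1)" by (simp add: algebra_simps)
      then have "0 \<le> \<rho> * ((\<rho> * \<mu> * r2 * k3 - 3 * (e * k1)) / 2)" using \<rho> by simp
      also have "\<dots> = - (\<rho> * (e * k1 - \<rho> * \<mu> * r2 * k3)) - \<rho> * (e * k1 / 2 + \<rho> * \<mu> * (r2 * k3 / 2))"
        by (simp add: field_simps)
      finally have le: "0 \<le> - (\<rho> * (e * k1 - \<rho> * \<mu> * r2 * k3)) - \<rho> * (e * k1 / 2 + \<rho> * \<mu> * (r2 * k3 / 2))" .
      have "\<rho> \<in> {\<delta>s..\<rho>}" using \<delta>s by simp
      from X[OF this y, THEN conjunct2, THEN conjunct2, THEN conjunct2] le show ?thesis by linarith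
    qed
  next
    fix x assume x: "x \<in> {\<delta>s..\<rho>}"
    show "G (x, - \<kappa>) \<le> 0" using X[OF x, of "- \<kappa>"] \<kappa> by (simp add: \<epsilon>_def abs_le_iff algebra_simps)
    show "0 \<le> G (x, \<kappa>)" using X[OF x, of \<kappa>] \<kappa> by (simp add: \<epsilon>_def abs_le_iff algebra_simps)
  qed (use that in auto)
  define z0 z1 where "z0 = Z0 (d0 (\<delta>, \<eta>))" and "z1 = Z1 (d1 (\<delta>, \<eta>))"
  have z0b: "\<And>t. t \<in> {0..m} \<Longrightarrow> \<bar>z0 t\<bar> \<le> 1/2" and z1b: "\<And>t. t \<in> {0..1 - m} \<Longrightarrow> \<bar>z1 t\<bar> \<le> 1/2"
    using X[OF de(1,2)] by (auto simp: z0_def z1_def)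
  have Gz: "z0 m = z1 (1 - m)" using de(4) by (simp add: G_def z0_def z1_def)
  have Fz: "L.K (bsrc q \<mu> z0) m + R.K (bsrc q \<mu> z1) (1 - m) = 0"
    using de(3,4) \<phi>_pos by (simp add: F_def z0_def z1_def)
  define h0 h1 where "h0 = (\<lambda>r. c \<mu> * (1 + z0 r))" and "h1 = (\<lambda>r. c \<mu> * (1 + z1 r))"
  have rs0: "c \<mu> * bsrc q \<mu> z0 r = src \<mu> h0 r" if "r \<in> {0..m}" for r
    unfolding h0_def by (rule rescale_bsrc[of \<mu> z0 r, OF \<mu>0 z0b[OF that]])
  have rs1: "c \<mu> * bsrc q \<mu> z1 r = src \<mu> h1 r" if "r \<in> {0..1 - m}" for r
    unfolding h1_def by (rule rescale_bsrc[of \<mu> z1 r, OF \<mu>0 z1b[OF that]])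
  have "L.ivp (c \<mu> * (1 + d0 (\<delta>, \<eta>))) (\<lambda>r. c \<mu> * (0 + bsrc q \<mu> z0 r)) h0"
    unfolding h0_def by (intro L.ivp_cmult L.ivp_add L.ivp_const) (simp add: z0_def Z0)
  then have i0: "L.ivp (c \<mu> * (1 + d0 (\<delta>, \<eta>))) (src \<mu> h0) h0"
    by (rule L.ivp_cong_source) (simp add: rs0)
  have "R.ivp (c \<mu> * (1 + d1 (\<delta>, \<eta>))) (\<lambda>r. c \<mu> * (0 + bsrc q \<mu> z1 r)) h1"
    unfolding h1_def by (intro R.ivp_cmult R.ivp_add R.ivp_const) (simp add: z1_def Z1)
  then have i1: "R.ivp (c \<mu> * (1 + d1 (\<delta>, \<eta>))) (src \<mu> h1) h1"
    by (rule R.ivp_cong_source) (simp add: rs1)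
  have K0: "L.K (src \<mu> h0) m = c \<mu> * L.K (bsrc q \<mu> z0) m"
    unfolding L.K_cmult[symmetric] by (rule L.K_cong) (use mem_m in \<open>auto simp: rs0\<close>)
  have K1: "R.K (src \<mu> h1) (1 - m) = c \<mu> * R.K (bsrc q \<mu> z1) (1 - m)"
    unfolding R.K_cmult[symmetric] by (rule R.K_cong) (use mem_m in \<open>auto simp: rs1\<close>)
  have "sol \<mu> (c \<mu> * (1 + d0 (\<delta>, \<eta>))) (c \<mu> * (1 + d1 (\<delta>, \<eta>))) h0 h1"
    unfolding sol_def
  proof (intro conjI ballI i0 i1)
    show "0 < h0 t" if "t \<in> {0..m}" for t
      unfolding h0_def using c_pos[OF \<mu>0] z0b[OF that] by (intro mult_pos_pos) (auto simp: abs_le_iff)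
    show "0 < h1 t" if "t \<in> {0..1 - m}" for t
      unfolding h1_def using c_pos[OF \<mu>0] z1b[OF that] by (intro mult_pos_pos) (auto simp: abs_le_iff)
    show "h0 m = h1 (1 - m)" by (simp add: h0_def h1_def Gz)
    show "L.K (src \<mu> h0) m + R.K (src \<mu> h1) (1 - m) = 0"
      unfolding K0 K1 using Fz by (simp flip: distrib_left)
  qed
  \<comment> \<open>The lower edge \<open>\<delta>s > 0\<close> of the box excludes the trivial
    zero; with \<open>\<bar>\<eta>\<bar> \<le> 1/2\<close> the shooting value differs from the
    constant.\<close>
  moreover have "c \<mu> * (1 + d0 (\<delta>, \<eta>)) \<noteq> c \<mu>"
    using c_pos[OF \<mu>0] L.ab_\<tau> de \<delta>s \<kappa> by (auto simp: d0_def)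
  ultimately show ?thesis using \<mu>0 \<mu>(1) by blast
qed

end

section \<open>Compactness and persistence\<close>

definition tsrc :: "real \<Rightarrow> real \<Rightarrow> real \<Rightarrow> (real \<Rightarrow> real) \<Rightarrow> real \<Rightarrow> real" where
  "tsrc q M \<mu> h r = cpow q M (h r) - \<mu> * h r"

lemma tsrc_diff:
  assumes q: "2 < q" and M: "0 \<le> M" and \<mu>: "0 \<le> \<mu>" "\<mu> \<le> \<mu>1"
  shows "\<bar>tsrc q M \<mu> h r - tsrc q M \<mu>' g r\<bar> \<le> ((q - 1) * M powr (q - 2) + \<mu>1) * \<bar>h r - g r\<bar> + \<bar>\<mu> - \<mu>'\<bar> * \<bar>g r\<bar>"
proof -
  have "tsrc q M \<mu> h r - tsrc q M \<mu>' g r = (cpow q M (h r) - cpow q M (g r)) - \<mu> * (h r - g r) - (\<mu> - \<mu>') * g r"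
    by (simp add: tsrc_def algebra_simps)
  then have "\<bar>tsrc q M \<mu> h r - tsrc q M \<mu>' g r\<bar> \<le> \<bar>cpow q M (h r) - cpow q M (g r)\<bar> + \<mu> * \<bar>h r - g r\<bar> + \<bar>\<mu> - \<mu>'\<bar> * \<bar>g r\<bar>"
    using \<mu> abs_triangle_ineq4[of "(cpow q M (h r) - cpow q M (g r)) - \<mu> * (h r - g r)" "(\<mu> - \<mu>') * g r"]
      abs_triangle_ineq4[of "cpow q M (h r) - cpow q M (g r)" "\<mu> * (h r - g r)"]
    by (simp add: abs_mult)
  moreover have "\<bar>cpow q M (h r) - cpow q M (g r)\<bar> \<le> (q - 1) * M powr (q - 2) * \<bar>h r - g r\<bar>"
    by (rule cpow_lipschitz[OF q M])
  moreover have "\<mu> * \<bar>h r - g r\<bar> \<le> \<mu>1 * \<bar>h r - g r\<bar>" using \<mu> by (intro mult_right_mono) auto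
  ultimately show ?thesis unfolding distrib_right by linarith
qed

text \<open>Near \<open>[l, u]\<close>, which lies inside \<open>(0, M)\<close>, the truncation is
  not felt, and the derivative of the power is uniformly continuous. So one \<open>\<delta>\<close>
  serves for all values of a solution.\<close>

lemma cpow_uniformly_differentiable:
  fixes q M \<eta> :: real
  assumes q: "2 < q" and lu: "0 < l" "u < M" "l \<le> u" and \<eta>: "0 < \<eta>"
  obtains \<delta> where "0 < \<delta>" "\<And>x y. y \<in> {l..u} \<Longrightarrow> \<bar>x - y\<bar> < \<delta> \<Longrightarrow>
    \<bar>cpow q M x - cpow q M y - (q - 1) * y powr (q - 2) * (x - y)\<bar> \<le> \<eta> * \<bar>x - y\<bar>"
proof -
  define S where "S = {l / 2..M}"
  define d where "d x = (q - 1) * x powr (q - 2)" for x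
  have "continuous_on S d" unfolding d_def S_def using lu by (intro continuous_intros) auto
  then have "uniformly_continuous_on S d" unfolding S_def by (rule compact_uniformly_continuous) simp
  then obtain \<delta>1 where \<delta>1: "0 < \<delta>1" "\<And>x y. x \<in> S \<Longrightarrow> y \<in> S \<Longrightarrow> \<bar>x - y\<bar> < \<delta>1 \<Longrightarrow> \<bar>d x - d y\<bar> < \<eta>"
    unfolding uniformly_continuous_on_def dist_real_def using \<eta> by metis
  define \<delta> where "\<delta> = min \<delta>1 (min (l / 2) (M - u))"
  show ?thesis
  proof (rule that[of \<delta>])
    show "0 < \<delta>" using \<delta>1 lu by (simp add: \<delta>_def)
    fix x y assume y: "y \<in> {l..u}" and xy: "\<bar>x - y\<bar> < \<delta>"
    define T where "T = {min x y..max x y}"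
    have TS: "z \<in> S" "\<bar>z - y\<bar> < \<delta>1" if "z \<in> T" for z
    proof -
      have *: "\<bar>z - y\<bar> \<le> \<bar>x - y\<bar>" using that by (auto simp: T_def min_def max_def split: if_splits)
      have **: "\<bar>x - y\<bar> < \<delta>1" "\<bar>x - y\<bar> < l / 2" "\<bar>x - y\<bar> < M - u" using xy by (auto simp: \<delta>_def)
      show "\<bar>z - y\<bar> < \<delta>1" using * ** by linarith
      have "l / 2 \<le> z" "z \<le> M" using * ** y unfolding atLeastAtMost_iff by linarith+
      then show "z \<in> S" by (simp add: S_def)
    qed
    have yS: "y \<in> S" using y lu by (auto simp: S_def)
    have "norm ((x powr (q - 1) - d y * x) - (y powr (q - 1) - d y * y)) \<le> \<eta> * norm (x - y)"
    proof (rule field_differentiable_bound[where S=T and f'="\<lambda>z. d z - d y"])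
      show "convex T" by (simp add: T_def)
      show "x \<in> T" "y \<in> T" by (auto simp: T_def)
      fix z assume z: "z \<in> T"
      have "0 < z" using TS(1)[OF z] lu by (auto simp: S_def)
      then show "((\<lambda>z. z powr (q - 1) - d y * z) has_field_derivative d z - d y) (at z within T)"
        unfolding d_def by (auto intro!: derivative_eq_intros)
      show "norm (d z - d y) \<le> \<eta>" using \<delta>1(2)[OF TS(1)[OF z] yS TS(2)[OF z]] by simp
    qed
    moreover have "cpow q M x = x powr (q - 1)" "cpow q M y = y powr (q - 1)"
      using TS(1)[of x] yS lu by (auto simp: T_def S_def intro!: cpow_eq)
    ultimately show "\<bar>cpow q M x - cpow q M y - (q - 1) * y powr (q - 2) * (x - y)\<bar> \<le> \<eta> * \<bar>x - y\<bar>"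
      by (simp add: d_def algebra_simps)
  qed
qed

context radial
begin

lemma tsrc_ivp_exists:
  assumes "2 < q" "0 \<le> M" "0 \<le> \<mu>"
  shows "\<exists>h. ivp A (tsrc q M \<mu> h) h"
proof -
  have "\<exists>h. ivp A (\<lambda>r. (\<lambda>_ x. cpow q M x - \<mu> * x) r (h r)) h"
  proof (rule ivp_exists[where k="(q - 1) * M powr (q - 2) + \<mu>"])
    show "continuous_on ({0..m} \<times> UNIV) (\<lambda>x. cpow q M (snd x) - \<mu> * snd x)"
      using assms by (intro continuous_intros) auto
    show "\<bar>(cpow q M x - \<mu> * x) - (cpow q M y - \<mu> * y)\<bar> \<le> ((q - 1) * M powr (q - 2) + \<mu>) * \<bar>x - y\<bar>" for t x y
      using tsrc_diff[OF assms(1,2,3) order_refl, of "\<lambda>_. x" 0 \<mu> "\<lambda>_. y"] by (simp add: tsrc_def)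
  qed (use assms in auto)
  then show ?thesis by (simp add: tsrc_def[abs_def])
qed

definition dep_const :: "real \<Rightarrow> real" where
  "dep_const k = (1 + C * (k + 1)) * (2 * exp (2 * C * (k + 1) * m))"

lemma tsrc_dependence:
  fixes q M \<mu>1 :: real
  defines "k \<equiv> (q - 1) * M powr (q - 2) + \<mu>1"
  assumes q: "2 < q" and M: "0 \<le> M" and \<mu>: "0 \<le> \<mu>" "\<mu> \<le> \<mu>1"
    and h: "ivp A (tsrc q M \<mu> h) h" and g: "ivp B (tsrc q M \<mu>' g) g"
    and G: "\<And>t. t \<in> {0..m} \<Longrightarrow> \<bar>g t\<bar> \<le> G" and t: "t \<in> {0..m}"
  shows "\<bar>h t - g t\<bar> \<le> dep_const k * (\<bar>A - B\<bar> + \<bar>\<mu> - \<mu>'\<bar> * G)"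
    and "\<bar>K (tsrc q M \<mu> h) t - K (tsrc q M \<mu>' g) t\<bar> \<le> dep_const k * (\<bar>A - B\<bar> + \<bar>\<mu> - \<mu>'\<bar> * G)"
proof -
  have k: "0 \<le> k" using q \<mu> by (simp add: k_def)
  define E where "E = 2 * exp (2 * C * (k + 1) * m)"
  have "1 \<le> exp (2 * C * (k + 1) * m)" using C_pos k m by simp
  then have E1: "1 \<le> E" unfolding E_def by linarith
  define F where "F = \<bar>\<mu> - \<mu>'\<bar> * G"
  have G0: "0 \<le> G" using G[of 0] m by auto
  then have F0: "0 \<le> F" by (simp add: F_def)
  have le: "\<bar>tsrc q M \<mu> h r - tsrc q M \<mu>' g r\<bar> \<le> k * \<bar>h r - g r\<bar> + F" if r: "r \<in> {0..m}" for r
    using tsrc_diff[OF q M \<mu>, of h r \<mu>' g] mult_left_mono[OF G[OF r], of "\<bar>\<mu> - \<mu>'\<bar>"] unfolding k_def F_def by linarith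
  have s: "0 \<le> \<bar>A - B\<bar> + F" using F0 by simp
  have "\<bar>h t - g t\<bar> \<le> 2 * (\<bar>A - B\<bar> + F) * exp (2 * C * (k + 1) * m)"
    by (rule ivp_dependence(1)[OF h g le k F0 t])
  then have "\<bar>h t - g t\<bar> \<le> 1 * E * (\<bar>A - B\<bar> + F)" by (simp only: E_def mult_1_left mult_ac)
  also have "\<dots> \<le> dep_const k * (\<bar>A - B\<bar> + F)"
    unfolding dep_const_def E_def[symmetric] using C_pos k E1 s by (intro mult_right_mono) auto
  finally show "\<bar>h t - g t\<bar> \<le> dep_const k * (\<bar>A - B\<bar> + \<bar>\<mu> - \<mu>'\<bar> * G)" by (simp add: F_def)
  have "\<bar>K (tsrc q M \<mu> h) t - K (tsrc q M \<mu>' g) t\<bar> \<le> C * (k * (2 * (\<bar>A - B\<bar> + F) * exp (2 * C * (k + 1) * m)) + F)"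
    by (rule ivp_dependence(2)[OF h g le k F0 t])
  also have "\<dots> = C * (k * (E * (\<bar>A - B\<bar> + F)) + F)" by (simp only: E_def mult_ac)
  also have "\<dots> \<le> C * (k * (E * (\<bar>A - B\<bar> + F)) + E * (\<bar>A - B\<bar> + F))"
  proof -
    have "1 * F \<le> E * (\<bar>A - B\<bar> + F)" using E1 F0 by (intro mult_mono) auto
    then show ?thesis using C_pos by simp
  qed
  also have "\<dots> = C * (k + 1) * E * (\<bar>A - B\<bar> + F)" by (simp add: algebra_simps)
  also have "\<dots> \<le> dep_const k * (\<bar>A - B\<bar> + F)"
    unfolding dep_const_def E_def[symmetric] using E1 s by (intro mult_right_mono) auto
  finally show "\<bar>K (tsrc q M \<mu> h) t - K (tsrc q M \<mu>' g) t\<bar> \<le> dep_const k * (\<bar>A - B\<bar> + \<bar>\<mu> - \<mu>'\<bar> * G)" by (simp add: F_def)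
qed

lemma dep_const_nonneg: "0 \<le> k \<Longrightarrow> 0 \<le> dep_const k"
  using C_pos by (simp add: dep_const_def)

text \<open>Because solutions depend on parameter and initial value in a Lipschitz way, convergence
  of these numbers already gives uniform convergence of the solutions and convergence of their
  derivatives at \<open>m\<close>.\<close>

lemma ivp_limit:
  assumes q: "2 < q" and M: "0 \<le> M" and \<mu>: "\<And>n. 0 \<le> \<mu> n" "\<And>n. \<mu> n \<le> \<mu>1"
    and h: "\<And>n. ivp (\<alpha> n) (tsrc q M (\<mu> n) (h n)) (h n)" and g: "ivp A (tsrc q M \<mu>' g) g"
    and lim: "\<mu> \<longlonglongrightarrow> \<mu>'" "\<alpha> \<longlonglongrightarrow> A"
  shows "uniform_limit {0..m} h g sequentially"
    and "(\<lambda>n. K (tsrc q M (\<mu> n) (h n)) m) \<longlonglongrightarrow> K (tsrc q M \<mu>' g) m"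
proof -
  define D where "D = dep_const ((q - 1) * M powr (q - 2) + \<mu>1)"
  have "continuous_on {0..m} (\<lambda>t. \<bar>g t\<bar>)" by (intro continuous_intros ivpD(1)[OF g])
  then have "\<exists>t0\<in>{0..m}. \<forall>t\<in>{0..m}. \<bar>g t\<bar> \<le> \<bar>g t0\<bar>"
    using m by (intro continuous_attains_sup) auto
  then obtain t0 where t0: "\<And>t. t \<in> {0..m} \<Longrightarrow> \<bar>g t\<bar> \<le> \<bar>g t0\<bar>" by blast
  define r where "r n = D * (\<bar>\<alpha> n - A\<bar> + \<bar>\<mu> n - \<mu>'\<bar> * \<bar>g t0\<bar>)" for n
  have "r \<longlonglongrightarrow> D * (\<bar>A - A\<bar> + \<bar>\<mu>' - \<mu>'\<bar> * \<bar>g t0\<bar>)"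
    unfolding r_def by (intro tendsto_intros lim)
  then have r: "r \<longlonglongrightarrow> 0" by simp
  have b1: "\<bar>h n t - g t\<bar> \<le> r n" if "t \<in> {0..m}" for n t
    unfolding r_def D_def by (rule tsrc_dependence(1)[OF q M \<mu> h g t0 that])
  have Kr: "\<bar>K (tsrc q M (\<mu> n) (h n)) m - K (tsrc q M \<mu>' g) m\<bar> \<le> r n" for n
    unfolding r_def D_def by (rule tsrc_dependence(2)[OF q M \<mu> h g t0]) (use m in auto)
  have "(\<lambda>n. K (tsrc q M (\<mu> n) (h n)) m - K (tsrc q M \<mu>' g) m) \<longlonglongrightarrow> 0"
    by (rule Lim_null_comparison[OF _ r]) (simp add: Kr)
  then show "(\<lambda>n. K (tsrc q M (\<mu> n) (h n)) m) \<longlonglongrightarrow> K (tsrc q M \<mu>' g) m"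
    by (rule LIM_zero_cancel)
  show "uniform_limit {0..m} h g sequentially"
  proof (rule uniform_limitI)
    fix \<epsilon> :: real assume "0 < \<epsilon>"
    with r have "\<forall>\<^sub>F n in sequentially. r n < \<epsilon>" by (rule order_tendstoD(2))
    then show "\<forall>\<^sub>F n in sequentially. \<forall>t\<in>{0..m}. dist (h n t) (g t) < \<epsilon>"
    proof eventually_elim
      case (elim n)
      then show ?case unfolding dist_real_def using le_less_trans[OF b1] by blast
    qed
  qed
qed

text \<open>The strong maximum principle: an interior zero of a nonnegative function is a minimum,
  so the derivative vanishes too and \<open>backward_unique\<close> applies.\<close>

lemma nonneg_zero_interior:
  assumes e1: "e = 1" and h: "ivp A y h" and nn: "\<And>t. t \<in> {0..m} \<Longrightarrow> 0 \<le> h t"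
    and k: "\<And>t. t \<in> {0..m} \<Longrightarrow> \<bar>y t\<bar> \<le> k * \<bar>h t\<bar>" and t: "0 < t" "t < m" and h0: "h t = 0"
  shows "A = 0"
proof -
  have "DERIV h t :> - K y t"
    using ivp_has_derivative[OF h, of t] t by (simp add: at_within_Icc_at)
  then have "- K y t = 0"
  proof (rule DERIV_local_min[of _ _ _ "min t (m - t)"])
    show "\<forall>s. \<bar>t - s\<bar> < min t (m - t) \<longrightarrow> h t \<le> h s" using nn h0 by (auto simp: abs_less_iff)
  qed (use t in auto)
  then have "h 0 = 0" using backward_unique[OF e1 h k, of t 0] t h0 by simp
  then show ?thesis using ivp_at_0[OF h] by simp
qed

text \<open>At the matching point a zero yields only a sign. The signs of both halves, together with
  the vanishing sum of the derivatives, then force both derivatives to vanish.\<close>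

lemma nonneg_zero_endpoint:
  assumes h: "ivp A y h" and nn: "\<And>t. t \<in> {0..m} \<Longrightarrow> 0 \<le> h t" and h0: "h m = 0"
  shows "0 \<le> K y m"
proof (rule ccontr)
  assume "\<not> ?thesis"
  then have "0 < - K y m" by simp
  then obtain d where d: "0 < d" "\<And>x. 0 < x \<Longrightarrow> m - x \<in> {0..m} \<Longrightarrow> x < d \<Longrightarrow> h (m - x) < h m"
    using has_real_derivative_pos_inc_left[OF ivp_has_derivative[OF h, of m]] m by auto
  define x where "x = min (d / 2) m"
  have "h (m - x) < h m" using d(1) m by (intro d(2)) (auto simp: x_def)
  moreover have "0 \<le> h (m - x)" using d(1) m by (intro nn) (auto simp: x_def)
  ultimately show False using h0 by simp
qed

text \<open>Differentiability of the shooting map in the initial value, with the linearized solution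
  as derivative, and a Lipschitz bound in the parameter. The constant \<open>c\<close> is fixed
  before \<open>\<epsilon>\<close>, so that \<open>persistence\<close> can choose the parameter
  last.\<close>

lemma shoot_expansion:
  assumes q: "2 < q" and \<mu>: "0 \<le> \<mu>" "\<mu> \<le> \<mu>1"
    and h: "ivp \<alpha> (tsrc q M \<mu> h) h" and hM: "\<And>t. t \<in> {0..m} \<Longrightarrow> 0 < h t \<and> h t < M"
    and \<psi>: "ivp 1 (\<lambda>r. ((q - 1) * h r powr (q - 2) - \<mu>) * \<psi> r) \<psi>"
  obtains c where "0 \<le> c" "\<And>\<epsilon>. 0 < \<epsilon> \<Longrightarrow> \<exists>\<rho>>0. \<rho> \<le> 1 \<and> (\<forall>x g \<mu>'. \<bar>x\<bar> \<le> \<rho> \<longrightarrow> 0 \<le> \<mu>' \<longrightarrow> \<mu>' \<le> \<mu>1 \<longrightarrow> ivp (\<alpha> + x) (tsrc q M \<mu>' g) g \<longrightarrow>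
     (\<forall>t\<in>{0..m}. \<bar>g t - h t\<bar> \<le> c * (\<bar>x\<bar> + \<bar>\<mu>' - \<mu>\<bar>)) \<and>
     \<bar>g m - h m - x * \<psi> m\<bar> \<le> \<epsilon> * \<bar>x\<bar> + c * \<bar>\<mu>' - \<mu>\<bar> \<and>
     \<bar>K (tsrc q M \<mu>' g) m - K (tsrc q M \<mu> h) m - x * K (\<lambda>r. ((q - 1) * h r powr (q - 2) - \<mu>) * \<psi> r) m\<bar> \<le> \<epsilon> * \<bar>x\<bar> + c * \<bar>\<mu>' - \<mu>\<bar>)"
proof -
  define n where "n r = (q - 1) * h r powr (q - 2) - \<mu>" for r
  have mm: "m \<in> {0..m}" using m by simp
  have M: "0 \<le> M" using hM[OF mm] by simp
  define D where "D = dep_const ((q - 1) * M powr (q - 2) + \<mu>1)"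
  have D: "0 \<le> D" unfolding D_def using q \<mu> by (intro dep_const_nonneg) auto
  note hc = ivpD(1)[OF h]
  obtain tl where tl: "tl \<in> {0..m}" "\<And>t. t \<in> {0..m} \<Longrightarrow> h tl \<le> h t"
    using continuous_attains_inf[of "{0..m}" h] hc m by auto
  obtain tu where tu: "tu \<in> {0..m}" "\<And>t. t \<in> {0..m} \<Longrightarrow> h t \<le> h tu"
    using continuous_attains_sup[of "{0..m}" h] hc m by auto
  define n0 where "n0 = (q - 1) * M powr (q - 2) + \<mu>1"
  have n0: "\<bar>n t\<bar> \<le> n0" if t: "t \<in> {0..m}" for t
  proof -
    have "h t powr (q - 2) \<le> M powr (q - 2)" using hM[OF t] q by (intro powr_mono2) auto
    then have "(q - 1) * h t powr (q - 2) \<le> (q - 1) * M powr (q - 2)" using q by (intro mult_left_mono) auto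
    moreover have "0 \<le> (q - 1) * h t powr (q - 2)" using q by simp
    ultimately show ?thesis unfolding n_def n0_def using \<mu> by linarith
  qed
  define Hb where "Hb = M + D"
  define c where "c = D * (1 + Hb)"
  have Hb: "0 \<le> Hb" "M \<le> Hb" using M D by (auto simp: Hb_def)
  have c0: "0 \<le> c" "D \<le> c" using D Hb by (auto simp: c_def algebra_simps)
  define Lc where "Lc = lin_const n0 + C * (n0 + 1) * lin_const n0"
  have n00: "0 \<le> n0" using n0[OF mm] by linarith
  have Lc: "0 < Lc" "lin_const n0 \<le> Lc" "C * (n0 + 1) * lin_const n0 \<le> Lc"
    unfolding Lc_def using lin_const_pos[of n0] C_pos n00 by (auto intro!: add_pos_nonneg)
  show ?thesis
  proof (rule that[OF c0(1)])
    fix \<epsilon> :: real assume \<epsilon>: "0 < \<epsilon>"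
    define \<eta> where "\<eta> = min 1 (\<epsilon> / Lc)"
    have \<eta>: "0 < \<eta>" "\<eta> \<le> 1" "Lc * \<eta> \<le> \<epsilon>"
      using \<epsilon> Lc by (auto simp: \<eta>_def min_def field_simps)
    obtain \<delta> where \<delta>: "0 < \<delta>" "\<And>x y. y \<in> {h tl..h tu} \<Longrightarrow> \<bar>x - y\<bar> < \<delta> \<Longrightarrow>
        \<bar>cpow q M x - cpow q M y - (q - 1) * y powr (q - 2) * (x - y)\<bar> \<le> \<eta> * \<bar>x - y\<bar>"
      using cpow_uniformly_differentiable[OF q, of "h tl" "h tu" M \<eta>] hM[OF tl(1)] hM[OF tu(1)] tl(2)[OF tu(1)] \<eta>(1) by auto
    define \<rho> where "\<rho> = min 1 (\<delta> / (2 * (D + 1)))"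
    have \<rho>: "0 < \<rho>" "\<rho> \<le> 1" using \<delta>(1) D by (auto simp: \<rho>_def)
    have \<rho>\<delta>: "D * \<rho> < \<delta>"
    proof -
      have "D * \<rho> \<le> D * (\<delta> / (2 * (D + 1)))" using D by (intro mult_left_mono) (auto simp: \<rho>_def)
      also have "\<dots> \<le> \<delta> / 2" using D \<delta>(1) by (simp add: field_simps)
      finally show ?thesis using \<delta>(1) by simp
    qed
    show "\<exists>\<rho>>0. \<rho> \<le> 1 \<and> (\<forall>x g \<mu>'. \<bar>x\<bar> \<le> \<rho> \<longrightarrow> 0 \<le> \<mu>' \<longrightarrow> \<mu>' \<le> \<mu>1 \<longrightarrow> ivp (\<alpha> + x) (tsrc q M \<mu>' g) g \<longrightarrow>
     (\<forall>t\<in>{0..m}. \<bar>g t - h t\<bar> \<le> c * (\<bar>x\<bar> + \<bar>\<mu>' - \<mu>\<bar>)) \<and>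
     \<bar>g m - h m - x * \<psi> m\<bar> \<le> \<epsilon> * \<bar>x\<bar> + c * \<bar>\<mu>' - \<mu>\<bar> \<and>
     \<bar>K (tsrc q M \<mu>' g) m - K (tsrc q M \<mu> h) m - x * K (\<lambda>r. ((q - 1) * h r powr (q - 2) - \<mu>) * \<psi> r) m\<bar> \<le> \<epsilon> * \<bar>x\<bar> + c * \<bar>\<mu>' - \<mu>\<bar>)"
    proof (intro exI[of _ \<rho>] conjI \<rho> allI impI)
      fix x g \<mu>'
      assume x: "\<bar>x\<bar> \<le> \<rho>" and \<mu>': "0 \<le> \<mu>'" "\<mu>' \<le> \<mu>1" and g: "ivp (\<alpha> + x) (tsrc q M \<mu>' g) g"
      \<comment> \<open>\<open>f\<close> differs from \<open>h\<close> in the initial value only,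
        and \<open>g\<close> from \<open>f\<close> in the parameter only; the two increments are
        estimated separately.\<close>
      obtain f where f: "ivp (\<alpha> + x) (tsrc q M \<mu> f) f" using tsrc_ivp_exists[OF q M \<mu>(1)] by blast
      have hb: "\<bar>h t\<bar> \<le> M" if "t \<in> {0..m}" for t using hM[OF that] by simp
      have fh: "\<bar>f t - h t\<bar> \<le> D * \<bar>x\<bar>" if "t \<in> {0..m}" for t
        using tsrc_dependence(1)[OF q M \<mu> f h hb that] by (simp add: D_def)
      have fb: "\<bar>f t\<bar> \<le> Hb" if t: "t \<in> {0..m}" for t
      proof -
        have "D * \<bar>x\<bar> \<le> D * 1" using D x \<rho> by (intro mult_left_mono) auto
        then show ?thesis using fh[OF t] hb[OF t] by (simp add: Hb_def)
      qed
      have gf: "\<bar>g t - f t\<bar> \<le> c * \<bar>\<mu>' - \<mu>\<bar>" "\<bar>K (tsrc q M \<mu>' g) t - K (tsrc q M \<mu> f) t\<bar> \<le> c * \<bar>\<mu>' - \<mu>\<bar>" if t: "t \<in> {0..m}" for t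
      proof -
        have "D * (\<bar>\<mu>' - \<mu>\<bar> * Hb) \<le> c * \<bar>\<mu>' - \<mu>\<bar>" using D by (simp add: c_def algebra_simps)
        then show "\<bar>g t - f t\<bar> \<le> c * \<bar>\<mu>' - \<mu>\<bar>" "\<bar>K (tsrc q M \<mu>' g) t - K (tsrc q M \<mu> f) t\<bar> \<le> c * \<bar>\<mu>' - \<mu>\<bar>"
          using tsrc_dependence[OF q M \<mu>' g f fb t] by (auto simp: D_def)
      qed
      have z: "ivp ((\<alpha> + x) - \<alpha>) (\<lambda>r. tsrc q M \<mu> f r - tsrc q M \<mu> h r) (\<lambda>r. f r - h r)"
        by (rule ivp_diff[OF f h])
      have \<psi>': "ivp 1 (\<lambda>r. n r * \<psi> r) \<psi>" using \<psi> by (simp add: n_def[abs_def])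
      have lin: "\<bar>(tsrc q M \<mu> f t - tsrc q M \<mu> h t) - n t * (f t - h t)\<bar> \<le> \<eta> * \<bar>f t - h t\<bar>" if t: "t \<in> {0..m}" for t
      proof -
        have "\<bar>f t - h t\<bar> < \<delta>"
          using fh[OF t] mult_left_mono[OF x D] \<rho>\<delta> by linarith
        moreover have "h t \<in> {h tl..h tu}" using tl(2)[OF t] tu(2)[OF t] by simp
        ultimately have "\<bar>cpow q M (f t) - cpow q M (h t) - (q - 1) * h t powr (q - 2) * (f t - h t)\<bar> \<le> \<eta> * \<bar>f t - h t\<bar>"
          by (rule \<delta>(2)[rotated])
        then show ?thesis by (simp add: tsrc_def n_def algebra_simps)
      qed
      have \<eta>0: "0 \<le> \<eta>" using \<eta> by simp
      note LL = linearization[OF z \<psi>' n0 \<eta>0 \<eta>(2) lin mm]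
      have "lin_const n0 * \<eta> * \<bar>x\<bar> \<le> Lc * \<eta> * \<bar>x\<bar>" "C * (n0 + 1) * lin_const n0 * \<eta> * \<bar>x\<bar> \<le> Lc * \<eta> * \<bar>x\<bar>" "Lc * \<eta> * \<bar>x\<bar> \<le> \<epsilon> * \<bar>x\<bar>"
        by (intro mult_right_mono Lc(2,3) \<eta>(3) \<eta>0 abs_ge_zero)+
      then have l1: "\<bar>f m - h m - x * \<psi> m\<bar> \<le> \<epsilon> * \<bar>x\<bar>"
        and l2: "\<bar>K (\<lambda>r. tsrc q M \<mu> f r - tsrc q M \<mu> h r) m - x * K (\<lambda>r. n r * \<psi> r) m\<bar> \<le> \<epsilon> * \<bar>x\<bar>"
        using LL(2,3) by simp_all
      have Kd: "K (\<lambda>r. tsrc q M \<mu> f r - tsrc q M \<mu> h r) m = K (tsrc q M \<mu> f) m - K (tsrc q M \<mu> h) m"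
        by (rule K_diff[OF ivpD(2)[OF f] ivpD(2)[OF h] mm])
      show "\<forall>t\<in>{0..m}. \<bar>g t - h t\<bar> \<le> c * (\<bar>x\<bar> + \<bar>\<mu>' - \<mu>\<bar>)"
      proof
        fix t assume t: "t \<in> {0..m}"
        have "D * \<bar>x\<bar> \<le> c * \<bar>x\<bar>" using c0 by (intro mult_right_mono) auto
        then show "\<bar>g t - h t\<bar> \<le> c * (\<bar>x\<bar> + \<bar>\<mu>' - \<mu>\<bar>)"
          using fh[OF t] gf(1)[OF t] unfolding distrib_left by linarith
      qed
      show "\<bar>g m - h m - x * \<psi> m\<bar> \<le> \<epsilon> * \<bar>x\<bar> + c * \<bar>\<mu>' - \<mu>\<bar>" using l1 gf(1)[OF mm] by linarith
      show "\<bar>K (tsrc q M \<mu>' g) m - K (tsrc q M \<mu> h) m - x * K (\<lambda>r. ((q - 1) * h r powr (q - 2) - \<mu>) * \<psi> r) m\<bar> \<le> \<epsilon> * \<bar>x\<bar> + c * \<bar>\<mu>' - \<mu>\<bar>"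
        using l2[unfolded Kd] gf(2)[OF mm] unfolding n_def by linarith
    qed
  qed
qed

end

lemma (in radial) linear_ivp_exists:
  assumes "continuous_on {0..m} n"
  shows "\<exists>\<psi>. ivp 1 (\<lambda>r. n r * \<psi> r) \<psi>"
proof -
  have "continuous_on {0..m} (\<lambda>t. \<bar>n t\<bar>)" by (intro continuous_intros assms)
  then have "\<exists>t0\<in>{0..m}. \<forall>t\<in>{0..m}. \<bar>n t\<bar> \<le> \<bar>n t0\<bar>"
    using m by (intro continuous_attains_sup) auto
  then obtain t0 where t0: "\<And>t. t \<in> {0..m} \<Longrightarrow> \<bar>n t\<bar> \<le> \<bar>n t0\<bar>" by blast
  show ?thesis
  proof (rule ivp_exists[where F="\<lambda>r x. n r * x" and k="\<bar>n t0\<bar>"])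
    show "continuous_on ({0..m} \<times> UNIV) (\<lambda>x. n (fst x) * snd x)"
      by (intro continuous_intros continuous_on_compose2[OF assms]) auto
    show "\<bar>n t * x - n t * y\<bar> \<le> \<bar>n t0\<bar> * \<bar>x - y\<bar>" if "t \<in> {0..m}" for t x y
      unfolding right_diff_distrib[symmetric] abs_mult using t0[OF that] by (rule mult_right_mono) simp
  qed simp
qed

section \<open>Matched solutions: bounds, rigidity, limits and persistence\<close>

context two_sided
begin

text \<open>Subcriticality reads \<open>a * (q - 2) < q\<close>, and the left side increases with
  the parameter.\<close>

lemma subcritical_a: "q * (a - 1) < 2 * a"
proof -
  have "a * (q - 2) \<le> b * (q - 2)" using ab q by (intro mult_right_mono) auto
  moreover have "b * (q - 2) < q" using sub by (simp add: algebra_simps)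
  ultimately show ?thesis by (simp add: algebra_simps)
qed

lemma solD:
  assumes "sol \<mu> \<alpha> \<beta> h0 h1"
  shows "L.ivp \<alpha> (src \<mu> h0) h0" "R.ivp \<beta> (src \<mu> h1) h1"
    "\<And>t. t \<in> {0..m} \<Longrightarrow> 0 < h0 t" "\<And>t. t \<in> {0..1 - m} \<Longrightarrow> 0 < h1 t"
    "h0 m = h1 (1 - m)" "L.K (src \<mu> h0) m + R.K (src \<mu> h1) (1 - m) = 0"
  using assms by (auto simp: sol_def)

lemma src_tsrc: "0 \<le> h r \<Longrightarrow> h r \<le> M \<Longrightarrow> tsrc q M \<mu> h r = src \<mu> h r"
  by (simp add: src_def tsrc_def cpow_eq)

text \<open>\<open>apriori_bound\<close> controls the two endpoint values, and
  \<open>ivp_upper\<close> carries the bound into each half. The strict inequality lets solutions be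
  treated as solutions of the truncated equation.\<close>

lemma sol_bounds:
  obtains M where "0 < M" "\<And>\<mu> \<alpha> \<beta> h0 h1. 0 \<le> \<mu> \<Longrightarrow> \<mu> \<le> \<mu>1 \<Longrightarrow> sol \<mu> \<alpha> \<beta> h0 h1 \<Longrightarrow>
     0 < \<alpha> \<and> \<alpha> \<le> M \<and> 0 < \<beta> \<and> \<beta> \<le> M \<and> (\<forall>t\<in>{0..m}. h0 t < M) \<and> (\<forall>t\<in>{0..1 - m}. h1 t < M)"
proof -
  have \<mu>10: "0 \<le> \<mu>1" using \<mu>1_pos by simp
  obtain AL where AL: "0 < AL" "\<And>\<mu> A h. 0 \<le> \<mu> \<Longrightarrow> \<mu> \<le> \<mu>1 \<Longrightarrow> L.ivp A (\<lambda>r. h r powr (q - 1) - \<mu> * h r) h \<Longrightarrow>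
       (\<And>t. t \<in> {0..m} \<Longrightarrow> 0 \<le> h t) \<Longrightarrow> A \<le> AL"
    using apriori_bound[OF L.radial_axioms q subcritical_a \<mu>10] by blast
  obtain AR where AR: "0 < AR" "\<And>\<mu> A h. 0 \<le> \<mu> \<Longrightarrow> \<mu> \<le> \<mu>1 \<Longrightarrow> R.ivp A (\<lambda>r. h r powr (q - 1) - \<mu> * h r) h \<Longrightarrow>
       (\<And>t. t \<in> {0..1 - m} \<Longrightarrow> 0 \<le> h t) \<Longrightarrow> A \<le> AR"
    using apriori_bound[OF R.radial_axioms q sub \<mu>10] by blast
  define BL where "BL = 2 * AL * exp (2 * L.C * (\<mu>1 + 1) * m)"
  define BR where "BR = 2 * AR * exp (2 * R.C * (\<mu>1 + 1) * (1 - m))"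
  define M where "M = AL + AR + BL + BR + 1"
  have nn: "0 \<le> BL" "0 \<le> BR" using AL AR by (auto simp: BL_def BR_def)
  show ?thesis
  proof (rule that[of M])
    show "0 < M" using AL AR nn by (simp add: M_def)
    fix \<mu> \<alpha> \<beta> h0 h1 assume \<mu>: "0 \<le> \<mu>" "\<mu> \<le> \<mu>1" and s: "sol \<mu> \<alpha> \<beta> h0 h1"
    note S = solD[OF s]
    have i0: "L.ivp \<alpha> (\<lambda>r. h0 r powr (q - 1) - \<mu> * h0 r) h0" and i1: "R.ivp \<beta> (\<lambda>r. h1 r powr (q - 1) - \<mu> * h1 r) h1"
      using S(1,2) by (simp_all add: src_def[abs_def])
    have p0: "0 < \<alpha>" "0 < \<beta>" using S(3)[of 0] S(4)[of 0] L.ivp_at_0[OF S(1)] R.ivp_at_0[OF S(2)] m0 m by auto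
    have \<alpha>: "\<alpha> \<le> AL" by (rule AL(2)[OF \<mu> i0]) (use S(3) in \<open>simp add: less_imp_le\<close>)
    have \<beta>: "\<beta> \<le> AR" by (rule AR(2)[OF \<mu> i1]) (use S(4) in \<open>simp add: less_imp_le\<close>)
    have bl: "h0 t \<le> BL" if t: "t \<in> {0..m}" for t
    proof -
      have "h0 t \<le> 2 * \<alpha> * exp (2 * L.C * (\<mu> + 1) * m)"
        by (rule L.ivp_upper[OF i0 _ _ \<mu>(1) t]) (use S(3) in \<open>auto simp: less_imp_le\<close>)
      also have "\<dots> \<le> BL" unfolding BL_def using \<alpha> p0 \<mu> L.C_pos m0 by (intro mult_mono) (auto intro!: mult_right_mono)
      finally show ?thesis .
    qed
    have br: "h1 t \<le> BR" if t: "t \<in> {0..1 - m}" for t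
    proof -
      have "h1 t \<le> 2 * \<beta> * exp (2 * R.C * (\<mu> + 1) * (1 - m))"
        by (rule R.ivp_upper[OF i1 _ _ \<mu>(1) t]) (use S(4) in \<open>auto simp: less_imp_le\<close>)
      also have "\<dots> \<le> BR" unfolding BR_def using \<beta> p0 \<mu> R.C_pos m by (intro mult_mono) (auto intro!: mult_right_mono)
      finally show ?thesis .
    qed
    have Ms: "AL \<le> M" "AR \<le> M" "BL < M" "BR < M" using AL AR nn by (auto simp: M_def)
    show "0 < \<alpha> \<and> \<alpha> \<le> M \<and> 0 < \<beta> \<and> \<beta> \<le> M \<and> (\<forall>t\<in>{0..m}. h0 t < M) \<and> (\<forall>t\<in>{0..1 - m}. h1 t < M)"
      using p0 order_trans[OF \<alpha> Ms(1)] order_trans[OF \<beta> Ms(2)] le_less_trans[OF bl Ms(3)] le_less_trans[OF br Ms(4)] by blast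
  qed
qed

lemma sol_tsrc:
  assumes s: "sol \<mu> \<alpha> \<beta> h0 h1" and M: "\<And>t. t \<in> {0..m} \<Longrightarrow> h0 t < M" "\<And>t. t \<in> {0..1 - m} \<Longrightarrow> h1 t < M"
  shows "L.ivp \<alpha> (tsrc q M \<mu> h0) h0" "R.ivp \<beta> (tsrc q M \<mu> h1) h1"
    "L.K (tsrc q M \<mu> h0) m + R.K (tsrc q M \<mu> h1) (1 - m) = 0"
proof -
  note S = solD[OF s]
  have e0: "tsrc q M \<mu> h0 r = src \<mu> h0 r" if "r \<in> {0..m}" for r
    using S(3)[OF that] M(1)[OF that] by (simp add: src_tsrc)
  have e1: "tsrc q M \<mu> h1 r = src \<mu> h1 r" if "r \<in> {0..1 - m}" for r
    using S(4)[OF that] M(2)[OF that] by (simp add: src_tsrc)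
  show "L.ivp \<alpha> (tsrc q M \<mu> h0) h0" by (rule L.ivp_cong_source[OF S(1)]) (simp add: e0)
  show "R.ivp \<beta> (tsrc q M \<mu> h1) h1" by (rule R.ivp_cong_source[OF S(2)]) (simp add: e1)
  have "L.K (tsrc q M \<mu> h0) m = L.K (src \<mu> h0) m" "R.K (tsrc q M \<mu> h1) (1 - m) = R.K (src \<mu> h1) (1 - m)"
    by (rule L.K_cong R.K_cong; use e0 e1 mem_m in auto)+
  then show "L.K (tsrc q M \<mu> h0) m + R.K (tsrc q M \<mu> h1) (1 - m) = 0" using S(6) by simp
qed

lemma tsrc_solI:
  assumes h: "L.ivp \<alpha> (tsrc q M \<mu> h0) h0" "R.ivp \<beta> (tsrc q M \<mu> h1) h1"
    and b: "\<And>t. t \<in> {0..m} \<Longrightarrow> 0 < h0 t \<and> h0 t \<le> M" "\<And>t. t \<in> {0..1 - m} \<Longrightarrow> 0 < h1 t \<and> h1 t \<le> M"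
    and eq: "h0 m = h1 (1 - m)" "L.K (tsrc q M \<mu> h0) m + R.K (tsrc q M \<mu> h1) (1 - m) = 0"
  shows "sol \<mu> \<alpha> \<beta> h0 h1"
proof -
  have e0: "tsrc q M \<mu> h0 r = src \<mu> h0 r" if "r \<in> {0..m}" for r
    using b(1)[OF that] by (simp add: src_tsrc)
  have e1: "tsrc q M \<mu> h1 r = src \<mu> h1 r" if "r \<in> {0..1 - m}" for r
    using b(2)[OF that] by (simp add: src_tsrc)
  have "L.ivp \<alpha> (src \<mu> h0) h0" by (rule L.ivp_cong_source[OF h(1)]) (simp add: e0)
  moreover have "R.ivp \<beta> (src \<mu> h1) h1" by (rule R.ivp_cong_source[OF h(2)]) (simp add: e1)
  moreover have "L.K (tsrc q M \<mu> h0) m = L.K (src \<mu> h0) m" "R.K (tsrc q M \<mu> h1) (1 - m) = R.K (src \<mu> h1) (1 - m)"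
    by (rule L.K_cong R.K_cong; use e0 e1 mem_m in auto)+
  ultimately show ?thesis using eq b by (simp add: sol_def)
qed

text \<open>\<open>bochner\<close> makes the boundary term at \<open>m\<close> nonnegative from
  either side. Under reflection both \<open>K\<close> and its coefficient change sign, so the two
  terms are negatives of each other; hence both vanish and \<open>h0\<close> is constant.\<close>

lemma sol_rigid:
  assumes \<mu>: "0 < \<mu>" and s: "sol \<mu> \<alpha> \<beta> h0 h1"
    and n0: "\<And>t. t \<in> {0..m} \<Longrightarrow> (q - 1) * h0 t powr (q - 2) - \<mu> < a + b"
    and n1: "\<And>t. t \<in> {0..1 - m} \<Longrightarrow> (q - 1) * h1 t powr (q - 2) - \<mu> < a + b"
  shows "\<alpha> = c \<mu>"
proof -
  note S = solD[OF s]
  have D0: "(src \<mu> h0 has_real_derivative ((q - 1) * h0 t powr (q - 2) - \<mu>) * (- L.K (src \<mu> h0) t)) (at t within {0..m})"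
    if "t \<in> {0..m}" for t
    unfolding src_def[abs_def] using S(3)[OF that] L.ivp_has_derivative[OF S(1) that]
    by (auto intro!: derivative_eq_intros simp: src_def[abs_def] algebra_simps)
  have D1: "(src \<mu> h1 has_real_derivative ((q - 1) * h1 t powr (q - 2) - \<mu>) * (- R.K (src \<mu> h1) t)) (at t within {0..1 - m})"
    if "t \<in> {0..1 - m}" for t
    unfolding src_def[abs_def] using S(4)[OF that] R.ivp_has_derivative[OF S(2) that]
    by (auto intro!: derivative_eq_intros simp: src_def[abs_def] algebra_simps)
  define P where "P = L.K (src \<mu> h0) m * (src \<mu> h0 m - (a - (a + b) * m) * L.K (src \<mu> h0) m)"
  have n1': "(q - 1) * h1 t powr (q - 2) - \<mu> < b + a" if "t \<in> {0..1 - m}" for t using n1[OF that] by simp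
  have "0 \<le> R.K (src \<mu> h1) (1 - m) * (src \<mu> h1 (1 - m) - (b - (b + a) * (1 - m)) * R.K (src \<mu> h1) (1 - m))"
    by (rule R.bochner(1)[OF refl S(2) D1 n1']) auto
  also have "R.K (src \<mu> h1) (1 - m) = - L.K (src \<mu> h0) m" using S(6) by simp
  also have "src \<mu> h1 (1 - m) = src \<mu> h0 m" by (simp add: src_def S(5))
  also have "b - (b + a) * (1 - m) = - (a - (a + b) * m)" by (simp add: algebra_simps)
  finally have "0 \<le> - P" unfolding P_def by (simp add: algebra_simps)
  then have P: "P \<le> 0" by simp
  have const: "h0 t = \<alpha>" if "t \<in> {0..m}" for t
    by (rule L.bochner(2)[OF refl S(1) D0 n0 P[unfolded P_def] that]) auto
  have \<alpha>: "0 < \<alpha>" using S(3)[of m] const[of m] m0 by simp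
  define s0 where "s0 = \<alpha> powr (q - 1) - \<mu> * \<alpha>"
  have src0: "L.K (src \<mu> h0) m = L.K (\<lambda>_. s0) m"
    by (rule L.K_cong) (use mem_m const in \<open>auto simp: src_def s0_def\<close>)
  have "(h0 has_real_derivative 0) (at m within {0..m})"
    by (rule has_field_derivative_transform_within[of "\<lambda>_. \<alpha>" _ _ _ 1]) (use m0 const in auto)
  moreover have "(h0 has_real_derivative - L.K (src \<mu> h0) m) (at m within {0..m})"
    by (rule L.ivp_has_derivative[OF S(1) mem_m(1)])
  \<comment> \<open>The derivative at the end of the interval is one-sided, and it is unique because
    \<open>m\<close> is a limit point of \<open>{0..m}\<close>.\<close>
  moreover have "at m within {0..m} \<noteq> bot" using m0 by (simp add: trivial_limit_within islimpt_Icc)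
  ultimately have K0: "L.K (\<lambda>_. s0) m = 0"
    using has_field_derivative_unique[of h0 0 m "{0..m}" "- L.K (src \<mu> h0) m"] src0 by simp
  have "s0 = 0"
  proof -
    have "0 < L.K (\<lambda>_. 1) m" by (rule L.K_pos) (use m0 in auto)
    moreover have "L.K (\<lambda>_. s0) m = s0 * L.K (\<lambda>_. 1) m" using L.K_cmult[of s0 "\<lambda>_. 1" m] by simp
    ultimately show ?thesis using K0 by simp
  qed
  moreover have "\<alpha> powr (q - 1) = \<alpha> * \<alpha> powr (q - 2)"
  proof -
    have "\<alpha> powr (q - 1) = \<alpha> powr (1 + (q - 2))" by simp
    then show ?thesis unfolding powr_add using \<alpha> by simp
  qed
  ultimately have "\<alpha> powr (q - 2) = \<mu>" using \<alpha> by (simp add: s0_def)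
  then have "c \<mu> = (\<alpha> powr (q - 2)) powr (1 / (q - 2))" by (simp add: c_def)
  also have "\<dots> = \<alpha>" using \<alpha> q by (simp add: powr_powr)
  finally show ?thesis by simp
qed

text \<open>The limit could lose positivity, become constant, or have \<open>\<mu>' = 0\<close>. A
  zero spreads by unique continuation until the limit is identically zero; zero and constant limits
  are excluded by rigidity of late terms of the sequence.\<close>

lemma sol_limit:
  fixes \<mu> \<alpha> \<beta> :: "nat \<Rightarrow> real"
  assumes M: "0 < M" and \<mu>: "\<And>n. 0 < \<mu> n" "\<And>n. \<mu> n < \<mu>1" and s: "\<And>n. sol (\<mu> n) (\<alpha> n) (\<beta> n) (h0 n) (h1 n)"
    and nc: "\<And>n. \<alpha> n \<noteq> c (\<mu> n)"
    and b0: "\<And>n t. t \<in> {0..m} \<Longrightarrow> h0 n t < M" and b1: "\<And>n t. t \<in> {0..1 - m} \<Longrightarrow> h1 n t < M"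
    and lim: "\<mu> \<longlonglongrightarrow> \<mu>'" "\<alpha> \<longlonglongrightarrow> A" "\<beta> \<longlonglongrightarrow> B" and \<mu>': "\<mu>' < \<mu>1"
  shows "\<exists>g0 g1. 0 < \<mu>' \<and> sol \<mu>' A B g0 g1 \<and> A \<noteq> c \<mu>'"
proof -
  have M0: "0 \<le> M" using M by simp
  have \<mu>0: "0 \<le> \<mu>'" using lim(1) \<mu>(1) by (intro LIMSEQ_le_const) (auto simp: less_imp_le)
  have \<mu>le: "\<And>n. 0 \<le> \<mu> n" "\<And>n. \<mu> n \<le> \<mu>1" using \<mu> by (auto simp: less_imp_le)
  obtain g0 where g0: "L.ivp A (tsrc q M \<mu>' g0) g0" using L.tsrc_ivp_exists[OF q M0 \<mu>0] by blast
  obtain g1 where g1: "R.ivp B (tsrc q M \<mu>' g1) g1" using R.tsrc_ivp_exists[OF q M0 \<mu>0] by blast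
  note T = sol_tsrc[OF s b0 b1]
  note L0 = L.ivp_limit[OF q M0 \<mu>le T(1) g0 lim(1,2)] and R0 = R.ivp_limit[OF q M0 \<mu>le T(2) g1 lim(1,3)]
  have p0: "(\<lambda>n. h0 n t) \<longlonglongrightarrow> g0 t" if "t \<in> {0..m}" for t by (rule tendsto_uniform_limitI[OF L0(1) that])
  have p1: "(\<lambda>n. h1 n t) \<longlonglongrightarrow> g1 t" if "t \<in> {0..1 - m}" for t by (rule tendsto_uniform_limitI[OF R0(1) that])
  have g0b: "0 \<le> g0 t" "g0 t \<le> M" if t: "t \<in> {0..m}" for t
    using LIMSEQ_le_const[OF p0[OF t], of 0] LIMSEQ_le_const2[OF p0[OF t], of M] solD(3)[OF s t] b0[OF t] by (auto simp: less_imp_le)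
  have g1b: "0 \<le> g1 t" "g1 t \<le> M" if t: "t \<in> {0..1 - m}" for t
    using LIMSEQ_le_const[OF p1[OF t], of 0] LIMSEQ_le_const2[OF p1[OF t], of M] solD(4)[OF s t] b1[OF t] by (auto simp: less_imp_le)
  have val: "g0 m = g1 (1 - m)"
    using LIMSEQ_unique[OF p0[OF mem_m(1)]] p1[OF mem_m(2)] solD(5)[OF s] by simp
  have der: "L.K (tsrc q M \<mu>' g0) m + R.K (tsrc q M \<mu>' g1) (1 - m) = 0"
    using LIMSEQ_unique[OF tendsto_add[OF L0(2) R0(2)], of 0] T(3) by simp
  define k where "k = (q - 1) * M powr (q - 2) + \<mu>1"
  have k0: "0 \<le> k" using q \<mu>1_pos by (simp add: k_def)
  have kb: "\<bar>tsrc q M \<mu>' g r\<bar> \<le> k * \<bar>g r\<bar>" for g r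
    using tsrc_diff[OF q M0 \<mu>0 less_imp_le[OF \<mu>'], of g r \<mu>' "\<lambda>_. 0"] M0 by (simp add: k_def tsrc_def cpow_eq)
  \<comment> \<open>The hypothesis of \<open>sol_rigid\<close> is an open condition. If it holds for
    a constant limit, uniform convergence passes it to some member of the sequence, which would then
    be constant against \<open>nc\<close>.\<close>
  have rigid: False if v: "0 \<le> v" "(q - 1) * v powr (q - 2) - \<mu>' < a + b"
    and c0: "\<And>t. t \<in> {0..m} \<Longrightarrow> g0 t = v" and c1: "\<And>t. t \<in> {0..1 - m} \<Longrightarrow> g1 t = v" for v
  proof -
    have "((\<lambda>d. (q - 1) * (v + d) powr (q - 2) - (\<mu>' - d)) \<longlongrightarrow> (q - 1) * (v + 0) powr (q - 2) - (\<mu>' - 0)) (at_right 0)"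
      using q v(1) by (intro tendsto_intros tendsto_powr') (auto simp: eventually_at_filter)
    then have "\<forall>\<^sub>F d in at_right 0. (q - 1) * (v + d) powr (q - 2) - (\<mu>' - d) < a + b"
      using v(2) by (intro order_tendstoD(2)) auto
    moreover have "\<forall>\<^sub>F d in at_right (0::real). 0 < d" by (simp add: eventually_at_filter)
    ultimately have "\<forall>\<^sub>F d in at_right (0::real). 0 < d \<and> (q - 1) * (v + d) powr (q - 2) - (\<mu>' - d) < a + b"
      by eventually_elim auto
    then obtain d where d: "0 < d" "(q - 1) * (v + d) powr (q - 2) - (\<mu>' - d) < a + b"
      using eventually_happens'[OF trivial_limit_at_right_real] by blast
    have "\<forall>\<^sub>F n in sequentially. \<forall>t\<in>{0..m}. dist (h0 n t) (g0 t) < d"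
      by (rule uniform_limitD[OF L0(1) d(1)])
    moreover have "\<forall>\<^sub>F n in sequentially. \<forall>t\<in>{0..1 - m}. dist (h1 n t) (g1 t) < d"
      by (rule uniform_limitD[OF R0(1) d(1)])
    moreover have "\<forall>\<^sub>F n in sequentially. dist (\<mu> n) \<mu>' < d" by (rule tendstoD[OF lim(1) d(1)])
    ultimately have "\<forall>\<^sub>F n in sequentially. (\<forall>t\<in>{0..m}. dist (h0 n t) (g0 t) < d) \<and> (\<forall>t\<in>{0..1 - m}. dist (h1 n t) (g1 t) < d) \<and> dist (\<mu> n) \<mu>' < d"
      by eventually_elim auto
    then obtain n where n': "(\<forall>t\<in>{0..m}. dist (h0 n t) (g0 t) < d) \<and> (\<forall>t\<in>{0..1 - m}. dist (h1 n t) (g1 t) < d) \<and> dist (\<mu> n) \<mu>' < d"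
      using eventually_happens'[OF sequentially_bot] by blast
    then have n: "\<And>t. t \<in> {0..m} \<Longrightarrow> \<bar>h0 n t - v\<bar> < d" "\<And>t. t \<in> {0..1 - m} \<Longrightarrow> \<bar>h1 n t - v\<bar> < d" "\<bar>\<mu> n - \<mu>'\<bar> < d"
      using c0 c1 by (auto simp: dist_real_def)
    have small: "(q - 1) * x powr (q - 2) - \<mu> n < a + b" if x: "0 < x" "\<bar>x - v\<bar> < d" for x
    proof -
      have "x powr (q - 2) \<le> (v + d) powr (q - 2)" using x q by (intro powr_mono2) auto
      then have "(q - 1) * x powr (q - 2) \<le> (q - 1) * (v + d) powr (q - 2)" using q by (intro mult_left_mono) auto
      then show ?thesis using d(2) n(3) by linarith
    qed
    have "\<alpha> n = c (\<mu> n)"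
      by (rule sol_rigid[OF \<mu>(1) s[of n]]) (use small n(1,2) solD(3,4)[OF s[of n]] in blast)+
    then show False using nc by simp
  qed
  have zero_rigid: False if "A = 0" "B = 0"
  proof (rule rigid[of 0])
    show "g0 t = 0" if "t \<in> {0..m}" for t
      using L.ivp_bound[OF g0 _ k0 order_refl that] kb \<open>A = 0\<close> by simp
    show "g1 t = 0" if "t \<in> {0..1 - m}" for t
      using R.ivp_bound[OF g1 _ k0 order_refl that] kb \<open>B = 0\<close> by simp
  qed (use \<mu>0 a b in auto)
  \<comment> \<open>If \<open>A = 0\<close>, the left half vanishes, hence so do value and
    derivative at \<open>m\<close>, hence the right half.\<close>
  have A0: "A \<noteq> 0"
  proof
    assume A: "A = 0"
    have z: "g0 t = 0" if "t \<in> {0..m}" for t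
      using L.ivp_bound[OF g0 _ k0 order_refl that] kb A by simp
    have "L.K (tsrc q M \<mu>' g0) m = L.K (\<lambda>_. 0) m"
      by (rule L.K_cong) (use mem_m z M0 in \<open>auto simp: tsrc_def cpow_eq\<close>)
    then have "R.K (tsrc q M \<mu>' g1) (1 - m) = 0" using der by simp
    moreover have "g1 (1 - m) = 0" using val z[OF mem_m(1)] by simp
    ultimately have "g1 0 = 0" using R.backward_unique[OF refl g1 kb, of "1 - m" 0] m by simp
    then show False using zero_rigid A R.ivp_at_0[OF g1] by simp
  qed
  have B0: "B \<noteq> 0"
  proof
    assume B: "B = 0"
    have z: "g1 t = 0" if "t \<in> {0..1 - m}" for t
      using R.ivp_bound[OF g1 _ k0 order_refl that] kb B by simp
    have "R.K (tsrc q M \<mu>' g1) (1 - m) = R.K (\<lambda>_. 0) (1 - m)"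
      by (rule R.K_cong) (use mem_m z M0 in \<open>auto simp: tsrc_def cpow_eq\<close>)
    then have "L.K (tsrc q M \<mu>' g0) m = 0" using der by simp
    moreover have "g0 m = 0" using val z[OF mem_m(2)] by simp
    ultimately have "g0 0 = 0" using L.backward_unique[OF refl g0 kb, of m 0] m0 by simp
    then show False using A0 L.ivp_at_0[OF g0] by simp
  qed
  have gm: "g0 m \<noteq> 0"
  proof
    assume z: "g0 m = 0"
    have "0 \<le> L.K (tsrc q M \<mu>' g0) m" by (rule L.nonneg_zero_endpoint[OF g0 g0b(1) z])
    moreover have "0 \<le> R.K (tsrc q M \<mu>' g1) (1 - m)" by (rule R.nonneg_zero_endpoint[OF g1 g1b(1)]) (auto simp: z val[symmetric])
    ultimately have "L.K (tsrc q M \<mu>' g0) m = 0" using der by simp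
    then have "g0 0 = 0" using L.backward_unique[OF refl g0 kb, of m 0] m0 z by simp
    then show False using A0 L.ivp_at_0[OF g0] by simp
  qed
  have pos0: "0 < g0 t" if t: "t \<in> {0..m}" for t
  proof -
    have "g0 t \<noteq> 0"
    proof
      assume z: "g0 t = 0"
      then have "t \<noteq> 0" "t \<noteq> m" using A0 L.ivp_at_0[OF g0] gm by auto
      then show False using L.nonneg_zero_interior[OF refl g0 g0b(1) kb _ _ z] t A0 by auto
    qed
    then show ?thesis using g0b(1)[OF t] by simp
  qed
  have pos1: "0 < g1 t" if t: "t \<in> {0..1 - m}" for t
  proof -
    have "g1 t \<noteq> 0"
    proof
      assume z: "g1 t = 0"
      then have "t \<noteq> 0" "t \<noteq> 1 - m" using B0 R.ivp_at_0[OF g1] gm val by auto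
      then show False using R.nonneg_zero_interior[OF refl g1 g1b(1) kb _ _ z] t B0 by auto
    qed
    then show ?thesis using g1b(1)[OF t] by simp
  qed
  have S: "sol \<mu>' A B g0 g1"
    by (rule tsrc_solI[OF g0 g1 _ _ val der]) (use pos0 pos1 g0b g1b in auto)
  \<comment> \<open>For \<open>\<mu>' = 0\<close> the source is positive, and a positive source
    cannot be balanced: both derivative terms at \<open>m\<close> would be positive while their sum
    is \<open>0\<close>.\<close>
  have \<mu>pos: "0 < \<mu>'"
  proof (rule ccontr)
    assume "\<not> ?thesis"
    then have "\<mu>' = 0" using \<mu>0 by simp
    note \<mu>z = this
    have "0 < L.K (src \<mu>' g0) m"
      using pos0 by (intro L.K_pos[OF L.ivpD(2)[OF solD(1)[OF S]] mem_m(1)]) (simp add: src_def \<mu>z less_imp_neq[symmetric])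
    moreover have "0 < R.K (src \<mu>' g1) (1 - m)"
      using pos1 by (intro R.K_pos[OF R.ivpD(2)[OF solD(2)[OF S]] mem_m(2)]) (simp add: src_def \<mu>z less_imp_neq[symmetric])
    ultimately show False using solD(6)[OF S] by simp
  qed
  have "A \<noteq> c \<mu>'"
  proof
    assume A: "A = c \<mu>'"
    define v where "v = c \<mu>'"
    have v: "0 < v" using c_pos[OF \<mu>pos] by (simp add: v_def)
    have vM: "v \<le> M" using g0b(2)[of 0] L.ivp_at_0[OF g0] A m0 by (simp add: v_def)
    have tv: "tsrc q M \<mu>' (\<lambda>_. v) r = 0" for r
      using v vM c_powr(2)[OF \<mu>pos] by (simp add: tsrc_def cpow_eq v_def)
    have kv: "\<bar>tsrc q M \<mu>' g r\<bar> \<le> k * \<bar>g r - v\<bar>" for g r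
      using tsrc_diff[OF q M0 \<mu>0 less_imp_le[OF \<mu>'], of g r \<mu>' "\<lambda>_. v"] tv by (simp add: k_def)
    have z0: "L.ivp (A - v) (\<lambda>r. tsrc q M \<mu>' g0 r - 0) (\<lambda>r. g0 r - v)" by (rule L.ivp_diff[OF g0 L.ivp_const])
    have e0: "g0 t = v" if "t \<in> {0..m}" for t
      using L.ivp_bound[OF z0 _ k0 order_refl that] kv A by (simp add: v_def)
    have "L.K (tsrc q M \<mu>' g0) m = L.K (\<lambda>_. 0) m"
      by (rule L.K_cong) (use e0 tv in \<open>auto simp: tsrc_def m0 less_imp_le\<close>)
    then have R0: "R.K (\<lambda>r. tsrc q M \<mu>' g1 r - 0) (1 - m) = 0" using der by simp
    have z1: "R.ivp (B - v) (\<lambda>r. tsrc q M \<mu>' g1 r - 0) (\<lambda>r. g1 r - v)" by (rule R.ivp_diff[OF g1 R.ivp_const])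
    have e1: "g1 t = v" if "t \<in> {0..1 - m}" for t
    proof -
      have k1: "\<bar>tsrc q M \<mu>' g1 r - 0\<bar> \<le> k * \<bar>g1 r - v\<bar>" for r using kv by simp
      have gv: "g1 (1 - m) - v = 0" using val e0[OF mem_m(1)] by simp
      have "g1 t - v = 0" by (rule R.backward_unique[OF refl z1 k1 _ _ gv R0 that]) (use m in auto)
      then show ?thesis by simp
    qed
    \<comment> \<open>At the constant solution the linearized coefficient is
      \<open>(q - 2) * \<mu>'\<close>, below the first eigenvalue exactly because
      \<open>\<mu>' < \<mu>1\<close>.\<close>
    have "(q - 1) * v powr (q - 2) - \<mu>' = (q - 2) * \<mu>'"
      using c_powr(1)[OF \<mu>pos] by (simp add: v_def algebra_simps)
    also have "\<dots> < a + b" using \<mu>' q by (simp add: \<mu>1_def field_simps)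
    finally show False using rigid[OF _ _ e0 e1] v by simp
  qed
  then show ?thesis using S \<mu>pos by blast
qed

text \<open>In the increments \<open>x\<close>, \<open>y\<close> of the initial values the
  mismatches are, to first order, \<open>x * p0 - y * p1\<close> and \<open>x * kL + y * kR\<close>.
  The expression in \<open>det\<close> is the determinant of this system; if it is nonzero, the
  mismatches can be made to vanish also for a slightly smaller parameter.\<close>

lemma persistence:
  assumes \<mu>: "0 < \<mu>" "\<mu> < \<mu>1" and s: "sol \<mu> \<alpha> \<beta> h0 h1" and nc: "\<alpha> \<noteq> c \<mu>"
    and \<psi>0: "L.ivp 1 (\<lambda>r. ((q - 1) * h0 r powr (q - 2) - \<mu>) * \<psi>0 r) \<psi>0"
    and \<psi>1: "R.ivp 1 (\<lambda>r. ((q - 1) * h1 r powr (q - 2) - \<mu>) * \<psi>1 r) \<psi>1"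
    and det: "\<psi>0 m * R.K (\<lambda>r. ((q - 1) * h1 r powr (q - 2) - \<mu>) * \<psi>1 r) (1 - m)
      + \<psi>1 (1 - m) * L.K (\<lambda>r. ((q - 1) * h0 r powr (q - 2) - \<mu>) * \<psi>0 r) m \<noteq> 0"
  shows "\<exists>\<mu>' \<alpha>' \<beta>' g0 g1. 0 < \<mu>' \<and> \<mu>' < \<mu> \<and> sol \<mu>' \<alpha>' \<beta>' g0 g1 \<and> \<alpha>' \<noteq> c \<mu>'"
proof -
  note S = solD[OF s]
  have mu1: "0 \<le> \<mu>" "\<mu> \<le> \<mu>1" using \<mu> by auto
  obtain M0 where "\<forall>t\<in>{0..m}. h0 t < M0" "\<forall>t\<in>{0..1 - m}. h1 t < M0"
    using sol_bounds mu1 s by metis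
  note M0 = this
  define p0 p1 kL kR where "p0 = \<psi>0 m" and "p1 = \<psi>1 (1 - m)"
    and "kL = L.K (\<lambda>r. ((q - 1) * h0 r powr (q - 2) - \<mu>) * \<psi>0 r) m"
    and "kR = R.K (\<lambda>r. ((q - 1) * h1 r powr (q - 2) - \<mu>) * \<psi>1 r) (1 - m)"
  define D where "D = p0 * kR + p1 * kL"
  have D: "D \<noteq> 0" using det by (simp add: D_def p0_def p1_def kL_def kR_def)
  \<comment> \<open>The margin \<open>1\<close> keeps nearby solutions below the truncation level as
    well.\<close>
  define M where "M = M0 + 1"
  have hM0: "0 < h0 t \<and> h0 t < M" if "t \<in> {0..m}" for t using S(3)[OF that] M0 that by (force simp: M_def)
  have hM1: "0 < h1 t \<and> h1 t < M" if "t \<in> {0..1 - m}" for t using S(4)[OF that] M0 that by (force simp: M_def)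
  have Mp: "0 \<le> M" using hM0[OF mem_m(1)] by simp
  have hb: "\<And>t. t \<in> {0..m} \<Longrightarrow> h0 t < M" "\<And>t. t \<in> {0..1 - m} \<Longrightarrow> h1 t < M" using hM0 hM1 by auto
  have T: "L.ivp \<alpha> (tsrc q M \<mu> h0) h0" "R.ivp \<beta> (tsrc q M \<mu> h1) h1"
    "L.K (tsrc q M \<mu> h0) m + R.K (tsrc q M \<mu> h1) (1 - m) = 0"
    by (rule sol_tsrc[OF s]; use hb in auto)+
  obtain cL where cL: "0 \<le> cL" "\<And>\<epsilon>. 0 < \<epsilon> \<Longrightarrow> \<exists>\<rho>>0. \<rho> \<le> 1 \<and> (\<forall>x g \<mu>'. \<bar>x\<bar> \<le> \<rho> \<longrightarrow> 0 \<le> \<mu>' \<longrightarrow> \<mu>' \<le> \<mu>1 \<longrightarrow> L.ivp (\<alpha> + x) (tsrc q M \<mu>' g) g \<longrightarrow>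
     (\<forall>t\<in>{0..m}. \<bar>g t - h0 t\<bar> \<le> cL * (\<bar>x\<bar> + \<bar>\<mu>' - \<mu>\<bar>)) \<and>
     \<bar>g m - h0 m - x * p0\<bar> \<le> \<epsilon> * \<bar>x\<bar> + cL * \<bar>\<mu>' - \<mu>\<bar> \<and>
     \<bar>L.K (tsrc q M \<mu>' g) m - L.K (tsrc q M \<mu> h0) m - x * kL\<bar> \<le> \<epsilon> * \<bar>x\<bar> + cL * \<bar>\<mu>' - \<mu>\<bar>)"
    using L.shoot_expansion[OF q mu1 T(1) hM0 \<psi>0] unfolding p0_def kL_def by blast
  obtain cR where cR: "0 \<le> cR" "\<And>\<epsilon>. 0 < \<epsilon> \<Longrightarrow> \<exists>\<rho>>0. \<rho> \<le> 1 \<and> (\<forall>x g \<mu>'. \<bar>x\<bar> \<le> \<rho> \<longrightarrow> 0 \<le> \<mu>' \<longrightarrow> \<mu>' \<le> \<mu>1 \<longrightarrow> R.ivp (\<beta> + x) (tsrc q M \<mu>' g) g \<longrightarrow>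
     (\<forall>t\<in>{0..1 - m}. \<bar>g t - h1 t\<bar> \<le> cR * (\<bar>x\<bar> + \<bar>\<mu>' - \<mu>\<bar>)) \<and>
     \<bar>g (1 - m) - h1 (1 - m) - x * p1\<bar> \<le> \<epsilon> * \<bar>x\<bar> + cR * \<bar>\<mu>' - \<mu>\<bar> \<and>
     \<bar>R.K (tsrc q M \<mu>' g) (1 - m) - R.K (tsrc q M \<mu> h1) (1 - m) - x * kR\<bar> \<le> \<epsilon> * \<bar>x\<bar> + cR * \<bar>\<mu>' - \<mu>\<bar>)"
    using R.shoot_expansion[OF q mu1 T(2) hM1 \<psi>1] unfolding p1_def kR_def by blast
  define cc where "cc = cL + cR"
  have cc: "0 \<le> cc" "cL \<le> cc" "cR \<le> cc" using cL(1) cR(1) by (auto simp: cc_def)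
  \<comment> \<open>Bounds the entries of the inverse matrix, hence how much it magnifies errors of
    the mismatches.\<close>
  define W where "W = (\<bar>kR\<bar> + \<bar>p1\<bar> + \<bar>kL\<bar> + \<bar>p0\<bar>) / \<bar>D\<bar>"
  have W: "0 \<le> W" by (simp add: W_def)
  \<comment> \<open>Chosen so that the magnified first-order error uses up a quarter of the box
    radius \<open>s\<close>; \<open>d2\<close> leaves another quarter for the change of the
    parameter, and \<open>s / 2\<close> results.\<close>
  define \<epsilon> where "\<epsilon> = 1 / (8 * (W + 1))"
  have \<epsilon>: "0 < \<epsilon>" "W * \<epsilon> \<le> 1/8" using W by (auto simp: \<epsilon>_def field_simps)
  obtain \<rho>L where \<rho>L: "0 < \<rho>L" and eL: "\<And>x g \<mu>'. \<bar>x\<bar> \<le> \<rho>L \<Longrightarrow> 0 \<le> \<mu>' \<Longrightarrow> \<mu>' \<le> \<mu>1 \<Longrightarrow> L.ivp (\<alpha> + x) (tsrc q M \<mu>' g) g \<Longrightarrow>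
     (\<forall>t\<in>{0..m}. \<bar>g t - h0 t\<bar> \<le> cL * (\<bar>x\<bar> + \<bar>\<mu>' - \<mu>\<bar>)) \<and>
     \<bar>g m - h0 m - x * p0\<bar> \<le> \<epsilon> * \<bar>x\<bar> + cL * \<bar>\<mu>' - \<mu>\<bar> \<and>
     \<bar>L.K (tsrc q M \<mu>' g) m - L.K (tsrc q M \<mu> h0) m - x * kL\<bar> \<le> \<epsilon> * \<bar>x\<bar> + cL * \<bar>\<mu>' - \<mu>\<bar>"
    using cL(2)[OF \<epsilon>(1)] by blast
  obtain \<rho>R where \<rho>R: "0 < \<rho>R" and eR: "\<And>x g \<mu>'. \<bar>x\<bar> \<le> \<rho>R \<Longrightarrow> 0 \<le> \<mu>' \<Longrightarrow> \<mu>' \<le> \<mu>1 \<Longrightarrow> R.ivp (\<beta> + x) (tsrc q M \<mu>' g) g \<Longrightarrow>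
     (\<forall>t\<in>{0..1 - m}. \<bar>g t - h1 t\<bar> \<le> cR * (\<bar>x\<bar> + \<bar>\<mu>' - \<mu>\<bar>)) \<and>
     \<bar>g (1 - m) - h1 (1 - m) - x * p1\<bar> \<le> \<epsilon> * \<bar>x\<bar> + cR * \<bar>\<mu>' - \<mu>\<bar> \<and>
     \<bar>R.K (tsrc q M \<mu>' g) (1 - m) - R.K (tsrc q M \<mu> h1) (1 - m) - x * kR\<bar> \<le> \<epsilon> * \<bar>x\<bar> + cR * \<bar>\<mu>' - \<mu>\<bar>"
    using cR(2)[OF \<epsilon>(1)] by blast
  obtain l0 where l0: "l0 \<in> {0..m}" "\<And>t. t \<in> {0..m} \<Longrightarrow> h0 l0 \<le> h0 t"
    using continuous_attains_inf[of "{0..m}" h0] L.ivpD(1)[OF S(1)] m0 by auto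
  obtain l1 where l1: "l1 \<in> {0..1 - m}" "\<And>t. t \<in> {0..1 - m} \<Longrightarrow> h1 l1 \<le> h1 t"
    using continuous_attains_inf[of "{0..1 - m}" h1] R.ivpD(1)[OF S(2)] m by auto
  define e0 where "e0 = min 1 (min (h0 l0) (h1 l1)) / 2"
  have e0: "0 < e0" using hM0[OF l0(1)] hM1[OF l1(1)] by (simp add: e0_def)
  have in0: "0 < h0 t - e0" "h0 t + e0 \<le> M" if t: "t \<in> {0..m}" for t
  proof -
    have "e0 < h0 l0" "e0 \<le> 1" using hM0[OF l0(1)] by (auto simp: e0_def min_def)
    then show "0 < h0 t - e0" "h0 t + e0 \<le> M" using l0(2)[OF t] M0(1) t by (force simp: M_def)+
  qed
  have in1: "0 < h1 t - e0" "h1 t + e0 \<le> M" if t: "t \<in> {0..1 - m}" for t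
  proof -
    have "e0 < h1 l1" "e0 \<le> 1" using hM1[OF l1(1)] by (auto simp: e0_def min_def)
    then show "0 < h1 t - e0" "h1 t + e0 \<le> M" using l1(2)[OF t] M0(2) t by (force simp: M_def)+
  qed
  \<comment> \<open>The box must lie in the range of both expansions, keep
    \<open>\<alpha> + x\<close> away from the constant solution, and move the solutions by at most
    \<open>e0 / 2\<close>, so that they stay positive and below \<open>M\<close>.\<close>
  define s where "s = min (min \<rho>L \<rho>R) (min (\<bar>\<alpha> - c \<mu>\<bar> / 4) (e0 / (2 * (cc + 1))))"
  have s0: "0 < s" using \<rho>L \<rho>R nc e0 cc by (simp add: s_def)
  have sr: "s \<le> \<rho>L" "s \<le> \<rho>R" "s \<le> \<bar>\<alpha> - c \<mu>\<bar> / 4" "s \<le> e0 / (2 * (cc + 1))" unfolding s_def by linarith+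
  have se: "cc * s \<le> e0 / 2"
  proof -
    have "cc * s \<le> cc * (e0 / (2 * (cc + 1)))" using sr cc by (intro mult_left_mono) auto
    also have "\<dots> \<le> e0 / 2" using cc e0 by (simp add: field_simps)
    finally show ?thesis .
  qed
  define \<delta>1 where "\<delta>1 = min (e0 / (2 * (cc + 1))) (s / 8 / (cc + 1) / (W + 1))"
  have \<delta>1: "0 < \<delta>1" using e0 cc s0 W by (simp add: \<delta>1_def)
  have "isCont c \<mu>" unfolding c_def[abs_def] using \<mu> by (intro continuous_intros) auto
  moreover have "0 < \<bar>\<alpha> - c \<mu>\<bar> / 2" using nc by simp
  ultimately have "\<exists>d>0. \<forall>x. dist x \<mu> < d \<longrightarrow> dist (c x) (c \<mu>) < \<bar>\<alpha> - c \<mu>\<bar> / 2"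
    unfolding continuous_at_eps_delta by blast
  then obtain \<delta>2 where \<delta>2: "0 < \<delta>2" "\<And>x. \<bar>x - \<mu>\<bar> < \<delta>2 \<Longrightarrow> \<bar>c x - c \<mu>\<bar> < \<bar>\<alpha> - c \<mu>\<bar> / 2"
    by (auto simp: dist_real_def)
  define \<delta> where "\<delta> = min (\<mu> / 2) (min (\<delta>1 / 2) (\<delta>2 / 2))"
  have \<delta>: "0 < \<delta>" using \<mu> \<delta>1 \<delta>2 by (simp add: \<delta>_def)
  have \<delta>le: "\<delta> \<le> \<mu> / 2" "\<delta> \<le> \<delta>1" "\<delta> < \<delta>2" using \<delta>1 \<delta>2 \<mu> unfolding \<delta>_def by linarith+
  define \<mu>' where "\<mu>' = \<mu> - \<delta>"
  have \<mu>': "0 < \<mu>'" "\<mu>' < \<mu>" "\<bar>\<mu>' - \<mu>\<bar> = \<delta>" using \<delta> \<delta>le \<mu> by (auto simp: \<mu>'_def)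
  have mu': "0 \<le> \<mu>'" "\<mu>' \<le> \<mu>1" using \<mu>' \<mu> by auto
  have d1: "cc * \<delta> \<le> e0 / 2"
  proof -
    have "\<delta> \<le> e0 / (2 * (cc + 1))" using \<delta>le(2) unfolding \<delta>1_def by linarith
    then have "cc * \<delta> \<le> cc * (e0 / (2 * (cc + 1)))" using cc by (intro mult_left_mono) auto
    also have "\<dots> \<le> e0 / 2" using cc e0 by (simp add: field_simps)
    finally show ?thesis .
  qed
  have d2: "W * (cc * \<delta>) \<le> s / 8"
  proof -
    have "\<delta> \<le> s / 8 / (cc + 1) / (W + 1)" using \<delta>le(2) unfolding \<delta>1_def by linarith
    then have "(W + 1) * ((cc + 1) * \<delta>) \<le> (W + 1) * ((cc + 1) * (s / 8 / (cc + 1) / (W + 1)))"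
      using cc W by (intro mult_left_mono) auto
    also have "\<dots> = s / 8"
    proof -
      have "u * (v * (s / 8 / v / u)) = s / 8" if "0 < u" "0 < v" for u v :: real using that by simp
      note cancel = this
      show ?thesis by (rule cancel) (use cc W in auto)
    qed
    finally have "(W + 1) * ((cc + 1) * \<delta>) \<le> s / 8" .
    moreover have "W * (cc * \<delta>) \<le> (W + 1) * ((cc + 1) * \<delta>)" using W cc \<delta> by (intro mult_mono) auto
    ultimately show ?thesis by linarith
  qed
  have "\<forall>d. \<exists>z. L.ivp d (tsrc q M \<mu>' z) z" using L.tsrc_ivp_exists[OF q Mp mu'(1)] by blast
  then obtain Z0 where Z0: "\<And>d. L.ivp d (tsrc q M \<mu>' (Z0 d)) (Z0 d)" by metis
  have "\<forall>d. \<exists>z. R.ivp d (tsrc q M \<mu>' z) z" using R.tsrc_ivp_exists[OF q Mp mu'(1)] by blast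
  then obtain Z1 where Z1: "\<And>d. R.ivp d (tsrc q M \<mu>' (Z1 d)) (Z1 d)" by metis
  define k where "k = (q - 1) * M powr (q - 2) + \<mu>1"
  have k: "0 \<le> k" using q \<mu>1_pos by (simp add: k_def)
  have lip: "\<bar>tsrc q M \<mu>' z t - tsrc q M \<mu>' w t\<bar> \<le> k * \<bar>z t - w t\<bar>" for z w t
    using tsrc_diff[OF q Mp mu', of z t \<mu>' w] by (simp add: k_def)
  note c0 = L.ivp_family_continuous[OF Z0 k lip mem_m(1)] and c1 = R.ivp_family_continuous[OF Z1 k lip mem_m(2)]
  define U where "U p = Z0 (\<alpha> + fst p) m - Z1 (\<beta> + snd p) (1 - m)" for p :: "real \<times> real"
  define V where "V p = L.K (tsrc q M \<mu>' (Z0 (\<alpha> + fst p))) m + R.K (tsrc q M \<mu>' (Z1 (\<beta> + snd p))) (1 - m)" for p :: "real \<times> real"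
  have dc: "continuous_on UNIV (\<lambda>p. \<alpha> + fst p :: real)" "continuous_on UNIV (\<lambda>p. \<beta> + snd p :: real)" by (intro continuous_intros)+
  have Uc: "continuous_on UNIV U" unfolding U_def
    by (intro continuous_on_diff continuous_on_compose2[OF c0(1) dc(1)] continuous_on_compose2[OF c1(1) dc(2)]) auto
  have Vc: "continuous_on UNIV V" unfolding V_def
    by (intro continuous_on_add continuous_on_compose2[OF c0(2) dc(1)] continuous_on_compose2[OF c1(2) dc(2)]) auto
  \<comment> \<open>Cramer's rule: \<open>(F, G)\<close> is the inverse of the linear part applied
    to \<open>(U, V)\<close>, hence close to the identity on the box, which gives the signs on its
    faces.\<close>
  define F where "F p = (kR * U p + p1 * V p) / D" for p
  define G where "G p = (p0 * V p - kL * U p) / D" for p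
  have Fc: "continuous_on UNIV F" unfolding F_def using D by (intro continuous_intros Uc Vc) auto
  have Gc: "continuous_on UNIV G" unfolding G_def using D by (intro continuous_intros Uc Vc) auto
  have tri1: "\<bar>u - h - v\<bar> \<le> B \<Longrightarrow> \<bar>u' - h' - v'\<bar> \<le> B \<Longrightarrow> h = h' \<Longrightarrow> \<bar>(u - u') - (v - v')\<bar> \<le> 2 * B"
    and tri2: "\<bar>u - h - v\<bar> \<le> B \<Longrightarrow> \<bar>u' - h' - v'\<bar> \<le> B \<Longrightarrow> h + h' = 0 \<Longrightarrow> \<bar>(u + u') - (v + v')\<bar> \<le> 2 * B"
    for u u' v v' h h' B :: real by linarith+
  have est: "\<bar>U (x, y) - (x * p0 - y * p1)\<bar> \<le> 2 * (\<epsilon> * s + cc * \<delta>)" "\<bar>V (x, y) - (x * kL + y * kR)\<bar> \<le> 2 * (\<epsilon> * s + cc * \<delta>)"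
    if x: "x \<in> {-s..s}" and y: "y \<in> {-s..s}" for x y
  proof -
    have xs: "\<bar>x\<bar> \<le> s" "\<bar>y\<bar> \<le> s" using x y by auto
    then have xr: "\<bar>x\<bar> \<le> \<rho>L" "\<bar>y\<bar> \<le> \<rho>R" using sr by auto
    note X = eL[OF xr(1) mu' Z0] and Y = eR[OF xr(2) mu' Z1]
    have bx: "\<epsilon> * \<bar>x\<bar> + cL * \<bar>\<mu>' - \<mu>\<bar> \<le> \<epsilon> * s + cc * \<delta>" "\<epsilon> * \<bar>y\<bar> + cR * \<bar>\<mu>' - \<mu>\<bar> \<le> \<epsilon> * s + cc * \<delta>"
      unfolding \<mu>'(3) using xs \<epsilon> cc \<delta> by (auto intro!: add_mono mult_left_mono mult_right_mono)
    show "\<bar>U (x, y) - (x * p0 - y * p1)\<bar> \<le> 2 * (\<epsilon> * s + cc * \<delta>)"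
      unfolding U_def fst_conv snd_conv
      by (rule tri1[OF order_trans[OF X[THEN conjunct2, THEN conjunct1] bx(1)] order_trans[OF Y[THEN conjunct2, THEN conjunct1] bx(2)] S(5)])
    show "\<bar>V (x, y) - (x * kL + y * kR)\<bar> \<le> 2 * (\<epsilon> * s + cc * \<delta>)"
      unfolding V_def fst_conv snd_conv
      by (rule tri2[OF order_trans[OF X[THEN conjunct2, THEN conjunct2] bx(1)] order_trans[OF Y[THEN conjunct2, THEN conjunct2] bx(2)] T(3)])
  qed
  have comb: "\<bar>(u * r + v * w) / D\<bar> \<le> W * B" if "\<bar>r\<bar> \<le> B" "\<bar>w\<bar> \<le> B" "\<bar>u\<bar> + \<bar>v\<bar> \<le> \<bar>kR\<bar> + \<bar>p1\<bar> + \<bar>kL\<bar> + \<bar>p0\<bar>" for u v r w B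
  proof -
    have B0: "0 \<le> B" using that(1) by linarith
    have "\<bar>u * r + v * w\<bar> \<le> \<bar>u\<bar> * \<bar>r\<bar> + \<bar>v\<bar> * \<bar>w\<bar>" using abs_triangle_ineq[of "u * r" "v * w"] by (simp add: abs_mult)
    also have "\<dots> \<le> \<bar>u\<bar> * B + \<bar>v\<bar> * B" using that by (intro add_mono mult_left_mono) auto
    also have "\<dots> = (\<bar>u\<bar> + \<bar>v\<bar>) * B" by (simp add: distrib_right)
    also have "\<dots> \<le> (\<bar>kR\<bar> + \<bar>p1\<bar> + \<bar>kL\<bar> + \<bar>p0\<bar>) * B" using that B0 by (intro mult_right_mono) auto
    finally show ?thesis using D by (simp add: W_def divide_right_mono)
  qed
  have WB: "W * (2 * (\<epsilon> * s + cc * \<delta>)) \<le> s / 2"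
  proof -
    have "W * (2 * (\<epsilon> * s + cc * \<delta>)) = 2 * (W * \<epsilon> * s) + 2 * (W * (cc * \<delta>))" by (simp add: algebra_simps)
    also have "W * \<epsilon> * s \<le> 1/8 * s" using \<epsilon>(2) s0 by (intro mult_right_mono) auto
    finally show ?thesis using d2 by linarith
  qed
  have FG: "\<bar>F (x, y) - x\<bar> \<le> s / 2" "\<bar>G (x, y) - y\<bar> \<le> s / 2" if x: "x \<in> {-s..s}" and y: "y \<in> {-s..s}" for x y
  proof -
    have "F (x, y) - x = (kR * (U (x, y) - (x * p0 - y * p1)) + p1 * (V (x, y) - (x * kL + y * kR))) / D"
      unfolding F_def using D by (simp add: field_simps) (simp add: D_def algebra_simps)
    moreover have "\<bar>(kR * (U (x, y) - (x * p0 - y * p1)) + p1 * (V (x, y) - (x * kL + y * kR))) / D\<bar> \<le> W * (2 * (\<epsilon> * s + cc * \<delta>))"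
      by (rule comb[OF est[OF x y]]) simp
    ultimately show "\<bar>F (x, y) - x\<bar> \<le> s / 2" using order_trans[OF _ WB] by (simp only:)
    have "G (x, y) - y = ((- kL) * (U (x, y) - (x * p0 - y * p1)) + p0 * (V (x, y) - (x * kL + y * kR))) / D"
      unfolding G_def using D by (simp add: field_simps) (simp add: D_def algebra_simps)
    moreover have "\<bar>((- kL) * (U (x, y) - (x * p0 - y * p1)) + p0 * (V (x, y) - (x * kL + y * kR))) / D\<bar> \<le> W * (2 * (\<epsilon> * s + cc * \<delta>))"
      by (rule comb[OF est[OF x y]]) simp
    ultimately show "\<bar>G (x, y) - y\<bar> \<le> s / 2" using order_trans[OF _ WB] by (simp only:)
  qed
  have box: "- s \<le> s" using s0 by simp
  obtain x y where xy: "x \<in> {-s..s}" "y \<in> {-s..s}" "F (x, y) = 0" "G (x, y) = 0"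
  proof (rule poincare_miranda[OF box box continuous_on_subset[OF Fc] continuous_on_subset[OF Gc]])
    fix w assume w: "w \<in> {-s..s}"
    have e: "- s \<in> {-s..s}" "s \<in> {-s..s}" using s0 by auto
    show "F (- s, w) \<le> 0" using FG(1)[OF e(1) w] s0 by linarith
    show "0 \<le> F (s, w)" using FG(1)[OF e(2) w] s0 by linarith
    show "G (w, - s) \<le> 0" using FG(2)[OF w e(1)] s0 by linarith
    show "0 \<le> G (w, s)" using FG(2)[OF w e(2)] s0 by linarith
  qed (use that in auto)
  have UV: "kR * U (x, y) + p1 * V (x, y) = 0" "p0 * V (x, y) - kL * U (x, y) = 0"
    using xy(3,4) D by (simp_all add: F_def G_def)
  have "D * U (x, y) = p0 * (kR * U (x, y) + p1 * V (x, y)) - p1 * (p0 * V (x, y) - kL * U (x, y))"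
    "D * V (x, y) = kL * (kR * U (x, y) + p1 * V (x, y)) + kR * (p0 * V (x, y) - kL * U (x, y))"
    by (simp_all add: D_def algebra_simps)
  then have UV0: "U (x, y) = 0" "V (x, y) = 0" unfolding UV using D by auto
  define g0 g1 where "g0 = Z0 (\<alpha> + x)" and "g1 = Z1 (\<beta> + y)"
  have xs: "\<bar>x\<bar> \<le> s" "\<bar>y\<bar> \<le> s" using xy by auto
  then have xr: "\<bar>x\<bar> \<le> \<rho>L" "\<bar>y\<bar> \<le> \<rho>R" using sr by auto
  have gb0: "0 < g0 t \<and> g0 t \<le> M" if t: "t \<in> {0..m}" for t
  proof -
    have "\<bar>g0 t - h0 t\<bar> \<le> cL * (\<bar>x\<bar> + \<bar>\<mu>' - \<mu>\<bar>)" using eL[OF xr(1) mu' Z0] t by (simp add: g0_def)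
    also have "\<dots> \<le> cc * (s + \<delta>)" unfolding \<mu>'(3) using cc xs \<delta> by (intro mult_mono) auto
    also have "\<dots> \<le> e0" using se d1 by (simp add: distrib_left)
    finally show ?thesis using in0[OF t] by linarith
  qed
  have gb1: "0 < g1 t \<and> g1 t \<le> M" if t: "t \<in> {0..1 - m}" for t
  proof -
    have "\<bar>g1 t - h1 t\<bar> \<le> cR * (\<bar>y\<bar> + \<bar>\<mu>' - \<mu>\<bar>)" using eR[OF xr(2) mu' Z1] t by (simp add: g1_def)
    also have "\<dots> \<le> cc * (s + \<delta>)" unfolding \<mu>'(3) using cc xs \<delta> by (intro mult_mono) auto
    also have "\<dots> \<le> e0" using se d1 by (simp add: distrib_left)
    finally show ?thesis using in1[OF t] by linarith
  qed
  have "sol \<mu>' (\<alpha> + x) (\<beta> + y) g0 g1"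
  proof (rule tsrc_solI[OF _ _ gb0 gb1])
    show "L.ivp (\<alpha> + x) (tsrc q M \<mu>' g0) g0" "R.ivp (\<beta> + y) (tsrc q M \<mu>' g1) g1" unfolding g0_def g1_def by (rule Z0 Z1)+
    show "g0 m = g1 (1 - m)" using UV0 by (simp add: U_def g0_def g1_def)
    show "L.K (tsrc q M \<mu>' g0) m + R.K (tsrc q M \<mu>' g1) (1 - m) = 0" using UV0 by (simp add: V_def g0_def g1_def)
  qed
  moreover have "\<alpha> + x \<noteq> c \<mu>'"
  proof -
    have "\<bar>c \<mu>' - c \<mu>\<bar> < \<bar>\<alpha> - c \<mu>\<bar> / 2" using \<mu>'(3) \<delta>le by (intro \<delta>2(2)) simp
    note close = this
    show ?thesis
    proof
      assume "\<alpha> + x = c \<mu>'"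
      then have "\<alpha> - c \<mu> = (c \<mu>' - c \<mu>) - x" by simp
      then have "\<bar>\<alpha> - c \<mu>\<bar> \<le> \<bar>c \<mu>' - c \<mu>\<bar> + \<bar>x\<bar>" by (simp only: abs_triangle_ineq4)
      moreover have "d \<le> p + r \<Longrightarrow> p < d / 2 \<Longrightarrow> r \<le> d / 4 \<Longrightarrow> 0 \<le> d \<Longrightarrow> False" for d p r :: real by linarith
      ultimately show False using close order_trans[OF xs(1) sr(3)] abs_ge_zero[of "\<alpha> - c \<mu>"] by blast
    qed
  qed
  ultimately show ?thesis using \<mu>' by blast
qed

lemma degenerate_sol_exists:
  "\<exists>\<mu> \<alpha> \<beta> h0 h1 x y v0 v1. 0 < \<mu> \<and> sol \<mu> \<alpha> \<beta> h0 h1 \<and> \<alpha> \<noteq> c \<mu> \<and>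
     L.ivp x (\<lambda>r. ((q - 1) * h0 r powr (q - 2) - \<mu>) * v0 r) v0 \<and>
     R.ivp y (\<lambda>r. ((q - 1) * h1 r powr (q - 2) - \<mu>) * v1 r) v1 \<and> v0 m = v1 (1 - m) \<and>
     L.K (\<lambda>r. ((q - 1) * h0 r powr (q - 2) - \<mu>) * v0 r) m + R.K (\<lambda>r. ((q - 1) * h1 r powr (q - 2) - \<mu>) * v1 r) (1 - m) = 0 \<and>
     (x \<noteq> 0 \<or> y \<noteq> 0)"
proof -
  define S where "S = {\<mu>. 0 < \<mu> \<and> \<mu> < \<mu>1 \<and> (\<exists>\<alpha> \<beta> h0 h1. sol \<mu> \<alpha> \<beta> h0 h1 \<and> \<alpha> \<noteq> c \<mu>)}"
  have Sne: "S \<noteq> {}" using bifurcation unfolding S_def by blast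
  have bdd: "bdd_below S" by (rule bdd_belowI[of _ 0]) (auto simp: S_def)
  define \<mu> where "\<mu> = Inf S"
  have \<mu>1: "\<mu> < \<mu>1"
  proof -
    obtain x where "x \<in> S" using Sne by blast
    then have "\<mu> \<le> x" "x < \<mu>1" unfolding \<mu>_def using cInf_lower[OF _ bdd] by (auto simp: S_def)
    then show ?thesis by simp
  qed
  obtain M where M: "0 < M" and Mb: "\<And>\<mu> \<alpha> \<beta> h0 h1. 0 \<le> \<mu> \<Longrightarrow> \<mu> \<le> \<mu>1 \<Longrightarrow> sol \<mu> \<alpha> \<beta> h0 h1 \<Longrightarrow>
     0 < \<alpha> \<and> \<alpha> \<le> M \<and> 0 < \<beta> \<and> \<beta> \<le> M \<and> (\<forall>t\<in>{0..m}. h0 t < M) \<and> (\<forall>t\<in>{0..1 - m}. h1 t < M)"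
    by (rule sol_bounds) blast
  have "\<exists>\<nu> \<alpha> \<beta> h0 h1. 0 < \<nu> \<and> \<nu> < \<mu>1 \<and> sol \<nu> \<alpha> \<beta> h0 h1 \<and> \<alpha> \<noteq> c \<nu> \<and> \<mu> \<le> \<nu> \<and> \<nu> < \<mu> + 1 / real (Suc n)" for n
  proof -
    obtain \<nu> where "\<nu> \<in> S" "\<nu> < \<mu> + 1 / real (Suc n)"
      using cInf_lessD[OF Sne, of "\<mu> + 1 / real (Suc n)"] by (auto simp: \<mu>_def)
    moreover then have "\<mu> \<le> \<nu>" unfolding \<mu>_def using cInf_lower[OF _ bdd] by simp
    ultimately show ?thesis unfolding S_def by blast
  qed
  then obtain \<nu> \<alpha>s \<beta>s hs ks where seq: "\<And>n. 0 < \<nu> n" "\<And>n. \<nu> n < \<mu>1" "\<And>n. sol (\<nu> n) (\<alpha>s n) (\<beta>s n) (hs n) (ks n)"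
    "\<And>n. \<alpha>s n \<noteq> c (\<nu> n)" "\<And>n. \<mu> \<le> \<nu> n" "\<And>n. \<nu> n < \<mu> + 1 / real (Suc n)"
    by metis
  have \<nu>lim: "\<nu> \<longlonglongrightarrow> \<mu>"
  proof (rule tendsto_sandwich[of "\<lambda>_. \<mu>"])
    show "(\<lambda>n. \<mu> + 1 / real (Suc n)) \<longlonglongrightarrow> \<mu>"
      using tendsto_add[OF tendsto_const LIMSEQ_inverse_real_of_nat, of \<mu>] by (simp add: inverse_eq_divide)
  qed (use seq(5,6) in \<open>auto simp: less_imp_le\<close>)
  note bnd = Mb[OF less_imp_le[OF seq(1)] less_imp_le[OF seq(2)] seq(3)]
  have "compact ({0..M} \<times> {0..M})" by (intro compact_Times) auto
  moreover have "\<forall>n. (\<alpha>s n, \<beta>s n) \<in> {0..M} \<times> {0..M}" using bnd by (auto simp: less_imp_le)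
  ultimately obtain l r where r: "strict_mono r" "((\<lambda>n. (\<alpha>s n, \<beta>s n)) \<circ> r) \<longlonglongrightarrow> l"
    unfolding compact_def by meson
  have lim: "(\<lambda>n. \<nu> (r n)) \<longlonglongrightarrow> \<mu>" "(\<lambda>n. \<alpha>s (r n)) \<longlonglongrightarrow> fst l" "(\<lambda>n. \<beta>s (r n)) \<longlonglongrightarrow> snd l"
    using LIMSEQ_subseq_LIMSEQ[OF \<nu>lim r(1)] tendsto_fst[OF r(2)] tendsto_snd[OF r(2)] by (auto simp: o_def)
  have "\<exists>g0 g1. 0 < \<mu> \<and> sol \<mu> (fst l) (snd l) g0 g1 \<and> fst l \<noteq> c \<mu>"
    by (rule sol_limit[OF M seq(1,2,3,4) _ _ lim \<mu>1]) (use bnd in blast)+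
  then obtain h0 h1 where \<mu>0: "0 < \<mu>" and s: "sol \<mu> (fst l) (snd l) h0 h1" and nc: "fst l \<noteq> c \<mu>" by blast
  note Sd = solD[OF s]
  have ex0: "\<exists>\<psi>. L.ivp 1 (\<lambda>r. ((q - 1) * h0 r powr (q - 2) - \<mu>) * \<psi> r) \<psi>"
    by (rule L.linear_ivp_exists) (use L.ivpD(1)[OF Sd(1)] Sd(3) in \<open>force intro!: continuous_intros\<close>)
  then obtain \<psi>0 where \<psi>0: "L.ivp 1 (\<lambda>r. ((q - 1) * h0 r powr (q - 2) - \<mu>) * \<psi>0 r) \<psi>0" by blast
  have ex1: "\<exists>\<psi>. R.ivp 1 (\<lambda>r. ((q - 1) * h1 r powr (q - 2) - \<mu>) * \<psi> r) \<psi>"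
    by (rule R.linear_ivp_exists) (use R.ivpD(1)[OF Sd(2)] Sd(4) in \<open>force intro!: continuous_intros\<close>)
  then obtain \<psi>1 where \<psi>1: "R.ivp 1 (\<lambda>r. ((q - 1) * h1 r powr (q - 2) - \<mu>) * \<psi>1 r) \<psi>1" by blast
  define p0 p1 kL kR where "p0 = \<psi>0 m" and "p1 = \<psi>1 (1 - m)"
    and "kL = L.K (\<lambda>r. ((q - 1) * h0 r powr (q - 2) - \<mu>) * \<psi>0 r) m"
    and "kR = R.K (\<lambda>r. ((q - 1) * h1 r powr (q - 2) - \<mu>) * \<psi>1 r) (1 - m)"
  have det: "p0 * kR + p1 * kL = 0"
  proof (rule ccontr)
    assume "p0 * kR + p1 * kL \<noteq> 0"
    then obtain \<mu>' \<alpha>' \<beta>' g0 g1 where n: "0 < \<mu>'" "\<mu>' < \<mu>" "sol \<mu>' \<alpha>' \<beta>' g0 g1" "\<alpha>' \<noteq> c \<mu>'"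
      using persistence[OF \<mu>0 \<mu>1 s nc \<psi>0 \<psi>1] unfolding p0_def p1_def kL_def kR_def by blast
    then have "\<mu>' \<in> S" unfolding S_def using \<mu>1 by force
    then have "\<mu> \<le> \<mu>'" unfolding \<mu>_def by (rule cInf_lower[OF _ bdd])
    then show False using n by simp
  qed
  \<comment> \<open>A kernel vector of the singular matching matrix: the combination of the two
    linearized solutions whose values and derivatives fit at \<open>m\<close>. The cases treat a
    vanishing first row or a vanishing matrix.\<close>
  have "\<exists>x y. (x \<noteq> 0 \<or> y \<noteq> 0) \<and> x * p0 = y * p1 \<and> x * kL + y * kR = 0"
  proof (cases "p0 = 0 \<and> p1 = 0")
    case False
    then show ?thesis using det by (intro exI[of _ p1] exI[of _ p0]) (auto simp: algebra_simps)
  next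
    case True
    show ?thesis
    proof (cases "kL = 0 \<and> kR = 0")
      case True
      then show ?thesis using \<open>p0 = 0 \<and> p1 = 0\<close> by (intro exI[of _ 1] exI[of _ 0]) auto
    next
      case False
      then show ?thesis using \<open>p0 = 0 \<and> p1 = 0\<close> by (intro exI[of _ kR] exI[of _ "- kL"]) auto
    qed
  qed
  then obtain x y where xy: "x \<noteq> 0 \<or> y \<noteq> 0" "x * p0 = y * p1" "x * kL + y * kR = 0" by blast
  have v0: "L.ivp x (\<lambda>r. ((q - 1) * h0 r powr (q - 2) - \<mu>) * (x * \<psi>0 r)) (\<lambda>r. x * \<psi>0 r)"
    using L.ivp_cmult[OF \<psi>0, of x] by (simp add: mult.left_commute)
  have v1: "R.ivp y (\<lambda>r. ((q - 1) * h1 r powr (q - 2) - \<mu>) * (y * \<psi>1 r)) (\<lambda>r. y * \<psi>1 r)"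
    using R.ivp_cmult[OF \<psi>1, of y] by (simp add: mult.left_commute)
  have K0: "L.K (\<lambda>r. ((q - 1) * h0 r powr (q - 2) - \<mu>) * (x * \<psi>0 r)) m = x * kL"
    unfolding kL_def L.K_cmult[symmetric] by (simp add: mult.left_commute)
  have K1: "R.K (\<lambda>r. ((q - 1) * h1 r powr (q - 2) - \<mu>) * (y * \<psi>1 r)) (1 - m) = y * kR"
    unfolding kR_def R.K_cmult[symmetric] by (simp add: mult.left_commute)
  show ?thesis
    by (rule exI[of _ \<mu>], rule exI[of _ "fst l"], rule exI[of _ "snd l"], rule exI[of _ h0], rule exI[of _ h1],
        rule exI[of _ x], rule exI[of _ y], rule exI[of _ "\<lambda>r. x * \<psi>0 r"], rule exI[of _ "\<lambda>r. y * \<psi>1 r"])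
       (use \<mu>0 s nc v0 v1 K0 K1 xy in \<open>simp add: p0_def p1_def\<close>)
qed

end

section \<open>Gluing the two halves\<close>

lemma eq_of_derivatives_eq:
  fixes f g :: "real \<Rightarrow> real"
  assumes f: "\<And>x. x \<in> {u..v} \<Longrightarrow> (f has_real_derivative D x) (at x within {u..v})"
    and g: "\<And>x. x \<in> {u..v} \<Longrightarrow> (g has_real_derivative D x) (at x within {u..v})"
    and eq: "w \<in> {u..v}" "f w = g w" and t: "t \<in> {u..v}"
  shows "f t = g t"
proof -
  have "\<exists>c. \<forall>x\<in>{u..v}. f x - g x = c"
  proof (rule has_field_derivative_zero_constant)
    fix x assume "x \<in> {u..v}"
    from DERIV_diff[OF f[OF this] g[OF this]]
    show "((\<lambda>x. f x - g x) has_field_derivative 0) (at x within {u..v})" by simp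
  qed simp
  then obtain c where "\<And>x. x \<in> {u..v} \<Longrightarrow> f x - g x = c" by blast
  from this[OF eq(1)] this[OF t] show ?thesis using eq(2) by simp
qed

text \<open>The open set around \<open>[0, 1]\<close> provides two-sided derivatives at the end
  values, which are attained by \<open>|z_0|^2\<close> on the sphere and met by the chain rule
  there.\<close>

definition C2_profile :: "real set \<Rightarrow> (real \<Rightarrow> real) \<Rightarrow> (real \<Rightarrow> real) \<Rightarrow> (real \<Rightarrow> real) \<Rightarrow> bool" where
  "C2_profile U f f' f'' \<longleftrightarrow> open U \<and> {0..1} \<subseteq> U \<and> continuous_on U f'' \<and>
     (\<forall>t\<in>U. (f has_real_derivative f' t) (at t) \<and> (f' has_real_derivative f'' t) (at t))"

lemma C2_profile_cmult:
  assumes "C2_profile U f f' f''"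
  shows "C2_profile U (\<lambda>t. k * f t) (\<lambda>t. k * f' t) (\<lambda>t. k * f'' t)"
  using assms unfolding C2_profile_def by (auto intro!: continuous_intros DERIV_cmult)

text \<open>For \<open>s > 0\<close> uniqueness of the derivative identifies \<open>D\<close> with
  the formula of \<open>K_has_derivative\<close>; at the singular endpoint the equation follows by
  continuity.\<close>

lemma (in radial) K_C1_ode:
  assumes y: "\<And>s. s \<in> {0..m} \<Longrightarrow> (y has_real_derivative y' s) (at s within {0..m})"
    and y': "continuous_on {0..m} y'" and e1: "e = 1"
  obtains D where "continuous_on {0..m} D" "\<And>s. s \<in> {0..m} \<Longrightarrow> (K y has_real_derivative D s) (at s within {0..m})"
    "\<And>s. s \<in> {0..m} \<Longrightarrow> s * (1 - s) * D s + (a - (a + b) * s) * K y s = y s"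
proof -
  obtain D where D: "continuous_on {0..m} D" "\<And>s. s \<in> {0..m} \<Longrightarrow> (K y has_real_derivative D s) (at s within {0..m})"
    using K_C1[OF y y'] by blast
  have yc: "continuous_on {0..m} y" using y by (meson DERIV_continuous_on)
  define E where "E s = s * (1 - s) * D s + (a - (a + b) * s) * K y s - y s" for s
  have Ec: "continuous_on {0..m} E" unfolding E_def by (intro continuous_intros D(1) continuous_on_K yc)
  have pos: "E s = 0" if s: "0 < s" "s \<le> m" for s
  proof -
    have s1: "s < 1" using s em e1 by simp
    have "at s within {0..m} \<noteq> bot" using s m by (simp add: trivial_limit_within islimpt_Icc)
    moreover have "(K y has_real_derivative (y s - (a - (a + b) * s) * K y s) / (s * (1 - s))) (at s within {0..m})"
      using K_has_derivative[OF yc s] by (simp add: e1)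
    ultimately have "D s = (y s - (a - (a + b) * s) * K y s) / (s * (1 - s))"
      using D(2)[of s] s by (intro has_field_derivative_unique[of "K y" _ s "{0..m}"]) auto
    then show ?thesis using s s1 by (simp add: E_def)
  qed
  have "E 0 = 0"
    using continuous_constant_on_closure[of "{0<..<m}" E 0 0] pos Ec m by simp
  then have "E s = 0" if "s \<in> {0..m}" for s using pos that by (cases "s = 0") auto
  then show ?thesis using that[OF D] by (simp add: E_def)
qed

context two_sided
begin

text \<open>Equal values, first derivatives and sources at \<open>m\<close> suffice: the equation
  expresses the second derivative through them, and its leading coefficient
  \<open>m * (1 - m)\<close> is nonzero.\<close>

lemma glue:
  assumes i0: "L.ivp A y0 g0" and i1: "R.ivp B y1 g1" and val: "g0 m = g1 (1 - m)"
    and der: "L.K y0 m + R.K y1 (1 - m) = 0" and ym: "y0 m = y1 (1 - m)"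
    and d0: "\<And>s. s \<in> {0..m} \<Longrightarrow> (y0 has_real_derivative y0' s) (at s within {0..m})" "continuous_on {0..m} y0'"
    and d1: "\<And>s. s \<in> {0..1 - m} \<Longrightarrow> (y1 has_real_derivative y1' s) (at s within {0..1 - m})" "continuous_on {0..1 - m} y1'"
  obtains f f' f'' where "C2_profile {-1<..<2} f f' f''"
    "\<And>t. t \<in> {0..m} \<Longrightarrow> f t = g0 t" "\<And>t. t \<in> {m..1} \<Longrightarrow> f t = g1 (1 - t)"
    "\<And>t. t \<in> {0..m} \<Longrightarrow> t * (1 - t) * f'' t + (a - (a + b) * t) * f' t = - y0 t"
    "\<And>t. t \<in> {m..1} \<Longrightarrow> t * (1 - t) * f'' t + (a - (a + b) * t) * f' t = - y1 (1 - t)"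
proof -
  obtain D0 where D0: "continuous_on {0..m} D0" "\<And>s. s \<in> {0..m} \<Longrightarrow> (L.K y0 has_real_derivative D0 s) (at s within {0..m})"
    "\<And>s. s \<in> {0..m} \<Longrightarrow> s * (1 - s) * D0 s + (a - (a + b) * s) * L.K y0 s = y0 s"
    using L.K_C1_ode[OF d0 refl] by blast
  obtain D1 where D1: "continuous_on {0..1 - m} D1" "\<And>s. s \<in> {0..1 - m} \<Longrightarrow> (R.K y1 has_real_derivative D1 s) (at s within {0..1 - m})"
    "\<And>s. s \<in> {0..1 - m} \<Longrightarrow> s * (1 - s) * D1 s + (b - (b + a) * s) * R.K y1 s = y1 s"
    using R.K_C1_ode[OF d1 refl] by blast
  have Dm: "D0 m = D1 (1 - m)"
  proof -
    define E k where "E = a - (a + b) * m" and "k = L.K y0 m"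
    have "m * (1 - m) * D0 m + (a - (a + b) * m) * L.K y0 m = (1 - m) * (1 - (1 - m)) * D1 (1 - m) + (b - (b + a) * (1 - m)) * R.K y1 (1 - m)"
      using D0(3)[OF mem_m(1)] D1(3)[OF mem_m(2)] ym by simp
    moreover have "R.K y1 (1 - m) = - L.K y0 m" using der by simp
    moreover have "b - (b + a) * (1 - m) = - (a - (a + b) * m)" by (simp add: algebra_simps)
    ultimately have "m * (1 - m) * D0 m + E * k = (1 - m) * (1 - (1 - m)) * D1 (1 - m) + (- E) * (- k)"
      unfolding E_def k_def by (simp only:)
    then have "m * (1 - m) * D0 m = m * (1 - m) * D1 (1 - m)" by (simp add: mult.commute)
    then show ?thesis using m m0 by simp
  qed
  \<comment> \<open>The second derivative is continued by constants beyond \<open>[0, 1]\<close>.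
    \<open>F1\<close> and \<open>F\<close> are recovered from it by integration, so C^2 regularity
    across the endpoints is automatic.\<close>
  define F2 where "F2 t = (if t \<le> m then - D0 (max 0 t) else - D1 (1 - min 1 t))" for t
  have F2c: "continuous_on UNIV F2"
  proof -
    have "continuous_on ({..m} \<union> {m..}) (\<lambda>t. if t \<le> m then - D0 (max 0 t) else - D1 (1 - min 1 t))"
    proof (rule continuous_on_If)
      show "continuous_on {..m} (\<lambda>t. - D0 (max 0 t))"
        using m0 by (intro continuous_intros continuous_on_compose2[OF D0(1)]) auto
      show "continuous_on {m..} (\<lambda>t. - D1 (1 - min 1 t))"
        using m by (intro continuous_intros continuous_on_compose2[OF D1(1)]) auto
      show "- D0 (max 0 t) = - D1 (1 - min 1 t)" if "t \<in> {..m}" "\<not> t \<le> m" for t using that by simp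
      show "- D0 (max 0 t) = - D1 (1 - min 1 t)" if "t \<in> {m..}" "t \<le> m" for t
        using that Dm m0 m by simp
    qed auto
    moreover have "{..m} \<union> {m..} = UNIV" by auto
    ultimately show ?thesis by (simp add: F2_def[abs_def])
  qed
  define F1 where "F1 t = - L.K y0 0 + (integral {-1..t} F2 - integral {-1..0} F2)" for t
  have F1D: "(F1 has_real_derivative F2 t) (at t within {-1..2})" if "t \<in> {-1..2}" for t
    unfolding F1_def using integral_has_real_derivative[OF continuous_on_subset[OF F2c], of "-1" 2 t] that
    by (auto intro!: derivative_eq_intros)
  have F1c: "continuous_on {-1..2} F1" using F1D by (meson DERIV_continuous_on)
  define F where "F t = A + (integral {-1..t} F1 - integral {-1..0} F1)" for t
  have FD: "(F has_real_derivative F1 t) (at t within {-1..2})" if "t \<in> {-1..2}" for t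
    unfolding F_def using integral_has_real_derivative[OF F1c that]
    by (auto intro!: derivative_eq_intros)
  have sub0: "(H has_real_derivative D) (at t within {0..m})" if "(H has_real_derivative D) (at t within {-1..2})" for H D t
    using that by (rule DERIV_subset) (use m in auto)
  have sub1: "(H has_real_derivative D) (at t within {m..1})" if "(H has_real_derivative D) (at t within {-1..2})" for H D t
    using that by (rule DERIV_subset) (use m0 in auto)
  have F1L: "F1 t = - L.K y0 t" if t: "t \<in> {0..m}" for t
  proof (rule eq_of_derivatives_eq[of 0 m F1 F2 "\<lambda>t. - L.K y0 t" 0])
    fix x assume x: "x \<in> {0..m}"
    show "(F1 has_real_derivative F2 x) (at x within {0..m})" using x m by (intro sub0 F1D) auto
    have "F2 x = - D0 x" using x by (simp add: F2_def)
    then show "((\<lambda>t. - L.K y0 t) has_real_derivative F2 x) (at x within {0..m})"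
      using D0(2)[OF x] by (auto intro!: derivative_eq_intros)
  qed (use t m0 in \<open>auto simp: F1_def\<close>)
  have FL: "F t = g0 t" if t: "t \<in> {0..m}" for t
  proof (rule eq_of_derivatives_eq[of 0 m F F1 g0 0])
    fix x assume x: "x \<in> {0..m}"
    show "(F has_real_derivative F1 x) (at x within {0..m})" using x m by (intro sub0 FD) auto
    show "(g0 has_real_derivative F1 x) (at x within {0..m})"
      unfolding F1L[OF x] by (rule L.ivp_has_derivative[OF i0 x])
  qed (use t m0 L.ivp_at_0[OF i0] in \<open>auto simp: F_def\<close>)
  have refl_D: "((\<lambda>t. H (1 - t)) has_real_derivative - D) (at t within {m..1})"
    if "(H has_real_derivative D) (at (1 - t) within {0..1 - m})" for H D t
  proof -
    have im: "(\<lambda>t. 1 - t) ` {m..1} \<subseteq> {0..1 - m}" by auto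
    have "((\<lambda>t. H (1 - t)) has_real_derivative D * (- 1)) (at t within {m..1})"
      by (rule DERIV_image_chain[unfolded o_def, where g="\<lambda>t. 1 - t"])
         (rule DERIV_subset[OF that im], auto intro!: derivative_eq_intros)
    then show ?thesis by simp
  qed
  have F1R: "F1 t = R.K y1 (1 - t)" if t: "t \<in> {m..1}" for t
  proof (rule eq_of_derivatives_eq[of m 1 F1 F2 "\<lambda>t. R.K y1 (1 - t)" m])
    fix x assume x: "x \<in> {m..1}"
    show "(F1 has_real_derivative F2 x) (at x within {m..1})" using x m0 by (intro sub1 F1D) auto
    have "F2 x = - D1 (1 - x)" using x Dm m0 by (auto simp: F2_def)
    then show "((\<lambda>t. R.K y1 (1 - t)) has_real_derivative F2 x) (at x within {m..1})"
      using refl_D[OF D1(2)[of "1 - x"]] x by auto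
  qed (use t m der F1L[OF mem_m(1)] in auto)
  have FR: "F t = g1 (1 - t)" if t: "t \<in> {m..1}" for t
  proof (rule eq_of_derivatives_eq[of m 1 F F1 "\<lambda>t. g1 (1 - t)" m])
    fix x assume x: "x \<in> {m..1}"
    show "(F has_real_derivative F1 x) (at x within {m..1})" using x m0 by (intro sub1 FD) auto
    show "((\<lambda>t. g1 (1 - t)) has_real_derivative F1 x) (at x within {m..1})"
      unfolding F1R[OF x] using refl_D[OF R.ivp_has_derivative[OF i1, of "1 - x"]] x by auto
  qed (use t m val FL[OF mem_m(1)] in auto)
  show ?thesis
  proof (rule that[of F F1 F2])
    show "C2_profile {-1<..<2} F F1 F2"
      unfolding C2_profile_def
    proof (intro conjI ballI)
      fix t :: real assume t: "t \<in> {-1<..<2}"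
      show "(F has_real_derivative F1 t) (at t)" using FD[of t] t by (simp add: at_within_Icc_at)
      show "(F1 has_real_derivative F2 t) (at t)" using F1D[of t] t by (simp add: at_within_Icc_at)
    qed (auto intro: continuous_on_subset[OF F2c])
    show "t * (1 - t) * F2 t + (a - (a + b) * t) * F1 t = - y0 t" if t: "t \<in> {0..m}" for t
    proof -
      have "F2 t = - D0 t" using t by (simp add: F2_def)
      then show ?thesis using D0(3)[OF t] F1L[OF t] by simp
    qed
    show "t * (1 - t) * F2 t + (a - (a + b) * t) * F1 t = - y1 (1 - t)" if t: "t \<in> {m..1}" for t
    proof -
      have F2: "F2 t = - D1 (1 - t)" using t Dm m0 by (auto simp: F2_def)
      have "1 - t \<in> {0..1 - m}" using t by auto
      note O = D1(3)[OF this]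
      define E k where "E = a - (a + b) * t" and "k = R.K y1 (1 - t)"
      have "b - (b + a) * (1 - t) = - E" by (simp add: E_def algebra_simps)
      then have "(1 - t) * (1 - (1 - t)) * D1 (1 - t) + (- E) * k = y1 (1 - t)" using O unfolding k_def by (simp only:)
      then have "t * (1 - t) * - D1 (1 - t) + E * k = - y1 (1 - t)" by (simp add: algebra_simps)
      then show ?thesis unfolding F2 F1R[OF t] E_def k_def .
    qed
  qed (use FL FR in auto)
qed

lemma profile_exists:
  obtains \<mu> f f' f'' v v' v'' where "0 < \<mu>" "C2_profile {-1<..<2} f f' f''" "C2_profile {-1<..<2} v v' v''"
    "\<And>t. t \<in> {0..1} \<Longrightarrow> 0 < f t" "\<And>k. \<exists>t\<in>{0..1}. f t \<noteq> k"
    "\<And>t. t \<in> {0..1} \<Longrightarrow> t * (1 - t) * f'' t + (a - (a + b) * t) * f' t + \<mu> * (f t powr (q - 1) - f t) = 0"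
    "\<exists>t\<in>{0..1}. v t \<noteq> 0"
    "\<And>t. t \<in> {0..1} \<Longrightarrow> t * (1 - t) * v'' t + (a - (a + b) * t) * v' t + \<mu> * ((q - 1) * f t powr (q - 2) - 1) * v t = 0"
proof -
  obtain \<mu> \<alpha> \<beta> h0 h1 x y v0 v1 where \<mu>: "0 < \<mu>" and s: "sol \<mu> \<alpha> \<beta> h0 h1" and nc: "\<alpha> \<noteq> c \<mu>"
    and w0: "L.ivp x (\<lambda>r. ((q - 1) * h0 r powr (q - 2) - \<mu>) * v0 r) v0"
    and w1: "R.ivp y (\<lambda>r. ((q - 1) * h1 r powr (q - 2) - \<mu>) * v1 r) v1"
    and wm: "v0 m = v1 (1 - m)"
    and wd: "L.K (\<lambda>r. ((q - 1) * h0 r powr (q - 2) - \<mu>) * v0 r) m + R.K (\<lambda>r. ((q - 1) * h1 r powr (q - 2) - \<mu>) * v1 r) (1 - m) = 0"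
    and xy: "x \<noteq> 0 \<or> y \<noteq> 0"
    using degenerate_sol_exists by (elim exE conjE) (rule that)
  note S = solD[OF s]
  have c0: "0 < c \<mu>" by (rule c_pos[OF \<mu>])
  define n0 where "n0 r = (q - 1) * h0 r powr (q - 2) - \<mu>" for r
  define n1 where "n1 r = (q - 1) * h1 r powr (q - 2) - \<mu>" for r
  define k0 where "k0 = L.K (src \<mu> h0)"
  define k1 where "k1 = R.K (src \<mu> h1)"
  define l0 where "l0 = L.K (\<lambda>r. n0 r * v0 r)"
  define l1 where "l1 = R.K (\<lambda>r. n1 r * v1 r)"
  have w0': "L.ivp x (\<lambda>r. n0 r * v0 r) v0" and w1': "R.ivp y (\<lambda>r. n1 r * v1 r) v1"
    using w0 w1 by (simp_all add: n0_def n1_def)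
  have cont: "continuous_on {0..m} h0" "continuous_on {0..1 - m} h1" "continuous_on {0..m} k0" "continuous_on {0..1 - m} k1"
    "continuous_on {0..m} v0" "continuous_on {0..1 - m} v1" "continuous_on {0..m} l0" "continuous_on {0..1 - m} l1"
    unfolding k0_def k1_def l0_def l1_def
    using L.ivpD(1)[OF S(1)] R.ivpD(1)[OF S(2)] L.continuous_on_K[OF L.ivpD(2)[OF S(1)]] R.continuous_on_K[OF R.ivpD(2)[OF S(2)]]
      L.ivpD(1)[OF w0'] R.ivpD(1)[OF w1'] L.continuous_on_K[OF L.ivpD(2)[OF w0']] R.continuous_on_K[OF R.ivpD(2)[OF w1']] by auto
  have nz0: "\<forall>x\<in>{0..m}. h0 x \<noteq> 0" and nz1: "\<forall>x\<in>{0..1 - m}. h1 x \<noteq> 0" using S(3,4) by force+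
  have nc0: "continuous_on {0..m} n0" unfolding n0_def by (intro continuous_intros cont nz0)
  have nc1: "continuous_on {0..1 - m} n1" unfolding n1_def by (intro continuous_intros cont nz1)
  have dh0: "(h0 has_real_derivative - k0 t) (at t within {0..m})" if "t \<in> {0..m}" for t
    unfolding k0_def by (rule L.ivp_has_derivative[OF S(1) that])
  have dh1: "(h1 has_real_derivative - k1 t) (at t within {0..1 - m})" if "t \<in> {0..1 - m}" for t
    unfolding k1_def by (rule R.ivp_has_derivative[OF S(2) that])
  have dv0: "(v0 has_real_derivative - l0 t) (at t within {0..m})" if "t \<in> {0..m}" for t
    unfolding l0_def by (rule L.ivp_has_derivative[OF w0' that])
  have dv1: "(v1 has_real_derivative - l1 t) (at t within {0..1 - m})" if "t \<in> {0..1 - m}" for t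
    unfolding l1_def by (rule R.ivp_has_derivative[OF w1' that])
  have D0: "(src \<mu> h0 has_real_derivative n0 t * (- k0 t)) (at t within {0..m})" if t: "t \<in> {0..m}" for t
    unfolding src_def[abs_def] n0_def using S(3)[OF t] dh0[OF t]
    by (auto intro!: derivative_eq_intros simp: algebra_simps)
  have D1: "(src \<mu> h1 has_real_derivative n1 t * (- k1 t)) (at t within {0..1 - m})" if t: "t \<in> {0..1 - m}" for t
    unfolding src_def[abs_def] n1_def using S(4)[OF t] dh1[OF t]
    by (auto intro!: derivative_eq_intros simp: algebra_simps)
  have cD0: "continuous_on {0..m} (\<lambda>t. n0 t * (- k0 t))" and cD1: "continuous_on {0..1 - m} (\<lambda>t. n1 t * (- k1 t))"
    by (intro continuous_intros nc0 nc1 cont)+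
  have sm: "src \<mu> h0 m = src \<mu> h1 (1 - m)" using S(5) by (simp add: src_def)
  obtain f f' f'' where f: "C2_profile {-1<..<2} f f' f''"
    "\<And>t. t \<in> {0..m} \<Longrightarrow> f t = h0 t" "\<And>t. t \<in> {m..1} \<Longrightarrow> f t = h1 (1 - t)"
    "\<And>t. t \<in> {0..m} \<Longrightarrow> t * (1 - t) * f'' t + (a - (a + b) * t) * f' t = - src \<mu> h0 t"
    "\<And>t. t \<in> {m..1} \<Longrightarrow> t * (1 - t) * f'' t + (a - (a + b) * t) * f' t = - src \<mu> h1 (1 - t)"
    by (rule glue[OF S(1,2,5,6) sm D0 cD0 D1 cD1]) (rule that | assumption)+
  have E0: "((\<lambda>r. n0 r * v0 r) has_real_derivative (q - 1) * ((q - 2) * h0 t powr (q - 3)) * (- k0 t) * v0 t + n0 t * (- l0 t)) (at t within {0..m})"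
    if t: "t \<in> {0..m}" for t
    unfolding n0_def using S(3)[OF t] dh0[OF t] dv0[OF t]
    by (auto intro!: derivative_eq_intros simp: algebra_simps)
  have E1: "((\<lambda>r. n1 r * v1 r) has_real_derivative (q - 1) * ((q - 2) * h1 t powr (q - 3)) * (- k1 t) * v1 t + n1 t * (- l1 t)) (at t within {0..1 - m})"
    if t: "t \<in> {0..1 - m}" for t
    unfolding n1_def using S(4)[OF t] dh1[OF t] dv1[OF t]
    by (auto intro!: derivative_eq_intros simp: algebra_simps)
  have cE0: "continuous_on {0..m} (\<lambda>t. (q - 1) * ((q - 2) * h0 t powr (q - 3)) * (- k0 t) * v0 t + n0 t * (- l0 t))"
    by (intro continuous_intros nc0 cont nz0)
  have cE1: "continuous_on {0..1 - m} (\<lambda>t. (q - 1) * ((q - 2) * h1 t powr (q - 3)) * (- k1 t) * v1 t + n1 t * (- l1 t))"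
    by (intro continuous_intros nc1 cont nz1)
  have wd': "L.K (\<lambda>r. n0 r * v0 r) m + R.K (\<lambda>r. n1 r * v1 r) (1 - m) = 0" using wd by (simp add: n0_def n1_def)
  have wn: "n0 m * v0 m = n1 (1 - m) * v1 (1 - m)" using S(5) wm by (simp add: n0_def n1_def)
  obtain v v' v'' where v: "C2_profile {-1<..<2} v v' v''"
    "\<And>t. t \<in> {0..m} \<Longrightarrow> v t = v0 t" "\<And>t. t \<in> {m..1} \<Longrightarrow> v t = v1 (1 - t)"
    "\<And>t. t \<in> {0..m} \<Longrightarrow> t * (1 - t) * v'' t + (a - (a + b) * t) * v' t = - (n0 t * v0 t)"
    "\<And>t. t \<in> {m..1} \<Longrightarrow> t * (1 - t) * v'' t + (a - (a + b) * t) * v' t = - (n1 (1 - t) * v1 (1 - t))"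
    by (rule glue[OF w0' w1' wm wd' wn E0 cE0 E1 cE1]) (rule that | assumption)+
  have ode: "t * (1 - t) * f'' t + (a - (a + b) * t) * f' t = - (f t powr (q - 1) - \<mu> * f t)" if t: "t \<in> {0..1}" for t
    using f(2-5)[of t] t by (cases "t \<le> m") (auto simp: src_def)
  have lode: "t * (1 - t) * v'' t + (a - (a + b) * t) * v' t = - (((q - 1) * f t powr (q - 2) - \<mu>) * v t)" if t: "t \<in> {0..1}" for t
    using f(2,3)[of t] v(2-5)[of t] t by (cases "t \<le> m") (auto simp: n0_def n1_def)
  have fpos: "0 < f t" if t: "t \<in> {0..1}" for t
    using f(2,3)[of t] S(3)[of t] S(4)[of "1 - t"] t by (cases "t \<le> m") auto
  \<comment> \<open>Dividing by the constant solution turns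
    \<open>L h + h powr (q - 1) - \<mu> * h = 0\<close> into the normalized equation, whose constant
    solution is \<open>1\<close>.\<close>
  define d where "d = 1 / c \<mu>"
  have d: "0 < d" using c0 by (simp add: d_def)
  have dp: "f t powr (q - 1) = c \<mu> * \<mu> * (d * f t) powr (q - 1)" "f t powr (q - 2) = \<mu> * (d * f t) powr (q - 2)" for t
  proof -
    have ff: "f t = c \<mu> * (d * f t)" using c0 by (simp add: d_def)
    show "f t powr (q - 1) = c \<mu> * \<mu> * (d * f t) powr (q - 1)"
      by (subst ff, subst powr_mult) (simp add: c_powr(2)[OF \<mu>])
    show "f t powr (q - 2) = \<mu> * (d * f t) powr (q - 2)"
      by (subst ff, subst powr_mult) (simp add: c_powr(1)[OF \<mu>])
  qed
  show ?thesis
  proof (rule that[OF \<mu> C2_profile_cmult[OF f(1), of d] v(1)])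
    show "0 < d * f t" if "t \<in> {0..1}" for t using fpos[OF that] d by simp
    show "\<exists>t\<in>{0..1}. d * f t \<noteq> k" for k
    proof (rule ccontr)
      assume "\<not> ?thesis"
      then have "\<forall>t\<in>{0..1}. d * f t = k" by simp
      then have const: "\<And>t. t \<in> {0..1} \<Longrightarrow> f t = k / d" using d by (simp add: field_simps)
      \<comment> \<open>For a constant \<open>f\<close> both derivatives vanish at
        \<open>1/2\<close>, and the equation there forces the excluded value
        \<open>\<alpha> = c \<mu>\<close>.\<close>
      have f1: "f' t = 0" if t: "t \<in> {0<..<1}" for t
      proof -
        have "(f has_real_derivative 0) (at t)"
          by (rule has_field_derivative_transform_within_open[of "\<lambda>_. k / d" _ _ "{0<..<1}"]) (use t const in auto)
        moreover have "(f has_real_derivative f' t) (at t)" using f(1) t by (auto simp: C2_profile_def)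
        ultimately show ?thesis using DERIV_unique by blast
      qed
      have "(f' has_real_derivative 0) (at (1/2))"
        by (rule has_field_derivative_transform_within_open[of "\<lambda>_. 0" _ _ "{0<..<1}"]) (use f1 in auto)
      moreover have "(f' has_real_derivative f'' (1/2)) (at (1/2))" using f(1) by (auto simp: C2_profile_def)
      ultimately have f2: "f'' (1/2) = 0" using DERIV_unique by blast
      have fa: "f (1/2) = \<alpha>" using const[of "1/2"] const[of 0] f(2)[of 0] L.ivp_at_0[OF S(1)] m0 by simp
      have \<alpha>: "0 < \<alpha>" using fpos[of "1/2"] fa by simp
      have "\<alpha> powr (q - 1) = \<mu> * \<alpha>" using ode[of "1/2"] f2 f1[of "1/2"] fa by simp
      moreover have "\<alpha> powr (q - 1) = \<alpha> * \<alpha> powr (q - 2)"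
      proof -
        have "\<alpha> powr (q - 1) = \<alpha> powr (1 + (q - 2))" by simp
        then show ?thesis unfolding powr_add using \<alpha> by simp
      qed
      ultimately have "\<alpha> powr (q - 2) = \<mu>" using \<alpha> by simp
      then have "c \<mu> = (\<alpha> powr (q - 2)) powr (1 / (q - 2))" by (simp add: c_def)
      also have "\<dots> = \<alpha>" using \<alpha> q by (simp add: powr_powr)
      finally show False using nc by simp
    qed
    show "t * (1 - t) * (d * f'' t) + (a - (a + b) * t) * (d * f' t) + \<mu> * ((d * f t) powr (q - 1) - d * f t) = 0" if t: "t \<in> {0..1}" for t
    proof -
      have "t * (1 - t) * (d * f'' t) + (a - (a + b) * t) * (d * f' t) = d * (t * (1 - t) * f'' t + (a - (a + b) * t) * f' t)"
        by (simp add: algebra_simps)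
      also have "\<dots> = - (d * (c \<mu> * \<mu> * (d * f t) powr (q - 1)) - \<mu> * (d * f t))"
        unfolding ode[OF t] dp(1)[of t] by (simp add: algebra_simps)
      also have "d * (c \<mu> * \<mu> * (d * f t) powr (q - 1)) = \<mu> * (d * f t) powr (q - 1)" using c0 by (simp add: d_def)
      finally show ?thesis by (simp add: algebra_simps)
    qed
    show "\<exists>t\<in>{0..1}. v t \<noteq> 0"
    proof -
      have "v 0 = x" using v(2)[of 0] L.ivp_at_0[OF w0'] m0 by simp
      moreover have "v 1 = y" using v(3)[of 1] R.ivp_at_0[OF w1'] m by simp
      ultimately show ?thesis using xy by (auto intro: bexI[of _ 0] bexI[of _ 1])
    qed
    show "t * (1 - t) * v'' t + (a - (a + b) * t) * v' t + \<mu> * ((q - 1) * (d * f t) powr (q - 2) - 1) * v t = 0" if t: "t \<in> {0..1}" for t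
      using lode[OF t] unfolding dp(2)[of t] by (simp add: algebra_simps)
  qed
qed

end

section \<open>Radial functions on quaternionic projective space\<close>

text \<open>Passes from a gradient field \<open>G\<close> and its derivative \<open>H\<close> to the
  operator-valued derivatives in \<open>C2_on\<close>. Continuity is checked direction by direction,
  which suffices in finite dimension.\<close>

lemma C2_onI:
  fixes f :: "'a::euclidean_space \<Rightarrow> real" and G :: "'a \<Rightarrow> 'a" and H :: "'a \<Rightarrow> 'a \<Rightarrow> 'a"
  assumes f: "\<And>x. x \<in> S \<Longrightarrow> (f has_derivative (\<lambda>v. G x \<bullet> v)) (at x)"
    and G: "\<And>x. x \<in> S \<Longrightarrow> (G has_derivative H x) (at x)"
    and H: "\<And>v. continuous_on S (\<lambda>x. H x v)"
  shows "C2_on S f"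
proof -
  define Df where "Df x = blinfun_inner_right (G x)" for x
  define D2f where "D2f x = Blinfun (\<lambda>v. blinfun_inner_right (H x v))" for x
  have bl: "bounded_linear (\<lambda>v. blinfun_inner_right (H x v))" if "x \<in> S" for x
    by (rule bounded_linear_compose[OF bounded_linear_blinfun_inner_right has_derivative_bounded_linear[OF G[OF that]]])
  have app: "blinfun_apply (D2f x) = (\<lambda>v. blinfun_inner_right (H x v))" if "x \<in> S" for x
    unfolding D2f_def by (rule bounded_linear_Blinfun_apply[OF bl[OF that]])
  have "(f has_derivative blinfun_apply (Df x)) (at x)" if "x \<in> S" for x
    using f[OF that] by (simp add: Df_def blinfun_inner_right.rep_eq[abs_def])
  moreover have "(Df has_derivative blinfun_apply (D2f x)) (at x)" if "x \<in> S" for x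
    unfolding app[OF that] Df_def
    by (rule bounded_linear.has_derivative[OF bounded_linear_blinfun_inner_right G[OF that]])
  moreover have "continuous_on S D2f"
  proof (rule continuous_on_blinfun_componentwise)
    fix i :: 'a
    have "continuous_on S (\<lambda>x. blinfun_inner_right (H x i))"
      by (rule bounded_linear.continuous_on[OF bounded_linear_blinfun_inner_right H])
    then show "continuous_on S (\<lambda>x. blinfun_apply (D2f x) i)"
      by (rule continuous_on_eq) (simp add: app)
  qed
  ultimately show ?thesis unfolding C2_on_def by blast
qed

text \<open>The outer \<open>deriv\<close> sees the inner one on a whole neighbourhood of
  \<open>0\<close>, so the gradient must be known on an open set, not just at
  \<open>x\<close>.\<close>

lemma lap_eq_trace:
  fixes f :: "'a::euclidean_space \<Rightarrow> real" and G :: "'a \<Rightarrow> 'a" and H :: "'a \<Rightarrow> 'a"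
  assumes S: "open S" "x \<in> S"
    and f: "\<And>y. y \<in> S \<Longrightarrow> (f has_derivative (\<lambda>v. G y \<bullet> v)) (at y)"
    and G: "(G has_derivative H) (at x)"
  shows "lap f x = (\<Sum>b\<in>Basis. H b \<bullet> b)"
  unfolding lap_def
proof (rule sum.cong[OF refl])
  fix b :: 'a
  interpret H: bounded_linear H by (rule has_derivative_bounded_linear[OF G])
  have line: "((\<lambda>s. x + s *\<^sub>R b) has_derivative (\<lambda>s. s *\<^sub>R b)) (at t)" for t
    by (auto intro!: derivative_eq_intros)
  have inner: "deriv (\<lambda>s. f (x + s *\<^sub>R b)) t = G (x + t *\<^sub>R b) \<bullet> b" if "x + t *\<^sub>R b \<in> S" for t
  proof -
    have "((\<lambda>s. f (x + s *\<^sub>R b)) has_derivative (\<lambda>s. G (x + t *\<^sub>R b) \<bullet> (s *\<^sub>R b))) (at t)"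
      by (rule has_derivative_compose[OF line f[OF that]])
    then have "((\<lambda>s. f (x + s *\<^sub>R b)) has_real_derivative G (x + t *\<^sub>R b) \<bullet> b) (at t)"
      by (rule has_derivative_imp_has_field_derivative) simp
    then show ?thesis by (rule DERIV_imp_deriv)
  qed
  have "\<forall>\<^sub>F t in nhds 0. x + t *\<^sub>R b \<in> S"
  proof -
    have "((\<lambda>t. x + t *\<^sub>R b) \<longlongrightarrow> x + 0 *\<^sub>R b) (nhds 0)"
      by (intro tendsto_intros filterlim_ident)
    then show ?thesis using S by (auto simp: tendsto_def)
  qed
  then have ev: "\<forall>\<^sub>F t in nhds 0. deriv (\<lambda>s. f (x + s *\<^sub>R b)) t = G (x + t *\<^sub>R b) \<bullet> b"
    by eventually_elim (rule inner)
  have G0: "(G has_derivative H) (at (x + 0 *\<^sub>R b))" using G by simp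
  have "((\<lambda>t. G (x + t *\<^sub>R b) \<bullet> b) has_derivative (\<lambda>t. H (t *\<^sub>R b) \<bullet> b)) (at 0)"
    by (rule has_derivative_inner_left[OF has_derivative_compose[OF line G0]])
  then have "((\<lambda>t. G (x + t *\<^sub>R b) \<bullet> b) has_real_derivative H b \<bullet> b) (at 0)"
    by (rule has_derivative_imp_has_field_derivative) (simp add: H.scaleR)
  then show "deriv (\<lambda>t. deriv (\<lambda>s. f (x + s *\<^sub>R b)) t) 0 = H b \<bullet> b"
    using deriv_cong_ev[OF ev refl] DERIV_imp_deriv by metis
qed

text \<open>For the projection \<open>P\<close> onto the coordinate \<open>z_0\<close>,
  \<open>T\<close> is the 0-homogeneous extension of \<open>|z_0|^2\<close> from the unit sphere.
  The calculus is coordinate-free; of \<open>P\<close> only the trace enters the Laplacian.\<close>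

locale orthogonal_projection =
  fixes P :: "'a::euclidean_space \<Rightarrow> 'a"
  assumes linear: "bounded_linear P" and selfadjoint: "P x \<bullet> y = x \<bullet> P y" and idem: "P (P x) = P x"
begin

definition T where "T x = (P x \<bullet> x) / (x \<bullet> x)"

lemma P_inner: "P x \<bullet> x = P x \<bullet> P x"
  by (metis selfadjoint idem)

lemma T_range: "T x \<in> {0..1}"
proof -
  have "(x - P x) \<bullet> (x - P x) = x \<bullet> x - P x \<bullet> x"
    by (simp add: inner_diff_left inner_diff_right P_inner[symmetric] inner_commute[of x "P x"])
  then have "P x \<bullet> x \<le> x \<bullet> x" using inner_ge_zero[of "x - P x"] by simp
  moreover have "0 \<le> P x \<bullet> x" by (simp add: P_inner)
  ultimately show ?thesis by (cases "x = 0") (auto simp: T_def)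
qed

definition grad where "grad x = (2 / (x \<bullet> x)) *\<^sub>R (P x - T x *\<^sub>R x)"

definition dgrad where "dgrad x v = (- (4 * (x \<bullet> v)) / (x \<bullet> x)\<^sup>2) *\<^sub>R (P x - T x *\<^sub>R x)
    + (2 / (x \<bullet> x)) *\<^sub>R (P v - (grad x \<bullet> v) *\<^sub>R x - T x *\<^sub>R v)"

lemma T_has_derivative:
  assumes "x \<noteq> 0"
  shows "(T has_derivative (\<lambda>v. grad x \<bullet> v)) (at x)"
proof -
  have P: "(P has_derivative P) (at x)" by (rule bounded_linear_imp_has_derivative[OF linear])
  have nz: "x \<bullet> x \<noteq> 0" using assms by simp
  have N: "((\<lambda>x. P x \<bullet> x) has_derivative (\<lambda>v. P x \<bullet> v + P v \<bullet> x)) (at x)"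
    by (rule has_derivative_inner[OF P has_derivative_ident])
  have D: "((\<lambda>x. x \<bullet> x) has_derivative (\<lambda>v. x \<bullet> v + v \<bullet> x)) (at x)"
    by (rule has_derivative_inner[OF has_derivative_ident has_derivative_ident])
  have "(T has_derivative (\<lambda>v. - (P x \<bullet> x) * (inverse (x \<bullet> x) * (x \<bullet> v + v \<bullet> x) * inverse (x \<bullet> x)) + (P x \<bullet> v + P v \<bullet> x) / (x \<bullet> x))) (at x)"
    unfolding T_def[abs_def] by (rule has_derivative_divide[OF N D nz])
  moreover have "- (P x \<bullet> x) * (inverse (x \<bullet> x) * (x \<bullet> v + v \<bullet> x) * inverse (x \<bullet> x)) + (P x \<bullet> v + P v \<bullet> x) / (x \<bullet> x) = grad x \<bullet> v" for v
  proof -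
    have 1: "P v \<bullet> x = P x \<bullet> v" by (metis selfadjoint inner_commute)
    have 2: "v \<bullet> x = x \<bullet> v" by (rule inner_commute)
    show ?thesis unfolding grad_def T_def 1 2 inner_scaleR_left inner_diff_left
      using nz by (simp add: divide_simps)
  qed
  ultimately show ?thesis by simp
qed

lemma grad_has_derivative:
  assumes "x \<noteq> 0"
  shows "(grad has_derivative dgrad x) (at x)"
proof -
  have P: "(P has_derivative P) (at x)" by (rule bounded_linear_imp_has_derivative[OF linear])
  have nz: "x \<bullet> x \<noteq> 0" using assms by simp
  have D: "((\<lambda>x. x \<bullet> x) has_derivative (\<lambda>v. x \<bullet> v + v \<bullet> x)) (at x)"
    by (rule has_derivative_inner[OF has_derivative_ident has_derivative_ident])
  have Q: "((\<lambda>x. 2 / (x \<bullet> x)) has_derivative (\<lambda>v. - 2 * (inverse (x \<bullet> x) * (x \<bullet> v + v \<bullet> x) * inverse (x \<bullet> x)) + 0 / (x \<bullet> x))) (at x)"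
    by (rule has_derivative_divide[OF has_derivative_const D nz])
  have W: "((\<lambda>x. P x - T x *\<^sub>R x) has_derivative (\<lambda>v. P v - (T x *\<^sub>R v + (grad x \<bullet> v) *\<^sub>R x))) (at x)"
    by (rule has_derivative_diff[OF P has_derivative_scaleR[OF T_has_derivative[OF assms] has_derivative_ident]])
  have grad_fun: "grad = (\<lambda>x. (2 / (x \<bullet> x)) *\<^sub>R (P x - T x *\<^sub>R x))" by (simp add: grad_def fun_eq_iff)
  have "(grad has_derivative (\<lambda>v. (2 / (x \<bullet> x)) *\<^sub>R (P v - (T x *\<^sub>R v + (grad x \<bullet> v) *\<^sub>R x))
      + (- 2 * (inverse (x \<bullet> x) * (x \<bullet> v + v \<bullet> x) * inverse (x \<bullet> x)) + 0 / (x \<bullet> x)) *\<^sub>R (P x - T x *\<^sub>R x))) (at x)"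
    using has_derivative_scaleR[OF Q W] unfolding grad_fun[symmetric] .
  moreover have "(2 / (x \<bullet> x)) *\<^sub>R (P v - (T x *\<^sub>R v + (grad x \<bullet> v) *\<^sub>R x))
      + (- 2 * (inverse (x \<bullet> x) * (x \<bullet> v + v \<bullet> x) * inverse (x \<bullet> x)) + 0 / (x \<bullet> x)) *\<^sub>R (P x - T x *\<^sub>R x) = dgrad x v" for v
  proof -
    have 1: "- 2 * (inverse (x \<bullet> x) * (x \<bullet> v + v \<bullet> x) * inverse (x \<bullet> x)) + 0 / (x \<bullet> x) = - (4 * (x \<bullet> v)) / (x \<bullet> x)\<^sup>2"
      using nz by (simp add: inner_commute[of v x] field_simps power2_eq_square)
    have 2: "P v - (T x *\<^sub>R v + (grad x \<bullet> v) *\<^sub>R x) = P v - (grad x \<bullet> v) *\<^sub>R x - T x *\<^sub>R v" by simp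
    show ?thesis unfolding 1 2 dgrad_def by simp
  qed
  ultimately show ?thesis by simp
qed

lemma continuous_on_T: "continuous_on (- {0}) T"
  by (rule has_derivative_continuous_on, rule has_derivative_at_withinI, rule T_has_derivative) simp

lemma continuous_on_grad: "continuous_on (- {0}) grad"
  by (rule has_derivative_continuous_on, rule has_derivative_at_withinI, rule grad_has_derivative) simp

lemma continuous_on_dgrad: "continuous_on (- {0}) (\<lambda>x. dgrad x v)"
proof -
  have P: "continuous_on (- {0}) P" by (rule bounded_linear.continuous_on[OF linear continuous_on_id])
  show ?thesis unfolding dgrad_def by (intro continuous_intros P continuous_on_T continuous_on_grad) auto
qed

context
  fixes U :: "real set" and F F' F'' :: "real \<Rightarrow> real"
  assumes F: "C2_profile U F F' F''"
begin

lemma profile_derivs: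
  shows "(F has_real_derivative F' (T x)) (at (T x))" "(F' has_real_derivative F'' (T x)) (at (T x))"
  using F T_range[of x] by (auto simp: C2_profile_def)

lemma comp_has_derivative:
  assumes "x \<noteq> 0"
  shows "((\<lambda>x. F (T x)) has_derivative (\<lambda>v. (F' (T x) *\<^sub>R grad x) \<bullet> v)) (at x)"
  using DERIV_compose_FDERIV[OF profile_derivs(1) T_has_derivative[OF assms]] by (simp add: mult.commute)

lemma comp_grad_has_derivative:
  assumes "x \<noteq> 0"
  shows "((\<lambda>x. F' (T x) *\<^sub>R grad x) has_derivative (\<lambda>v. F' (T x) *\<^sub>R dgrad x v + (F'' (T x) * (grad x \<bullet> v)) *\<^sub>R grad x)) (at x)"
  using has_derivative_scaleR[OF DERIV_compose_FDERIV[OF profile_derivs(2) T_has_derivative[OF assms]] grad_has_derivative[OF assms]]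
  by (simp add: mult.commute)

lemma comp_C2_on: "C2_on (- {0}) (\<lambda>x. F (T x))"
proof (rule C2_onI[OF comp_has_derivative comp_grad_has_derivative])
  fix v :: 'a
  have TU: "T ` S \<subseteq> U" for S using T_range F unfolding C2_profile_def by blast
  have "continuous_on U F'" using F unfolding C2_profile_def by (meson DERIV_isCont continuous_at_imp_continuous_on)
  then have 1: "continuous_on (- {0}) (\<lambda>x. F' (T x))" by (rule continuous_on_compose2[OF _ continuous_on_T TU])
  have "continuous_on U F''" using F unfolding C2_profile_def by blast
  then have 2: "continuous_on (- {0}) (\<lambda>x. F'' (T x))" by (rule continuous_on_compose2[OF _ continuous_on_T TU])
  show "continuous_on (- {0}) (\<lambda>x. F' (T x) *\<^sub>R dgrad x v + (F'' (T x) * (grad x \<bullet> v)) *\<^sub>R grad x)"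
    by (intro continuous_intros 1 2 continuous_on_grad continuous_on_dgrad)
qed auto

text \<open>The chain rule \<open>F'' |grad T|^2 + F' lap T\<close>. On the unit sphere
  \<open>grad T\<close> is \<open>2 w\<close> with \<open>w\<close> orthogonal to \<open>x\<close>,
  which removes the mixed terms and gives \<open>|w|^2 = T (1 - T)\<close>.\<close>

lemma lap_comp:
  assumes h: "\<And>x. x \<noteq> 0 \<Longrightarrow> h x = F (T x)" and x: "norm x = 1"
  shows "lap h x = 4 * T x * (1 - T x) * F'' (T x)
    + 2 * ((\<Sum>b\<in>Basis. P b \<bullet> b) - T x * DIM('a)) * F' (T x)"
proof -
  have x0: "x \<noteq> 0" using x by auto
  have xx: "x \<bullet> x = 1" using x by (simp add: dot_square_norm)
  have Tx: "T x = P x \<bullet> x" by (simp add: T_def xx)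
  have g: "grad x = 2 *\<^sub>R (P x - T x *\<^sub>R x)" by (simp add: grad_def xx)
  define w where "w = P x - T x *\<^sub>R x"
  have wx: "x \<bullet> w = 0" by (simp add: w_def inner_diff_right xx Tx inner_commute)
  have ww: "w \<bullet> w = T x * (1 - T x)"
  proof -
    have "w \<bullet> w = w \<bullet> P x - T x * (x \<bullet> w)"
      by (simp add: w_def inner_diff_right inner_diff_left inner_commute algebra_simps)
    also have "\<dots> = P x \<bullet> P x - T x * (x \<bullet> P x)" by (simp add: wx) (simp add: w_def inner_diff_left)
    also have "\<dots> = T x - T x * T x" by (simp add: Tx P_inner[symmetric] inner_commute)
    finally show ?thesis by (simp add: algebra_simps)
  qed
  have hd: "(h has_derivative (\<lambda>v. (F' (T y) *\<^sub>R grad y) \<bullet> v)) (at y)" if "y \<in> - {0}" for y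
    by (rule has_derivative_transform_within_open[OF comp_has_derivative, of _ "- {0}"]) (use that h in auto)
  have "lap h x = (\<Sum>b\<in>Basis. (F' (T x) *\<^sub>R dgrad x b + (F'' (T x) * (grad x \<bullet> b)) *\<^sub>R grad x) \<bullet> b)"
    by (rule lap_eq_trace[where S="- {0}" and G="\<lambda>y. F' (T y) *\<^sub>R grad y", OF _ _ hd comp_grad_has_derivative[OF x0]]) (use x0 in auto)
  also have "\<dots> = (\<Sum>b\<in>Basis. F' (T x) * (- 4 * ((x \<bullet> b) * (w \<bullet> b)) + 2 * (P b \<bullet> b) - 4 * ((w \<bullet> b) * (x \<bullet> b)) - 2 * T x * (b \<bullet> b))
      + F'' (T x) * 4 * ((w \<bullet> b) * (w \<bullet> b)))"
    by (intro sum.cong refl) (simp add: dgrad_def xx g w_def[symmetric] inner_simps algebra_simps)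
  also have "\<dots> = F' (T x) * (- 4 * (\<Sum>b\<in>Basis. (x \<bullet> b) * (w \<bullet> b)) + 2 * (\<Sum>b\<in>Basis. P b \<bullet> b) - 4 * (\<Sum>b\<in>Basis. (w \<bullet> b) * (x \<bullet> b))
      - 2 * T x * (\<Sum>b\<in>(Basis :: 'a set). b \<bullet> b)) + F'' (T x) * 4 * (\<Sum>b\<in>Basis. (w \<bullet> b) * (w \<bullet> b))"
    by (simp only: sum.distrib sum_subtractf sum_distrib_left[symmetric])
  also have "(\<Sum>b\<in>Basis. (x \<bullet> b) * (w \<bullet> b)) = 0" using euclidean_inner[of x w] wx by simp
  also have "(\<Sum>b\<in>Basis. (w \<bullet> b) * (x \<bullet> b)) = 0" using euclidean_inner[of w x] wx by (simp add: inner_commute)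
  also have "(\<Sum>b\<in>Basis. (w \<bullet> b) * (w \<bullet> b)) = T x * (1 - T x)" using euclidean_inner[of w w] ww by simp
  also have "(\<Sum>b\<in>(Basis :: 'a set). b \<bullet> b) = DIM('a)" by simp
  finally show ?thesis by (simp add: algebra_simps)
qed

end

end

section \<open>Functions of the modulus of the fixed coordinate\<close>

definition proj0 :: "real^4^('n::finite option) \<Rightarrow> real^4^('n option)" where
  "proj0 x = axis None (x $ None)"

interpretation proj0: orthogonal_projection "proj0 :: real^4^('n::finite option) \<Rightarrow> real^4^('n option)"
proof (rule orthogonal_projection.intro)
  show "bounded_linear (proj0 :: real^4^('n option) \<Rightarrow> real^4^('n option))"
    unfolding linear_conv_bounded_linear[symmetric]
    by (rule linearI) (auto simp: proj0_def axis_def vec_eq_iff)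
  show "proj0 x \<bullet> y = x \<bullet> proj0 y" for x y :: "real^4^('n option)"
    by (simp add: proj0_def inner_axis inner_axis')
  show "proj0 (proj0 x) = proj0 x" for x :: "real^4^('n option)"
    by (simp add: proj0_def axis_def)
qed

lemma proj0_inner: "proj0 x \<bullet> x = (norm (x $ None))\<^sup>2"
  by (simp add: proj0_def inner_axis' dot_square_norm)

lemma trace_proj0: "(\<Sum>b\<in>Basis. proj0 b \<bullet> (b :: real^4^('n::finite option))) = 4"
proof -
  have bij: "bij_betw (\<lambda>p. axis (fst p) (snd p) :: real^4^('n option)) (UNIV \<times> Basis) Basis"
    by (auto simp: bij_betw_def inj_on_def axis_eq_axis nonzero_Basis Basis_vec_def image_iff)
  have "(\<Sum>b\<in>Basis. proj0 b \<bullet> (b :: real^4^('n option))) =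
      (\<Sum>p\<in>UNIV \<times> Basis. proj0 (axis (fst p) (snd p)) \<bullet> (axis (fst p) (snd p) :: real^4^('n option)))"
    by (rule sum.reindex_bij_betw[OF bij, symmetric])
  also have "\<dots> = (\<Sum>p\<in>(UNIV :: 'n option set) \<times> (Basis :: (real^4) set). if fst p = None then 1 else 0)"
    by (intro sum.cong refl) (auto simp: proj0_inner axis_def)
  also have "\<dots> = (\<Sum>i\<in>(UNIV :: 'n option set). \<Sum>u\<in>(Basis :: (real^4) set). if i = None then 1 else (0::real))"
    unfolding sum.cartesian_product by (simp add: case_prod_unfold)
  also have "\<dots> = (\<Sum>i\<in>(UNIV :: 'n option set). if i = None then 4 else 0)"
    by (intro sum.cong refl) simp
  finally show ?thesis by simp
qed

text \<open>Euler's four-square identity. It makes \<open>|z_0|\<close> invariant under right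
  multiplication by unit quaternions.\<close>

lemma norm_qmul: "norm (qmul p r) = norm p * norm r"
proof (rule power2_eq_imp_eq)
  show "(norm (qmul p r))\<^sup>2 = (norm p * norm r)\<^sup>2"
    unfolding power_mult_distrib power2_norm_eq_inner inner_vec_def sum_4
    by (simp add: qmul_def algebra_simps power2_eq_square)
qed auto

text \<open>Transfers "not constant" and "not zero" from profiles on \<open>[0, 1]\<close> to
  functions on the sphere.\<close>

lemma sphere_point:
  assumes t: "t \<in> {0..1}"
  obtains x :: "real^4^('n::finite option)" where "x \<in> sphere 0 1" "(norm (x $ None))\<^sup>2 = t"
proof -
  define i :: "'n option" where "i = Some undefined"
  define x :: "real^4^('n option)" where "x = axis None (axis 1 (sqrt t)) + axis i (axis 1 (sqrt (1 - t)))"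
  have n1: "(norm (axis 1 s :: real^4))\<^sup>2 = s\<^sup>2" for s :: real
    unfolding power2_norm_eq_inner by (simp add: inner_axis_axis power2_eq_square)
  have "x $ None = axis 1 (sqrt t)" by (simp add: x_def axis_def i_def vec_eq_iff)
  then have 1: "(norm (x $ None))\<^sup>2 = t" using n1 t by simp
  have "x \<bullet> x = (norm (axis 1 (sqrt t) :: real^4))\<^sup>2 + (norm (axis 1 (sqrt (1 - t)) :: real^4))\<^sup>2"
    unfolding x_def power2_norm_eq_inner
    by (simp add: inner_add_left inner_add_right inner_axis_axis i_def)
  then have "x \<bullet> x = 1" unfolding n1 using t by simp
  then have "norm x = 1" by (simp add: norm_eq_1)
  then show ?thesis using that[of x] 1 by simp
qed

text \<open>\<open>lap_comp\<close> with trace \<open>4\<close> and dimension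
  \<open>4 n + 4\<close>: taking out the factor \<open>4\<close> leaves the Jacobi parameters
  \<open>a = 2\<close> and \<open>a + b = 2 n + 2\<close>.\<close>

lemma radial_function:
  fixes F F' F'' :: "real \<Rightarrow> real"
  assumes F: "C2_profile U F F' F''"
  defines "u \<equiv> (\<lambda>x :: real^4^('n::finite option). F ((norm (x $ None))\<^sup>2))"
  shows "HP_fun u" "Sp_invariant u" "C2_on (- {0}) (hom0 u)"
    "\<And>x :: real^4^('n option). x \<in> sphere 0 1 \<Longrightarrow> (norm (x $ None))\<^sup>2 \<in> {0..1}"
    "\<And>x t. x \<in> sphere 0 1 \<Longrightarrow> t = (norm (x $ None))\<^sup>2 \<Longrightarrow>
      lap_HP u x = 4 * (t * (1 - t) * F'' t + (2 - (2 * real CARD('n) + 2) * t) * F' t)"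
proof -
  show "HP_fun u" unfolding HP_fun_def u_def by (simp add: rmul_def norm_qmul)
  show "Sp_invariant u" unfolding Sp_invariant_def u_def by (simp add: sp_act_def)
  have hom: "hom0 u x = F (proj0.T x)" if "x \<noteq> 0" for x
  proof -
    have "(norm ((x /\<^sub>R norm x) $ None))\<^sup>2 = proj0.T x"
      by (simp add: proj0.T_def proj0_inner dot_square_norm power_mult_distrib divide_simps)
    then show ?thesis by (simp add: hom0_def u_def)
  qed
  show "C2_on (- {0}) (hom0 u)"
  proof -
    obtain Df D2f where D: "\<And>x. x \<in> - {0} \<Longrightarrow> ((\<lambda>x. F (proj0.T x)) has_derivative blinfun_apply (Df x)) (at (x :: real^4^('n option)))"
      "\<And>x. x \<in> - {0} \<Longrightarrow> (Df has_derivative blinfun_apply (D2f x)) (at x)" "continuous_on (- {0}) D2f"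
      using proj0.comp_C2_on[OF F] unfolding C2_on_def by blast
    have "(hom0 u has_derivative blinfun_apply (Df x)) (at x)" if "x \<in> - {0}" for x
      by (rule has_derivative_transform_within_open[OF D(1)[OF that], of "- {0}"]) (use that hom in auto)
    then show ?thesis unfolding C2_on_def using D(2,3) by blast
  qed
  fix x :: "real^4^('n option)" assume x: "x \<in> sphere 0 1"
  then have nx: "norm x = 1" by simp
  have T: "proj0.T x = (norm (x $ None))\<^sup>2" by (simp add: proj0.T_def proj0_inner dot_square_norm nx)
  show "(norm (x $ None))\<^sup>2 \<in> {0..1}" using proj0.T_range[of x] unfolding T .
  fix t assume t: "t = (norm (x $ None))\<^sup>2"
  have "real DIM(real^4^('n option)) = 4 * real CARD('n) + 4" by (simp add: card_option)
  moreover have "lap (hom0 u) x = 4 * proj0.T x * (1 - proj0.T x) * F'' (proj0.T x)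
      + 2 * ((\<Sum>b\<in>Basis. proj0 b \<bullet> (b :: real^4^('n option))) - proj0.T x * DIM(real^4^('n option))) * F' (proj0.T x)"
    by (rule proj0.lap_comp[OF F hom nx])
  ultimately show "lap_HP u x = 4 * (t * (1 - t) * F'' t + (2 - (2 * real CARD('n) + 2) * t) * F' t)"
    unfolding lap_HP_def T t[symmetric] trace_proj0 by (simp add: algebra_simps)
qed

lemma theorem_from_profile:
  fixes F F' F'' V V' V'' :: "real \<Rightarrow> real" and q lam :: real
  assumes F: "C2_profile U F F' F''" and V: "C2_profile U V V' V''" and lam: "0 < lam"
    and pos: "\<And>t. t \<in> {0..1} \<Longrightarrow> 0 < F t" and nc: "\<And>k. \<exists>t\<in>{0..1}. F t \<noteq> k" and nz: "\<exists>t\<in>{0..1}. V t \<noteq> 0"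
    and eq: "\<And>t. t \<in> {0..1} \<Longrightarrow> 4 * (t * (1 - t) * F'' t + (2 - (2 * real CARD('n) + 2) * t) * F' t) + lam * (F t powr (q - 1) - F t) = 0"
    and lin: "\<And>t. t \<in> {0..1} \<Longrightarrow> 4 * (t * (1 - t) * V'' t + (2 - (2 * real CARD('n) + 2) * t) * V' t) + lam * ((q - 1) * F t powr (q - 2) - 1) * V t = 0"
  shows "\<exists>lam>0. \<exists>u :: real^4^('n::finite option) \<Rightarrow> real.
      HP_fun u \<and> C2_on (- {0}) (hom0 u) \<and>
      (\<forall>x\<in>sphere 0 1. u x > 0) \<and>
      \<not> (\<exists>c. \<forall>x\<in>sphere 0 1. u x = c) \<and>
      Sp_invariant u \<and>
      (\<forall>x\<in>sphere 0 1. - lap_HP u x + lam * u x = lam * u x powr (q - 1)) \<and>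
      (\<exists>v :: real^4^('n option) \<Rightarrow> real.
          HP_fun v \<and> C2_on (- {0}) (hom0 v) \<and>
          (\<exists>x\<in>sphere 0 1. v x \<noteq> 0) \<and>
          (\<forall>x\<in>sphere 0 1. - lap_HP v x + lam * v x = lam * (q - 1) * u x powr (q - 2) * v x))"
proof -
  define u where "u = (\<lambda>x :: real^4^('n option). F ((norm (x $ None))\<^sup>2))"
  define v where "v = (\<lambda>x :: real^4^('n option). V ((norm (x $ None))\<^sup>2))"
  note Fu = radial_function[where 'n='n, OF F, folded u_def] and Vv = radial_function[where 'n='n, OF V, folded v_def]
  have "u x > 0" if "x \<in> sphere 0 1" for x using pos[OF Fu(4)[OF that]] by (simp add: u_def)
  moreover have "\<not> (\<exists>c. \<forall>x\<in>sphere 0 1. u x = c)"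
  proof
    assume "\<exists>c. \<forall>x\<in>sphere 0 1. u x = c"
    then obtain c where c: "\<And>x. x \<in> sphere 0 1 \<Longrightarrow> u x = c" by blast
    obtain t where t: "t \<in> {0..1}" "F t \<noteq> c" using nc by blast
    obtain x :: "real^4^('n option)" where "x \<in> sphere 0 1" "(norm (x $ None))\<^sup>2 = t" by (rule sphere_point[OF t(1)])
    then show False using c[of x] t by (simp add: u_def)
  qed
  moreover have "- lap_HP u x + lam * u x = lam * u x powr (q - 1)" if x: "x \<in> sphere 0 1" for x
    using eq[OF Fu(4)[OF x]] Fu(5)[OF x refl] by (simp add: u_def algebra_simps)
  moreover have "\<exists>x\<in>sphere 0 1. v x \<noteq> 0"
  proof -
    obtain t where t: "t \<in> {0..1}" "V t \<noteq> 0" using nz by blast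
    obtain x :: "real^4^('n option)" where "x \<in> sphere 0 1" "(norm (x $ None))\<^sup>2 = t" by (rule sphere_point[OF t(1)])
    then show ?thesis using t by (auto simp: v_def)
  qed
  moreover have "- lap_HP v x + lam * v x = lam * (q - 1) * u x powr (q - 2) * v x" if x: "x \<in> sphere 0 1" for x
    using lin[OF Fu(4)[OF x]] Vv(5)[OF x refl] by (simp add: u_def v_def algebra_simps)
  ultimately show ?thesis using lam Fu(1-3) Vv(1,3) by blast
qed

text \<open>On \<open>HP^1 = S^4\<close> the first eigenfunction is odd in \<open>2 t - 1\<close>, hence its third moment vanishes.
  Restricting to even functions removes it.\<close>

lemma C2_profile_even:
  assumes "C2_profile {-1<..<2} f f' f''"
  shows "C2_profile {t. (2 * t - 1)\<^sup>2 < 2} (\<lambda>t. f ((2 * t - 1)\<^sup>2)) (\<lambda>t. 4 * (2 * t - 1) * f' ((2 * t - 1)\<^sup>2))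
    (\<lambda>t. 16 * (2 * t - 1)\<^sup>2 * f'' ((2 * t - 1)\<^sup>2) + 8 * f' ((2 * t - 1)\<^sup>2))"
proof -
  note f = assms[unfolded C2_profile_def]
  define U :: "real set" where "U = {t. (2 * t - 1)\<^sup>2 < 2}"
  have mem: "(2 * t - 1)\<^sup>2 \<in> {-1<..<2::real}" if "t \<in> U" for t
    using that zero_le_power2[of "2 * t - 1"] unfolding U_def mem_Collect_eq greaterThanLessThan_iff by linarith
  have d1: "((\<lambda>t. f ((2 * t - 1)\<^sup>2)) has_real_derivative 4 * (2 * t - 1) * f' ((2 * t - 1)\<^sup>2)) (at t)"
    and d2: "((\<lambda>t. f' ((2 * t - 1)\<^sup>2)) has_real_derivative 4 * (2 * t - 1) * f'' ((2 * t - 1)\<^sup>2)) (at t)" if "t \<in> U" for t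
  proof -
    have s: "((\<lambda>t. (2 * t - 1)\<^sup>2) has_real_derivative 4 * (2 * t - 1)) (at t)" by (auto intro!: derivative_eq_intros)
    show "((\<lambda>t. f ((2 * t - 1)\<^sup>2)) has_real_derivative 4 * (2 * t - 1) * f' ((2 * t - 1)\<^sup>2)) (at t)"
      using DERIV_chain2[OF _ s, of f "f' ((2 * t - 1)\<^sup>2)"] f mem[OF that] by (auto simp: mult.commute)
    show "((\<lambda>t. f' ((2 * t - 1)\<^sup>2)) has_real_derivative 4 * (2 * t - 1) * f'' ((2 * t - 1)\<^sup>2)) (at t)"
      using DERIV_chain2[OF _ s, of f' "f'' ((2 * t - 1)\<^sup>2)"] f mem[OF that] by (auto simp: mult.commute)
  qed
  have c': "continuous_on U (\<lambda>t. f' ((2 * t - 1)\<^sup>2))" using d2 by (meson DERIV_isCont continuous_at_imp_continuous_on)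
  have fc: "continuous_on {-1<..<2} f''" using f by blast
  have c'': "continuous_on U (\<lambda>t. f'' ((2 * t - 1)\<^sup>2))"
    using mem by (intro continuous_on_compose2[OF fc] continuous_intros) auto
  have op: "open U" unfolding U_def by (intro open_Collect_less continuous_intros)
  have "{0..1} \<subseteq> U"
  proof
    fix t :: real assume "t \<in> {0..1}"
    then have "\<bar>2 * t - 1\<bar> \<le> 1" by auto
    then have "(2 * t - 1)\<^sup>2 \<le> 1" by (simp add: abs_square_le_1)
    then show "t \<in> U" by (simp add: U_def)
  qed
  moreover have "continuous_on U (\<lambda>t. 16 * (2 * t - 1)\<^sup>2 * f'' ((2 * t - 1)\<^sup>2) + 8 * f' ((2 * t - 1)\<^sup>2))"
    by (intro continuous_intros c' c'')
  moreover have "((\<lambda>t. 4 * (2 * t - 1) * f' ((2 * t - 1)\<^sup>2)) has_real_derivative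
      16 * (2 * t - 1)\<^sup>2 * f'' ((2 * t - 1)\<^sup>2) + 8 * f' ((2 * t - 1)\<^sup>2)) (at t)" if "t \<in> U" for t
  proof -
    have "((\<lambda>t. 4 * (2 * t - 1)) has_real_derivative 8) (at t)" by (auto intro!: derivative_eq_intros)
    from DERIV_mult[OF this d2[OF that]] show ?thesis by (simp add: algebra_simps power2_eq_square)
  qed
  ultimately show ?thesis using op d1 unfolding C2_profile_def U_def[symmetric] by blast
qed

theorem theorem1p4:
  fixes q :: real
  assumes "2 < q" and "q < 4 * real CARD('n::finite) / (2 * real CARD('n) - 1)"
  shows "\<exists>lam>0. \<exists>u :: real^4^('n option) \<Rightarrow> real.
      HP_fun u \<and> C2_on (- {0}) (hom0 u) \<and>
      (\<forall>x\<in>sphere 0 1. u x > 0) \<and>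
      \<not> (\<exists>c. \<forall>x\<in>sphere 0 1. u x = c) \<and>
      Sp_invariant u \<and>
      (\<forall>x\<in>sphere 0 1. - lap_HP u x + lam * u x = lam * u x powr (q - 1)) \<and>
      (\<exists>v :: real^4^('n option) \<Rightarrow> real.
          HP_fun v \<and> C2_on (- {0}) (hom0 v) \<and>
          (\<exists>x\<in>sphere 0 1. v x \<noteq> 0) \<and>
          (\<forall>x\<in>sphere 0 1. - lap_HP v x + lam * v x = lam * (q - 1) * u x powr (q - 2) * v x))"
proof (cases "CARD('n) = 1")
  case True
  have q4: "q < 4" using assms(2) True by simp
  \<comment> \<open>The matching point \<open>3/4\<close> lies to the right of the eigenfunction's
    zero, which is \<open>1/5\<close> here and at most \<open>1/3\<close> for
    \<open>n \<ge> 2\<close>.\<close>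
  interpret two_sided "1/2" 2 "3/4" q
    by unfold_locales (use assms(1) q4 in auto)
  obtain \<mu> f f' f'' v v' v'' where \<mu>: "0 < \<mu>" and f: "C2_profile {-1<..<2} f f' f''" and v: "C2_profile {-1<..<2} v v' v''"
    and pos: "\<And>t. t \<in> {0..1} \<Longrightarrow> 0 < f t" and nc: "\<And>k. \<exists>t\<in>{0..1}. f t \<noteq> k"
    and eq: "\<And>t. t \<in> {0..1} \<Longrightarrow> t * (1 - t) * f'' t + (1/2 - (1/2 + 2) * t) * f' t + \<mu> * (f t powr (q - 1) - f t) = 0"
    and nz: "\<exists>t\<in>{0..1}. v t \<noteq> 0"
    and lin: "\<And>t. t \<in> {0..1} \<Longrightarrow> t * (1 - t) * v'' t + (1/2 - (1/2 + 2) * t) * v' t + \<mu> * ((q - 1) * f t powr (q - 2) - 1) * v t = 0"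
    by (rule profile_exists) (rule that)
  have s01: "(2 * t - 1)\<^sup>2 \<in> {0..1}" if "t \<in> {0..1}" for t :: real
  proof -
    have "\<bar>2 * t - 1\<bar> \<le> 1" using that by auto
    then show ?thesis by (simp add: abs_square_le_1)
  qed
  have onto: "\<exists>t\<in>{0..1}. (2 * t - 1)\<^sup>2 = s" if "s \<in> {0..1}" for s :: real
  proof (rule bexI[of _ "(1 + sqrt s) / 2"])
    have "2 * ((1 + sqrt s) / 2) - 1 = sqrt s" by (simp add: field_simps)
    then show "(2 * ((1 + sqrt s) / 2) - 1)\<^sup>2 = s" using that by simp
  qed (use that in auto)
  \<comment> \<open>For \<open>s = (2 * t - 1)\<^sup>2\<close> one has
    \<open>t * (1 - t) = (1 - s) / 4\<close>. In the variable \<open>s\<close> the operator is four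
    times the one with parameters \<open>1/2\<close> and \<open>2\<close>, which explains
    \<open>16 * \<mu>\<close> in place of \<open>4 * \<mu>\<close>.\<close>
  have op: "4 * (t * (1 - t) * (16 * (2 * t - 1)\<^sup>2 * g2 + 8 * g1) + (2 - (2 * real CARD('n) + 2) * t) * (4 * (2 * t - 1) * g1))
      = 16 * ((2 * t - 1)\<^sup>2 * (1 - (2 * t - 1)\<^sup>2) * g2 + (1/2 - (1/2 + 2) * (2 * t - 1)\<^sup>2) * g1)" for t g1 g2 :: real
    unfolding True by (simp add: algebra_simps power2_eq_square)
  show ?thesis
  proof (rule theorem_from_profile[OF C2_profile_even[OF f] C2_profile_even[OF v], of "16 * \<mu>" q])
    show "0 < 16 * \<mu>" using \<mu> by simp
    show "\<exists>t\<in>{0..1}. f ((2 * t - 1)\<^sup>2) \<noteq> k" for k using nc[of k] onto by metis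
    show "\<exists>t\<in>{0..1}. v ((2 * t - 1)\<^sup>2) \<noteq> 0" using nz onto by metis
    fix t :: real assume "t \<in> {0..1}"
    note t = s01[OF this]
    show "0 < f ((2 * t - 1)\<^sup>2)" by (rule pos[OF t])
    show "4 * (t * (1 - t) * (16 * (2 * t - 1)\<^sup>2 * f'' ((2 * t - 1)\<^sup>2) + 8 * f' ((2 * t - 1)\<^sup>2)) + (2 - (2 * real CARD('n) + 2) * t) * (4 * (2 * t - 1) * f' ((2 * t - 1)\<^sup>2)))
        + 16 * \<mu> * (f ((2 * t - 1)\<^sup>2) powr (q - 1) - f ((2 * t - 1)\<^sup>2)) = 0"
      unfolding op using eq[OF t] by (simp add: algebra_simps)
    show "4 * (t * (1 - t) * (16 * (2 * t - 1)\<^sup>2 * v'' ((2 * t - 1)\<^sup>2) + 8 * v' ((2 * t - 1)\<^sup>2)) + (2 - (2 * real CARD('n) + 2) * t) * (4 * (2 * t - 1) * v' ((2 * t - 1)\<^sup>2)))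
        + 16 * \<mu> * ((q - 1) * f ((2 * t - 1)\<^sup>2) powr (q - 2) - 1) * v ((2 * t - 1)\<^sup>2) = 0"
      unfolding op using lin[OF t] by (simp add: algebra_simps)
  qed
next
  case False
  have "CARD('n) \<noteq> 0" by simp
  then have n: "2 \<le> real CARD('n)" using False by linarith
  define b where "b = 2 * real CARD('n)"
  have b: "4 \<le> b" using n by (simp add: b_def)
  have sub: "q * (b - 1) < 2 * b" using assms(2) b by (simp add: b_def pos_less_divide_eq)
  have m: "2 / (2 + b) < 3/4" using b by (simp add: field_simps)
  interpret two_sided 2 b "3/4" q
    by unfold_locales (use assms(1) b sub m in auto)
  obtain \<mu> f f' f'' v v' v'' where \<mu>: "0 < \<mu>" and f: "C2_profile {-1<..<2} f f' f''" and v: "C2_profile {-1<..<2} v v' v''"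
    and pos: "\<And>t. t \<in> {0..1} \<Longrightarrow> 0 < f t" and nc: "\<And>k. \<exists>t\<in>{0..1}. f t \<noteq> k"
    and eq: "\<And>t. t \<in> {0..1} \<Longrightarrow> t * (1 - t) * f'' t + (2 - (2 + b) * t) * f' t + \<mu> * (f t powr (q - 1) - f t) = 0"
    and nz: "\<exists>t\<in>{0..1}. v t \<noteq> 0"
    and lin: "\<And>t. t \<in> {0..1} \<Longrightarrow> t * (1 - t) * v'' t + (2 - (2 + b) * t) * v' t + \<mu> * ((q - 1) * f t powr (q - 2) - 1) * v t = 0"
    by (rule profile_exists) (rule that)
  have bb: "2 * real CARD('n) + 2 = 2 + b" by (simp add: b_def)
  show ?thesis
  proof (rule theorem_from_profile[OF f v, of "4 * \<mu>" q])
    show "0 < 4 * \<mu>" using \<mu> by simp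
    fix t :: real assume t: "t \<in> {0..1}"
    show "0 < f t" by (rule pos[OF t])
    show "4 * (t * (1 - t) * f'' t + (2 - (2 * real CARD('n) + 2) * t) * f' t) + 4 * \<mu> * (f t powr (q - 1) - f t) = 0"
      unfolding bb using eq[OF t] by (simp add: algebra_simps)
    show "4 * (t * (1 - t) * v'' t + (2 - (2 * real CARD('n) + 2) * t) * v' t) + 4 * \<mu> * ((q - 1) * f t powr (q - 2) - 1) * v t = 0"
      unfolding bb using lin[OF t] by (simp add: algebra_simps)
  qed (use nc nz in auto)
qed


end
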